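(* Let $R$ be a $p$-adically complete and separated ring and let $\mathcal{H}$ be a $p$-divisible group over $\mathrm{Spf}\,R$ with Serre dual $\mathcal{H}^\vee$. The Fourier transforms $$\mathbb{F}^{\mathcal{H}}:\mathcal{O}(\mathcal{H})^*\xrightarrow{\sim}\mathcal{O}(T_p\mathcal{H}^\vee)\quad\text{and}\quad\mathbb{F}_{\mathcal{H}}:\mathcal{O}(T_p\mathcal{H}^\vee)^*\xrightarrow{\sim}\mathcal{O}(\mathcal{H})$$ are equivariant for the actions of $\mathrm{Sym}^\bullet\mathrm{Lie}\,\mathcal{H}$ described in the context.
   Context: $T_p\mathcal{H}^\vee=\varprojlim_n\mathcal{H}^\vee[p^n]=\underline{\mathrm{Hom}}(\mathcal{H},\mathbb{G}_m)$. $\mathcal{O}(\mathcal{H})=\varprojlim_k\varprojlim_n\mathcal{O}(\mathcal{H}[p^n]_{R/p^k})$ with the inverse limit topology and $\mathcal{O}(T_p\mathcal{H}^\vee)=\varprojlim_k\varinjlim_n\mathcal{O}(\mathcal{H}^\vee[p^n]_{R/p^k})$ with the $p$-adic topology; $(-)^*$ is the continuous $R$-linear dual. The canonical pairing $\mathcal{H}\times T_p\mathcal{H}^\vee\to\mathbb{G}_m\subset\mathbb{A}^1$ gives $\kappa\in\mathcal{O}(\mathcal{H})\widehat\otimes_R\mathcal{O}(T_p\mathcal{H}^\vee)$, and $\mathbb{F}^{\mathcal{H}}$, $\mathbb{F}_{\mathcal{H}}$ are given by contraction with $\kappa$. Actions. $\omega_{\mathcal{H}}$ is the module of invariant differentials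 and $\mathrm{Lie}\,\mathcal{H}$ its dual. $\mathrm{Sym}^\bullet\mathrm{Lie}\,\mathcal{H}$ acts on $\mathcal{O}(\mathcal{H})$ through the action of $\mathrm{Lie}\,\mathcal{H}$ by differentiation along invariant vector fields. The Hodge–Tate map $\mathrm{HT}:T_p\mathcal{H}^\vee=\underline{\mathrm{Hom}}(\mathcal{H},\mathbb{G}_m)\to\omega_{\mathcal{H}}$ is $f\mapsto f^*\frac{dt}{1+t}$ ($1+t$ the coordinate on $\mathbb{G}_m$); $\mathrm{Sym}^\bullet\mathrm{Lie}\,\mathcal{H}=\mathcal{O}(\omega_{\mathcal{H}})$ (polynomial functions on $\omega_{\mathcal{H}}$) acts on $\mathcal{O}(T_p\mathcal{H}^\vee)$ through multiplication by functions pulled back along $\mathrm{HT}$. The duals carry the dual actions $(P\cdot\mu)(f)=\mu(P\cdot f)$. *)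

theory Defs
  imports
    "HOL-Library.Multiset"
    "HOL-Computational_Algebra.Primes"
    "HOL-Algebra.Module"
    "HOL-Algebra.QuotRing"
begin

section \<open>Formal sums modulo relations\<close>

text \<open>
  Tensor products, Kaehler differentials and symmetric algebras are all built in the same way: a list
  stands for the formal sum of its entries, and one divides by the smallest congruence for
  concatenation that makes it commutative and contains the given relations.  In each of
  the three instances the relations provide negatives, e.g. \<open>(-x, y)\<close> is opposite to \<open>(x, y)\<close>,
  so that the quotient is the usual abelian group.
\<close>

inductive fsum_eq :: "'x set \<Rightarrow> ('x list \<Rightarrow> 'x list \<Rightarrow> bool) \<Rightarrow> 'x list \<Rightarrow> 'x list \<Rightarrow> bool"
  for X and gen_rel
where
  base: "gen_rel xs ys \<Longrightarrow> set xs \<subseteq> X \<Longrightarrow> set ys \<subseteq> X \<Longrightarrow> fsum_eq X gen_rel xs ys"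
| refl: "set xs \<subseteq> X \<Longrightarrow> fsum_eq X gen_rel xs xs"
| sym: "fsum_eq X gen_rel xs ys \<Longrightarrow> fsum_eq X gen_rel ys xs"
| trans: "fsum_eq X gen_rel xs ys \<Longrightarrow> fsum_eq X gen_rel ys zs \<Longrightarrow> fsum_eq X gen_rel xs zs"
| append: "fsum_eq X gen_rel xs xs' \<Longrightarrow> fsum_eq X gen_rel ys ys' \<Longrightarrow> fsum_eq X gen_rel (xs @ ys) (xs' @ ys')"
| commute: "set xs \<subseteq> X \<Longrightarrow> set ys \<subseteq> X \<Longrightarrow> fsum_eq X gen_rel (xs @ ys) (ys @ xs)"

definition fsum_class :: "'x set \<Rightarrow> ('x list \<Rightarrow> 'x list \<Rightarrow> bool) \<Rightarrow> 'x list \<Rightarrow> 'x list set" where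
  "fsum_class X gen_rel xs = {ys. fsum_eq X gen_rel xs ys}"

definition rep :: "'y set \<Rightarrow> 'y" where
  "rep t = (SOME xs. xs \<in> t)"

definition lsum :: "('m, 'e) ring_scheme \<Rightarrow> 'm list \<Rightarrow> 'm" where
  "lsum P xs = foldr (add P) xs \<zero>\<^bsub>P\<^esub>"

text \<open>The additive map to \<open>P\<close> given by \<open>b\<close> on generators (meaningful when \<open>b\<close> respects the relations).\<close>

definition fs_lift :: "('m, 'e) ring_scheme \<Rightarrow> ('x \<Rightarrow> 'm) \<Rightarrow> 'x list set \<Rightarrow> 'm" where
  "fs_lift P b t = lsum P (map b (rep t))"


section \<open>Modules\<close>

definition ring_module :: "('s, 'e) ring_scheme \<Rightarrow> ('s, 's) module" where
  "ring_module S = \<lparr>carrier = carrier S, mult = mult S, one = one S, zero = zero S, add = add S,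
     smult = mult S\<rparr>"

definition alg_via :: "('b, 'e) ring_scheme \<Rightarrow> ('a \<Rightarrow> 'b) \<Rightarrow> ('a, 'b) module" where
  "alg_via B \<rho> = \<lparr>carrier = carrier B, mult = mult B, one = one B, zero = zero B, add = add B,
     smult = (\<lambda>a x. \<rho> a \<otimes>\<^bsub>B\<^esub> x)\<rparr>"

text \<open>Additive maps \<open>M \<rightarrow> N\<close> compatible with the base change \<open>h\<close> of scalars.\<close>

definition semilinear ::
  "('s, 'e) ring_scheme \<Rightarrow> ('s \<Rightarrow> 't) \<Rightarrow> ('s, 'a, 'f) module_scheme \<Rightarrow> ('t, 'b, 'g) module_scheme
    \<Rightarrow> ('a \<Rightarrow> 'b) \<Rightarrow> bool" where
  "semilinear S h M N f \<longleftrightarrow> f \<in> carrier M \<rightarrow> carrier N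
     \<and> (\<forall>x\<in>carrier M. \<forall>y\<in>carrier M. f (x \<oplus>\<^bsub>M\<^esub> y) = f x \<oplus>\<^bsub>N\<^esub> f y)
     \<and> (\<forall>r\<in>carrier S. \<forall>x\<in>carrier M. f (r \<odot>\<^bsub>M\<^esub> x) = h r \<odot>\<^bsub>N\<^esub> f x)"

abbreviation linear_map ::
  "('s, 'e) ring_scheme \<Rightarrow> ('s, 'a, 'f) module_scheme \<Rightarrow> ('s, 'b, 'g) module_scheme
    \<Rightarrow> ('a \<Rightarrow> 'b) \<Rightarrow> bool" where
  "linear_map S \<equiv> semilinear S (\<lambda>r. r)"

definition linear_iso ::
  "('s, 'e) ring_scheme \<Rightarrow> ('s, 'a, 'f) module_scheme \<Rightarrow> ('s, 'b, 'g) module_scheme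
    \<Rightarrow> ('a \<Rightarrow> 'b) \<Rightarrow> bool" where
  "linear_iso S M N f \<longleftrightarrow> linear_map S M N f \<and> bij_betw f (carrier M) (carrier N)"

text \<open>
  The record type of modules carries the ring operations as well; where only a module is meant
  (here and for differentials below) multiplication and unit are left unspecified.
\<close>

definition lin_dual :: "('s, 'e) ring_scheme \<Rightarrow> ('s, 'a, 'f) module_scheme \<Rightarrow> ('s, 'a \<Rightarrow> 's) module" where
  "lin_dual S M = \<lparr>
     carrier = {\<phi> \<in> carrier M \<rightarrow>\<^sub>E carrier S. linear_map S M (ring_module S) \<phi>},
     mult = undefined, one = undefined,
     zero = (\<lambda>x\<in>carrier M. \<zero>\<^bsub>S\<^esub>),
     add = (\<lambda>\<phi> \<psi>. \<lambda>x\<in>carrier M. \<phi> x \<oplus>\<^bsub>S\<^esub> \<psi> x),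
     smult = (\<lambda>r \<phi>. \<lambda>x\<in>carrier M. r \<otimes>\<^bsub>S\<^esub> \<phi> x)\<rparr>"

text \<open>
  Finite locally free means finitely generated projective, i.e. a retract of some \<open>S\<^sup>n\<close>:
  the entries \<open>(e, \<phi>)\<close> of the list are the components of \<open>S\<^sup>n \<rightarrow> M\<close> and of its section \<open>M \<rightarrow> S\<^sup>n\<close>.
\<close>

definition finite_projective :: "('s, 'e) ring_scheme \<Rightarrow> ('s, 'a, 'f) module_scheme \<Rightarrow> bool" where
  "finite_projective S M \<longleftrightarrow> module S M \<and>
     (\<exists>bs. set bs \<subseteq> carrier M \<times> carrier (lin_dual S M) \<and>
       (\<forall>x\<in>carrier M. x = lsum M (map (\<lambda>(e, \<phi>). \<phi> x \<odot>\<^bsub>M\<^esub> e) bs)))"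


subsection \<open>Tensor products\<close>

inductive tensor_rel ::
  "('s, 'e) ring_scheme \<Rightarrow> ('s, 'a, 'f) module_scheme \<Rightarrow> ('s, 'b, 'g) module_scheme
    \<Rightarrow> ('a \<times> 'b) list \<Rightarrow> ('a \<times> 'b) list \<Rightarrow> bool"
  for S M N
where
  add_left: "x \<in> carrier M \<Longrightarrow> x' \<in> carrier M \<Longrightarrow>
    tensor_rel S M N [(x \<oplus>\<^bsub>M\<^esub> x', y)] [(x, y), (x', y)]"
| add_right: "y \<in> carrier N \<Longrightarrow> y' \<in> carrier N \<Longrightarrow>
    tensor_rel S M N [(x, y \<oplus>\<^bsub>N\<^esub> y')] [(x, y), (x, y')]"
| balanced: "r \<in> carrier S \<Longrightarrow> x \<in> carrier M \<Longrightarrow> y \<in> carrier N \<Longrightarrow>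
    tensor_rel S M N [(r \<odot>\<^bsub>M\<^esub> x, y)] [(x, r \<odot>\<^bsub>N\<^esub> y)]"
| zero: "tensor_rel S M N [(\<zero>\<^bsub>M\<^esub>, y)] []"

definition tclass ::
  "('s, 'e) ring_scheme \<Rightarrow> ('s, 'a, 'f) module_scheme \<Rightarrow> ('s, 'b, 'g) module_scheme
    \<Rightarrow> ('a \<times> 'b) list \<Rightarrow> ('a \<times> 'b) list set" where
  "tclass S M N = fsum_class (carrier M \<times> carrier N) (tensor_rel S M N)"

text \<open>Multiplication and unit are meaningful when \<open>M\<close> and \<open>N\<close> are algebras.\<close>

definition tensor ::
  "('s, 'e) ring_scheme \<Rightarrow> ('s, 'a, 'f) module_scheme \<Rightarrow> ('s, 'b, 'g) module_scheme
    \<Rightarrow> ('s, ('a \<times> 'b) list set) module" where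
  "tensor S M N = \<lparr>
     carrier = tclass S M N ` lists (carrier M \<times> carrier N),
     mult = (\<lambda>t u. tclass S M N
       [(x \<otimes>\<^bsub>M\<^esub> x', y \<otimes>\<^bsub>N\<^esub> y'). (x, y) \<leftarrow> rep t, (x', y') \<leftarrow> rep u]),
     one = tclass S M N [(\<one>\<^bsub>M\<^esub>, \<one>\<^bsub>N\<^esub>)],
     zero = tclass S M N [],
     add = (\<lambda>t u. tclass S M N (rep t @ rep u)),
     smult = (\<lambda>r t. tclass S M N (map (\<lambda>(x, y). (r \<odot>\<^bsub>M\<^esub> x, y)) (rep t)))\<rparr>"


section \<open>Affine group schemes\<close>

record ('s, 'a) hopf = "('s, 'a) module" +
  comult :: "'a \<Rightarrow> ('a \<times> 'a) list set"
  counit :: "'a \<Rightarrow> 's"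
  antipode :: "'a \<Rightarrow> 'a"

text \<open>Cocommutative commutative Hopf algebras, i.e. commutative affine group schemes \<open>Spec A\<close> over \<open>S\<close>.\<close>

definition hopf_algebra :: "('s, 'e) ring_scheme \<Rightarrow> ('s, 'a) hopf \<Rightarrow> bool" where
  "hopf_algebra S A \<longleftrightarrow> (let AA = tensor S A A in
     algebra S A
     \<and> comult A \<in> ring_hom A AA \<and> linear_map S A AA (comult A)
     \<and> counit A \<in> ring_hom A S \<and> linear_map S A (ring_module S) (counit A)
     \<and> antipode A \<in> ring_hom A A \<and> linear_map S A A (antipode A)
     \<and> (\<forall>a\<in>carrier A.
          fs_lift (tensor S A AA)
            (\<lambda>(x, z). fs_lift (tensor S A AA) (\<lambda>(x1, x2). tclass S A AA [(x1, tclass S A A [(x2, z)])])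
               (comult A x)) (comult A a)
          = fs_lift (tensor S A AA) (\<lambda>(x, z). tclass S A AA [(x, comult A z)]) (comult A a))
     \<and> (\<forall>a\<in>carrier A. fs_lift A (\<lambda>(x, y). counit A x \<odot>\<^bsub>A\<^esub> y) (comult A a) = a)
     \<and> (\<forall>a\<in>carrier A. fs_lift A (\<lambda>(x, y). antipode A x \<otimes>\<^bsub>A\<^esub> y) (comult A a)
          = counit A a \<odot>\<^bsub>A\<^esub> \<one>\<^bsub>A\<^esub>)
     \<and> (\<forall>a\<in>carrier A. fs_lift AA (\<lambda>(x, y). tclass S A A [(y, x)]) (comult A a) = comult A a))"

text \<open>Homomorphisms of Hopf algebras over \<open>S\<close> and \<open>S'\<close> covering \<open>h : S \<rightarrow> S'\<close>.\<close>

definition hopf_hom ::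
  "('s, 'e) ring_scheme \<Rightarrow> ('t, 'f) ring_scheme \<Rightarrow> ('s \<Rightarrow> 't) \<Rightarrow> ('s, 'a) hopf \<Rightarrow> ('t, 'b) hopf
    \<Rightarrow> ('a \<Rightarrow> 'b) \<Rightarrow> bool" where
  "hopf_hom S S' h A B f \<longleftrightarrow> f \<in> ring_hom A B \<and> semilinear S h A B f
     \<and> (\<forall>a\<in>carrier A. comult B (f a)
          = fs_lift (tensor S' B B) (\<lambda>(x, y). tclass S' B B [(f x, f y)]) (comult A a))
     \<and> (\<forall>a\<in>carrier A. counit B (f a) = h (counit A a))"

text \<open>\<open>nat_mult A m\<close> is the pullback of functions along multiplication by \<open>m\<close> on the group \<open>Spec A\<close>.\<close>

primrec nat_mult :: "('s, 'a) hopf \<Rightarrow> nat \<Rightarrow> 'a \<Rightarrow> 'a" where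
  "nat_mult A 0 a = counit A a \<odot>\<^bsub>A\<^esub> \<one>\<^bsub>A\<^esub>"
| "nat_mult A (Suc m) a = fs_lift A (\<lambda>(x, y). x \<otimes>\<^bsub>A\<^esub> nat_mult A m y) (comult A a)"


subsection \<open>Cartier duality\<close>

text \<open>
  For \<open>G = Spec A\<close> finite locally free over \<open>S\<close>, the Cartier dual \<open>Hom(G, G_m)\<close> is the spectrum of
  \<open>Hom_S(A, S)\<close> with the transposed structure: a point \<open>u : Hom_S(A, S) \<rightarrow> B\<close> corresponds to the
  unit of \<open>A \<otimes> B\<close> whose contraction with \<open>\<phi>\<close> is \<open>u \<phi>\<close>, for all \<open>\<phi>\<close>.
\<close>

definition cartier_dual :: "('s, 'e) ring_scheme \<Rightarrow> ('s, 'a) hopf \<Rightarrow> ('s, 'a \<Rightarrow> 's) hopf" where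
  "cartier_dual S A = (let D = lin_dual S A in \<lparr>
     carrier = carrier D,
     mult = (\<lambda>\<phi> \<psi>. \<lambda>a\<in>carrier A. fs_lift S (\<lambda>(x, y). \<phi> x \<otimes>\<^bsub>S\<^esub> \<psi> y) (comult A a)),
     one = (\<lambda>a\<in>carrier A. counit A a),
     zero = zero D, add = add D, smult = smult D,
     comult = (\<lambda>\<phi>. THE t. t \<in> carrier (tensor S D D) \<and>
       (\<forall>a\<in>carrier A. \<forall>b\<in>carrier A.
          fs_lift S (\<lambda>(\<chi>, \<psi>). \<chi> a \<otimes>\<^bsub>S\<^esub> \<psi> b) t = \<phi> (a \<otimes>\<^bsub>A\<^esub> b))),
     counit = (\<lambda>\<phi>. \<phi> \<one>\<^bsub>A\<^esub>),
     antipode = (\<lambda>\<phi>. \<lambda>a\<in>carrier A. \<phi> (antipode A a))\<rparr>)"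

text \<open>
  The coordinate of \<open>G_m\<close> pulled back along the tautological pairing of \<open>Spec A\<close> and its dual: the unit
  of \<open>A \<otimes> Hom_S(A, S)\<close> corresponding to the identity point of the dual.
\<close>

definition pairing_unit :: "('s, 'e) ring_scheme \<Rightarrow> ('s, 'a) hopf \<Rightarrow> ('a \<times> ('a \<Rightarrow> 's)) list set" where
  "pairing_unit S A = (THE t. t \<in> carrier (tensor S A (cartier_dual S A)) \<and>
     (\<forall>\<phi>\<in>carrier (cartier_dual S A).
        fs_lift (cartier_dual S A) (\<lambda>(a, \<psi>). \<phi> a \<odot>\<^bsub>cartier_dual S A\<^esub> \<psi>) t = \<phi>))"


subsection \<open>Differentials\<close>

text \<open>The entry \<open>(a, b)\<close> stands for \<open>a db\<close>.\<close>

inductive kahler_rel ::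
  "('s, 'e) ring_scheme \<Rightarrow> ('s, 'a, 'f) module_scheme \<Rightarrow> ('a \<times> 'a) list \<Rightarrow> ('a \<times> 'a) list \<Rightarrow> bool"
  for S A
where
  add_coeff: "a \<in> carrier A \<Longrightarrow> a' \<in> carrier A \<Longrightarrow>
    kahler_rel S A [(a \<oplus>\<^bsub>A\<^esub> a', b)] [(a, b), (a', b)]"
| zero: "kahler_rel S A [(\<zero>\<^bsub>A\<^esub>, b)] []"
| d_add: "b \<in> carrier A \<Longrightarrow> b' \<in> carrier A \<Longrightarrow>
    kahler_rel S A [(a, b \<oplus>\<^bsub>A\<^esub> b')] [(a, b), (a, b')]"
| d_smult: "r \<in> carrier S \<Longrightarrow> a \<in> carrier A \<Longrightarrow> b \<in> carrier A \<Longrightarrow>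
    kahler_rel S A [(a, r \<odot>\<^bsub>A\<^esub> b)] [(r \<odot>\<^bsub>A\<^esub> a, b)]"
| leibniz: "a \<in> carrier A \<Longrightarrow> b \<in> carrier A \<Longrightarrow> b' \<in> carrier A \<Longrightarrow>
    kahler_rel S A [(a, b \<otimes>\<^bsub>A\<^esub> b')] [(a \<otimes>\<^bsub>A\<^esub> b, b'), (a \<otimes>\<^bsub>A\<^esub> b', b)]"

definition kclass ::
  "('s, 'e) ring_scheme \<Rightarrow> ('s, 'a, 'f) module_scheme \<Rightarrow> ('a \<times> 'a) list \<Rightarrow> ('a \<times> 'a) list set" where
  "kclass S A = fsum_class (carrier A \<times> carrier A) (kahler_rel S A)"

definition kahler ::
  "('s, 'e) ring_scheme \<Rightarrow> ('s, 'a, 'f) module_scheme \<Rightarrow> ('s, ('a \<times> 'a) list set) module" where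
  "kahler S A = \<lparr>
     carrier = kclass S A ` lists (carrier A \<times> carrier A),
     mult = undefined, one = undefined,
     zero = kclass S A [],
     add = (\<lambda>v w. kclass S A (rep v @ rep w)),
     smult = (\<lambda>r w. kclass S A (map (\<lambda>(a, b). (r \<odot>\<^bsub>A\<^esub> a, b)) (rep w)))\<rparr>"

definition kahler_act ::
  "('s, 'e) ring_scheme \<Rightarrow> ('s, 'a, 'f) module_scheme \<Rightarrow> 'a \<Rightarrow> ('a \<times> 'a) list set
    \<Rightarrow> ('a \<times> 'a) list set" where
  "kahler_act S A c w = kclass S A (map (\<lambda>(a, b). (c \<otimes>\<^bsub>A\<^esub> a, b)) (rep w))"

definition kahler_d ::
  "('s, 'e) ring_scheme \<Rightarrow> ('s, 'a, 'f) module_scheme \<Rightarrow> 'a \<Rightarrow> ('a \<times> 'a) list set" where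
  "kahler_d S A b = kclass S A [(\<one>\<^bsub>A\<^esub>, b)]"

text \<open>Pullback of differentials along the ring map \<open>f : A \<rightarrow> B\<close>.\<close>

definition kahler_map ::
  "('t, 'e) ring_scheme \<Rightarrow> ('t, 'b, 'f) module_scheme \<Rightarrow> ('a \<Rightarrow> 'b) \<Rightarrow> ('a \<times> 'a) list set
    \<Rightarrow> ('b \<times> 'b) list set" where
  "kahler_map S' B f w = kclass S' B (map (\<lambda>(a, b). (f a, f b)) (rep w))"

text \<open>
  For an \<open>S\<close>-algebra \<open>B\<close>, the \<open>B\<close>-linear differential \<open>A \<otimes> B \<rightarrow> \<Omega> \<otimes> B\<close> and the action of
  \<open>A \<otimes> B\<close> on \<open>\<Omega> \<otimes> B\<close>; note that \<open>\<Omega> \<otimes> B\<close> is the module of differentials of \<open>A \<otimes> B\<close> over \<open>B\<close>.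
\<close>

definition rel_d ::
  "('s, 'e) ring_scheme \<Rightarrow> ('s, 'a, 'f) module_scheme \<Rightarrow> ('s, 'b, 'g) module_scheme
    \<Rightarrow> ('a \<times> 'b) list set \<Rightarrow> (('a \<times> 'a) list set \<times> 'b) list set" where
  "rel_d S A B t = fs_lift (tensor S (kahler S A) B)
     (\<lambda>(a, b). tclass S (kahler S A) B [(kahler_d S A a, b)]) t"

definition rel_act ::
  "('s, 'e) ring_scheme \<Rightarrow> ('s, 'a, 'f) module_scheme \<Rightarrow> ('s, 'b, 'g) module_scheme
    \<Rightarrow> ('a \<times> 'b) list set \<Rightarrow> (('a \<times> 'a) list set \<times> 'b) list set
    \<Rightarrow> (('a \<times> 'a) list set \<times> 'b) list set" where
  "rel_act S A B t u = tclass S (kahler S A) B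
     [(kahler_act S A a w, b \<otimes>\<^bsub>B\<^esub> c). (a, b) \<leftarrow> rep t, (w, c) \<leftarrow> rep u]"

text \<open>
  Let \<open>G = Spec A\<close>.  The multiplication \<open>m : G \<times> G \<rightarrow> G\<close> is viewed over the second factor,
  that is, as the universal translation.  It pulls \<open>a db\<close> back to \<open>\<Delta>(a) d\<Delta>(b)\<close> with \<open>d\<close> acting on the
  first tensor factor, and a differential is invariant if this is its pullback along the projection.
  (As \<open>G\<close> is commutative, left and right invariance coincide.)
\<close>

definition translate ::
  "('s, 'e) ring_scheme \<Rightarrow> ('s, 'a) hopf \<Rightarrow> ('a \<times> 'a) list set
    \<Rightarrow> (('a \<times> 'a) list set \<times> 'a) list set" where
  "translate S A w = fs_lift (tensor S (kahler S A) A)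
     (\<lambda>(a, b). rel_act S A A (comult A a) (rel_d S A A (comult A b))) w"

definition invariant_differentials ::
  "('s, 'e) ring_scheme \<Rightarrow> ('s, 'a) hopf \<Rightarrow> ('s, ('a \<times> 'a) list set) module" where
  "invariant_differentials S A = (kahler S A)\<lparr>carrier :=
     {w \<in> carrier (kahler S A). translate S A w = tclass S (kahler S A) A [(w, \<one>\<^bsub>A\<^esub>)]}\<rparr>"


section \<open>Limits and colimits\<close>

text \<open>Inverse limits, with scalars acting on the \<open>k\<close>-th stage through \<open>h k\<close>.\<close>

definition invlim ::
  "(nat \<Rightarrow> ('s, 'c, 'z) module_scheme) \<Rightarrow> (nat \<Rightarrow> 'c \<Rightarrow> 'c) \<Rightarrow> (nat \<Rightarrow> 'r \<Rightarrow> 's)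
    \<Rightarrow> ('r, nat \<Rightarrow> 'c) module" where
  "invlim C f h = \<lparr>
     carrier = {x. \<forall>k. x k \<in> carrier (C k) \<and> f k (x (Suc k)) = x k},
     mult = (\<lambda>x y k. x k \<otimes>\<^bsub>C k\<^esub> y k), one = (\<lambda>k. \<one>\<^bsub>C k\<^esub>),
     zero = (\<lambda>k. \<zero>\<^bsub>C k\<^esub>), add = (\<lambda>x y k. x k \<oplus>\<^bsub>C k\<^esub> y k),
     smult = (\<lambda>r x k. h k r \<odot>\<^bsub>C k\<^esub> x k)\<rparr>"

text \<open>Direct limits of algebras; \<open>push f n l\<close> is the composite transition map from stage \<open>n\<close> to \<open>l \<ge> n\<close>.\<close>

definition push :: "(nat \<Rightarrow> 'c \<Rightarrow> 'c) \<Rightarrow> nat \<Rightarrow> nat \<Rightarrow> 'c \<Rightarrow> 'c" where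
  "push f n l = fold f [n..<l]"

definition dl_class ::
  "(nat \<Rightarrow> ('s, 'c, 'z) module_scheme) \<Rightarrow> (nat \<Rightarrow> 'c \<Rightarrow> 'c) \<Rightarrow> nat \<times> 'c \<Rightarrow> (nat \<times> 'c) set" where
  "dl_class C f = (\<lambda>(n, x). {(m, y). y \<in> carrier (C m) \<and>
     (\<exists>l. n \<le> l \<and> m \<le> l \<and> push f n l x = push f m l y)})"

definition dl_binop ::
  "(nat \<Rightarrow> ('s, 'c, 'z) module_scheme) \<Rightarrow> (nat \<Rightarrow> 'c \<Rightarrow> 'c) \<Rightarrow> (nat \<Rightarrow> 'c \<Rightarrow> 'c \<Rightarrow> 'c)
    \<Rightarrow> (nat \<times> 'c) set \<Rightarrow> (nat \<times> 'c) set \<Rightarrow> (nat \<times> 'c) set" where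
  "dl_binop C f opn u v = (case (rep u, rep v) of ((m, x), (n, y)) \<Rightarrow>
     let l = max m n in dl_class C f (l, opn l (push f m l x) (push f n l y)))"

definition dirlim ::
  "(nat \<Rightarrow> ('s, 'c, 'z) module_scheme) \<Rightarrow> (nat \<Rightarrow> 'c \<Rightarrow> 'c) \<Rightarrow> ('s, (nat \<times> 'c) set) module" where
  "dirlim C f = \<lparr>
     carrier = {dl_class C f (n, x) | n x. x \<in> carrier (C n)},
     mult = dl_binop C f (\<lambda>l. mult (C l)), one = dl_class C f (0, \<one>\<^bsub>C 0\<^esub>),
     zero = dl_class C f (0, \<zero>\<^bsub>C 0\<^esub>), add = dl_binop C f (\<lambda>l. add (C l)),
     smult = (\<lambda>r u. case rep u of (n, x) \<Rightarrow> dl_class C f (n, r \<odot>\<^bsub>C n\<^esub> x))\<rparr>"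


section \<open>The \<open>p\<close>-adic topology\<close>

definition p_ideal :: "('r, 'm) ring_scheme \<Rightarrow> nat \<Rightarrow> nat \<Rightarrow> 'r set" where
  "p_ideal R p k = PIdl\<^bsub>R\<^esub> ([(p ^ k :: nat)] \<cdot>\<^bsub>R\<^esub> \<one>\<^bsub>R\<^esub>)"

definition R_mod :: "('r, 'm) ring_scheme \<Rightarrow> nat \<Rightarrow> nat \<Rightarrow> 'r set ring" where
  "R_mod R p k = R Quot p_ideal R p k"

definition to_mod :: "('r, 'm) ring_scheme \<Rightarrow> nat \<Rightarrow> nat \<Rightarrow> 'r \<Rightarrow> 'r set" where
  "to_mod R p k r = p_ideal R p k +>\<^bsub>R\<^esub> r"

text \<open>The reduction map \<open>R/p\<^sup>k\<^sup>+\<^sup>1 \<rightarrow> R/p\<^sup>k\<close> on cosets.\<close>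

definition mod_red :: "('r, 'm) ring_scheme \<Rightarrow> nat \<Rightarrow> nat \<Rightarrow> 'r set \<Rightarrow> 'r set" where
  "mod_red R p k c = p_ideal R p k <+>\<^bsub>R\<^esub> c"

text \<open>Complete and separated: \<open>R\<close> maps bijectively to the inverse limit of the \<open>R/p\<^sup>k\<close>.\<close>

definition p_adically_complete :: "('r, 'm) ring_scheme \<Rightarrow> nat \<Rightarrow> bool" where
  "p_adically_complete R p \<longleftrightarrow>
     (\<forall>c. (\<forall>k. c k \<in> carrier (R_mod R p k) \<and> mod_red R p k (c (Suc k)) = c k)
        \<longrightarrow> (\<exists>!r. r \<in> carrier R \<and> (\<forall>k. to_mod R p k r = c k)))"

definition p_multiples :: "nat \<Rightarrow> ('b, 'f) ring_scheme \<Rightarrow> nat \<Rightarrow> 'b set" where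
  "p_multiples p M k = (\<lambda>x. [(p ^ k :: nat)] \<cdot>\<^bsub>M\<^esub> x) ` carrier M"

text \<open>Bases of open neighbourhoods of zero: \<open>p\<close>-adic, and inverse limit of discrete stages.\<close>

definition p_adic_nhds :: "nat \<Rightarrow> ('b, 'f) ring_scheme \<Rightarrow> 'b set set" where
  "p_adic_nhds p M = range (p_multiples p M)"

definition limit_nhds :: "(nat \<Rightarrow> nat \<Rightarrow> 'c, 'f) ring_scheme \<Rightarrow> (nat \<Rightarrow> nat \<Rightarrow> 'c) set set" where
  "limit_nhds M = {{x \<in> carrier M. x k n = \<zero>\<^bsub>M\<^esub> k n} | k n. True}"

definition continuous_at_zero :: "'a set set \<Rightarrow> 'b set set \<Rightarrow> ('a \<Rightarrow> 'b) \<Rightarrow> bool" where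
  "continuous_at_zero \<U> \<V> f \<longleftrightarrow> (\<forall>V\<in>\<V>. \<exists>U\<in>\<U>. f ` U \<subseteq> V)"

text \<open>The continuous dual, where \<open>M\<close> has the linear topology with basis \<open>\<U>\<close> and \<open>R\<close> the \<open>p\<close>-adic one.\<close>

definition cont_dual ::
  "('r, 'm) ring_scheme \<Rightarrow> nat \<Rightarrow> ('r, 'b, 'f) module_scheme \<Rightarrow> 'b set set \<Rightarrow> ('r, 'b \<Rightarrow> 'r) module" where
  "cont_dual R p M \<U> = (lin_dual R M)\<lparr>carrier :=
     {\<mu> \<in> carrier (lin_dual R M). continuous_at_zero \<U> (p_adic_nhds p R) \<mu>}\<rparr>"


section \<open>Divisible groups\<close>

text \<open>
  Data of a group over \<open>Spf R\<close>: \<open>lev H k n\<close> is the Hopf algebra of the \<open>p\<^sup>n\<close>-torsion over \<open>R/p\<^sup>k\<close>,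
  \<open>incl H k n\<close> is restriction of functions from the \<open>p\<^sup>n\<^sup>+\<^sup>1\<close>-torsion to the \<open>p\<^sup>n\<close>-torsion, and
  \<open>bc H k n\<close> is reduction of functions from \<open>R/p\<^sup>k\<^sup>+\<^sup>1\<close> to \<open>R/p\<^sup>k\<close>.
\<close>

record ('s, 'a) pdiv =
  lev :: "nat \<Rightarrow> nat \<Rightarrow> ('s, 'a) hopf"
  incl :: "nat \<Rightarrow> nat \<Rightarrow> 'a \<Rightarrow> 'a"
  bc :: "nat \<Rightarrow> nat \<Rightarrow> 'a \<Rightarrow> 'a"

text \<open>
  Over a base ring \<open>S\<close>: finite locally free \<open>G\<^sub>n\<close> with \<open>G\<^sub>n\<close> identified with the kernel of \<open>p\<^sup>n\<close> on
  \<open>G\<^sub>n\<^sub>+\<^sub>1\<close>, and such that the map \<open>G\<^sub>n\<^sub>+\<^sub>1 \<rightarrow> G\<^sub>n\<close> through which multiplication by \<open>p\<close> factors is an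
  epimorphism.  The latter is expressed by \<open>\<rho>\<close> being faithfully flat, which
  for finite locally free group schemes means finite locally free and surjective on spectra
  (for finite \<open>\<rho>\<close>, injectivity of \<open>\<rho>\<close> gives the surjectivity).
\<close>

definition p_divisible_over ::
  "nat \<Rightarrow> ('s, 'e) ring_scheme \<Rightarrow> (nat \<Rightarrow> ('s, 'a) hopf) \<Rightarrow> (nat \<Rightarrow> 'a \<Rightarrow> 'a) \<Rightarrow> bool" where
  "p_divisible_over p S A \<pi> \<longleftrightarrow> (\<forall>n.
     hopf_algebra S (A n) \<and> finite_projective S (A n)
     \<and> hopf_hom S S (\<lambda>r. r) (A (Suc n)) (A n) (\<pi> n)
     \<and> \<pi> n ` carrier (A (Suc n)) = carrier (A n)
     \<and> a_kernel (A (Suc n)) (A n) (\<pi> n)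
         = Idl\<^bsub>A (Suc n)\<^esub> (nat_mult (A (Suc n)) (p ^ n) ` a_kernel (A (Suc n)) S (counit (A (Suc n))))
     \<and> (\<exists>\<rho>\<in>ring_hom (A n) (A (Suc n)).
          (\<forall>a\<in>carrier (A (Suc n)). \<rho> (\<pi> n a) = nat_mult (A (Suc n)) p a)
          \<and> finite_projective (A n) (alg_via (A (Suc n)) \<rho>) \<and> inj_on \<rho> (carrier (A n))))"

text \<open>
  Over \<open>Spf R\<close>: a compatible system of such groups over the \<open>R/p\<^sup>k\<close>, the stage \<open>k\<close> being the base change
  of the stage \<open>k + 1\<close> (a surjective reduction map whose kernel consists of the multiples of \<open>p\<^sup>k\<close>).
\<close>

definition p_divisible_group ::
  "('r, 'm) ring_scheme \<Rightarrow> nat \<Rightarrow> ('r set, 'a) pdiv \<Rightarrow> bool" where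
  "p_divisible_group R p H \<longleftrightarrow>
     (\<forall>k. p_divisible_over p (R_mod R p k) (lev H k) (incl H k))
     \<and> (\<forall>k n. hopf_hom (R_mod R p (Suc k)) (R_mod R p k) (mod_red R p k)
               (lev H (Suc k) n) (lev H k n) (bc H k n)
          \<and> bc H k n ` carrier (lev H (Suc k) n) = carrier (lev H k n)
          \<and> a_kernel (lev H (Suc k) n) (lev H k n) (bc H k n) = p_multiples p (lev H (Suc k) n) k
          \<and> (\<forall>a\<in>carrier (lev H (Suc k) (Suc n)).
               incl H k n (bc H k (Suc n) a) = bc H k n (incl H (Suc k) n a)))"


subsection \<open>Functions and differentials on the group\<close>

definition O_H :: "('r, 'm) ring_scheme \<Rightarrow> nat \<Rightarrow> ('r set, 'a) pdiv \<Rightarrow> ('r, nat \<Rightarrow> nat \<Rightarrow> 'a) module" where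
  "O_H R p H = invlim (\<lambda>k. invlim (lev H k) (incl H k) (\<lambda>n r. r)) (\<lambda>k x n. bc H k n (x n)) (to_mod R p)"

definition Omega_H ::
  "('r, 'm) ring_scheme \<Rightarrow> nat \<Rightarrow> ('r set, 'a) pdiv \<Rightarrow> ('r, nat \<Rightarrow> nat \<Rightarrow> ('a \<times> 'a) list set) module" where
  "Omega_H R p H = invlim
     (\<lambda>k. invlim (\<lambda>n. kahler (R_mod R p k) (lev H k n))
        (\<lambda>n. kahler_map (R_mod R p k) (lev H k n) (incl H k n)) (\<lambda>n r. r))
     (\<lambda>k w n. kahler_map (R_mod R p k) (lev H k n) (bc H k n) (w n)) (to_mod R p)"

definition omega_H ::
  "('r, 'm) ring_scheme \<Rightarrow> nat \<Rightarrow> ('r set, 'a) pdiv \<Rightarrow> ('r, nat \<Rightarrow> nat \<Rightarrow> ('a \<times> 'a) list set) module" where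
  "omega_H R p H = invlim
     (\<lambda>k. invlim (\<lambda>n. invariant_differentials (R_mod R p k) (lev H k n))
        (\<lambda>n. kahler_map (R_mod R p k) (lev H k n) (incl H k n)) (\<lambda>n r. r))
     (\<lambda>k w n. kahler_map (R_mod R p k) (lev H k n) (bc H k n) (w n)) (to_mod R p)"

definition Lie_H ::
  "('r, 'm) ring_scheme \<Rightarrow> nat \<Rightarrow> ('r set, 'a) pdiv
    \<Rightarrow> ('r, (nat \<Rightarrow> nat \<Rightarrow> ('a \<times> 'a) list set) \<Rightarrow> 'r) module" where
  "Lie_H R p H = lin_dual R (omega_H R p H)"

text \<open>
  The invariant vector field attached to \<open>v\<close>: the continuous \<open>O_H\<close>-linear form on differentials whose
  value on each invariant differential \<open>w\<close> is the constant \<open>v w\<close>.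
\<close>

definition invariant_field ::
  "('r, 'm) ring_scheme \<Rightarrow> nat \<Rightarrow> ('r set, 'a) pdiv \<Rightarrow> ((nat \<Rightarrow> nat \<Rightarrow> ('a \<times> 'a) list set) \<Rightarrow> 'r)
    \<Rightarrow> (nat \<Rightarrow> nat \<Rightarrow> ('a \<times> 'a) list set) \<Rightarrow> nat \<Rightarrow> nat \<Rightarrow> 'a" where
  "invariant_field R p H v = (THE X.
     X \<in> carrier (Omega_H R p H) \<rightarrow>\<^sub>E carrier (O_H R p H)
     \<and> (\<forall>w\<in>carrier (Omega_H R p H). \<forall>w'\<in>carrier (Omega_H R p H).
          X (w \<oplus>\<^bsub>Omega_H R p H\<^esub> w') = X w \<oplus>\<^bsub>O_H R p H\<^esub> X w')
     \<and> (\<forall>f\<in>carrier (O_H R p H). \<forall>w\<in>carrier (Omega_H R p H).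
          X (\<lambda>k n. kahler_act (R_mod R p k) (lev H k n) (f k n) (w k n)) = f \<otimes>\<^bsub>O_H R p H\<^esub> X w)
     \<and> continuous_at_zero (limit_nhds (Omega_H R p H)) (limit_nhds (O_H R p H)) X
     \<and> (\<forall>w\<in>carrier (omega_H R p H). X w = v w \<odot>\<^bsub>O_H R p H\<^esub> \<one>\<^bsub>O_H R p H\<^esub>))"

definition field_deriv ::
  "('r, 'm) ring_scheme \<Rightarrow> nat \<Rightarrow> ('r set, 'a) pdiv \<Rightarrow> ((nat \<Rightarrow> nat \<Rightarrow> ('a \<times> 'a) list set) \<Rightarrow> 'r)
    \<Rightarrow> (nat \<Rightarrow> nat \<Rightarrow> 'a) \<Rightarrow> nat \<Rightarrow> nat \<Rightarrow> 'a" where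
  "field_deriv R p H v f = invariant_field R p H v (\<lambda>k n. kahler_d (R_mod R p k) (lev H k n) (f k n))"


subsection \<open>Functions on the Tate module of the dual\<close>

text \<open>
  Multiplication by \<open>p\<close> from the \<open>p\<^sup>n\<^sup>+\<^sup>1\<close>-torsion to the \<open>p\<^sup>n\<close>-torsion of the Serre dual is the restriction of
  characters from the \<open>p\<^sup>n\<^sup>+\<^sup>1\<close>-torsion of \<open>H\<close> to its \<open>p\<^sup>n\<close>-torsion.  On functions it is therefore
  the transpose of \<open>incl H k n\<close>.
\<close>

definition dual_lev :: "('r, 'm) ring_scheme \<Rightarrow> nat \<Rightarrow> ('r set, 'a) pdiv \<Rightarrow> nat \<Rightarrow> nat
    \<Rightarrow> ('r set, 'a \<Rightarrow> 'r set) hopf" where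
  "dual_lev R p H k n = cartier_dual (R_mod R p k) (lev H k n)"

definition dual_trans :: "('r set, 'a) pdiv \<Rightarrow> nat \<Rightarrow> nat \<Rightarrow> ('a \<Rightarrow> 'r set) \<Rightarrow> 'a \<Rightarrow> 'r set" where
  "dual_trans H k n \<phi> = (\<lambda>a\<in>carrier (lev H k (Suc n)). \<phi> (incl H k n a))"

definition dual_bc :: "('r, 'm) ring_scheme \<Rightarrow> nat \<Rightarrow> ('r set, 'a) pdiv \<Rightarrow> nat \<Rightarrow> nat
    \<Rightarrow> ('a \<Rightarrow> 'r set) \<Rightarrow> 'a \<Rightarrow> 'r set" where
  "dual_bc R p H k n \<phi> = (\<lambda>x\<in>carrier (lev H k n).
     mod_red R p k (\<phi> (SOME a. a \<in> carrier (lev H (Suc k) n) \<and> bc H k n a = x)))"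

definition O_T_mod :: "('r, 'm) ring_scheme \<Rightarrow> nat \<Rightarrow> ('r set, 'a) pdiv \<Rightarrow> nat
    \<Rightarrow> ('r set, (nat \<times> ('a \<Rightarrow> 'r set)) set) module" where
  "O_T_mod R p H k = dirlim (dual_lev R p H k) (dual_trans H k)"

definition O_T :: "('r, 'm) ring_scheme \<Rightarrow> nat \<Rightarrow> ('r set, 'a) pdiv
    \<Rightarrow> ('r, nat \<Rightarrow> (nat \<times> ('a \<Rightarrow> 'r set)) set) module" where
  "O_T R p H = invlim (O_T_mod R p H)
     (\<lambda>k u. case rep u of (n, \<phi>) \<Rightarrow> dl_class (dual_lev R p H k) (dual_trans H k) (n, dual_bc R p H k n \<phi>))
     (to_mod R p)"


subsection \<open>The kernel and the Fourier transforms\<close>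

text \<open>
  The completed tensor product of \<open>O_H\<close> and \<open>O_T\<close> is the inverse limit over \<open>k\<close> and \<open>n\<close> of the
  \<open>lev H k n \<otimes> O_T_mod R p H k\<close>.  Its element \<open>\<kappa>\<close> is given by its components; the \<open>(k, n)\<close>-component
  comes from the pairing of the \<open>p\<^sup>n\<close>-torsion of \<open>H\<close> with the \<open>p\<^sup>n\<close>-torsion of the dual.
\<close>

definition kappa :: "('r, 'm) ring_scheme \<Rightarrow> nat \<Rightarrow> ('r set, 'a) pdiv \<Rightarrow> nat \<Rightarrow> nat
    \<Rightarrow> ('a \<times> (nat \<times> ('a \<Rightarrow> 'r set)) set) list set" where
  "kappa R p H k n = (let S = R_mod R p k; A = lev H k n; B = O_T_mod R p H k in
     fs_lift (tensor S A B)
       (\<lambda>(a, \<phi>). tclass S A B [(a, dl_class (dual_lev R p H k) (dual_trans H k) (n, \<phi>))])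
       (pairing_unit S A))"

text \<open>
  A contraction is the continuous extension of a map \<open>F\<close> on algebraic tensors \<open>\<Sum> x \<otimes> y\<close>.
  \<open>approximates\<close> says that such a sum, with \<open>x \<in> M\<close> and \<open>y \<in> O_T\<close>, has the same \<open>(k, n)\<close>-component,
  in \<open>Q k n \<otimes> O_T_mod R p H k\<close>, as the given element \<open>t\<close> of the completed tensor product;
  \<open>contraction\<close> is the limit of the values \<open>\<Sum> F (x, y)\<close> in \<open>P\<close>.
\<close>

definition approximates ::
  "('r, 'm) ring_scheme \<Rightarrow> nat \<Rightarrow> ('r set, 'a) pdiv
    \<Rightarrow> (nat \<Rightarrow> nat \<Rightarrow> ('r set, 'c, 'f) module_scheme)
    \<Rightarrow> (nat \<Rightarrow> nat \<Rightarrow> ('c \<times> (nat \<times> ('a \<Rightarrow> 'r set)) set) list set)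
    \<Rightarrow> ('r, nat \<Rightarrow> nat \<Rightarrow> 'c, 'g) module_scheme
    \<Rightarrow> nat \<Rightarrow> nat \<Rightarrow> ((nat \<Rightarrow> nat \<Rightarrow> 'c) \<times> (nat \<Rightarrow> (nat \<times> ('a \<Rightarrow> 'r set)) set)) list \<Rightarrow> bool" where
  "approximates R p H Q t M k n zs \<longleftrightarrow>
     set zs \<subseteq> carrier M \<times> carrier (O_T R p H)
     \<and> tclass (R_mod R p k) (Q k n) (O_T_mod R p H k) (map (\<lambda>(x, y). (x k n, y k)) zs) = t k n"

definition contraction ::
  "('b, 'f) ring_scheme \<Rightarrow> 'b set set \<Rightarrow> ('z \<Rightarrow> 'b) \<Rightarrow> (nat \<Rightarrow> nat \<Rightarrow> 'z list \<Rightarrow> bool) \<Rightarrow> 'b" where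
  "contraction P \<U> F appr = (THE g. g \<in> carrier P \<and>
     (\<forall>U\<in>\<U>. \<exists>N. \<forall>k\<ge>N. \<forall>n\<ge>N. \<forall>zs. appr k n zs \<longrightarrow> lsum P (map F zs) \<ominus>\<^bsub>P\<^esub> g \<in> U))"

definition O_H_dual :: "('r, 'm) ring_scheme \<Rightarrow> nat \<Rightarrow> ('r set, 'a) pdiv
    \<Rightarrow> ('r, (nat \<Rightarrow> nat \<Rightarrow> 'a) \<Rightarrow> 'r) module" where
  "O_H_dual R p H = cont_dual R p (O_H R p H) (limit_nhds (O_H R p H))"

definition O_T_dual :: "('r, 'm) ring_scheme \<Rightarrow> nat \<Rightarrow> ('r set, 'a) pdiv
    \<Rightarrow> ('r, (nat \<Rightarrow> (nat \<times> ('a \<Rightarrow> 'r set)) set) \<Rightarrow> 'r) module" where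
  "O_T_dual R p H = cont_dual R p (O_T R p H) (p_adic_nhds p (O_T R p H))"

definition fourier_upper :: "('r, 'm) ring_scheme \<Rightarrow> nat \<Rightarrow> ('r set, 'a) pdiv
    \<Rightarrow> ((nat \<Rightarrow> nat \<Rightarrow> 'a) \<Rightarrow> 'r) \<Rightarrow> nat \<Rightarrow> (nat \<times> ('a \<Rightarrow> 'r set)) set" where
  "fourier_upper R p H \<mu> = contraction (O_T R p H) (p_adic_nhds p (O_T R p H))
     (\<lambda>(x, y). \<mu> x \<odot>\<^bsub>O_T R p H\<^esub> y) (approximates R p H (lev H) (kappa R p H) (O_H R p H))"

definition fourier_lower :: "('r, 'm) ring_scheme \<Rightarrow> nat \<Rightarrow> ('r set, 'a) pdiv
    \<Rightarrow> ((nat \<Rightarrow> (nat \<times> ('a \<Rightarrow> 'r set)) set) \<Rightarrow> 'r) \<Rightarrow> nat \<Rightarrow> nat \<Rightarrow> 'a" where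
  "fourier_lower R p H \<nu> = contraction (O_H R p H) (limit_nhds (O_H R p H))
     (\<lambda>(x, y). \<nu> y \<odot>\<^bsub>O_H R p H\<^esub> x) (approximates R p H (lev H) (kappa R p H) (O_H R p H))"


subsection \<open>The Hodge--Tate map\<close>

text \<open>
  The universal point of the Tate module is the character \<open>\<kappa>\<close>; its image under the Hodge--Tate map
  is the pullback \<open>\<kappa>\<^sup>-\<^sup>1 d\<kappa>\<close> of \<open>dt/(1+t)\<close>, given here by its components.
  Evaluating \<open>v\<close>, a linear function on the invariant differentials, at the universal point
  is the pullback of the function \<open>v\<close> along the Hodge--Tate map.
\<close>

definition hodge_tate :: "('r, 'm) ring_scheme \<Rightarrow> nat \<Rightarrow> ('r set, 'a) pdiv \<Rightarrow> nat \<Rightarrow> nat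
    \<Rightarrow> (('a \<times> 'a) list set \<times> (nat \<times> ('a \<Rightarrow> 'r set)) set) list set" where
  "hodge_tate R p H k n = (let S = R_mod R p k; A = lev H k n; B = O_T_mod R p H k in
     THE t. t \<in> carrier (tensor S (kahler S A) B) \<and>
       rel_act S A B (kappa R p H k n) t = rel_d S A B (kappa R p H k n))"

definition HT_linear :: "('r, 'm) ring_scheme \<Rightarrow> nat \<Rightarrow> ('r set, 'a) pdiv
    \<Rightarrow> ((nat \<Rightarrow> nat \<Rightarrow> ('a \<times> 'a) list set) \<Rightarrow> 'r) \<Rightarrow> nat \<Rightarrow> (nat \<times> ('a \<Rightarrow> 'r set)) set" where
  "HT_linear R p H v = contraction (O_T R p H) (p_adic_nhds p (O_T R p H))
     (\<lambda>(w, y). v w \<odot>\<^bsub>O_T R p H\<^esub> y)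
     (approximates R p H (\<lambda>k n. kahler (R_mod R p k) (lev H k n)) (hodge_tate R p H) (omega_H R p H))"


section \<open>The symmetric algebra and its actions\<close>

text \<open>The entry \<open>(r, [v\<^sub>1, \<dots>, v\<^sub>m])\<close> stands for \<open>r v\<^sub>1 \<cdots> v\<^sub>m\<close>.\<close>

inductive sym_rel ::
  "('r, 'm) ring_scheme \<Rightarrow> ('r, 'v, 'f) module_scheme \<Rightarrow> ('r \<times> 'v list) list \<Rightarrow> ('r \<times> 'v list) list \<Rightarrow> bool"
  for R M
where
  add_coeff: "r \<in> carrier R \<Longrightarrow> s \<in> carrier R \<Longrightarrow>
    sym_rel R M [(r \<oplus>\<^bsub>R\<^esub> s, vs)] [(r, vs), (s, vs)]"
| zero: "sym_rel R M [(\<zero>\<^bsub>R\<^esub>, vs)] []"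
| add_var: "v \<in> carrier M \<Longrightarrow> w \<in> carrier M \<Longrightarrow>
    sym_rel R M [(r, (v \<oplus>\<^bsub>M\<^esub> w) # vs)] [(r, v # vs), (r, w # vs)]"
| smult_var: "r \<in> carrier R \<Longrightarrow> s \<in> carrier R \<Longrightarrow> v \<in> carrier M \<Longrightarrow>
    sym_rel R M [(r, (s \<odot>\<^bsub>M\<^esub> v) # vs)] [(r \<otimes>\<^bsub>R\<^esub> s, v # vs)]"
| perm: "mset vs = mset ws \<Longrightarrow> sym_rel R M [(r, vs)] [(r, ws)]"

definition symclass ::
  "('r, 'm) ring_scheme \<Rightarrow> ('r, 'v, 'f) module_scheme \<Rightarrow> ('r \<times> 'v list) list \<Rightarrow> ('r \<times> 'v list) list set" where
  "symclass R M = fsum_class (carrier R \<times> lists (carrier M)) (sym_rel R M)"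

definition sym_algebra ::
  "('r, 'm) ring_scheme \<Rightarrow> ('r, 'v, 'f) module_scheme \<Rightarrow> ('r, ('r \<times> 'v list) list set) module" where
  "sym_algebra R M = \<lparr>
     carrier = symclass R M ` lists (carrier R \<times> lists (carrier M)),
     mult = (\<lambda>t u. symclass R M [(r \<otimes>\<^bsub>R\<^esub> s, vs @ ws). (r, vs) \<leftarrow> rep t, (s, ws) \<leftarrow> rep u]),
     one = symclass R M [(\<one>\<^bsub>R\<^esub>, [])],
     zero = symclass R M [],
     add = (\<lambda>t u. symclass R M (rep t @ rep u)),
     smult = (\<lambda>s t. symclass R M (map (\<lambda>(r, vs). (s \<otimes>\<^bsub>R\<^esub> r, vs)) (rep t)))\<rparr>"

type_synonym ('r, 'a) lie = "(nat \<Rightarrow> nat \<Rightarrow> ('a \<times> 'a) list set) \<Rightarrow> 'r"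

definition Sym_Lie :: "('r, 'm) ring_scheme \<Rightarrow> nat \<Rightarrow> ('r set, 'a) pdiv
    \<Rightarrow> ('r, ('r \<times> ('r, 'a) lie list) list set) module" where
  "Sym_Lie R p H = sym_algebra R (Lie_H R p H)"

definition act_O_H :: "('r, 'm) ring_scheme \<Rightarrow> nat \<Rightarrow> ('r set, 'a) pdiv
    \<Rightarrow> ('r \<times> ('r, 'a) lie list) list set \<Rightarrow> (nat \<Rightarrow> nat \<Rightarrow> 'a) \<Rightarrow> nat \<Rightarrow> nat \<Rightarrow> 'a" where
  "act_O_H R p H P f = fs_lift (O_H R p H)
     (\<lambda>(r, vs). r \<odot>\<^bsub>O_H R p H\<^esub> foldr (field_deriv R p H) vs f) P"

text \<open>Pullback along the Hodge--Tate map of polynomial functions on the invariant differentials.\<close>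

definition HT_pullback :: "('r, 'm) ring_scheme \<Rightarrow> nat \<Rightarrow> ('r set, 'a) pdiv
    \<Rightarrow> ('r \<times> ('r, 'a) lie list) list set \<Rightarrow> nat \<Rightarrow> (nat \<times> ('a \<Rightarrow> 'r set)) set" where
  "HT_pullback R p H P = fs_lift (O_T R p H)
     (\<lambda>(r, vs). r \<odot>\<^bsub>O_T R p H\<^esub>
        foldr (\<lambda>v g. HT_linear R p H v \<otimes>\<^bsub>O_T R p H\<^esub> g) vs \<one>\<^bsub>O_T R p H\<^esub>) P"

definition act_O_T :: "('r, 'm) ring_scheme \<Rightarrow> nat \<Rightarrow> ('r set, 'a) pdiv
    \<Rightarrow> ('r \<times> ('r, 'a) lie list) list set \<Rightarrow> (nat \<Rightarrow> (nat \<times> ('a \<Rightarrow> 'r set)) set)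
    \<Rightarrow> nat \<Rightarrow> (nat \<times> ('a \<Rightarrow> 'r set)) set" where
  "act_O_T R p H P g = HT_pullback R p H P \<otimes>\<^bsub>O_T R p H\<^esub> g"

definition dual_act :: "('b, 'f) ring_scheme \<Rightarrow> ('q \<Rightarrow> 'b \<Rightarrow> 'b) \<Rightarrow> 'q \<Rightarrow> ('b \<Rightarrow> 'r) \<Rightarrow> 'b \<Rightarrow> 'r" where
  "dual_act M act P \<mu> = (\<lambda>f\<in>carrier M. \<mu> (act P f))"

end

theory Submission
  imports Defs
begin

text \<open>
  The two rings of functions are in perfect topological duality.  A continuous functional on \<open>O_H\<close> with values
  in \<open>R/p\<^sup>j\<close> factors through a torsion level over \<open>R/p\<^sup>j\<close> (\<open>functional_dual\<close>), hence is an element of the dual of that level,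
  and these duals are the stages of \<open>O_T\<close>.  Conversely each level is finitely generated projective, hence reflexive, so a functional
  on \<open>O_T\<close> is evaluation at a function on the group.  This yields an \<open>R\<close>-valued bilinear map \<open>pair\<close> on \<open>O_H \<times> O_T\<close> that represents
  both continuous duals (\<open>OHd_pair\<close>, \<open>Td_pair\<close>).  The kernel \<open>\<kappa>\<close> is on each level the canonical element \<open>\<Sum> e\<^sub>i \<otimes> \<phi>\<^sub>i\<close> of a module and its
  dual, so that contraction with \<open>\<kappa>\<close> inverts the pairing (\<open>fourier_upper_eqI\<close>, \<open>fourier_lower_eqI\<close>), and the Fourier transforms are
  isomorphisms.

  Equivariance then becomes the adjunction \<open>pair (D\<^sub>v f) g = pair f (HT(v) g)\<close>, where \<open>D\<^sub>v\<close> is differentiation along \<open>v\<close> and \<open>HT(v)\<close> is the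
  function \<open>v\<close> pulled back along the Hodge--Tate map (\<open>pair_field_deriv\<close>).  Let \<open>\<theta>(f)\<close> be the invariant differential with
  the value of \<open>df\<close> at the origin, \<open>\<Sum> \<sigma>(f\<^sub>1) df\<^sub>2\<close> in Sweedler's notation.  Then \<open>f \<mapsto> v(\<theta>(f))\<close> is a tangent vector at the origin, which
  on a torsion level modulo \<open>p\<^sup>j\<close> is an element \<open>\<delta>\<close> of the dual algebra, and the adjunction has three ingredients.
  First, multiplication in the dual algebra is convolution, so
  the transpose of multiplication by \<open>\<delta>\<close> is \<open>f \<mapsto> \<Sum> \<delta>(f\<^sub>2) f\<^sub>1\<close> (\<open>D_deriv\<close>).  Second, this derivation is
  the invariant vector field of \<open>v\<close>, as \<open>df = \<Sum> f\<^sub>1 \<theta>(f\<^sub>2)\<close> and invariant differentials span all differentials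
  (\<open>vector_field_unique\<close>, \<open>field_deriv_eq\<close>).  Third, by the same formula the logarithmic derivative of \<open>\<kappa> = \<Sum> e\<^sub>i \<otimes> \<phi>\<^sub>i\<close>
  is \<open>\<Sum> \<theta>(e\<^sub>i) \<otimes> \<phi>\<^sub>i\<close> (\<open>log_derivative_unique\<close>), whose contraction with \<open>v\<close> is \<open>\<delta>\<close> (\<open>HT_linear_eq\<close>).

  The passage between levels rests on one fact about invariant differentials: an invariant differential that vanishes modulo
  \<open>p\<^sup>j\<close> on the \<open>p\<^sup>n\<close>-torsion for some \<open>n \<ge> j\<close> is divisible by \<open>p\<^sup>j\<close> (\<open>wH_divide\<close>).  It makes every \<open>R\<close>-linear \<open>v\<close> continuous, and it holds
  because the \<open>p\<^sup>n\<close>-torsion is cut out by functions pulled back along \<open>p\<^sup>n\<close>, whose differential at the origin is a multiple of \<open>p\<^sup>n\<close>.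
\<close>

text \<open>
  Almost every hypothesis below is membership in the carrier of a structure, and many operations are indexed by a
  structure with a one-letter name; both get a compact notation.
\<close>

abbreviation mem_carrier (infix "<:" 50) where
  "x <: M \<equiv> x \<in> carrier M"

syntax "_index" :: "logic \<Rightarrow> index"  ("\<^sub>_" [1000])

section \<open>Sums over lists and additive maps\<close>

lemma lsum_Nil [simp]: "lsum P [] = \<zero>\<^sub>P"
 by (simp add: lsum_def)

lemma lsum_Cons [simp]: "lsum P (x # xs) = x \<oplus>\<^sub>P lsum P xs"
 by (simp add: lsum_def)

context abelian_monoid
begin

lemma lsum_closed [simp, intro]: "set xs \<subseteq> carrier G ==> lsum G xs <: G"
 by (induction xs) auto

lemma lsum_append:
 "set xs \<subseteq> carrier G ==> set ys \<subseteq> carrier G ==> lsum G (xs @ ys) = lsum G xs \<oplus> lsum G ys"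
 by (induction xs) (auto simp: a_assoc)

lemma lsum_map_closed:
 "(\<And>x. x \<in> set xs ==> f x <: G) ==> lsum G (map f xs) <: G"
 by (rule lsum_closed) auto

lemma lsum_map_zero: "(\<And>x. x \<in> set xs ==> f x = \<zero>) ==> lsum G (map f xs) = \<zero>"
 by (induction xs) auto

lemma lsum_map_add:
 assumes "\<And>x. x \<in> set xs ==> f x <: G" "\<And>x. x \<in> set xs ==> g x <: G"
 shows "lsum G (map (\<lambda>x. f x \<oplus> g x) xs) = lsum G (map f xs) \<oplus> lsum G (map g xs)"
 using assms
proof (induction xs)
 case (Cons x xs)
 have "f x <: G" "g x <: G" "lsum G (map f xs) <: G" "lsum G (map g xs) <: G"
  using Cons.prems by (auto intro!: lsum_map_closed)
 then show ?case using Cons by (simp add: a_ac)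
qed simp

lemma lsum_swap:
 assumes "\<And>x y. x \<in> set xs ==> y \<in> set ys ==> f x y <: G"
 shows "lsum G (map (\<lambda>x. lsum G (map (f x) ys)) xs) = lsum G (map (\<lambda>y. lsum G (map (\<lambda>x. f x y) xs)) ys)"
 using assms
proof (induction xs)
 case Nil then show ?case by (simp add: lsum_map_zero)
next
 case (Cons x xs)
 have "lsum G (map (\<lambda>y. f x y \<oplus> lsum G (map (\<lambda>x. f x y) xs)) ys)
  = lsum G (map (f x) ys) \<oplus> lsum G (map (\<lambda>y. lsum G (map (\<lambda>x. f x y) xs)) ys)"
  using Cons.prems by (intro lsum_map_add) (auto intro!: lsum_map_closed)
 then show ?case using Cons by simp
qed

lemma lsum_concat:
 assumes "\<And>x y. x \<in> set xs ==> y \<in> set (f x) ==> g y <: G"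
 shows "lsum G (map g (concat (map f xs))) = lsum G (map (\<lambda>x. lsum G (map g (f x))) xs)"
 using assms
proof (induction xs)
 case (Cons x xs)
 have "lsum G (map g (f x) @ map g (concat (map f xs)))
   = lsum G (map g (f x)) \<oplus> lsum G (map g (concat (map f xs)))"
  using Cons.prems by (intro lsum_append) auto
 moreover have "lsum G (map g (concat (map f xs))) = lsum G (map (\<lambda>x. lsum G (map g (f x))) xs)"
  using Cons.prems by (intro Cons.IH) auto
 ultimately show ?case by simp
qed simp

end

lemma lsum_cong: "(\<And>x. x \<in> set xs ==> f x = g x) ==> lsum G (map f xs) = lsum G (map g xs)"
 by (metis map_eq_conv)

definition additive :: "('a, 'e) ring_scheme \<Rightarrow> ('b, 'f) ring_scheme \<Rightarrow> ('a \<Rightarrow> 'b) \<Rightarrow> bool" where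
 "additive G H f \<longleftrightarrow> f \<in> carrier G \<rightarrow> carrier H
  \<and> (\<forall>x\<in>carrier G. \<forall>y\<in>carrier G. f (x \<oplus>\<^sub>G y) = f x \<oplus>\<^sub>H f y)"

lemma additive_mapI:
 assumes "\<And>x. x <: G ==> f x <: H"
  and "\<And>x y. x <: G ==> y <: G ==> f (x \<oplus>\<^sub>G y) = f x \<oplus>\<^sub>H f y"
 shows "additive G H f"
 using assms by (auto simp: additive_def)

lemma additive_closed: "additive G H f ==> x <: G ==> f x <: H"
 by (auto simp: additive_def)

lemma additive_add:
 "additive G H f ==> x <: G ==> y <: G ==> f (x \<oplus>\<^sub>G y) = f x \<oplus>\<^sub>H f y"
 by (auto simp: additive_def)

lemma additive_zero:
 assumes "additive G H f" "abelian_group G" "abelian_group H"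
 shows "f \<zero>\<^sub>G = \<zero>\<^sub>H"
proof -
 interpret G: abelian_group G by fact
 interpret H: abelian_group H by fact
 have "f \<zero>\<^sub>G \<oplus>\<^sub>H f \<zero>\<^sub>G = f \<zero>\<^sub>G"
  using additive_add[OF assms(1), of "\<zero>\<^sub>G" "\<zero>\<^sub>G"] by simp
 then show ?thesis
  using additive_closed[OF assms(1), of "\<zero>\<^sub>G"] by (simp add: H.add.l_cancel_one)
qed

lemma additive_minus:
 assumes f: "additive G H f" and G: "abelian_group G" and H: "abelian_group H"
  and x: "x <: G"
 shows "f (\<ominus>\<^sub>G x) = \<ominus>\<^sub>H f x"
proof -
 interpret G: abelian_group G by fact
 interpret H: abelian_group H by fact
 have "f (\<ominus>\<^sub>G x) \<oplus>\<^sub>H f x = \<zero>\<^sub>H"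
  using additive_add[OF f, of "\<ominus>\<^sub>G x" x] x additive_zero[OF f G H] by (simp add: G.l_neg)
 then show ?thesis using x additive_closed[OF f] by (simp add: H.minus_equality)
qed

lemma additive_diff:
 assumes f: "additive G H f" and G: "abelian_group G" and H: "abelian_group H"
  and x: "x <: G" and y: "y <: G"
 shows "f (x \<ominus>\<^sub>G y) = f x \<ominus>\<^sub>H f y"
proof -
 interpret G: abelian_group G by fact
 show ?thesis using assms by (simp add: a_minus_def additive_add[OF f] additive_minus[OF f G H])
qed

lemma additive_lsum:
 assumes "additive G H f" "abelian_group G" "abelian_group H" "set xs \<subseteq> carrier G"
 shows "f (lsum G xs) = lsum H (map f xs)"
proof -
 interpret G: abelian_group G by fact
 show ?thesis using assms(4)
  by (induction xs) (simp_all add: additive_zero[OF assms(1-3)] additive_add[OF assms(1)])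
qed

lemma additive_lsum_map:
 assumes "additive G H f" "abelian_group G" "abelian_group H" "\<And>x. x \<in> set xs ==> g x <: G"
 shows "f (lsum G (map g xs)) = lsum H (map (\<lambda>x. f (g x)) xs)"
 using additive_lsum[OF assms(1-3), of "map g xs"] assms(4) by (auto simp: comp_def)

lemma additive_comp:
 "additive G H f ==> additive H K g ==> additive G K (\<lambda>x. g (f x))"
 by (auto simp: additive_def Pi_iff)

lemma additive_sum:
 assumes "abelian_group H" "additive G H f" "additive G H g"
 shows "additive G H (\<lambda>x. f x \<oplus>\<^sub>H g x)"
proof -
 interpret H: abelian_group H by fact
 show ?thesis using assms(2,3) by (auto simp: additive_def Pi_iff H.a_ac)
qed

lemma additive_lsum_fun:
 assumes H: "abelian_group H" and f: "\<And>z. z \<in> set zs ==> additive G H (f z)"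
 shows "additive G H (\<lambda>x. lsum H (map (\<lambda>z. f z x) zs))"
proof -
 interpret H: abelian_group H by fact
 show ?thesis
 proof (rule additive_mapI)
  fix x assume "x <: G"
  then show "lsum H (map (\<lambda>z. f z x) zs) <: H"
   using f by (intro H.lsum_map_closed) (auto dest: additive_closed)
 next
  fix x y assume xy: "x <: G" "y <: G"
  have "lsum H (map (\<lambda>z. f z (x \<oplus>\<^sub>G y)) zs) = lsum H (map (\<lambda>z. f z x \<oplus>\<^sub>H f z y) zs)"
   using xy f by (intro lsum_cong) (auto dest: additive_add)
  also have "\<dots> = lsum H (map (\<lambda>z. f z x) zs) \<oplus>\<^sub>H lsum H (map (\<lambda>z. f z y) zs)"
   using xy f by (intro H.lsum_map_add) (auto dest: additive_closed)
  finally show "lsum H (map (\<lambda>z. f z (x \<oplus>\<^sub>G y)) zs) = lsum H (map (\<lambda>z. f z x) zs) \<oplus>\<^sub>H lsum H (map (\<lambda>z. f z y) zs)" .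
 qed
qed

lemma lin_additive: "semilinear S h M N f ==> additive M N f"
 by (auto simp: semilinear_def additive_def)

lemma lin_smult:
 "semilinear S h M N f ==> r <: S ==> x <: M ==> f (r \<odot>\<^sub>M x) = h r \<odot>\<^sub>N f x"
 by (auto simp: semilinear_def)

lemma lin_closed: "semilinear S h M N f ==> x <: M ==> f x <: N"
 by (auto simp: semilinear_def)

lemma semilinearI:
 assumes "additive M N f"
  and "\<And>r x. r <: S ==> x <: M ==> f (r \<odot>\<^sub>M x) = h r \<odot>\<^sub>N f x"
 shows "semilinear S h M N f"
 using assms by (auto simp: semilinear_def additive_def)

lemma ring_hom_additive: "f \<in> ring_hom A B ==> additive A B f"
 by (auto simp: ring_hom_def additive_def)

lemma module_group: "module S M ==> abelian_group M"
 by (simp add: module_def)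

lemma algebra_module: "algebra S M ==> module S M"
 by (simp add: algebra.module)

lemma algebra_smult_right:
 assumes "algebra S A" "r <: S" "x <: A" "y <: A"
 shows "x \<otimes>\<^sub>A (r \<odot>\<^sub>A y) = r \<odot>\<^sub>A (x \<otimes>\<^sub>A y)"
proof -
 interpret A: algebra S A by fact
 show ?thesis using assms(2-) A.smult_assoc2[of r y x] by (simp add: A.m_comm)
qed

lemma ring_module_simps [simp]:
 "carrier (ring_module S) = carrier S" "mult (ring_module S) = mult S" "one (ring_module S) = one S"
 "zero (ring_module S) = zero S" "add (ring_module S) = add S" "smult (ring_module S) = mult S"
 by (simp_all add: ring_module_def)

lemma algebra_ring_module:
 assumes "cring S" shows "algebra S (ring_module S)"
proof -
 interpret S: cring S by fact
 have "cring (ring_module S)"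
 proof (rule cringI)
  show "abelian_group (ring_module S)"
  proof (rule abelian_groupI)
   fix x assume "x <: ring_module S"
   then show "\<exists>y\<in>carrier (ring_module S). y \<oplus>\<^bsub>ring_module S\<^esub> x = \<zero>\<^bsub>ring_module S\<^esub>"
    by (intro bexI[of _ "\<ominus>\<^sub>S x"]) (auto simp: S.l_neg)
  qed (auto simp: S.a_ac)
  show "comm_monoid (ring_module S)" by (rule comm_monoidI) (auto simp: S.m_ac)
 qed (auto simp: S.l_distr)
 then show ?thesis using assms
  by (intro algebraI) (auto simp: S.l_distr S.r_distr S.m_assoc)
qed

lemma lsum_ring_module [simp]: "lsum (ring_module S) = lsum S"
 by (simp add: lsum_def fun_eq_iff)


section \<open>Formal sums modulo relations\<close>

lemma fsum_eq_subset: "fsum_eq X rel xs ys ==> set xs \<subseteq> X \<and> set ys \<subseteq> X"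
 by (induction rule: fsum_eq.induct) auto

lemma fsum_class_eq_iff:
 assumes "set xs \<subseteq> X"
 shows "fsum_class X rel xs = fsum_class X rel ys \<longleftrightarrow> fsum_eq X rel xs ys"
proof
 assume "fsum_class X rel xs = fsum_class X rel ys"
 moreover have "xs \<in> fsum_class X rel xs" using assms by (simp add: fsum_class_def fsum_eq.refl)
 ultimately show "fsum_eq X rel xs ys" by (auto simp: fsum_class_def intro: fsum_eq.sym)
next
 assume "fsum_eq X rel xs ys"
 then show "fsum_class X rel xs = fsum_class X rel ys"
  unfolding fsum_class_def by (blast intro: fsum_eq.sym fsum_eq.trans)
qed

lemma fsum_eq_rep:
 assumes "set xs \<subseteq> X" shows "fsum_eq X rel xs (rep (fsum_class X rel xs))"
proof -
 have "xs \<in> fsum_class X rel xs" using assms by (simp add: fsum_class_def fsum_eq.refl)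
 then have "rep (fsum_class X rel xs) \<in> fsum_class X rel xs" unfolding rep_def by (rule someI)
 then show ?thesis by (simp add: fsum_class_def)
qed

lemma rep_fsum_class_subset:
 "t \<in> fsum_class X rel ` lists X ==> set (rep t) \<subseteq> X"
 using fsum_eq_subset[OF fsum_eq_rep[of _ X rel]] by auto

lemma fsum_class_rep:
 assumes "t \<in> fsum_class X rel ` lists X" shows "fsum_class X rel (rep t) = t"
proof -
 obtain xs where "set xs \<subseteq> X" "t = fsum_class X rel xs" using assms by auto
 then show ?thesis using fsum_eq_rep[of xs X rel] by (simp add: fsum_class_eq_iff[symmetric])
qed

lemma fsum_class_append_cong:
 assumes "fsum_class X rel xs = fsum_class X rel xs'" "fsum_class X rel ys = fsum_class X rel ys'"
  "set xs \<subseteq> X" "set ys \<subseteq> X"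
 shows "fsum_class X rel (xs @ ys) = fsum_class X rel (xs' @ ys')"
 using assms by (auto simp: fsum_class_eq_iff intro: fsum_eq.append)

lemma fsum_class_map_cong:
 assumes "fsum_eq X rel xs ys" and g: "g ` X \<subseteq> Y"
  and rel: "\<And>xs ys. rel xs ys ==> set xs \<subseteq> X ==> set ys \<subseteq> X ==>
     fsum_class Y rel' (map g xs) = fsum_class Y rel' (map g ys)"
 shows "fsum_class Y rel' (map g xs) = fsum_class Y rel' (map g ys)"
 using assms(1)
proof (induction rule: fsum_eq.induct)
 case (base xs ys) then show ?case by (rule rel)
next
 case (append xs xs' ys ys')
 moreover have "set (map g xs) \<subseteq> Y" "set (map g ys) \<subseteq> Y"
  using append fsum_eq_subset g by fastforce+
 ultimately show ?case by (simp add: fsum_class_append_cong)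
next
 case (commute xs ys)
 then have "set (map g xs) \<subseteq> Y" "set (map g ys) \<subseteq> Y" using g by auto
 then show ?case using fsum_eq.commute[of "map g xs" Y "map g ys" rel'] by (simp add: fsum_class_eq_iff)
qed auto

lemma fsum_class_map_rep:
 assumes "set xs \<subseteq> X" "g ` X \<subseteq> Y"
  and "\<And>xs ys. rel xs ys ==> set xs \<subseteq> X ==> set ys \<subseteq> X ==>
     fsum_class Y rel' (map g xs) = fsum_class Y rel' (map g ys)"
 shows "fsum_class Y rel' (map g (rep (fsum_class X rel xs))) = fsum_class Y rel' (map g xs)"
 using fsum_class_map_cong[OF fsum_eq_rep[OF assms(1)] assms(2,3)] by metis

text \<open>
 The universal property of the quotient: an additive map out of it is the same as a map on
 generators that respects the relations, and \<^const>\<open>fs_lift\<close> then does not depend on the chosen list.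
\<close>

lemma fs_lift_fsum_class:
 assumes P: "abelian_monoid P" and b: "b ` X \<subseteq> carrier P"
  and rel: "\<And>xs ys. rel xs ys ==> set xs \<subseteq> X ==> set ys \<subseteq> X ==> lsum P (map b xs) = lsum P (map b ys)"
  and xs: "set xs \<subseteq> X"
 shows "fs_lift P b (fsum_class X rel xs) = lsum P (map b xs)"
proof -
 interpret P: abelian_monoid P by fact
 have "lsum P (map b us) = lsum P (map b vs)" if "fsum_eq X rel us vs" for us vs
  using that
 proof (induction rule: fsum_eq.induct)
  case (base xs ys) then show ?case by (rule rel)
 next
  case (append xs xs' ys ys')
  then have "set (map b xs) \<subseteq> carrier P" "set (map b ys) \<subseteq> carrier P"
   "set (map b xs') \<subseteq> carrier P" "set (map b ys') \<subseteq> carrier P"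
   using fsum_eq_subset b by fastforce+
  then show ?case using append.IH by (simp add: P.lsum_append)
 next
  case (commute xs ys)
  then have "set (map b xs) \<subseteq> carrier P" "set (map b ys) \<subseteq> carrier P" using b by auto
  then show ?case by (simp add: P.lsum_append P.a_comm)
 qed auto
 from this[OF fsum_eq_rep[OF xs, of rel]] show ?thesis by (simp add: fs_lift_def)
qed

locale formal_sums =
 fixes X :: "'x set" and rel and G :: "('x list set, 'e) ring_scheme" (structure)
 assumes carrier_eq: "carrier G = fsum_class X rel ` lists X"
  and zero_eq: "\<zero> = fsum_class X rel []"
  and add_eq: "\<And>t u. t \<oplus> u = fsum_class X rel (rep t @ rep u)"
begin

abbreviation "cl \<equiv> fsum_class X rel"

lemma cl_closed: "set xs \<subseteq> X ==> cl xs <: G"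
 by (auto simp: carrier_eq)

lemma cl_append: "set xs \<subseteq> X ==> set ys \<subseteq> X ==> cl xs \<oplus> cl ys = cl (xs @ ys)"
 using fsum_class_append_cong[of X rel xs "rep (cl xs)" ys "rep (cl ys)"]
  fsum_class_rep[of "cl xs" X rel] fsum_class_rep[of "cl ys" X rel] cl_closed[of xs] cl_closed[of ys]
 by (simp add: add_eq carrier_eq)

lemma carrierE:
 assumes "t <: G" obtains xs where "set xs \<subseteq> X" "t = cl xs"
 using assms by (auto simp: carrier_eq)

lemma abelian_monoid: "abelian_monoid G"
proof (rule abelian_monoidI)
 fix t u assume "t <: G" "u <: G"
 then show "t \<oplus> u <: G" by (elim carrierE) (auto simp: cl_append intro!: cl_closed)
next
 show "\<zero> <: G" by (simp add: zero_eq cl_closed)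
next
 fix t u v assume "t <: G" "u <: G" "v <: G"
 then show "t \<oplus> u \<oplus> v = t \<oplus> (u \<oplus> v)" by (elim carrierE) (simp add: cl_append)
next
 fix t assume "t <: G"
 then show "\<zero> \<oplus> t = t" by (elim carrierE) (simp add: cl_append zero_eq)
next
 fix t u assume "t <: G" "u <: G"
 then show "t \<oplus> u = u \<oplus> t"
  by (elim carrierE) (auto simp: cl_append fsum_class_eq_iff intro!: fsum_eq.commute)
qed

lemma cl_eq_lsum:
 assumes "set xs \<subseteq> X" shows "cl xs = lsum G (map (\<lambda>x. cl [x]) xs)"
proof -
 interpret abelian_monoid G by (rule abelian_monoid)
 show ?thesis using assms
 proof (induction xs)
  case (Cons x xs)
  then have "cl (x # xs) = cl [x] \<oplus> cl xs" by (subst cl_append) auto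
  then show ?case using Cons by simp
 qed (simp add: zero_eq)
qed

lemma fsum_induct [consumes 1, case_names zero gen add]:
 assumes "t <: G" "Q \<zero>" "\<And>x. x \<in> X ==> Q (cl [x])"
  "\<And>t u. t <: G ==> u <: G ==> Q t ==> Q u ==> Q (t \<oplus> u)"
 shows "Q t"
proof -
 obtain xs where xs: "set xs \<subseteq> X" "t = cl xs" using assms(1) by (rule carrierE)
 have "Q (cl xs)" using xs(1)
 proof (induction xs)
  case Nil then show ?case using assms(2) by (simp add: zero_eq)
 next
  case (Cons x xs)
  then have "cl (x # xs) = cl [x] \<oplus> cl xs" by (subst cl_append) auto
  then show ?case using Cons assms(3,4) by (simp add: cl_closed)
 qed
 then show ?thesis by (simp add: xs(2))
qed

lemma abelian_group:
 assumes "\<And>x. x \<in> X ==> neg x \<in> X" "\<And>x. x \<in> X ==> cl [neg x, x] = cl []"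
 shows "abelian_group G"
proof -
 interpret abelian_monoid G by (rule abelian_monoid)
 have "\<exists>u\<in>carrier G. u \<oplus> t = \<zero>" if "t <: G" for t
  using that
 proof (induction rule: fsum_induct)
  case zero show ?case by (intro bexI[of _ \<zero>]) auto
 next
  case (gen x)
  then show ?case using assms[of x] by (intro bexI[of _ "cl [neg x]"]) (auto simp: cl_append zero_eq cl_closed)
 next
  case (add t u)
  then obtain t' u' where tu: "t' <: G" "u' <: G" "t' \<oplus> t = \<zero>" "u' \<oplus> u = \<zero>" by auto
  have "(t' \<oplus> u') \<oplus> (t \<oplus> u) = (t' \<oplus> t) \<oplus> (u' \<oplus> u)" using tu(1,2) add(1,2) by (simp add: a_ac)
  then show ?case using tu by (intro bexI[of _ "t' \<oplus> u'"]) auto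
 qed
 then show ?thesis by (intro abelian_groupI) (auto simp: a_ac)
qed

lemma additive_eqI:
 assumes "additive G H f" "additive G H g" "abelian_group G" "abelian_group H"
  "\<And>x. x \<in> X ==> f (cl [x]) = g (cl [x])" "t <: G"
 shows "f t = g t"
 using assms(6)
 by (induction rule: fsum_induct)
  (auto simp: assms(5) additive_zero[OF _ assms(3,4)] assms(1,2)
    additive_add[OF assms(1)] additive_add[OF assms(2)])

lemma fs_lift_additive:
 assumes P: "abelian_monoid P" and b: "b ` X \<subseteq> carrier P"
  and rel: "\<And>xs ys. rel xs ys ==> set xs \<subseteq> X ==> set ys \<subseteq> X ==> lsum P (map b xs) = lsum P (map b ys)"
 shows "additive G P (fs_lift P b)"
proof -
 interpret P: abelian_monoid P by fact
 note lift = fs_lift_fsum_class[where rel = rel, OF P b rel]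
 have cl: "set (map b xs) \<subseteq> carrier P" if "set xs \<subseteq> X" for xs using that b by auto
 show ?thesis
 proof (rule additive_mapI)
  fix t assume "t <: G"
  then show "fs_lift P b t <: P" using cl by (elim carrierE) (simp add: lift)
 next
  fix t u assume "t <: G" "u <: G"
  then show "fs_lift P b (t \<oplus> u) = fs_lift P b t \<oplus>\<^sub>P fs_lift P b u"
   using cl by (elim carrierE) (simp add: cl_append lift P.lsum_append)
 qed
qed

end

lemma formal_sums_module:
 fixes G :: "('s, 'x list set, 'e) module_scheme"
 assumes "formal_sums X rel G" and S: "cring S" and G: "abelian_group G"
  and smult: "\<And>r t. r \<odot>\<^sub>G t = fsum_class X rel (map (sc r) (rep t))"
  and sc: "\<And>r x. r <: S ==> x \<in> X ==> sc r x \<in> X"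
  and rel: "\<And>r xs ys. r <: S ==> rel xs ys ==> set xs \<subseteq> X ==> set ys \<subseteq> X ==>
     fsum_class X rel (map (sc r) xs) = fsum_class X rel (map (sc r) ys)"
  and add: "\<And>r s x. r <: S ==> s <: S ==> x \<in> X ==>
     fsum_class X rel [sc (r \<oplus>\<^sub>S s) x] = fsum_class X rel [sc r x, sc s x]"
  and mult: "\<And>r s x. r <: S ==> s <: S ==> x \<in> X ==> sc (r \<otimes>\<^sub>S s) x = sc r (sc s x)"
  and one: "\<And>x. x \<in> X ==> sc \<one>\<^sub>S x = x"
 shows "module S G"
  and "\<And>r xs. r <: S ==> set xs \<subseteq> X ==>
   r \<odot>\<^sub>G fsum_class X rel xs = fsum_class X rel (map (sc r) xs)"
proof -
 interpret F: formal_sums X rel G by fact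
 interpret S: cring S by fact
 interpret G: abelian_group G by fact
 show cls: "r \<odot>\<^sub>G F.cl xs = F.cl (map (sc r) xs)" if r: "r <: S" "set xs \<subseteq> X" for r xs
  unfolding smult using r sc by (intro fsum_class_map_rep rel) auto
 have sub: "set (map (sc r) xs) \<subseteq> X" if "r <: S" "set xs \<subseteq> X" for r xs using that sc by auto
 have sadd: "r \<odot>\<^sub>G (t \<oplus>\<^sub>G u) = r \<odot>\<^sub>G t \<oplus>\<^sub>G r \<odot>\<^sub>G u"
  if "r <: S" "t <: G" "u <: G" for r t u
  using that sub[of r] by (elim F.carrierE) (simp add: F.cl_append cls)
 have scl: "r \<odot>\<^sub>G t <: G" if "r <: S" "t <: G" for r t
  using that sub[of r] by (elim F.carrierE) (simp add: cls F.cl_closed)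
 have amap: "additive G G (\<lambda>t. r \<odot>\<^sub>G t)" if "r <: S" for r
  using that by (intro additive_mapI) (auto simp: sadd scl)
 show "module S G"
 proof (rule moduleI[OF S G])
  fix r s t assume rs: "r <: S" "s <: S" and t: "t <: G"
  have "additive G G (\<lambda>t. r \<odot>\<^sub>G t \<oplus>\<^sub>G s \<odot>\<^sub>G t)"
   by (intro additive_sum amap rs G)
  then show "(r \<oplus>\<^sub>S s) \<odot>\<^sub>G t = r \<odot>\<^sub>G t \<oplus>\<^sub>G s \<odot>\<^sub>G t"
   using F.additive_eqI[OF amap[of "r \<oplus>\<^sub>S s"] _ G G _ t] rs
   by (simp add: cls F.cl_append sc add)
  have "additive G G (\<lambda>t. r \<odot>\<^sub>G (s \<odot>\<^sub>G t))"
   by (rule additive_comp[OF amap[OF rs(2)] amap[OF rs(1)]])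
  then show "(r \<otimes>\<^sub>S s) \<odot>\<^sub>G t = r \<odot>\<^sub>G (s \<odot>\<^sub>G t)"
   using F.additive_eqI[OF amap[of "r \<otimes>\<^sub>S s"] _ G G _ t] rs
   by (simp add: cls F.cl_append sc mult)
 next
  fix t assume t: "t <: G"
  have "additive G G (\<lambda>t. t)" by (intro additive_mapI) auto
  then show "\<one>\<^sub>S \<odot>\<^sub>G t = t"
   using F.additive_eqI[OF amap[of "\<one>\<^sub>S"] _ G G _ t] by (simp add: cls one)
 qed (auto simp: sadd scl)
qed

section \<open>Tensor products\<close>

definition balanced where
 "balanced S M N P \<beta> \<longleftrightarrow> (\<forall>x\<in>carrier M. additive N P (\<beta> x))
  \<and> (\<forall>y\<in>carrier N. additive M P (\<lambda>x. \<beta> x y))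
  \<and> (\<forall>r\<in>carrier S. \<forall>x\<in>carrier M. \<forall>y\<in>carrier N. \<beta> (r \<odot>\<^sub>M x) y = \<beta> x (r \<odot>\<^sub>N y))"

definition bilinear where
 "bilinear S M N P \<beta> \<longleftrightarrow> (\<forall>x\<in>carrier M. linear_map S N P (\<beta> x))
  \<and> (\<forall>y\<in>carrier N. linear_map S M P (\<lambda>x. \<beta> x y))"

lemma balancedI:
 assumes "\<And>x. x <: M ==> additive N P (\<beta> x)"
  and "\<And>y. y <: N ==> additive M P (\<lambda>x. \<beta> x y)"
  and "\<And>r x y. r <: S ==> x <: M ==> y <: N ==>
     \<beta> (r \<odot>\<^sub>M x) y = \<beta> x (r \<odot>\<^sub>N y)"
 shows "balanced S M N P \<beta>"
 using assms by (simp add: balanced_def)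

lemma balancedD:
 assumes "balanced S M N P \<beta>"
 shows "x <: M ==> additive N P (\<beta> x)"
  and "y <: N ==> additive M P (\<lambda>x. \<beta> x y)"
  and "r <: S ==> x <: M ==> y <: N ==> \<beta> (r \<odot>\<^sub>M x) y = \<beta> x (r \<odot>\<^sub>N y)"
 using assms by (simp_all add: balanced_def)

lemma balanced_closed:
 "balanced S M N P \<beta> ==> x <: M ==> y <: N ==> \<beta> x y <: P"
 using additive_closed[OF balancedD(1)] .

lemma bilinearI:
 assumes "\<And>x. x <: M ==> linear_map S N P (\<beta> x)"
  and "\<And>y. y <: N ==> linear_map S M P (\<lambda>x. \<beta> x y)"
 shows "bilinear S M N P \<beta>"
 using assms by (simp add: bilinear_def)

lemma bilinearD:
 assumes "bilinear S M N P \<beta>"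
 shows "x <: M ==> linear_map S N P (\<beta> x)"
  and "y <: N ==> linear_map S M P (\<lambda>x. \<beta> x y)"
 using assms by (simp_all add: bilinear_def)

lemma bilinear_balanced: "bilinear S M N P \<beta> ==> balanced S M N P \<beta>"
 unfolding bilinear_def balanced_def semilinear_def additive_def by auto

lemma bilinear_closed:
 "bilinear S M N P \<beta> ==> x <: M ==> y <: N ==> \<beta> x y <: P"
 using balanced_closed[OF bilinear_balanced] .

lemma bilinear_smult:
 assumes "bilinear S M N P \<beta>" "r <: S" "x <: M" "y <: N"
 shows "\<beta> (r \<odot>\<^sub>M x) y = r \<odot>\<^sub>P \<beta> x y" "\<beta> x (r \<odot>\<^sub>N y) = r \<odot>\<^sub>P \<beta> x y"
 using lin_smult[OF bilinearD(1)[OF assms(1,3)] assms(2,4)]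
  lin_smult[OF bilinearD(2)[OF assms(1,4)] assms(2,3)] by simp_all

lemma fsum_class_base:
 "rel xs ys ==> set xs \<subseteq> X ==> set ys \<subseteq> X ==> fsum_class X rel xs = fsum_class X rel ys"
 by (simp add: fsum_class_eq_iff fsum_eq.base)

abbreviation pure where
 "pure S M N x y \<equiv> tclass S M N [(x, y)]"

lemma tensor_formal_sums: "formal_sums (carrier M \<times> carrier N) (tensor_rel S M N) (tensor S M N)"
 by unfold_locales (auto simp: tensor_def tclass_def)

lemma balanced_respects:
 assumes M: "abelian_group M" and N: "abelian_group N" and P: "abelian_group P"
  and b: "balanced S M N P \<beta>"
  and rel: "tensor_rel S M N xs ys" "set xs \<subseteq> carrier M \<times> carrier N" "set ys \<subseteq> carrier M \<times> carrier N"
 shows "lsum P (map (\<lambda>(x, y). \<beta> x y) xs) = lsum P (map (\<lambda>(x, y). \<beta> x y) ys)"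
proof -
 interpret P: abelian_group P by fact
 note cl [simp] = balanced_closed[OF b]
 show ?thesis using rel
 proof (cases rule: tensor_rel.cases)
  case (add_left x x' y)
  then show ?thesis using rel(2,3) additive_add[OF balancedD(2)[OF b]] by simp
 next
  case (add_right y y' x)
  then show ?thesis using rel(2,3) additive_add[OF balancedD(1)[OF b]] by simp
 next
  case (balanced r x y)
  then show ?thesis using rel(2,3) balancedD(3)[OF b] by simp
 next
  case (zero y)
  then show ?thesis using rel(2,3) additive_zero[OF balancedD(2)[OF b] M P] by simp
 qed
qed

lemma tensor_lift:
 assumes "abelian_group M" "abelian_group N" "abelian_group P" "balanced S M N P \<beta>"
  and "set xs \<subseteq> carrier M \<times> carrier N"
 shows "fs_lift P (\<lambda>(x, y). \<beta> x y) (tclass S M N xs) = lsum P (map (\<lambda>(x, y). \<beta> x y) xs)"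
 unfolding tclass_def
 using assms balanced_respects[OF assms(1-4)]
 by (intro fs_lift_fsum_class) (auto simp: abelian_group_def balanced_closed)

lemma tensor_lift_pure:
 assumes "abelian_group M" "abelian_group N" "abelian_group P" "balanced S M N P \<beta>"
  and "x <: M" "y <: N"
 shows "fs_lift P (\<lambda>(x, y). \<beta> x y) (pure S M N x y) = \<beta> x y"
proof -
 interpret P: abelian_group P by fact
 show ?thesis using assms by (subst tensor_lift) (auto simp: balanced_closed)
qed

lemma tensor_lift_additive:
 assumes "abelian_group M" "abelian_group N" "abelian_group P" "balanced S M N P \<beta>"
 shows "additive (tensor S M N) P (fs_lift P (\<lambda>(x, y). \<beta> x y))"
 using assms balanced_respects[OF assms(1-4)]
 by (intro formal_sums.fs_lift_additive[OF tensor_formal_sums[where S = S]])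
  (auto simp: abelian_group_def balanced_closed)

lemma pure_relations:
 assumes "abelian_group M" "abelian_group N"
 shows "x <: M ==> x' <: M ==> y <: N ==>
   tclass S M N [(x \<oplus>\<^sub>M x', y)] = tclass S M N [(x, y), (x', y)]"
  and "x <: M ==> y <: N ==> y' <: N ==>
   tclass S M N [(x, y \<oplus>\<^sub>N y')] = tclass S M N [(x, y), (x, y')]"
  and "y <: N ==> tclass S M N [(\<zero>\<^sub>M, y)] = tclass S M N []"
proof -
 interpret M: abelian_group M by fact
 interpret N: abelian_group N by fact
 show "x <: M ==> x' <: M ==> y <: N ==>
   tclass S M N [(x \<oplus>\<^sub>M x', y)] = tclass S M N [(x, y), (x', y)]"
  unfolding tclass_def by (rule fsum_class_base) (auto intro: tensor_rel.intros)
 show "x <: M ==> y <: N ==> y' <: N ==>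
   tclass S M N [(x, y \<oplus>\<^sub>N y')] = tclass S M N [(x, y), (x, y')]"
  unfolding tclass_def by (rule fsum_class_base) (auto intro: tensor_rel.intros)
 show "y <: N ==> tclass S M N [(\<zero>\<^sub>M, y)] = tclass S M N []"
  unfolding tclass_def by (rule fsum_class_base) (auto intro: tensor_rel.intros)
qed

lemma tensor_group:
 assumes "abelian_group M" "abelian_group N"
 shows "abelian_group (tensor S M N)"
proof -
 interpret M: abelian_group M by fact
 interpret N: abelian_group N by fact
 note rels = pure_relations[OF assms, where S = S]
 show ?thesis
  by (rule formal_sums.abelian_group[OF tensor_formal_sums, of M N "\<lambda>(x, y). (\<ominus>\<^sub>M x, y)" S])
   (auto simp: tclass_def[symmetric] rels[symmetric] M.l_neg)
qed

lemma
 assumes "module S M" "module S N"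
 shows tensor_module: "module S (tensor S M N)"
  and tensor_smult_tclass: "\<And>r xs. r <: S ==> set xs \<subseteq> carrier M \<times> carrier N ==>
   r \<odot>\<^bsub>tensor S M N\<^esub> tclass S M N xs = tclass S M N (map (\<lambda>(x, y). (r \<odot>\<^sub>M x, y)) xs)"
proof -
 interpret M: module S M by fact
 interpret N: module S N by fact
 note ab = module_group[OF assms(1)] module_group[OF assms(2)]
 note rels = pure_relations[OF ab, where S = S]
 have resp: "fsum_class (carrier M \<times> carrier N) (tensor_rel S M N) (map (\<lambda>(x, y). (r \<odot>\<^sub>M x, y)) xs)
   = fsum_class (carrier M \<times> carrier N) (tensor_rel S M N) (map (\<lambda>(x, y). (r \<odot>\<^sub>M x, y)) ys)"
  if r: "r <: S" and rel: "tensor_rel S M N xs ys"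
   and sub: "set xs \<subseteq> carrier M \<times> carrier N" "set ys \<subseteq> carrier M \<times> carrier N" for r xs ys
  using rel
 proof (cases rule: tensor_rel.cases)
  case (balanced s x y)
  have "r \<odot>\<^sub>M (s \<odot>\<^sub>M x) = s \<odot>\<^sub>M (r \<odot>\<^sub>M x)"
   using r balanced by (simp add: M.smult_assoc1[symmetric] M.R.m_comm)
  then show ?thesis unfolding balanced(1,2) using r balanced(3-5)
   by (intro fsum_class_base) (auto intro: tensor_rel.balanced)
 qed (use r sub rels in "auto simp: tclass_def M.smult_r_distr")
 have step: "fsum_class (carrier M \<times> carrier N) (tensor_rel S M N) [(\<lambda>(x, y). ((r \<oplus>\<^sub>S s) \<odot>\<^sub>M x, y)) z]
  = fsum_class (carrier M \<times> carrier N) (tensor_rel S M N)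
    [(\<lambda>(x, y). (r \<odot>\<^sub>M x, y)) z, (\<lambda>(x, y). (s \<odot>\<^sub>M x, y)) z]"
  if "r <: S" "s <: S" "z \<in> carrier M \<times> carrier N" for r s z
  using that by (auto simp: M.smult_l_distr tclass_def[symmetric] rels)
 note fm = formal_sums_module[OF tensor_formal_sums M.R.is_cring tensor_group[OF ab],
   where sc = "\<lambda>r (x, y). (r \<odot>\<^sub>M x, y)", OF _ _ resp step]
 have "module S (tensor S M N) \<and> (\<forall>r xs. r <: S \<longrightarrow> set xs \<subseteq> carrier M \<times> carrier N \<longrightarrow>
   r \<odot>\<^bsub>tensor S M N\<^esub> fsum_class (carrier M \<times> carrier N) (tensor_rel S M N) xs
   = fsum_class (carrier M \<times> carrier N) (tensor_rel S M N) (map (\<lambda>(x, y). (r \<odot>\<^sub>M x, y)) xs))"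
  by (intro conjI allI impI fm) (auto simp: M.smult_assoc1 tensor_def tclass_def)
 then show "module S (tensor S M N)"
  "\<And>r xs. r <: S ==> set xs \<subseteq> carrier M \<times> carrier N ==>
   r \<odot>\<^bsub>tensor S M N\<^esub> tclass S M N xs = tclass S M N (map (\<lambda>(x, y). (r \<odot>\<^sub>M x, y)) xs)"
  by (simp_all add: tclass_def)
qed

lemma tclass_closed: "set xs \<subseteq> carrier M \<times> carrier N ==> tclass S M N xs <: tensor S M N"
 unfolding tclass_def using formal_sums.cl_closed[OF tensor_formal_sums] .

lemma tensor_rep:
 assumes "t <: tensor S M N"
 shows "set (rep t) \<subseteq> carrier M \<times> carrier N" "tclass S M N (rep t) = t"
 using assms rep_fsum_class_subset[of t] fsum_class_rep[of t]
 by (auto simp: tensor_def tclass_def)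

lemma tclass_eq_lsum:
 "set xs \<subseteq> carrier M \<times> carrier N ==>
  tclass S M N xs = lsum (tensor S M N) (map (\<lambda>(x, y). pure S M N x y) xs)"
 using formal_sums.cl_eq_lsum[OF tensor_formal_sums] by (simp add: tclass_def case_prod_unfold)

lemma pure_bilinear:
 assumes "module S M" "module S N"
 shows "bilinear S M N (tensor S M N) (pure S M N)"
proof -
 interpret M: module S M by fact
 interpret N: module S N by fact
 note ab = module_group[OF assms(1)] module_group[OF assms(2)]
 note rels = pure_relations[OF ab, where S = S]
 have app: "pure S M N x y \<oplus>\<^bsub>tensor S M N\<^esub> pure S M N x' y' = tclass S M N [(x, y), (x', y')]"
  if "x <: M" "y <: N" "x' <: M" "y' <: N" for x y x' y'
  using formal_sums.cl_append[OF tensor_formal_sums, of "[(x, y)]" M N "[(x', y')]"] that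
  by (simp add: tclass_def)
 have bal: "pure S M N (r \<odot>\<^sub>M x) y = pure S M N x (r \<odot>\<^sub>N y)"
  if "r <: S" "x <: M" "y <: N" for r x y
  unfolding tclass_def using that by (intro fsum_class_base) (auto intro: tensor_rel.balanced)
 show ?thesis
  by (intro bilinearI semilinearI additive_mapI)
   (auto simp: rels app tclass_closed tensor_smult_tclass[OF assms] bal[symmetric])
qed

text \<open>Pure tensors generate, so most identities between maps on a tensor product are checked on them.\<close>

lemma tensor_map_eqI:
 assumes "additive (tensor S M N) P f" "additive (tensor S M N) P g"
  and "abelian_group M" "abelian_group N" "abelian_group P"
  and "\<And>x y. x <: M ==> y <: N ==> f (pure S M N x y) = g (pure S M N x y)"
  and "t <: tensor S M N"
 shows "f t = g t"
 by (rule formal_sums.additive_eqI[OF tensor_formal_sums assms(1,2) tensor_group assms(5)])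
  (use assms in "auto simp: tclass_def[symmetric]")

text \<open>
 Bilinear operations on the factors induce one on tensor products; the multiplication of
 \<open>A \<otimes> B\<close> and its action on \<open>\<Omega> \<otimes> B\<close> are both of this form.
\<close>

definition tensor_prod where
 "tensor_prod S P Q op1 op2 t u =
  tclass S P Q [(op1 x x', op2 y y'). (x, y) \<leftarrow> rep t, (x', y') \<leftarrow> rep u]"

text \<open>
 The definition multiplies chosen representatives; rewriting it as an iterated lift, first in \<open>u\<close> and then in \<open>t\<close>,
 shows that it depends on \<open>t\<close> and \<open>u\<close> only.
\<close>

lemma
 assumes mods: "module S M" "module S N" "module S M'" "module S N'" "module S P" "module S Q"
  and op1: "bilinear S M M' P op1" and op2: "bilinear S N N' Q op2"
 shows tensor_prod_additive_right: "\<And>t. t <: tensor S M N ==>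
   additive (tensor S M' N') (tensor S P Q) (tensor_prod S P Q op1 op2 t)"
  and tensor_prod_additive_left: "\<And>u. u <: tensor S M' N' ==>
   additive (tensor S M N) (tensor S P Q) (\<lambda>t. tensor_prod S P Q op1 op2 t u)"
  and tensor_prod_pure: "\<And>x y x' y'. x <: M ==> y <: N ==> x' <: M' ==>
   y' <: N' ==> tensor_prod S P Q op1 op2 (pure S M N x y) (pure S M' N' x' y')
    = pure S P Q (op1 x x') (op2 y y')"
proof -
 note ab = mods[THEN module_group]
 let ?T = "tensor S P Q"
 interpret T: abelian_group ?T by (rule tensor_group[OF ab(5,6)])
 have T: "abelian_group ?T" ..
 note c1 = bilinear_closed[OF op1] and c2 = bilinear_closed[OF op2]
 note pb = pure_bilinear[OF mods(5,6)]
 note pa1 = bilinearD(1)[OF pb, THEN lin_additive]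
  and pa2 = bilinearD(2)[OF pb, THEN lin_additive]
  and ps = bilinear_smult[OF pb]
 define \<gamma> where "\<gamma> x y u = fs_lift ?T (\<lambda>(x', y'). pure S P Q (op1 x x') (op2 y y')) u" for x y u
 have bal_in: "balanced S M' N' ?T (\<lambda>x' y'. pure S P Q (op1 x x') (op2 y y'))"
  if "x <: M" "y <: N" for x y
 proof (rule balancedI)
  fix x' assume "x' <: M'"
  then show "additive N' ?T (\<lambda>y'. pure S P Q (op1 x x') (op2 y y'))"
   using additive_comp[OF lin_additive[OF bilinearD(1)[OF op2 that(2)]] pa1[OF c1[OF that(1)]]]
   by blast
 next
  fix y' assume "y' <: N'"
  then show "additive M' ?T (\<lambda>x'. pure S P Q (op1 x x') (op2 y y'))"
   using additive_comp[OF lin_additive[OF bilinearD(1)[OF op1 that(1)]] pa2[OF c2[OF that(2)]]]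
   by blast
 next
  fix r x' y' assume "r <: S" "x' <: M'" "y' <: N'"
  then show "pure S P Q (op1 x (r \<odot>\<^bsub>M'\<^esub> x')) (op2 y y') = pure S P Q (op1 x x') (op2 y (r \<odot>\<^bsub>N'\<^esub> y'))"
   using that by (simp add: bilinear_smult[OF op1] bilinear_smult[OF op2] ps c1 c2)
 qed
 have \<gamma>_add: "additive (tensor S M' N') ?T (\<gamma> x y)" if "x <: M" "y <: N" for x y
  unfolding \<gamma>_def by (rule tensor_lift_additive[OF ab(3,4) T bal_in[OF that]])
 have \<gamma>_pure: "\<gamma> x y (pure S M' N' x' y') = pure S P Q (op1 x x') (op2 y y')"
  if "x <: M" "y <: N" "x' <: M'" "y' <: N'" for x y x' y'
  unfolding \<gamma>_def using tensor_lift_pure[OF ab(3,4) T bal_in[OF that(1,2)] that(3,4)] .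
 have bal_out: "balanced S M N ?T (\<lambda>x y. \<gamma> x y u)" if u: "u <: tensor S M' N'" for u
 proof (intro balancedI additive_mapI)
  fix x y assume xy: "x <: M" "y <: N"
  show "\<gamma> x y u <: ?T" by (rule additive_closed[OF \<gamma>_add[OF xy] u])
  then show "\<gamma> x y u <: ?T" .
 next
  fix x y y' assume xy: "x <: M" "y <: N" "y' <: N"
  interpret N: module S N by fact
  show "\<gamma> x (y \<oplus>\<^sub>N y') u = \<gamma> x y u \<oplus>\<^bsub>?T\<^esub> \<gamma> x y' u"
   by (rule tensor_map_eqI[OF _ _ ab(3,4) T _ u]; (intro additive_sum T \<gamma>_add)?)
    (use xy in "simp_all add: \<gamma>_pure c1 c2 additive_add[OF pa1]
      additive_add[OF lin_additive[OF bilinearD(2)[OF op2]]]")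
 next
  fix x x' y assume xy: "x <: M" "x' <: M" "y <: N"
  interpret M: module S M by fact
  show "\<gamma> (x \<oplus>\<^sub>M x') y u = \<gamma> x y u \<oplus>\<^bsub>?T\<^esub> \<gamma> x' y u"
   by (rule tensor_map_eqI[OF _ _ ab(3,4) T _ u]; (intro additive_sum T \<gamma>_add)?)
    (use xy in "simp_all add: \<gamma>_pure c1 c2 additive_add[OF pa2]
      additive_add[OF lin_additive[OF bilinearD(2)[OF op1]]]")
 next
  fix r x y assume xy: "r <: S" "x <: M" "y <: N"
  interpret M: module S M by fact
  interpret N: module S N by fact
  show "\<gamma> (r \<odot>\<^sub>M x) y u = \<gamma> x (r \<odot>\<^sub>N y) u"
   by (rule tensor_map_eqI[OF _ _ ab(3,4) T _ u]; (intro additive_sum T \<gamma>_add)?)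
    (use xy in "simp_all add: \<gamma>_pure c1 c2 bilinear_smult[OF op1] bilinear_smult[OF op2] ps")
 qed
 have eq: "tensor_prod S P Q op1 op2 t u = fs_lift ?T (\<lambda>(x, y). \<gamma> x y u) t"
  if t: "t <: tensor S M N" and u: "u <: tensor S M' N'" for t u
 proof -
  have sub: "set (rep t) \<subseteq> carrier M \<times> carrier N" "set (rep u) \<subseteq> carrier M' \<times> carrier N'"
   using t u by (auto dest: subsetD[OF tensor_rep(1)])
  define f where "f = (\<lambda>(x, y). map (\<lambda>(x', y'). (op1 x x', op2 y y')) (rep u))"
  have cl: "set (concat (map f (rep t))) \<subseteq> carrier P \<times> carrier Q"
   by (auto simp: f_def intro!: c1 c2 dest!: subsetD[OF sub(1)] subsetD[OF sub(2)])
  have "tensor_prod S P Q op1 op2 t u = tclass S P Q (concat (map f (rep t)))"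
   by (simp add: tensor_prod_def f_def case_prod_unfold)
  also have "\<dots> = lsum ?T (map (\<lambda>(x, y). pure S P Q x y) (concat (map f (rep t))))"
   by (rule tclass_eq_lsum[OF cl])
  also have "\<dots> = lsum ?T (map (\<lambda>z. lsum ?T (map (\<lambda>(x, y). pure S P Q x y) (f z))) (rep t))"
   by (rule T.lsum_concat) (use cl in "force intro!: tclass_closed")
  also have "\<dots> = fs_lift ?T (\<lambda>(x, y). \<gamma> x y u) t"
   by (simp add: fs_lift_def \<gamma>_def f_def comp_def case_prod_unfold)
  finally show ?thesis .
 qed
 show *: "additive (tensor S M N) ?T (\<lambda>t. tensor_prod S P Q op1 op2 t u)"
  if "u <: tensor S M' N'" for u
 proof (rule additive_mapI)
  interpret T0: abelian_group "tensor S M N" by (rule tensor_group[OF ab(1,2)])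
  note la = tensor_lift_additive[OF ab(1,2) T bal_out[OF that]]
  fix t t' assume t: "t <: tensor S M N" "t' <: tensor S M N"
  then show "tensor_prod S P Q op1 op2 (t \<oplus>\<^bsub>tensor S M N\<^esub> t') u
    = tensor_prod S P Q op1 op2 t u \<oplus>\<^bsub>?T\<^esub> tensor_prod S P Q op1 op2 t' u"
   by (simp add: eq that additive_add[OF la])
 next
  fix t assume "t <: tensor S M N"
  then show "tensor_prod S P Q op1 op2 t u <: ?T"
   by (simp add: eq that additive_closed[OF tensor_lift_additive[OF ab(1,2) T bal_out[OF that]]])
 qed
 show "tensor_prod S P Q op1 op2 (pure S M N x y) (pure S M' N' x' y') = pure S P Q (op1 x x') (op2 y y')"
  if "x <: M" "y <: N" "x' <: M'" "y' <: N'" for x y x' y'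
 proof -
  have "pure S M' N' x' y' <: tensor S M' N'" "pure S M N x y <: tensor S M N"
   using that by (auto intro!: tclass_closed)
  then show ?thesis
   using tensor_lift_pure[OF ab(1,2) T bal_out that(1,2)] \<gamma>_pure[OF that] by (simp add: eq)
 qed
 interpret T': abelian_group "tensor S M' N'" by (rule tensor_group[OF ab(3,4)])
 show "additive (tensor S M' N') ?T (tensor_prod S P Q op1 op2 t)"
  if t: "t <: tensor S M N" for t
 proof (rule additive_mapI)
  fix u assume "u <: tensor S M' N'"
  then show "tensor_prod S P Q op1 op2 t u <: ?T" using additive_closed[OF * t] by blast
 next
  fix u v assume uv: "u <: tensor S M' N'" "v <: tensor S M' N'"
  show "tensor_prod S P Q op1 op2 t (u \<oplus>\<^bsub>tensor S M' N'\<^esub> v)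
   = tensor_prod S P Q op1 op2 t u \<oplus>\<^bsub>?T\<^esub> tensor_prod S P Q op1 op2 t v"
   by (rule tensor_map_eqI[OF _ _ ab(1,2) T _ t]; (intro additive_sum T *)?)
    (use uv tensor_lift_pure[OF ab(1,2) T bal_out] in "simp_all add: eq tclass_closed
      additive_add[OF \<gamma>_add]")
 qed
qed

lemma tensor_mult_eq: "mult (tensor S A B) = tensor_prod S A B (mult A) (mult B)"
 by (simp add: tensor_def tensor_prod_def fun_eq_iff)

lemma algebra_mult_bilinear:
 assumes "algebra S A" shows "bilinear S A A A (mult A)"
proof -
 interpret A: algebra S A by fact
 show ?thesis
  by (intro bilinearI semilinearI additive_mapI)
   (auto simp: A.r_distr A.l_distr A.smult_assoc2 algebra_smult_right[OF assms])
qed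

lemma tensor_prod_assoc:
 assumes A: "algebra S A" and B: "algebra S B" and W: "module S W" and Q: "module S Q"
  and op1: "bilinear S A W W op1" and op2: "bilinear S B Q Q op2"
  and assoc1: "\<And>a a' w. a <: A ==> a' <: A ==> w <: W ==>
     op1 (a \<otimes>\<^sub>A a') w = op1 a (op1 a' w)"
  and assoc2: "\<And>b b' q. b <: B ==> b' <: B ==> q <: Q ==>
     op2 (b \<otimes>\<^sub>B b') q = op2 b (op2 b' q)"
  and t: "t <: tensor S A B" and t': "t' <: tensor S A B"
  and u: "u <: tensor S W Q"
 shows "tensor_prod S W Q op1 op2 (t \<otimes>\<^bsub>tensor S A B\<^esub> t') u
   = tensor_prod S W Q op1 op2 t (tensor_prod S W Q op1 op2 t' u)"
proof -
 interpret A: algebra S A by fact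
 interpret B: algebra S B by fact
 note mA = algebra_module[OF A] and mB = algebra_module[OF B]
 note ab = mA[THEN module_group] mB[THEN module_group]
 let ?T = "tensor S A B" and ?U = "tensor S W Q" and ?a = "tensor_prod S W Q op1 op2"
 have U: "abelian_group ?U" by (rule tensor_group[OF module_group[OF W] module_group[OF Q]])
 have T: "abelian_group ?T" by (intro tensor_group ab)
 note ar = tensor_prod_additive_right[OF mA mB W Q W Q op1 op2]
  and al = tensor_prod_additive_left[OF mA mB W Q W Q op1 op2]
  and ap = tensor_prod_pure[OF mA mB W Q W Q op1 op2]
 note mm = algebra_mult_bilinear[OF A] algebra_mult_bilinear[OF B]
 note mr = tensor_prod_additive_right[OF mA mB mA mB mA mB mm]
  and ml = tensor_prod_additive_left[OF mA mB mA mB mA mB mm]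
  and mp = tensor_prod_pure[OF mA mB mA mB mA mB mm]
 let ?m = "tensor_prod S A B (mult A) (mult B)"
 note acl = additive_closed[OF ar]
 have 1: "?a (?m (pure S A B a b) (pure S A B a' b')) u = ?a (pure S A B a b) (?a (pure S A B a' b') u)"
  if "a <: A" "b <: B" "a' <: A" "b' <: B" for a b a' b'
  by (rule tensor_map_eqI[OF _ additive_comp[OF ar ar] module_group[OF W]
     module_group[OF Q] U _ u])
   (use that in "auto simp: mp ap assoc1 assoc2 bilinear_closed[OF op1] bilinear_closed[OF op2]
     intro!: ar tclass_closed")
 have 2: "?a (?m (pure S A B a b) t') u = ?a (pure S A B a b) (?a t' u)"
  if "a <: A" "b <: B" for a b
  by (rule tensor_map_eqI[OF additive_comp[OF mr al[OF u]] additive_comp[OF al[OF u] ar] ab U _ t'])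
   (use that in "auto simp: 1 intro!: tclass_closed")
 have "?a (?m t t') u = ?a t (?a t' u)"
  by (rule tensor_map_eqI[OF additive_comp[OF ml[OF t'] al[OF u]] al[OF acl[OF t' u]] ab U _ t])
   (auto simp: 2)
 then show ?thesis by (simp add: tensor_mult_eq)
qed

section \<open>Kaehler differentials\<close>

lemma kahler_formal_sums: "formal_sums (carrier A \<times> carrier A) (kahler_rel S A) (kahler S A)"
 by unfold_locales (auto simp: kahler_def kclass_def)

lemma kclass_closed: "set xs \<subseteq> carrier A \<times> carrier A ==> kclass S A xs <: kahler S A"
 unfolding kclass_def using formal_sums.cl_closed[OF kahler_formal_sums] .

lemma kahler_carrierE:
 assumes "w <: kahler S A"
 obtains xs where "set xs \<subseteq> carrier A \<times> carrier A" "w = kclass S A xs"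
 using formal_sums.carrierE[OF kahler_formal_sums assms] by (auto simp: kclass_def)

lemma kclass_append:
 "set xs \<subseteq> carrier A \<times> carrier A ==> set ys \<subseteq> carrier A \<times> carrier A ==>
  kclass S A xs \<oplus>\<^bsub>kahler S A\<^esub> kclass S A ys = kclass S A (xs @ ys)"
 unfolding kclass_def using formal_sums.cl_append[OF kahler_formal_sums] .

lemma kclass_relI:
 "kahler_rel S A xs ys ==> set xs \<subseteq> carrier A \<times> carrier A ==> set ys \<subseteq> carrier A \<times> carrier A ==>
  kclass S A xs = kclass S A ys"
 unfolding kclass_def by (rule fsum_class_base)

context algebra
begin

abbreviation "\<Omega> \<equiv> kahler R M"

lemma kahler_group: "abelian_group \<Omega>"
proof (rule formal_sums.abelian_group[OF kahler_formal_sums, where neg = "\<lambda>(a, b). (\<ominus>\<^sub>M a, b)"])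
 fix x assume x: "x \<in> carrier M \<times> carrier M"
 then obtain a b where ab: "x = (a, b)" "a <: M" "b <: M" by auto
 have "kclass R M [(\<ominus>\<^sub>M a \<oplus>\<^sub>M a, b)] = kclass R M [(\<ominus>\<^sub>M a, b), (a, b)]"
  using ab by (intro kclass_relI kahler_rel.add_coeff) auto
 moreover have "kclass R M [(\<zero>\<^sub>M, b)] = kclass R M []"
  using ab by (intro kclass_relI kahler_rel.zero) auto
 ultimately show "fsum_class (carrier M \<times> carrier M) (kahler_rel R M) [(\<lambda>(a, b). (\<ominus>\<^sub>M a, b)) x, x]
   = fsum_class (carrier M \<times> carrier M) (kahler_rel R M) []"
  using ab by (simp add: kclass_def[symmetric] M.l_neg)
qed auto

lemma kahler_act_respects:
 assumes c: "c <: M" and rel: "kahler_rel R M xs ys"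
  and sub: "set xs \<subseteq> carrier M \<times> carrier M" "set ys \<subseteq> carrier M \<times> carrier M"
 shows "kclass R M (map (\<lambda>(a, b). (c \<otimes>\<^sub>M a, b)) xs) = kclass R M (map (\<lambda>(a, b). (c \<otimes>\<^sub>M a, b)) ys)"
 using rel
proof (cases rule: kahler_rel.cases)
 case (add_coeff a a' b)
 then show ?thesis using c sub by (simp add: r_distr) (intro kclass_relI kahler_rel.intros; simp)
next
 case (zero b)
 then show ?thesis using c sub by simp (intro kclass_relI kahler_rel.intros; simp)
next
 case (d_add b b' a)
 then show ?thesis using c sub by simp (intro kclass_relI kahler_rel.intros; simp)
next
 case (d_smult r a b)
 have "kclass R M [(c \<otimes>\<^sub>M a, r \<odot>\<^sub>M b)] = kclass R M [(r \<odot>\<^sub>M (c \<otimes>\<^sub>M a), b)]"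
  using d_smult c by (intro kclass_relI kahler_rel.intros) auto
 moreover have "r \<odot>\<^sub>M (c \<otimes>\<^sub>M a) = c \<otimes>\<^sub>M (r \<odot>\<^sub>M a)"
  using d_smult c by (simp add: algebra_smult_right[OF algebra_axioms])
 ultimately show ?thesis using d_smult by simp
next
 case (leibniz a b b')
 have "kclass R M [(c \<otimes>\<^sub>M a, b \<otimes>\<^sub>M b')] = kclass R M [((c \<otimes>\<^sub>M a) \<otimes>\<^sub>M b, b'), ((c \<otimes>\<^sub>M a) \<otimes>\<^sub>M b', b)]"
  using leibniz c by (intro kclass_relI kahler_rel.intros) auto
 then show ?thesis using leibniz c by (simp add: m_assoc)
qed

lemma kahler_act_kclass:
 assumes "c <: M" "set xs \<subseteq> carrier M \<times> carrier M"
 shows "kahler_act R M c (kclass R M xs) = kclass R M (map (\<lambda>(a, b). (c \<otimes>\<^sub>M a, b)) xs)"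
 unfolding kahler_act_def kclass_def
 using assms kahler_act_respects[OF assms(1)]
 by (intro fsum_class_map_rep) (auto simp: kclass_def)

lemma kahler_act_additive: "c <: M ==> additive \<Omega> \<Omega> (kahler_act R M c)"
proof (rule additive_mapI)
 fix w assume "c <: M" "w <: \<Omega>"
 then show "kahler_act R M c w <: \<Omega>"
  by (elim kahler_carrierE) (force simp: kahler_act_kclass intro!: kclass_closed)
next
 fix w w' assume c: "c <: M" and w: "w <: \<Omega>" "w' <: \<Omega>"
 have sub: "(\<lambda>(a, b). (c \<otimes>\<^sub>M a, b)) ` set xs \<subseteq> carrier M \<times> carrier M"
  if "set xs \<subseteq> carrier M \<times> carrier M" for xs using that c by auto
 from w show "kahler_act R M c (w \<oplus>\<^sub>\<Omega> w') = kahler_act R M c w \<oplus>\<^sub>\<Omega> kahler_act R M c w'"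
  by (elim kahler_carrierE) (simp add: c kclass_append kahler_act_kclass sub)
qed

lemmas kahler_act_closed [simp, intro] = additive_closed[OF kahler_act_additive]

lemma kahler_d_closed [simp, intro]: "b <: M ==> kahler_d R M b <: \<Omega>"
 by (auto simp: kahler_d_def intro!: kclass_closed)

lemma kclass_pair: "a <: M ==> b <: M ==> kclass R M [(a, b)] = kahler_act R M a (kahler_d R M b)"
 by (simp add: kahler_d_def kahler_act_kclass)

lemma kahler_induct [consumes 1, case_names zero gen add]:
 assumes "w <: \<Omega>" "Q \<zero>\<^sub>\<Omega>"
  "\<And>a b. a <: M ==> b <: M ==> Q (kahler_act R M a (kahler_d R M b))"
  "\<And>t u. t <: \<Omega> ==> u <: \<Omega> ==> Q t ==> Q u ==> Q (t \<oplus>\<^sub>\<Omega> u)"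
 shows "Q w"
 by (rule formal_sums.fsum_induct[OF kahler_formal_sums assms(1)])
  (use assms(2-) in "auto simp: kclass_def[symmetric] kclass_pair")

lemma kahler_map_eqI:
 assumes "additive \<Omega> P f" "additive \<Omega> P g" "abelian_group P"
  and "\<And>a b. a <: M ==> b <: M ==>
     f (kahler_act R M a (kahler_d R M b)) = g (kahler_act R M a (kahler_d R M b))"
  and "w <: \<Omega>"
 shows "f w = g w"
 by (rule formal_sums.additive_eqI[OF kahler_formal_sums assms(1,2) kahler_group assms(3)])
  (use assms in "auto simp: kclass_def[symmetric] kclass_pair")

lemma kahler_act_coeff_additive:
 assumes w: "w <: \<Omega>" shows "additive M \<Omega> (\<lambda>c. kahler_act R M c w)"
proof (rule additive_mapI)
 interpret W: abelian_group \<Omega> by (rule kahler_group)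
 fix c c' assume c: "c <: M" "c' <: M"
 show "kahler_act R M (c \<oplus>\<^sub>M c') w = kahler_act R M c w \<oplus>\<^sub>\<Omega> kahler_act R M c' w"
 proof (rule kahler_map_eqI[OF _ _ kahler_group _ w])
  fix a b assume ab: "a <: M" "b <: M"
  have "kclass R M [(c \<otimes>\<^sub>M a \<oplus>\<^sub>M c' \<otimes>\<^sub>M a, b)] = kclass R M [(c \<otimes>\<^sub>M a, b), (c' \<otimes>\<^sub>M a, b)]"
   using ab c by (intro kclass_relI kahler_rel.intros) auto
  then show "kahler_act R M (c \<oplus>\<^sub>M c') (kahler_act R M a (kahler_d R M b))
   = kahler_act R M c (kahler_act R M a (kahler_d R M b)) \<oplus>\<^sub>\<Omega> kahler_act R M c' (kahler_act R M a (kahler_d R M b))"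
   using ab c by (simp add: kclass_pair[symmetric] kahler_act_kclass kclass_append l_distr)
 qed (use c in "auto intro!: additive_sum kahler_group kahler_act_additive")
qed (use w in auto)

lemma kahler_act_assoc:
 assumes "c <: M" "c' <: M" "w <: \<Omega>"
 shows "kahler_act R M (c \<otimes>\<^sub>M c') w = kahler_act R M c (kahler_act R M c' w)"
proof (rule kahler_map_eqI[OF _ _ kahler_group _ assms(3)])
 show "additive \<Omega> \<Omega> (\<lambda>w. kahler_act R M c (kahler_act R M c' w))"
  by (rule additive_comp[OF kahler_act_additive[OF assms(2)] kahler_act_additive[OF assms(1)]])
qed (use assms in "auto simp: kclass_pair[symmetric] kahler_act_kclass m_assoc intro!: kahler_act_additive")

lemma kahler_act_one:
 assumes "w <: \<Omega>" shows "kahler_act R M \<one>\<^sub>M w = w"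
 by (rule kahler_map_eqI[OF kahler_act_additive _ kahler_group _ assms])
  (auto simp: kclass_pair[symmetric] kahler_act_kclass intro!: additive_mapI)

lemma
 shows kahler_module: "module R \<Omega>"
  and kahler_smult_kclass: "\<And>r xs. r <: R ==> set xs \<subseteq> carrier M \<times> carrier M ==>
   r \<odot>\<^sub>\<Omega> kclass R M xs = kclass R M (map (\<lambda>(a, b). (r \<odot>\<^sub>M a, b)) xs)"
proof -
 let ?X = "carrier M \<times> carrier M" and ?rel = "kahler_rel R M"
 have eq: "map (\<lambda>(a, b). (r \<odot>\<^sub>M a, b)) xs = map (\<lambda>(a, b). ((r \<odot>\<^sub>M \<one>\<^sub>M) \<otimes>\<^sub>M a, b)) xs"
  if "r <: R" "set xs \<subseteq> ?X" for r xs
  using that by (auto simp: smult_assoc2)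
 have resp: "fsum_class ?X ?rel (map (\<lambda>(a, b). (r \<odot>\<^sub>M a, b)) xs) = fsum_class ?X ?rel (map (\<lambda>(a, b). (r \<odot>\<^sub>M a, b)) ys)"
  if "r <: R" "kahler_rel R M xs ys" "set xs \<subseteq> ?X" "set ys \<subseteq> ?X" for r xs ys
  using kahler_act_respects[of "r \<odot>\<^sub>M \<one>\<^sub>M" xs ys] that by (simp add: kclass_def[symmetric] eq)
 have step: "fsum_class ?X ?rel [(\<lambda>(x, y). ((r \<oplus>\<^sub>R s) \<odot>\<^sub>M x, y)) z]
  = fsum_class ?X ?rel [(\<lambda>(x, y). (r \<odot>\<^sub>M x, y)) z, (\<lambda>(x, y). (s \<odot>\<^sub>M x, y)) z]"
  if "r <: R" "s <: R" "z \<in> ?X" for r s z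
  using that
  by (cases z) (simp add: smult_l_distr kclass_def[symmetric], intro kclass_relI kahler_rel.intros; simp)
 note fm = formal_sums_module[OF kahler_formal_sums R_cring kahler_group,
   where sc = "\<lambda>r (x, y). (r \<odot>\<^sub>M x, y)", OF _ _ resp step]
 have "module R \<Omega> \<and> (\<forall>r xs. r <: R \<longrightarrow> set xs \<subseteq> ?X \<longrightarrow>
   r \<odot>\<^sub>\<Omega> fsum_class ?X ?rel xs = fsum_class ?X ?rel (map (\<lambda>(x, y). (r \<odot>\<^sub>M x, y)) xs))"
  by (intro conjI allI impI fm) (auto simp: smult_assoc1 kahler_def kclass_def)
 then show "module R \<Omega>"
  "\<And>r xs. r <: R ==> set xs \<subseteq> ?X ==>
   r \<odot>\<^sub>\<Omega> kclass R M xs = kclass R M (map (\<lambda>(x, y). (r \<odot>\<^sub>M x, y)) xs)"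
  by (simp_all add: kclass_def)
qed

lemma kahler_smult_act:
 assumes "r <: R" "c <: M" "w <: \<Omega>"
 shows "kahler_act R M (r \<odot>\<^sub>M c) w = r \<odot>\<^sub>\<Omega> kahler_act R M c w"
  and "kahler_act R M c (r \<odot>\<^sub>\<Omega> w) = r \<odot>\<^sub>\<Omega> kahler_act R M c w"
proof -
 obtain xs where xs: "set xs \<subseteq> carrier M \<times> carrier M" "w = kclass R M xs"
  using assms(3) by (rule kahler_carrierE)
 have sub: "set (map (\<lambda>(a, b). (c \<otimes>\<^sub>M a, b)) xs) \<subseteq> carrier M \<times> carrier M"
  "set (map (\<lambda>(a, b). (r \<odot>\<^sub>M a, b)) xs) \<subseteq> carrier M \<times> carrier M"
  using xs assms by auto
 have "map (\<lambda>(a, b). ((r \<odot>\<^sub>M c) \<otimes>\<^sub>M a, b)) xs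
   = map ((\<lambda>(a, b). (r \<odot>\<^sub>M a, b)) \<circ> (\<lambda>(a, b). (c \<otimes>\<^sub>M a, b))) xs"
  using xs(1) assms by (auto simp: smult_assoc2)
 then show "kahler_act R M (r \<odot>\<^sub>M c) w = r \<odot>\<^sub>\<Omega> kahler_act R M c w"
  using assms sub xs by (simp add: kahler_act_kclass kahler_smult_kclass del: map_eq_conv)
 have "map ((\<lambda>(a, b). (c \<otimes>\<^sub>M a, b)) \<circ> (\<lambda>(a, b). (r \<odot>\<^sub>M a, b))) xs
   = map ((\<lambda>(a, b). (r \<odot>\<^sub>M a, b)) \<circ> (\<lambda>(a, b). (c \<otimes>\<^sub>M a, b))) xs"
  using xs(1) assms by (auto simp: algebra_smult_right[OF algebra_axioms])
 then show "kahler_act R M c (r \<odot>\<^sub>\<Omega> w) = r \<odot>\<^sub>\<Omega> kahler_act R M c w"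
  using assms sub xs by (simp add: kahler_act_kclass kahler_smult_kclass del: map_eq_conv)
qed

lemma kahler_act_bilinear: "bilinear R M \<Omega> \<Omega> (kahler_act R M)"
 by (intro bilinearI semilinearI kahler_act_additive kahler_act_coeff_additive)
  (simp_all add: kahler_smult_act)

lemma kahler_d_linear: "linear_map R M \<Omega> (kahler_d R M)"
proof (intro semilinearI additive_mapI)
 fix b b' assume "b <: M" "b' <: M"
 then show "kahler_d R M (b \<oplus>\<^sub>M b') = kahler_d R M b \<oplus>\<^sub>\<Omega> kahler_d R M b'"
  unfolding kahler_d_def by (subst kclass_append; simp?) (intro kclass_relI kahler_rel.intros; simp)
next
 fix r b assume "r <: R" "b <: M"
 then show "kahler_d R M (r \<odot>\<^sub>M b) = r \<odot>\<^sub>\<Omega> kahler_d R M b"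
  unfolding kahler_d_def by (subst kahler_smult_kclass; simp?) (intro kclass_relI kahler_rel.intros; simp)
qed auto

lemma kahler_d_mult:
 assumes "b <: M" "b' <: M"
 shows "kahler_d R M (b \<otimes>\<^sub>M b') = kahler_act R M b (kahler_d R M b') \<oplus>\<^sub>\<Omega> kahler_act R M b' (kahler_d R M b)"
proof -
 have "kclass R M [(\<one>\<^sub>M, b \<otimes>\<^sub>M b')] = kclass R M [(\<one>\<^sub>M \<otimes>\<^sub>M b, b'), (\<one>\<^sub>M \<otimes>\<^sub>M b', b)]"
  using assms by (intro kclass_relI kahler_rel.intros) auto
 then show ?thesis using assms
  by (simp add: kclass_pair[symmetric] kclass_append) (simp add: kahler_d_def)
qed

text \<open>The forms \<open>\<beta> a b = a \<cdot> D b\<close> attached to derivations \<open>D\<close>: these are the additive maps out of \<open>\<Omega>\<close>.\<close>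

definition derivation_form where
 "derivation_form P \<beta> \<longleftrightarrow> balanced R M M P \<beta>
  \<and> (\<forall>a\<in>carrier M. \<forall>b\<in>carrier M. \<forall>b'\<in>carrier M.
     \<beta> a (b \<otimes>\<^sub>M b') = \<beta> (a \<otimes>\<^sub>M b) b' \<oplus>\<^sub>P \<beta> (a \<otimes>\<^sub>M b') b)"

lemma derivation_form_respects:
 assumes P: "abelian_group P" and form: "derivation_form P \<beta>" and rel: "kahler_rel R M xs ys"
  and sub: "set xs \<subseteq> carrier M \<times> carrier M" "set ys \<subseteq> carrier M \<times> carrier M"
 shows "lsum P (map (\<lambda>(x, y). \<beta> x y) xs) = lsum P (map (\<lambda>(x, y). \<beta> x y) ys)"
proof -
 interpret P: abelian_group P by fact
 have b: "balanced R M M P \<beta>" using form by (simp add: derivation_form_def)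
 note cl [simp] = balanced_closed[OF b]
 show ?thesis using rel
 proof (cases rule: kahler_rel.cases)
  case (add_coeff a a' b')
  then show ?thesis using sub additive_add[OF balancedD(2)[OF b]] by simp
 next
  case (zero b')
  then show ?thesis using sub additive_zero[OF balancedD(2)[OF b] M.abelian_group_axioms P] by simp
 next
  case (d_add b b' a)
  then show ?thesis using sub additive_add[OF balancedD(1)[OF \<open>balanced R M M P \<beta>\<close>]] by simp
 next
  case (d_smult r a b')
  then show ?thesis using sub balancedD(3)[OF b] by simp
 next
  case (leibniz a b b')
  then show ?thesis using sub form by (simp add: derivation_form_def)
 qed
qed

lemma kahler_lift:
 assumes P: "abelian_group P" and form: "derivation_form P \<beta>"
 shows "additive \<Omega> P (fs_lift P (\<lambda>(a, b). \<beta> a b))"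
  and "\<And>a b. a <: M ==> b <: M ==>
     fs_lift P (\<lambda>(a, b). \<beta> a b) (kahler_act R M a (kahler_d R M b)) = \<beta> a b"
proof -
 interpret P: abelian_group P by fact
 have b: "balanced R M M P \<beta>" using form by (simp add: derivation_form_def)
 show "additive \<Omega> P (fs_lift P (\<lambda>(a, b). \<beta> a b))"
  by (rule formal_sums.fs_lift_additive[OF kahler_formal_sums P.abelian_monoid_axioms])
   (auto simp: balanced_closed[OF b] derivation_form_respects[OF assms])
 show "fs_lift P (\<lambda>(a, b). \<beta> a b) (kahler_act R M a (kahler_d R M b)) = \<beta> a b"
  if "a <: M" "b <: M" for a b
  unfolding kclass_pair[OF that, symmetric] kclass_def using that
  by (subst fs_lift_fsum_class)
   (auto simp: balanced_closed[OF b] P.abelian_monoid_axioms derivation_form_respects[OF assms])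
qed

end

subsection \<open>Functoriality of differentials\<close>

lemma
 assumes A: "algebra S A" and B: "algebra S' B" and f: "f \<in> ring_hom A B" "semilinear S h A B f"
  and h: "h ` carrier S \<subseteq> carrier S'"
 shows kahler_map_kclass: "\<And>xs. set xs \<subseteq> carrier A \<times> carrier A ==>
   kahler_map S' B f (kclass S A xs) = kclass S' B (map (\<lambda>(a, b). (f a, f b)) xs)"
  and kahler_map_semilinear: "semilinear S h (kahler S A) (kahler S' B) (kahler_map S' B f)"
  and kahler_map_act: "\<And>c w. c <: A ==> w <: kahler S A ==>
   kahler_map S' B f (kahler_act S A c w) = kahler_act S' B (f c) (kahler_map S' B f w)"
  and kahler_map_d: "\<And>b. b <: A ==> kahler_map S' B f (kahler_d S A b) = kahler_d S' B (f b)"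
proof -
 interpret A: algebra S A by fact
 interpret B: algebra S' B by fact
 have cl: "a <: A ==> f a <: B" for a using f(1) by (auto simp: ring_hom_def)
 have hcl: "r <: S ==> h r <: S'" for r using h by auto
 have sub: "set (map (\<lambda>(a, b). (f a, f b)) xs) \<subseteq> carrier B \<times> carrier B"
  "(\<lambda>(a, b). (f a, f b)) ` set xs \<subseteq> carrier B \<times> carrier B"
  if "set xs \<subseteq> carrier A \<times> carrier A" for xs using that cl by auto
 note hom = ring_hom_add[OF f(1)] ring_hom_mult[OF f(1)] ring_hom_one[OF f(1)]
  ring_hom_zero[OF f(1) A.ring_axioms B.ring_axioms] lin_smult[OF f(2)]
 have resp: "kclass S' B (map (\<lambda>(a, b). (f a, f b)) xs) = kclass S' B (map (\<lambda>(a, b). (f a, f b)) ys)"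
  if "kahler_rel S A xs ys" "set xs \<subseteq> carrier A \<times> carrier A" "set ys \<subseteq> carrier A \<times> carrier A" for xs ys
  using that
  by (cases rule: kahler_rel.cases; simp add: hom cl hcl; intro kclass_relI kahler_rel.intros; simp add: hom cl hcl)
 show kc: "kahler_map S' B f (kclass S A xs) = kclass S' B (map (\<lambda>(a, b). (f a, f b)) xs)"
  if "set xs \<subseteq> carrier A \<times> carrier A" for xs
  unfolding kahler_map_def kclass_def using that resp cl
  by (intro fsum_class_map_rep) (auto simp: kclass_def)
 show "semilinear S h (kahler S A) (kahler S' B) (kahler_map S' B f)"
 proof (intro semilinearI additive_mapI)
  fix w assume "w <: kahler S A"
  then show "kahler_map S' B f w <: kahler S' B"
   by (elim kahler_carrierE) (simp add: kc kclass_closed sub)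
 next
  fix w w' assume "w <: kahler S A" "w' <: kahler S A"
  then show "kahler_map S' B f (w \<oplus>\<^bsub>kahler S A\<^esub> w') = kahler_map S' B f w \<oplus>\<^bsub>kahler S' B\<^esub> kahler_map S' B f w'"
   by (elim kahler_carrierE) (simp add: kc kclass_append sub)
 next
  fix r w assume r: "r <: S" and "w <: kahler S A"
  then obtain xs where xs: "set xs \<subseteq> carrier A \<times> carrier A" "w = kclass S A xs"
   by (auto elim: kahler_carrierE)
  have "map (\<lambda>(a, b). (f a, f b)) (map (\<lambda>(a, b). (r \<odot>\<^sub>A a, b)) xs)
   = map (\<lambda>(a, b). (h r \<odot>\<^sub>B a, b)) (map (\<lambda>(a, b). (f a, f b)) xs)"
   using xs(1) r by (auto simp: hom)
  moreover have "set (map (\<lambda>(a, b). (r \<odot>\<^sub>A a, b)) xs) \<subseteq> carrier A \<times> carrier A" using xs(1) r by auto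
  ultimately show "kahler_map S' B f (r \<odot>\<^bsub>kahler S A\<^esub> w) = h r \<odot>\<^bsub>kahler S' B\<^esub> kahler_map S' B f w"
   using xs r by (simp only: xs(2) A.kahler_smult_kclass kc B.kahler_smult_kclass sub hcl)
 qed
 show "kahler_map S' B f (kahler_act S A c w) = kahler_act S' B (f c) (kahler_map S' B f w)"
  if c: "c <: A" and w: "w <: kahler S A" for c w
 proof -
  obtain xs where xs: "set xs \<subseteq> carrier A \<times> carrier A" "w = kclass S A xs"
   using w by (rule kahler_carrierE)
  have "map (\<lambda>(a, b). (f a, f b)) (map (\<lambda>(a, b). (c \<otimes>\<^sub>A a, b)) xs)
   = map (\<lambda>(a, b). (f c \<otimes>\<^sub>B a, b)) (map (\<lambda>(a, b). (f a, f b)) xs)"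
   using xs(1) c by (auto simp: hom)
  moreover have "set (map (\<lambda>(a, b). (c \<otimes>\<^sub>A a, b)) xs) \<subseteq> carrier A \<times> carrier A" using xs(1) c by auto
  ultimately show ?thesis
   using xs c by (simp only: xs(2) A.kahler_act_kclass kc B.kahler_act_kclass sub cl)
 qed
 show "kahler_map S' B f (kahler_d S A b) = kahler_d S' B (f b)" if "b <: A" for b
  using that by (simp add: kahler_d_def kc hom)
qed

lemma linear_comp:
 "linear_map S M N f ==> linear_map S N P g ==> linear_map S M P (\<lambda>x. g (f x))"
 by (auto simp: semilinear_def Pi_iff)

lemma linear_id: "linear_map S M M (\<lambda>x. x)"
 by (auto simp: semilinear_def)

lemma linear_sum:
 assumes "module S P" "linear_map S M P f" "linear_map S M P g"
 shows "linear_map S M P (\<lambda>x. f x \<oplus>\<^sub>P g x)"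
proof -
 interpret P: module S P by fact
 show ?thesis using assms(2,3)
  by (intro semilinearI additive_sum lin_additive[OF assms(2)] lin_additive[OF assms(3)]
     P.M.abelian_group_axioms) (auto simp: lin_smult lin_closed P.smult_r_distr)
qed

lemma linear_smult_left:
 assumes "module S P" "m <: P" shows "linear_map S (ring_module S) P (\<lambda>r. r \<odot>\<^sub>P m)"
proof -
 interpret P: module S P by fact
 show ?thesis using assms(2)
  by (intro semilinearI additive_mapI) (auto simp: P.smult_l_distr P.smult_assoc1)
qed

lemma linear_smult_right:
 assumes "module S P" "r <: S" shows "linear_map S P P (\<lambda>m. r \<odot>\<^sub>P m)"
proof -
 interpret P: module S P by fact
 have "s \<odot>\<^sub>P (r \<odot>\<^sub>P m) = r \<odot>\<^sub>P (s \<odot>\<^sub>P m)" if "s <: S" "m <: P" for s m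
  using that assms(2) by (simp add: P.smult_assoc1[symmetric] P.R.m_comm)
 then show ?thesis using assms(2)
  by (intro semilinearI additive_mapI) (auto simp: P.smult_r_distr)
qed

lemma smult_bilinear:
 assumes "module S P" shows "bilinear S (ring_module S) P P (smult P)"
 using linear_smult_left[OF assms] linear_smult_right[OF assms] by (intro bilinearI) auto

lemma bilinear_compose:
 assumes "bilinear S M N P \<beta>" "linear_map S M' M f" "linear_map S N' N g"
 shows "bilinear S M' N' P (\<lambda>x y. \<beta> (f x) (g y))"
 using assms
 by (intro bilinearI linear_comp[OF assms(2)] linear_comp[OF assms(3)])
  (auto intro: bilinearD lin_closed)

lemma bilinear_postcomp:
 "bilinear S M N P \<beta> ==> linear_map S P Q h ==> bilinear S M N Q (\<lambda>x y. h (\<beta> x y))"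
 by (auto intro!: bilinearI linear_comp[of S _ P _ Q h] dest: bilinearD)

lemma bilinear_flip: "bilinear S M N P \<beta> ==> bilinear S N M P (\<lambda>y x. \<beta> x y)"
 by (auto intro!: bilinearI dest: bilinearD)

lemma tensor_prod_bilinear:
 assumes mods: "module S M" "module S N" "module S M'" "module S N'" "module S P" "module S Q"
  and op1: "bilinear S M M' P op1" and op2: "bilinear S N N' Q op2"
 shows "bilinear S (tensor S M N) (tensor S M' N') (tensor S P Q) (tensor_prod S P Q op1 op2)"
proof -
 note ab = mods[THEN module_group]
 note ar = tensor_prod_additive_right[OF assms] and al = tensor_prod_additive_left[OF assms]
  and ap = tensor_prod_pure[OF assms]
 note pM = bilinear_smult(1)[OF pure_bilinear[OF mods(1,2)], symmetric]
  and pM' = bilinear_smult(1)[OF pure_bilinear[OF mods(3,4)], symmetric]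
  and pP = bilinear_smult(1)[OF pure_bilinear[OF mods(5,6)], symmetric]
 interpret M: module S M by fact
 interpret M': module S M' by fact
 interpret T: module S "tensor S M N" by (rule tensor_module[OF mods(1,2)])
 interpret T': module S "tensor S M' N'" by (rule tensor_module[OF mods(3,4)])
 note T'' = tensor_module[OF mods(5,6)]
 note aP = module_group[OF T'']
 note sm = lin_additive[OF linear_smult_right]
 let ?p = "tensor_prod S P Q op1 op2"
 have pure_l: "?p (pure S M N x y) (r \<odot>\<^bsub>tensor S M' N'\<^esub> u) = r \<odot>\<^bsub>tensor S P Q\<^esub> ?p (pure S M N x y) u"
  if "r <: S" "x <: M" "y <: N" "u <: tensor S M' N'" for r x y u
  by (rule tensor_map_eqI[OF additive_comp[OF sm[OF T'.module_axioms] ar] additive_comp[OF ar sm[OF T'']] ab(3,4) aP _ that(4)])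
   (use that in "auto simp: pM' ap pP bilinear_closed[OF op1] bilinear_closed[OF op2] bilinear_smult[OF op1] intro!: tclass_closed")
 have right: "?p t (r \<odot>\<^bsub>tensor S M' N'\<^esub> u) = r \<odot>\<^bsub>tensor S P Q\<^esub> ?p t u"
  if "r <: S" "t <: tensor S M N" "u <: tensor S M' N'" for r t u
  by (rule tensor_map_eqI[OF al additive_comp[OF al sm[OF T'']] ab(1,2) aP _ that(2)])
   (use that in "auto simp: pure_l")
 have pure_r: "?p (r \<odot>\<^bsub>tensor S M N\<^esub> pure S M N x y) u = r \<odot>\<^bsub>tensor S P Q\<^esub> ?p (pure S M N x y) u"
  if "r <: S" "x <: M" "y <: N" "u <: tensor S M' N'" for r x y u
  by (rule tensor_map_eqI[OF ar additive_comp[OF ar sm[OF T'']] ab(3,4) aP _ that(4)])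
   (use that in "auto simp: pM ap pP bilinear_closed[OF op1] bilinear_closed[OF op2] bilinear_smult[OF op1] intro!: tclass_closed")
 have left: "?p (r \<odot>\<^bsub>tensor S M N\<^esub> t) u = r \<odot>\<^bsub>tensor S P Q\<^esub> ?p t u"
  if "r <: S" "t <: tensor S M N" "u <: tensor S M' N'" for r t u
  by (rule tensor_map_eqI[OF additive_comp[OF sm[OF T.module_axioms] al] additive_comp[OF al sm[OF T'']] ab(1,2) aP _ that(2)])
   (use that in "auto simp: pure_r")
 show ?thesis by (intro bilinearI semilinearI ar al) (auto simp: left right)
qed

definition restr :: "('r \<Rightarrow> 's) \<Rightarrow> ('s, 'a, 'e) module_scheme \<Rightarrow> ('r, 'a) module" where
 "restr h M = \<lparr>carrier = carrier M, mult = mult M, one = one M, zero = zero M, add = add M,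
  smult = (\<lambda>r x. h r \<odot>\<^sub>M x)\<rparr>"

lemma restr_simps [simp]:
 "carrier (restr h M) = carrier M" "add (restr h M) = add M" "zero (restr h M) = zero M"
 "smult (restr h M) = (\<lambda>r x. h r \<odot>\<^sub>M x)"
 by (simp_all add: restr_def)

lemma restr_module:
 assumes "cring S" "module S' M" "h \<in> ring_hom S S'" shows "module S (restr h M)"
proof -
 interpret M: module S' M by fact
 have "abelian_group (restr h M)"
 proof (rule abelian_groupI)
  fix x assume "x <: restr h M"
  then show "\<exists>y\<in>carrier (restr h M). y \<oplus>\<^bsub>restr h M\<^esub> x = \<zero>\<^bsub>restr h M\<^esub>"
   by (intro bexI[of _ "\<ominus>\<^sub>M x"]) (auto simp: M.M.l_neg)
 qed (auto simp: M.M.a_ac)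
 then show ?thesis using assms(1)
  by (rule_tac moduleI)
   (auto simp: M.smult_l_distr M.smult_r_distr M.smult_assoc1 ring_hom_add[OF assms(3)]
     ring_hom_mult[OF assms(3)] ring_hom_one[OF assms(3)] ring_hom_closed[OF assms(3)])
qed

lemma lsum_restr [simp]: "lsum (restr h M) = lsum M"
 by (simp add: lsum_def fun_eq_iff)


section \<open>Calculus in Hopf algebras\<close>

text \<open>\<open>sweedler A P \<beta> a\<close> is the sum of \<open>\<beta> a\<^sub>1 a\<^sub>2\<close>, in Sweedler's notation \<open>\<Delta> a = \<Sum> a\<^sub>1 \<otimes> a\<^sub>2\<close>.\<close>

definition sweedler :: "('s, 'a) hopf \<Rightarrow> ('m, 'e) ring_scheme \<Rightarrow> ('a \<Rightarrow> 'a \<Rightarrow> 'm) \<Rightarrow> 'a \<Rightarrow> 'm" where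
 "sweedler A P \<beta> a = fs_lift P (\<lambda>(x, y). \<beta> x y) (comult A a)"

lemma sweedler_lsum: "sweedler A P \<beta> a = lsum P (map (\<lambda>(x, y). \<beta> x y) (rep (comult A a)))"
 by (simp add: sweedler_def fs_lift_def)

lemma sweedler_restr [simp]: "sweedler A (restr h P) = sweedler A P"
 by (simp add: sweedler_lsum fun_eq_iff)

lemma sweedler_ring_module [simp]: "sweedler A (ring_module S) = sweedler A S"
 by (simp add: sweedler_lsum fun_eq_iff)

definition trilinear where
 "trilinear S A P T \<longleftrightarrow> (\<forall>z\<in>carrier A. bilinear S A A P (\<lambda>x y. T x y z))
  \<and> (\<forall>x\<in>carrier A. bilinear S A A P (T x))"

lemma trilinearI:
 "(\<And>z. z <: A ==> bilinear S A A P (\<lambda>x y. T x y z)) ==>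
 (\<And>x. x <: A ==> bilinear S A A P (T x)) ==> trilinear S A P T"
 by (simp add: trilinear_def)

lemma trilinear_compose:
 assumes \<alpha>: "bilinear S A P Q \<alpha>" and \<beta>: "bilinear S A A P \<beta>"
 shows "trilinear S A Q (\<lambda>x y z. \<alpha> x (\<beta> y z))"
proof (rule trilinearI)
 fix z assume "z <: A"
 then show "bilinear S A A Q (\<lambda>x y. \<alpha> x (\<beta> y z))"
  using bilinear_compose[OF \<alpha> linear_id bilinearD(2)[OF \<beta>]] by blast
next
 fix x assume "x <: A"
 then show "bilinear S A A Q (\<lambda>y z. \<alpha> x (\<beta> y z))"
  using bilinear_postcomp[OF \<beta> bilinearD(1)[OF \<alpha>]] by blast
qed

locale hopf_alg =
 fixes S :: "('s, 'e) ring_scheme" and A :: "('s, 'a) hopf"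
 assumes hopf: "hopf_algebra S A"
begin

lemma algebra: "algebra S A"
 using hopf by (simp add: hopf_algebra_def Let_def)

end

sublocale hopf_alg \<subseteq> algebra S A
 by (rule algebra)

context hopf_alg
begin

abbreviation "AA \<equiv> tensor S A A"
abbreviation "\<Delta> \<equiv> comult A"
abbreviation "\<epsilon> \<equiv> counit A"
abbreviation "\<sigma> \<equiv> antipode A"
abbreviation "act \<equiv> kahler_act S A"
abbreviation "d \<equiv> kahler_d S A"
abbreviation "sw \<equiv> sweedler A"

lemma
 shows comult_hom: "\<Delta> \<in> ring_hom A AA" and comult_linear: "linear_map S A AA \<Delta>"
  and counit_hom: "\<epsilon> \<in> ring_hom A S" and counit_linear: "linear_map S A (ring_module S) \<epsilon>"
  and antipode_hom: "\<sigma> \<in> ring_hom A A" and antipode_linear: "linear_map S A A \<sigma>"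
 using hopf by (simp_all add: hopf_algebra_def Let_def)

lemmas comult_closed [simp, intro] = ring_hom_closed[OF comult_hom]
lemmas counit_closed [simp, intro] = ring_hom_closed[OF counit_hom]
lemmas antipode_closed [simp, intro] = ring_hom_closed[OF antipode_hom]

lemma A_module: "module S A" by (rule module)
lemma A_group: "abelian_group A" by (rule M.abelian_group_axioms)
lemma AA_group: "abelian_group AA" by (rule tensor_group[OF A_group A_group])
lemma mult_bilinear: "bilinear S A A A (mult A)" by (rule algebra_mult_bilinear[OF algebra])

lemma comult_rep: "a <: A ==> (x, y) \<in> set (rep (\<Delta> a)) ==> x <: A \<and> y <: A"
 using tensor_rep(1)[OF comult_closed] by blast

lemma sw_closed:
 assumes "abelian_group P" "a <: A" "\<And>x y. x <: A ==> y <: A ==> \<beta> x y <: P"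
 shows "sw P \<beta> a <: P"
proof -
 interpret P: abelian_group P by fact
 show ?thesis unfolding sweedler_lsum using assms(2,3)
  by (intro P.lsum_map_closed) (auto dest: comult_rep)
qed

lemma sw_cong:
 "a <: A ==> (\<And>x y. x <: A ==> y <: A ==> \<beta> x y = \<beta>' x y) ==> sw P \<beta> a = sw P \<beta>' a"
 unfolding sweedler_lsum by (rule lsum_cong) (auto dest: comult_rep)

lemma sw_additive:
 assumes "abelian_group P" "balanced S A A P \<beta>" shows "additive A P (sw P \<beta>)"
 unfolding sweedler_def
 by (rule additive_comp[OF lin_additive[OF comult_linear] tensor_lift_additive[OF A_group A_group assms]])

lemma sw_map:
 assumes "additive P Q h" "abelian_group P" "abelian_group Q" "a <: A"
  "\<And>x y. x <: A ==> y <: A ==> \<beta> x y <: P"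
 shows "h (sw P \<beta> a) = sw Q (\<lambda>x y. h (\<beta> x y)) a"
 unfolding sweedler_lsum using assms(4,5)
 by (subst additive_lsum_map[OF assms(1-3)]) (auto dest: comult_rep simp: case_prod_unfold)

lemma sw_add:
 assumes P: "abelian_group P" and "a <: A"
  "\<And>x y. x <: A ==> y <: A ==> \<beta> x y <: P"
  "\<And>x y. x <: A ==> y <: A ==> \<beta>' x y <: P"
 shows "sw P (\<lambda>x y. \<beta> x y \<oplus>\<^sub>P \<beta>' x y) a = sw P \<beta> a \<oplus>\<^sub>P sw P \<beta>' a"
proof -
 interpret P: abelian_group P by fact
 show ?thesis unfolding sweedler_lsum using assms(2-)
  by (subst P.lsum_map_add[symmetric]) (auto dest: comult_rep intro!: lsum_cong)
qed

lemma sw_linear: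
 assumes P: "module S P" and \<beta>: "bilinear S A A P \<beta>" shows "linear_map S A P (sw P \<beta>)"
proof (rule semilinearI)
 interpret P: module S P by fact
 note lift = tensor_lift_additive[OF A_group A_group P.M.abelian_group_axioms bilinear_balanced[OF \<beta>]]
 show "additive A P (sw P \<beta>)"
  by (rule sw_additive[OF P.M.abelian_group_axioms bilinear_balanced[OF \<beta>]])
 fix r a assume r: "r <: S" "a <: A"
 have "fs_lift P (\<lambda>(x, y). \<beta> x y) (r \<odot>\<^bsub>AA\<^esub> \<Delta> a) = r \<odot>\<^sub>P fs_lift P (\<lambda>(x, y). \<beta> x y) (\<Delta> a)"
  by (rule tensor_map_eqI[OF
     additive_comp[OF lin_additive[OF linear_smult_right[OF tensor_module[OF A_module A_module] r(1)]] lift]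
     additive_comp[OF lift lin_additive[OF linear_smult_right[OF P r(1)]]] A_group A_group P.M.abelian_group_axioms])
   (use r in "auto simp: bilinear_smult(1)[OF pure_bilinear[OF A_module A_module], symmetric]
     tensor_lift_pure[OF A_group A_group P.M.abelian_group_axioms bilinear_balanced[OF \<beta>]] bilinear_smult[OF \<beta>]")
 then show "sw P \<beta> (r \<odot>\<^sub>A a) = r \<odot>\<^sub>P sw P \<beta> a"
  using r by (simp add: sweedler_def lin_smult[OF comult_linear])
qed

lemma sw_comm:
 assumes P: "abelian_group P" and \<beta>: "balanced S A A P \<beta>" and a: "a <: A"
 shows "sw P (\<lambda>x y. \<beta> y x) a = sw P \<beta> a"
proof -
 have "fs_lift AA (\<lambda>(x, y). pure S A A y x) (\<Delta> a) = \<Delta> a"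
  using hopf a by (simp add: hopf_algebra_def Let_def)
 then have "sw P \<beta> a = fs_lift P (\<lambda>(x, y). \<beta> x y) (sw AA (\<lambda>x y. pure S A A y x) a)"
  by (simp add: sweedler_def)
 also have "\<dots> = sw P (\<lambda>x y. fs_lift P (\<lambda>(x, y). \<beta> x y) (pure S A A y x)) a"
  by (rule sw_map[OF tensor_lift_additive[OF A_group A_group P \<beta>] AA_group P a]) (auto intro!: tclass_closed)
 also have "\<dots> = sw P (\<lambda>x y. \<beta> y x) a"
  by (rule sw_cong[OF a]) (simp add: tensor_lift_pure[OF A_group A_group P \<beta>])
 finally show ?thesis by simp
qed

lemma sw_counit_left:
 assumes "additive A P f" "abelian_group P" "a <: A"
 shows "sw P (\<lambda>x y. f (\<epsilon> x \<odot>\<^sub>A y)) a = f a"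
proof -
 have "sw A (\<lambda>x y. \<epsilon> x \<odot>\<^sub>A y) a = a"
  using hopf assms(3) by (simp add: hopf_algebra_def Let_def sweedler_def)
 moreover have "f (sw A (\<lambda>x y. \<epsilon> x \<odot>\<^sub>A y) a) = sw P (\<lambda>x y. f (\<epsilon> x \<odot>\<^sub>A y)) a"
  by (rule sw_map[OF assms(1) A_group assms(2,3)]) auto
 ultimately show ?thesis by simp
qed

lemma counit_smult_bilinear: "bilinear S A A A (\<lambda>x y. \<epsilon> x \<odot>\<^sub>A y)"
 by (rule bilinear_compose[OF smult_bilinear[OF A_module] counit_linear linear_id])

lemma sw_counit_right:
 assumes "a <: A" shows "sw A (\<lambda>x y. \<epsilon> y \<odot>\<^sub>A x) a = a"
 using sw_comm[OF A_group bilinear_balanced[OF counit_smult_bilinear] assms]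
  sw_counit_left[OF lin_additive[OF linear_id] A_group assms] by simp

lemma sw_antipode_left: "a <: A ==> sw A (\<lambda>x y. \<sigma> x \<otimes>\<^sub>A y) a = \<epsilon> a \<odot>\<^sub>A \<one>\<^sub>A"
 using hopf by (simp add: hopf_algebra_def Let_def sweedler_def)

lemma sw_antipode_right:
 assumes "a <: A" shows "sw A (\<lambda>x y. x \<otimes>\<^sub>A \<sigma> y) a = \<epsilon> a \<odot>\<^sub>A \<one>\<^sub>A"
proof -
 have "sw A (\<lambda>x y. x \<otimes>\<^sub>A \<sigma> y) a = sw A (\<lambda>x y. \<sigma> y \<otimes>\<^sub>A x) a"
  using assms by (intro sw_cong) (auto simp: m_comm)
 also have "\<dots> = sw A (\<lambda>x y. \<sigma> x \<otimes>\<^sub>A y) a"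
  by (rule sw_comm[OF A_group bilinear_balanced assms])
   (rule bilinear_compose[OF mult_bilinear antipode_linear linear_id])
 finally show ?thesis using assms by (simp add: sw_antipode_left)
qed

lemma sw_mult:
 assumes P: "abelian_group P" and \<beta>: "balanced S A A P \<beta>" and a: "a <: A" and b: "b <: A"
 shows "sw P \<beta> (a \<otimes>\<^sub>A b) = sw P (\<lambda>x y. sw P (\<lambda>x' y'. \<beta> (x \<otimes>\<^sub>A x') (y \<otimes>\<^sub>A y')) b) a"
proof -
 interpret P: abelian_group P by fact
 define f where "f = (\<lambda>(x, y). map (\<lambda>(x', y'). (x \<otimes>\<^sub>A x', y \<otimes>\<^sub>A y')) (rep (\<Delta> b)))"
 have sub: "set (concat (map f (rep (\<Delta> a)))) \<subseteq> carrier A \<times> carrier A"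
  using a b by (auto simp: f_def dest: comult_rep)
 have "\<Delta> (a \<otimes>\<^sub>A b) = tclass S A A (concat (map f (rep (\<Delta> a))))"
  using ring_hom_mult[OF comult_hom a b] by (simp add: tensor_def f_def case_prod_unfold)
 then have "sw P \<beta> (a \<otimes>\<^sub>A b) = lsum P (map (\<lambda>(x, y). \<beta> x y) (concat (map f (rep (\<Delta> a)))))"
  by (simp add: sweedler_def tensor_lift[OF A_group A_group P \<beta> sub])
 also have "\<dots> = lsum P (map (\<lambda>z. lsum P (map (\<lambda>(x, y). \<beta> x y) (f z))) (rep (\<Delta> a)))"
  by (rule P.lsum_concat) (use sub in "force intro!: balanced_closed[OF \<beta>]")
 finally show ?thesis
  by (simp add: sweedler_lsum f_def comp_def case_prod_unfold)
qed

text \<open>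
 Coassociativity is an equation in \<open>A \<otimes> (A \<otimes> A)\<close>; evaluating a trilinear form on both sides of it makes it
 available for arbitrary expressions in \<open>a\<^sub>1, a\<^sub>2, a\<^sub>3\<close>.
\<close>

lemma sw_coassoc:
 assumes P: "module S P" and T: "trilinear S A P T" and a: "a <: A"
 shows "sw P (\<lambda>x z. sw P (\<lambda>x1 x2. T x1 x2 z) x) a = sw P (\<lambda>x z. sw P (T x) z) a"
proof -
 note Pg = module_group[OF P]
 interpret P: abelian_group P by (rule Pg)
 have T1: "bilinear S A A P (\<lambda>x y. T x y z)" if "z <: A" for z using T that by (simp add: trilinear_def)
 have T2: "bilinear S A A P (T x)" if "x <: A" for x using T that by (simp add: trilinear_def)
 note b2 = bilinear_balanced[OF T2]
 let ?B = "tensor S A AA"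
 have B: "abelian_group ?B" by (rule tensor_group[OF A_group AA_group])
 define E where "E x t = fs_lift P (\<lambda>(y, z). T x y z) t" for x t
 have E_add: "additive AA P (E x)" if "x <: A" for x
  unfolding E_def by (rule tensor_lift_additive[OF A_group A_group Pg b2[OF that]])
 have E_pure: "E x (pure S A A y z) = T x y z" if "x <: A" "y <: A" "z <: A" for x y z
  unfolding E_def by (rule tensor_lift_pure[OF A_group A_group Pg b2[OF that(1)] that(2,3)])
 have E_bal: "balanced S A AA P E"
 proof (rule balancedI[OF E_add additive_mapI])
  fix x x' t assume x: "x <: A" "x' <: A" and t: "t <: AA"
  show "E (x \<oplus>\<^sub>A x') t = E x t \<oplus>\<^sub>P E x' t"
   by (rule tensor_map_eqI[OF E_add additive_sum[OF Pg E_add E_add] A_group A_group Pg _ t])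
    (use x in "auto simp: E_pure additive_add[OF lin_additive[OF bilinearD(2)[OF T1]]]")
 next
  fix r x t assume r: "r <: S" and x: "x <: A" and t: "t <: AA"
  show "E (r \<odot>\<^sub>A x) t = E x (r \<odot>\<^bsub>AA\<^esub> t)"
   by (rule tensor_map_eqI[OF E_add additive_comp[OF lin_additive[OF linear_smult_right[OF tensor_module[OF A_module A_module] r]] E_add]
      A_group A_group Pg _ t])
    (use r x in "auto simp: E_pure bilinear_smult(1)[OF pure_bilinear[OF A_module A_module], symmetric]
      bilinear_smult[OF T1]")
 qed (use E_add in "auto intro: additive_closed")
 define L where "L = fs_lift P (\<lambda>(x, t). E x t)"
 have L_add: "additive ?B P L" unfolding L_def by (rule tensor_lift_additive[OF A_group AA_group Pg E_bal])
 have L_pure: "L (pure S A AA x t) = E x t" if "x <: A" "t <: AA" for x t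
  unfolding L_def by (rule tensor_lift_pure[OF A_group AA_group Pg E_bal that])
 have pcl: "pure S A AA x (pure S A A y z) <: ?B"
  if "x <: A" "y <: A" "z <: A" for x y z
  using that by (auto intro!: tclass_closed)
 have "sw ?B (\<lambda>x z. sw ?B (\<lambda>x1 x2. pure S A AA x1 (pure S A A x2 z)) x) a = sw ?B (\<lambda>x z. pure S A AA x (\<Delta> z)) a"
  using hopf a by (simp add: hopf_algebra_def Let_def sweedler_def)
 moreover have "L (sw ?B (\<lambda>x z. sw ?B (\<lambda>x1 x2. pure S A AA x1 (pure S A A x2 z)) x) a)
   = sw P (\<lambda>x z. sw P (\<lambda>x1 x2. T x1 x2 z) x) a"
 proof -
  have "L (sw ?B (\<lambda>x z. sw ?B (\<lambda>x1 x2. pure S A AA x1 (pure S A A x2 z)) x) a)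
   = sw P (\<lambda>x z. L (sw ?B (\<lambda>x1 x2. pure S A AA x1 (pure S A A x2 z)) x)) a"
   by (rule sw_map[OF L_add B Pg a]) (auto intro!: sw_closed B pcl)
  also have "\<dots> = sw P (\<lambda>x z. sw P (\<lambda>x1 x2. T x1 x2 z) x) a"
  proof (rule sw_cong[OF a])
   fix x z assume xz: "x <: A" "z <: A"
   have "L (sw ?B (\<lambda>x1 x2. pure S A AA x1 (pure S A A x2 z)) x)
     = sw P (\<lambda>x1 x2. L (pure S A AA x1 (pure S A A x2 z))) x"
    by (rule sw_map[OF L_add B Pg xz(1)]) (use xz pcl in auto)
   also have "\<dots> = sw P (\<lambda>x1 x2. T x1 x2 z) x"
    by (rule sw_cong[OF xz(1)]) (use xz in "simp add: L_pure tclass_closed E_pure")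
   finally show "L (sw ?B (\<lambda>x1 x2. pure S A AA x1 (pure S A A x2 z)) x) = sw P (\<lambda>x1 x2. T x1 x2 z) x" .
  qed
  finally show ?thesis .
 qed
 moreover have "L (sw ?B (\<lambda>x z. pure S A AA x (\<Delta> z)) a) = sw P (\<lambda>x z. sw P (T x) z) a"
 proof -
  have "L (sw ?B (\<lambda>x z. pure S A AA x (\<Delta> z)) a) = sw P (\<lambda>x z. L (pure S A AA x (\<Delta> z))) a"
   by (rule sw_map[OF L_add B Pg a]) (auto intro!: tclass_closed)
  also have "\<dots> = sw P (\<lambda>x z. sw P (T x) z) a"
   by (rule sw_cong[OF a]) (simp add: L_pure E_def sweedler_def)
  finally show ?thesis .
 qed
 ultimately show ?thesis by simp
qed

text \<open>
 A convolution inverse cancels.  When \<open>\<alpha>'\<close> is inverse to \<open>\<alpha>\<close> under convolution of actions on \<open>P\<close>,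
 a linear map \<open>\<Psi>\<close> is recovered from its convolution with \<open>\<alpha>\<close>; this replaces most manipulations of
 iterated coproducts below.
\<close>

lemma convolution_cancel:
 assumes P: "module S P" and \<alpha>: "bilinear S A P P \<alpha>" and \<alpha>': "bilinear S A P P \<alpha>'"
  and inv: "\<And>x m. x <: A ==> m <: P ==> sw P (\<lambda>u v. \<alpha>' u (\<alpha> v m)) x = \<epsilon> x \<odot>\<^sub>P m"
  and \<Psi>: "linear_map S A P \<Psi>" and a: "a <: A"
 shows "sw P (\<lambda>x y. \<alpha>' x (sw P (\<lambda>u v. \<alpha> u (\<Psi> v)) y)) a = \<Psi> a"
proof -
 note Pg = module_group[OF P]
 have b: "bilinear S A A P (\<lambda>u v. \<alpha> u (\<Psi> v))" by (rule bilinear_compose[OF \<alpha> linear_id \<Psi>])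
 have "sw P (\<lambda>x y. \<alpha>' x (sw P (\<lambda>u v. \<alpha> u (\<Psi> v)) y)) a = sw P (\<lambda>x y. sw P (\<lambda>u v. \<alpha>' x (\<alpha> u (\<Psi> v))) y) a"
  by (rule sw_cong[OF a]) (auto intro!: sw_map[OF lin_additive[OF bilinearD(1)[OF \<alpha>']] Pg Pg] bilinear_closed[OF b])
 also have "\<dots> = sw P (\<lambda>x y. sw P (\<lambda>u v. \<alpha>' u (\<alpha> v (\<Psi> y))) x) a"
  by (rule sw_coassoc[OF P trilinear_compose[OF \<alpha>' b] a, symmetric])
 also have "\<dots> = sw P (\<lambda>x y. \<Psi> (\<epsilon> x \<odot>\<^sub>A y)) a"
  by (rule sw_cong[OF a]) (simp add: inv lin_closed[OF \<Psi>] lin_smult[OF \<Psi>])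
 also have "\<dots> = \<Psi> a" by (rule sw_counit_left[OF lin_additive[OF \<Psi>] Pg a])
 finally show ?thesis .
qed

lemma convolution_cancel_eq:
 assumes P: "module S P" and \<alpha>: "bilinear S A P P \<alpha>" and \<alpha>': "bilinear S A P P \<alpha>'"
  and inv: "\<And>x m. x <: A ==> m <: P ==> sw P (\<lambda>u v. \<alpha>' u (\<alpha> v m)) x = \<epsilon> x \<odot>\<^sub>P m"
  and \<Psi>: "linear_map S A P \<Psi>" and \<Phi>: "linear_map S A P \<Phi>"
  and eq: "\<And>b. b <: A ==> sw P (\<lambda>u v. \<alpha> u (\<Psi> v)) b = sw P (\<lambda>u v. \<alpha> u (\<Phi> v)) b"
  and a: "a <: A"
 shows "\<Psi> a = \<Phi> a"
proof -
 have "\<Psi> a = sw P (\<lambda>x y. \<alpha>' x (sw P (\<lambda>u v. \<alpha> u (\<Psi> v)) y)) a"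
  by (rule convolution_cancel[OF P \<alpha> \<alpha>' inv \<Psi> a, symmetric])
 also have "\<dots> = sw P (\<lambda>x y. \<alpha>' x (sw P (\<lambda>u v. \<alpha> u (\<Phi> v)) y)) a"
  by (rule sw_cong[OF a]) (simp add: eq)
 also have "\<dots> = \<Phi> a" by (rule convolution_cancel[OF P \<alpha> \<alpha>' inv \<Phi> a])
 finally show ?thesis .
qed

end

section \<open>Invariant differentials\<close>

context hopf_alg
begin

text \<open>
 The invariant differential with the same value at the origin as \<open>db\<close>: the translates of \<open>db\<close> back to
 the origin and out again combine to \<open>\<Sum> \<sigma>(b\<^sub>1) db\<^sub>2\<close>.
\<close>

definition \<theta> :: "'a \<Rightarrow> ('a \<times> 'a) list set" where
 "\<theta> b = sw \<Omega> (\<lambda>x y. act (\<sigma> x) (d y)) b"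

lemma act_bilinear: "bilinear S A \<Omega> \<Omega> act" by (rule kahler_act_bilinear)

lemma \<theta>_linear: "linear_map S A \<Omega> \<theta>"
 unfolding \<theta>_def
 by (rule sw_linear[OF kahler_module bilinear_compose[OF act_bilinear antipode_linear kahler_d_linear]])

lemma \<theta>_additive: "additive A \<Omega> \<theta>" by (rule lin_additive[OF \<theta>_linear])

lemma \<theta>_closed [simp, intro]: "b <: A ==> \<theta> b <: \<Omega>"
 by (rule lin_closed[OF \<theta>_linear])

lemma act_scalar: "r <: S ==> m <: \<Omega> ==> act (r \<odot>\<^sub>A \<one>\<^sub>A) m = r \<odot>\<^sub>\<Omega> m"
 by (simp add: kahler_smult_act kahler_act_one)

lemma sw_act:
 assumes "a <: A" "m <: \<Omega>" "\<And>x y. x <: A ==> y <: A ==> \<beta> x y <: A"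
 shows "sw \<Omega> (\<lambda>x y. act (\<beta> x y) m) a = act (sw A \<beta> a) m"
 using sw_map[OF kahler_act_coeff_additive[OF assms(2)] A_group kahler_group assms(1,3)] by simp

lemma sw_act_antipode_right:
 assumes "x <: A" "m <: \<Omega>"
 shows "sw \<Omega> (\<lambda>u v. act u (act (\<sigma> v) m)) x = \<epsilon> x \<odot>\<^sub>\<Omega> m"
proof -
 have "sw \<Omega> (\<lambda>u v. act u (act (\<sigma> v) m)) x = sw \<Omega> (\<lambda>u v. act (u \<otimes>\<^sub>A \<sigma> v) m) x"
  using assms by (intro sw_cong) (auto simp: kahler_act_assoc)
 then show ?thesis using assms by (simp add: sw_act sw_antipode_right act_scalar)
qed

text \<open>Convolution with the antipode, which defines \<open>\<theta>\<close>, is undone by convolution with the identity.\<close>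

lemma d_via_\<theta>: "b <: A ==> sw \<Omega> (\<lambda>x y. act x (\<theta> y)) b = d b"
 unfolding \<theta>_def
 using convolution_cancel[OF kahler_module bilinear_compose[OF act_bilinear antipode_linear linear_id]
   act_bilinear sw_act_antipode_right kahler_d_linear] by simp

text \<open>The Leibniz rule restricted to the origin, where functions become their values under \<open>\<epsilon>\<close>.\<close>

lemma \<theta>_mult:
 assumes b: "b <: A" and c: "c <: A"
 shows "\<theta> (b \<otimes>\<^sub>A c) = \<epsilon> b \<odot>\<^sub>\<Omega> \<theta> c \<oplus>\<^sub>\<Omega> \<epsilon> c \<odot>\<^sub>\<Omega> \<theta> b"
proof -
 interpret W: module S \<Omega> by (rule kahler_module)
 note G = kahler_group
 have bil: "bilinear S A A \<Omega> (\<lambda>x y. act (\<sigma> x) (d y))"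
  by (rule bilinear_compose[OF act_bilinear antipode_linear kahler_d_linear])
 have inner: "sw \<Omega> (\<lambda>x' y'. act (\<sigma> (x \<otimes>\<^sub>A x')) (d (y \<otimes>\<^sub>A y'))) c
   = act (\<sigma> x \<otimes>\<^sub>A y) (\<theta> c) \<oplus>\<^sub>\<Omega> \<epsilon> c \<odot>\<^sub>\<Omega> act (\<sigma> x) (d y)"
  if x: "x <: A" and y: "y <: A" for x y
 proof -
  have "sw \<Omega> (\<lambda>x' y'. act (\<sigma> (x \<otimes>\<^sub>A x')) (d (y \<otimes>\<^sub>A y'))) c
   = sw \<Omega> (\<lambda>x' y'. act (\<sigma> x \<otimes>\<^sub>A y) (act (\<sigma> x') (d y')) \<oplus>\<^sub>\<Omega> act (\<sigma> x' \<otimes>\<^sub>A y') (act (\<sigma> x) (d y))) c"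
   by (rule sw_cong[OF c])
    (simp add: x y ring_hom_mult[OF antipode_hom] kahler_d_mult kahler_act_assoc[symmetric]
      additive_add[OF kahler_act_additive] m_ac W.M.a_comm)
  also have "\<dots> = sw \<Omega> (\<lambda>x' y'. act (\<sigma> x \<otimes>\<^sub>A y) (act (\<sigma> x') (d y'))) c
    \<oplus>\<^sub>\<Omega> sw \<Omega> (\<lambda>x' y'. act (\<sigma> x' \<otimes>\<^sub>A y') (act (\<sigma> x) (d y))) c"
   by (rule sw_add[OF G c]) (use x y in auto)
  also have "sw \<Omega> (\<lambda>x' y'. act (\<sigma> x \<otimes>\<^sub>A y) (act (\<sigma> x') (d y'))) c = act (\<sigma> x \<otimes>\<^sub>A y) (\<theta> c)"
   unfolding \<theta>_def by (rule sw_map[OF kahler_act_additive G G c, symmetric]) (use x y in auto)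
  also have "sw \<Omega> (\<lambda>x' y'. act (\<sigma> x' \<otimes>\<^sub>A y') (act (\<sigma> x) (d y))) c = \<epsilon> c \<odot>\<^sub>\<Omega> act (\<sigma> x) (d y)"
   using x y c by (simp add: sw_act sw_antipode_left act_scalar)
  finally show ?thesis .
 qed
 have "\<theta> (b \<otimes>\<^sub>A c) = sw \<Omega> (\<lambda>x y. sw \<Omega> (\<lambda>x' y'. act (\<sigma> (x \<otimes>\<^sub>A x')) (d (y \<otimes>\<^sub>A y'))) c) b"
  unfolding \<theta>_def by (rule sw_mult[OF G bilinear_balanced[OF bil] b c])
 also have "\<dots> = sw \<Omega> (\<lambda>x y. act (\<sigma> x \<otimes>\<^sub>A y) (\<theta> c) \<oplus>\<^sub>\<Omega> \<epsilon> c \<odot>\<^sub>\<Omega> act (\<sigma> x) (d y)) b"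
  by (rule sw_cong[OF b]) (simp add: inner)
 also have "\<dots> = sw \<Omega> (\<lambda>x y. act (\<sigma> x \<otimes>\<^sub>A y) (\<theta> c)) b \<oplus>\<^sub>\<Omega> sw \<Omega> (\<lambda>x y. \<epsilon> c \<odot>\<^sub>\<Omega> act (\<sigma> x) (d y)) b"
  by (rule sw_add[OF G b]) (use c in auto)
 also have "sw \<Omega> (\<lambda>x y. act (\<sigma> x \<otimes>\<^sub>A y) (\<theta> c)) b = \<epsilon> b \<odot>\<^sub>\<Omega> \<theta> c"
  using b c by (simp add: sw_act sw_antipode_left act_scalar)
 also have "sw \<Omega> (\<lambda>x y. \<epsilon> c \<odot>\<^sub>\<Omega> act (\<sigma> x) (d y)) b = \<epsilon> c \<odot>\<^sub>\<Omega> \<theta> b"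
  unfolding \<theta>_def
  by (rule sw_map[OF lin_additive[OF linear_smult_right[OF kahler_module]] G G b, symmetric]) (use c in auto)
 finally show ?thesis .
qed

lemma \<theta>_one: "\<theta> \<one>\<^sub>A = \<zero>\<^sub>\<Omega>"
proof -
 interpret W: module S \<Omega> by (rule kahler_module)
 have "\<theta> \<one>\<^sub>A = \<theta> \<one>\<^sub>A \<oplus>\<^sub>\<Omega> \<theta> \<one>\<^sub>A"
  using \<theta>_mult[of "\<one>\<^sub>A" "\<one>\<^sub>A"] by (simp add: ring_hom_one[OF counit_hom])
 then show ?thesis using W.M.add.l_cancel_one[of "\<theta> \<one>\<^sub>A" "\<theta> \<one>\<^sub>A"] by simp
qed

text \<open>The value at the origin, extended to an invariant differential: the map \<open>a db \<mapsto> \<epsilon>(a) \<theta>(b)\<close>.\<close>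

definition inv_proj :: "('a \<times> 'a) list set \<Rightarrow> ('a \<times> 'a) list set" where
 "inv_proj = fs_lift \<Omega> (\<lambda>(a, b). \<epsilon> a \<odot>\<^sub>\<Omega> \<theta> b)"

lemma origin_form:
 assumes P: "module S P" and f: "linear_map S A P f"
  and leib: "\<And>b c. b <: A ==> c <: A ==>
    f (b \<otimes>\<^sub>A c) = \<epsilon> b \<odot>\<^sub>P f c \<oplus>\<^sub>P \<epsilon> c \<odot>\<^sub>P f b"
 shows "derivation_form P (\<lambda>a b. \<epsilon> a \<odot>\<^sub>P f b)"
proof -
 interpret P: module S P by fact
 show ?thesis unfolding derivation_form_def
  using bilinear_balanced[OF bilinear_compose[OF smult_bilinear[OF P] counit_linear f]]
  by (auto simp: leib ring_hom_mult[OF counit_hom] lin_closed[OF f] P.smult_r_distr P.smult_assoc1)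
qed

lemma
 shows inv_proj_additive: "additive \<Omega> \<Omega> inv_proj"
  and inv_proj_gen: "\<And>a b. a <: A ==> b <: A ==> inv_proj (act a (d b)) = \<epsilon> a \<odot>\<^sub>\<Omega> \<theta> b"
 using kahler_lift[OF kahler_group origin_form[OF kahler_module \<theta>_linear \<theta>_mult]]
 by (simp_all add: inv_proj_def)

subsection \<open>Translation\<close>

abbreviation "WA \<equiv> tensor S \<Omega> A"
abbreviation "ract \<equiv> rel_act S A A"

lemma comult_sweedler: "u <: A ==> \<Delta> u = sw AA (pure S A A) u"
 using tclass_eq_lsum[OF tensor_rep(1)[OF comult_closed], of u S] tensor_rep(2)[OF comult_closed, of u]
 by (simp add: sweedler_lsum)

lemma rel_act_eq: "rel_act S A B = tensor_prod S \<Omega> B act (mult B)"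
 by (simp add: rel_act_def tensor_prod_def fun_eq_iff)

lemma rel_act_bilinear:
 assumes B: "algebra S B"
 shows "bilinear S (tensor S A B) (tensor S \<Omega> B) (tensor S \<Omega> B) (rel_act S A B)"
 unfolding rel_act_eq
 by (intro tensor_prod_bilinear A_module kahler_module algebra_module[OF B] act_bilinear algebra_mult_bilinear[OF B])

lemma rel_act_pure:
 assumes B: "algebra S B" and "a <: A" "b <: B" "w <: \<Omega>" "c <: B"
 shows "rel_act S A B (pure S A B a b) (pure S \<Omega> B w c) = pure S \<Omega> B (act a w) (b \<otimes>\<^sub>B c)"
 unfolding rel_act_eq
 by (rule tensor_prod_pure[OF A_module algebra_module[OF B] kahler_module algebra_module[OF B]
    kahler_module algebra_module[OF B] act_bilinear algebra_mult_bilinear[OF B] assms(2-)])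

lemma rel_act_assoc:
 assumes B: "algebra S B" and "t <: tensor S A B" "t' <: tensor S A B" "u <: tensor S \<Omega> B"
 shows "rel_act S A B (t \<otimes>\<^bsub>tensor S A B\<^esub> t') u = rel_act S A B t (rel_act S A B t' u)"
proof -
 interpret B: algebra S B by fact
 show ?thesis unfolding rel_act_eq
  by (rule tensor_prod_assoc[OF algebra B kahler_module algebra_module[OF B] act_bilinear algebra_mult_bilinear[OF B] _ _ assms(2-)])
   (auto simp: kahler_act_assoc B.m_assoc)
qed

lemma rel_act_one:
 assumes B: "algebra S B" and u: "u <: tensor S \<Omega> B"
 shows "rel_act S A B (pure S A B \<one>\<^sub>A \<one>\<^sub>B) u = u"
proof -
 interpret B: algebra S B by fact
 have "additive (tensor S \<Omega> B) (tensor S \<Omega> B) (rel_act S A B (pure S A B \<one>\<^sub>A \<one>\<^sub>B))"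
  by (rule lin_additive[OF bilinearD(1)[OF rel_act_bilinear[OF B]]]) (auto intro!: tclass_closed)
 then show ?thesis
  by (rule tensor_map_eqI[OF _ lin_additive[OF linear_id[of S]] kahler_group B.M.abelian_group_axioms
     tensor_group[OF kahler_group B.M.abelian_group_axioms] _ u])
   (auto simp: rel_act_pure[OF B] kahler_act_one)
qed

lemma
 assumes B: "algebra S B"
 shows rel_d_additive: "additive (tensor S A B) (tensor S \<Omega> B) (rel_d S A B)"
  and rel_d_pure: "\<And>a b. a <: A ==> b <: B ==> rel_d S A B (pure S A B a b) = pure S \<Omega> B (d a) b"
proof -
 note Bm = algebra_module[OF B]
 note Bg = module_group[OF Bm]
 have bal: "balanced S A B (tensor S \<Omega> B) (\<lambda>a b. pure S \<Omega> B (d a) b)"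
  by (rule bilinear_balanced[OF bilinear_compose[OF pure_bilinear[OF kahler_module Bm] kahler_d_linear linear_id]])
 note T = tensor_group[OF kahler_group Bg]
 show "additive (tensor S A B) (tensor S \<Omega> B) (rel_d S A B)"
  using tensor_lift_additive[OF A_group Bg T bal] by (simp add: rel_d_def[abs_def])
 show "rel_d S A B (pure S A B a b) = pure S \<Omega> B (d a) b" if "a <: A" "b <: B" for a b
  using tensor_lift_pure[OF A_group Bg T bal that] by (simp add: rel_d_def)
qed

lemma rel_d_linear:
 assumes B: "algebra S B" shows "linear_map S (tensor S A B) (tensor S \<Omega> B) (rel_d S A B)"
proof (rule semilinearI[OF rel_d_additive[OF B]])
 note Bm = algebra_module[OF B]
 note Bg = module_group[OF Bm]
 note T = tensor_group[OF kahler_group Bg]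
 fix r t assume r: "r <: S" and t: "t <: tensor S A B"
 show "rel_d S A B (r \<odot>\<^bsub>tensor S A B\<^esub> t) = r \<odot>\<^bsub>tensor S \<Omega> B\<^esub> rel_d S A B t"
  by (rule tensor_map_eqI[OF additive_comp[OF lin_additive[OF linear_smult_right[OF tensor_module[OF A_module Bm] r]] rel_d_additive[OF B]]
     additive_comp[OF rel_d_additive[OF B] lin_additive[OF linear_smult_right[OF tensor_module[OF kahler_module Bm] r]]] A_group Bg T _ t])
   (use r in "auto simp: bilinear_smult(1)[OF pure_bilinear, symmetric] A_module Bm kahler_module rel_d_pure[OF B]
      lin_smult[OF kahler_d_linear]")
qed

lemma rel_d_mult:
 assumes t: "t <: AA" and u: "u <: AA"
 shows "rel_d S A A (t \<otimes>\<^bsub>AA\<^esub> u) = ract t (rel_d S A A u) \<oplus>\<^bsub>WA\<^esub> ract u (rel_d S A A t)"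
proof -
 note WG = tensor_group[OF kahler_group A_group, of S]
 note rb = rel_act_bilinear[OF algebra]
 note r1 = lin_additive[OF bilinearD(1)[OF rb]] and r2 = lin_additive[OF bilinearD(2)[OF rb]]
 note da = rel_d_additive[OF algebra] and dp = rel_d_pure[OF algebra]
 note dc = additive_closed[OF da]
 note mb = tensor_prod_bilinear[OF A_module A_module A_module A_module A_module A_module mult_bilinear mult_bilinear]
 note m1 = lin_additive[OF bilinearD(1)[OF mb]] and m2 = lin_additive[OF bilinearD(2)[OF mb]]
  and mp = tensor_prod_pure[OF A_module A_module A_module A_module A_module A_module mult_bilinear mult_bilinear]
 let ?m = "tensor_prod S A A (mult A) (mult A)"
 let ?R = "rel_d S A A"
 interpret WG: abelian_group WA by (rule WG)
 note pW = lin_additive[OF bilinearD(2)[OF pure_bilinear[OF kahler_module A_module]]]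
 have pure_pure: "?R (?m (pure S A A a b) (pure S A A a' b'))
   = ract (pure S A A a b) (?R (pure S A A a' b')) \<oplus>\<^bsub>WA\<^esub> ract (pure S A A a' b') (?R (pure S A A a b))"
  if "a <: A" "b <: A" "a' <: A" "b' <: A" for a b a' b'
  using that
  by (simp add: mp dp kahler_d_mult rel_act_pure[OF algebra] additive_add[OF pW] tclass_closed m_comm WG.a_comm)
 have pure_any: "?R (?m (pure S A A a b) u) = ract (pure S A A a b) (?R u) \<oplus>\<^bsub>WA\<^esub> ract u (?R (pure S A A a b))"
  if ab: "a <: A" "b <: A" for a b
  by (rule tensor_map_eqI[OF additive_comp[OF m1 da] additive_sum[OF WG additive_comp[OF da r1] r2] A_group A_group WG _ u])
   (use ab in "auto simp: pure_pure intro!: tclass_closed dc")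
 have "?R (?m t u) = ract t (?R u) \<oplus>\<^bsub>WA\<^esub> ract u (?R t)"
  by (rule tensor_map_eqI[OF additive_comp[OF m2[OF u] da] additive_sum[OF WG r2[OF dc[OF u]] additive_comp[OF da r1[OF u]]] A_group A_group WG _ t])
   (auto simp: pure_any)
 then show ?thesis by (simp add: tensor_mult_eq)
qed

lemma WA_group: "abelian_group WA" by (rule tensor_group[OF kahler_group A_group])
lemma WA_module: "module S WA" by (rule tensor_module[OF kahler_module A_module])
lemma comult_mult: "a <: A ==> b <: A ==> \<Delta> (a \<otimes>\<^sub>A b) = \<Delta> a \<otimes>\<^bsub>AA\<^esub> \<Delta> b"
 by (rule ring_hom_mult[OF comult_hom])

lemma ract_comult_bilinear: "bilinear S A WA WA (\<lambda>x m. ract (\<Delta> x) m)"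
 by (rule bilinear_compose[OF rel_act_bilinear[OF algebra] comult_linear linear_id])

lemmas ract_closed = bilinear_closed[OF rel_act_bilinear[OF algebra]]
lemmas rel_d_closed = additive_closed[OF rel_d_additive[OF algebra]]

lemma translate_form: "derivation_form WA (\<lambda>a b. ract (\<Delta> a) (rel_d S A A (\<Delta> b)))"
proof -
 have "bilinear S A A WA (\<lambda>a b. ract (\<Delta> a) (rel_d S A A (\<Delta> b)))"
  by (rule bilinear_compose[OF rel_act_bilinear[OF algebra] comult_linear linear_comp[OF comult_linear rel_d_linear[OF algebra]]])
 moreover have "ract (\<Delta> a) (rel_d S A A (\<Delta> (b \<otimes>\<^sub>A c)))
   = ract (\<Delta> (a \<otimes>\<^sub>A b)) (rel_d S A A (\<Delta> c)) \<oplus>\<^bsub>WA\<^esub> ract (\<Delta> (a \<otimes>\<^sub>A c)) (rel_d S A A (\<Delta> b))"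
  if "a <: A" "b <: A" "c <: A" for a b c
  using that
  by (simp add: comult_mult rel_d_mult rel_act_assoc[OF algebra] rel_d_closed ract_closed
    additive_add[OF lin_additive[OF bilinearD(1)[OF rel_act_bilinear[OF algebra]]]])
 ultimately show ?thesis by (auto simp: derivation_form_def bilinear_balanced)
qed

lemma
 shows translate_additive: "additive \<Omega> WA (translate S A)"
  and translate_gen: "\<And>a b. a <: A ==> b <: A ==>
     translate S A (act a (d b)) = ract (\<Delta> a) (rel_d S A A (\<Delta> b))"
 using kahler_lift[OF WA_group translate_form] by (simp_all add: translate_def[abs_def])

lemma translate_act:
 assumes c: "c <: A" and w: "w <: \<Omega>"
 shows "translate S A (act c w) = ract (\<Delta> c) (translate S A w)"
 by (rule kahler_map_eqI[OF additive_comp[OF kahler_act_additive[OF c] translate_additive]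
    additive_comp[OF translate_additive lin_additive[OF bilinearD(1)[OF rel_act_bilinear[OF algebra]]]] WA_group _ w])
  (use c in "auto simp: translate_gen kahler_act_assoc[symmetric] comult_mult rel_act_assoc[OF algebra] rel_d_closed")

lemma comult_one: "\<Delta> \<one>\<^sub>A = pure S A A \<one>\<^sub>A \<one>\<^sub>A"
 using ring_hom_one[OF comult_hom] by (simp add: tensor_def)

lemma translate_d: "b <: A ==> translate S A (d b) = rel_d S A A (\<Delta> b)"
 using translate_gen[of "\<one>\<^sub>A" b] by (simp add: kahler_act_one comult_one rel_act_one[OF algebra] rel_d_closed)

lemma translate_linear: "linear_map S \<Omega> WA (translate S A)"
proof (rule semilinearI[OF translate_additive])
 fix r w assume "r <: S" "w <: \<Omega>"
 then show "translate S A (r \<odot>\<^sub>\<Omega> w) = r \<odot>\<^bsub>WA\<^esub> translate S A w"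
  using additive_closed[OF translate_additive, of w] translate_act[of "r \<odot>\<^sub>A \<one>\<^sub>A" w]
  by (simp add: act_scalar bilinear_smult(1)[OF ract_comult_bilinear] comult_one rel_act_one[OF algebra])
qed

text \<open>
 Both \<open>translate \<theta>(b)\<close> and \<open>\<theta>(b) \<otimes> 1\<close>, convolved with the action through \<open>\<Delta>\<close>, give
 \<open>\<Sum> db\<^sub>1 \<otimes> b\<^sub>2\<close>: the first because translation is multiplicative and \<open>db = \<Sum> b\<^sub>1 \<theta>(b\<^sub>2)\<close>, the second by
 commutativity of the group.  Now \<open>\<Delta>\<close> is invertible under convolution.
\<close>

lemma translate_\<theta>:
 assumes "b <: A" shows "translate S A (\<theta> b) = pure S \<Omega> A (\<theta> b) \<one>\<^sub>A"
proof (rule convolution_cancel_eq[where \<Psi> = "\<lambda>b. translate S A (\<theta> b)" and \<Phi> = "\<lambda>b. pure S \<Omega> A (\<theta> b) \<one>\<^sub>A",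
   OF WA_module ract_comult_bilinear _ _ _ _ _ assms])
 show "bilinear S A WA WA (\<lambda>x m. ract (\<Delta> (\<sigma> x)) m)"
  by (rule bilinear_compose[OF ract_comult_bilinear antipode_linear linear_id])
 show "linear_map S A WA (\<lambda>b. translate S A (\<theta> b))" by (rule linear_comp[OF \<theta>_linear translate_linear])
 show "linear_map S A WA (\<lambda>b. pure S \<Omega> A (\<theta> b) \<one>\<^sub>A)"
  by (rule linear_comp[OF \<theta>_linear bilinearD(2)[OF pure_bilinear[OF kahler_module A_module]]]) auto
next
 fix x m assume x: "x <: A" and m: "m <: WA"
 have "sw WA (\<lambda>u v. ract (\<Delta> (\<sigma> u)) (ract (\<Delta> v) m)) x = sw WA (\<lambda>u v. ract (\<Delta> (\<sigma> u \<otimes>\<^sub>A v)) m) x"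
  by (rule sw_cong[OF x]) (simp add: m comult_mult rel_act_assoc[OF algebra])
 also have "\<dots> = ract (\<Delta> (sw A (\<lambda>u v. \<sigma> u \<otimes>\<^sub>A v) x)) m"
  by (rule sw_map[OF lin_additive[OF bilinearD(2)[OF ract_comult_bilinear m]] A_group WA_group x, symmetric]) auto
 also have "\<dots> = \<epsilon> x \<odot>\<^bsub>WA\<^esub> m"
  using x m by (simp add: sw_antipode_left bilinear_smult(1)[OF ract_comult_bilinear] comult_one rel_act_one[OF algebra])
 finally show "sw WA (\<lambda>u v. ract (\<Delta> (\<sigma> u)) (ract (\<Delta> v) m)) x = \<epsilon> x \<odot>\<^bsub>WA\<^esub> m" .
next
 fix b assume b: "b <: A"
 let ?p = "pure S \<Omega> A"
 note pb = pure_bilinear[OF kahler_module A_module]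
 note Wm = kahler_module
 have act\<theta>: "bilinear S A A \<Omega> (\<lambda>x y. act x (\<theta> y))" by (rule bilinear_compose[OF act_bilinear linear_id \<theta>_linear])
 have "sw WA (\<lambda>u v. ract (\<Delta> u) (translate S A (\<theta> v))) b = sw WA (\<lambda>u v. translate S A (act u (\<theta> v))) b"
  by (rule sw_cong[OF b]) (simp add: translate_act)
 also have "\<dots> = translate S A (d b)"
  using sw_map[OF translate_additive kahler_group WA_group b, of "\<lambda>u v. act u (\<theta> v)"]
  by (simp add: d_via_\<theta>[OF b])
 also have "\<dots> = sw WA (\<lambda>x y. ?p (d x) y) b"
  by (simp add: translate_d[OF b] rel_d_def sweedler_def)
 finally have L: "sw WA (\<lambda>u v. ract (\<Delta> u) (translate S A (\<theta> v))) b = sw WA (\<lambda>x y. ?p (d x) y) b" .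
 have tri1: "trilinear S A WA (\<lambda>x y z. ?p (act x (\<theta> z)) y)"
 proof (rule trilinearI)
  fix z assume "z <: A"
  then show "bilinear S A A WA (\<lambda>x y. ?p (act x (\<theta> z)) y)"
   by (intro bilinear_compose[OF pb _ linear_id] bilinearD(2)[OF act\<theta>])
 next
  fix x assume "x <: A"
  then show "bilinear S A A WA (\<lambda>y z. ?p (act x (\<theta> z)) y)"
   using bilinear_flip[OF bilinear_compose[OF pb bilinearD(1)[OF act\<theta>] linear_id]] by blast
 qed
 have tri2: "trilinear S A WA (\<lambda>x z y. ?p (act x (\<theta> z)) y)"
 proof (rule trilinearI)
  fix y assume "y <: A"
  then show "bilinear S A A WA (\<lambda>x z. ?p (act x (\<theta> z)) y)"
   by (intro bilinear_postcomp[OF act\<theta>] bilinearD(2)[OF pb])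
 next
  fix x assume "x <: A"
  then show "bilinear S A A WA (\<lambda>z y. ?p (act x (\<theta> z)) y)"
   by (intro bilinear_compose[OF pb _ linear_id] bilinearD(1)[OF act\<theta>])
 qed
 have "sw WA (\<lambda>u v. ract (\<Delta> u) (?p (\<theta> v) \<one>\<^sub>A)) b = sw WA (\<lambda>u v. sw WA (\<lambda>x y. ?p (act x (\<theta> v)) y) u) b"
 proof (rule sw_cong[OF b])
  fix u v assume u: "u <: A" and v: "v <: A"
  have pcl: "?p (\<theta> v) \<one>\<^sub>A <: WA" using v by (auto intro!: tclass_closed)
  from comult_sweedler[OF u] have "ract (\<Delta> u) (?p (\<theta> v) \<one>\<^sub>A) = ract (sw AA (pure S A A) u) (?p (\<theta> v) \<one>\<^sub>A)" by simp
  also have "\<dots> = sw WA (\<lambda>x y. ract (pure S A A x y) (?p (\<theta> v) \<one>\<^sub>A)) u"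
   by (rule sw_map[OF lin_additive[OF bilinearD(2)[OF rel_act_bilinear[OF algebra] pcl]] AA_group WA_group u])
    (auto intro!: tclass_closed)
  also have "\<dots> = sw WA (\<lambda>x y. ?p (act x (\<theta> v)) y) u"
   by (rule sw_cong[OF u]) (simp add: rel_act_pure[OF algebra] v)
  finally show "ract (\<Delta> u) (?p (\<theta> v) \<one>\<^sub>A) = sw WA (\<lambda>x y. ?p (act x (\<theta> v)) y) u" .
 qed
 also have "\<dots> = sw WA (\<lambda>x v. sw WA (\<lambda>y z. ?p (act x (\<theta> z)) y) v) b"
  by (rule sw_coassoc[OF WA_module tri1 b])
 also have "\<dots> = sw WA (\<lambda>x v. sw WA (\<lambda>z y. ?p (act x (\<theta> z)) y) v) b"
  using tri2 by (intro sw_cong[OF b] sw_comm[OF WA_group bilinear_balanced]) (auto simp: trilinear_def)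
 also have "\<dots> = sw WA (\<lambda>u y. sw WA (\<lambda>x z. ?p (act x (\<theta> z)) y) u) b"
  by (rule sw_coassoc[OF WA_module tri2 b, symmetric])
 also have "\<dots> = sw WA (\<lambda>x y. ?p (d x) y) b"
 proof (rule sw_cong[OF b])
  fix u y assume u: "u <: A" and y: "y <: A"
  have "?p (sw \<Omega> (\<lambda>x z. act x (\<theta> z)) u) y = sw WA (\<lambda>x z. ?p (act x (\<theta> z)) y) u"
   by (rule sw_map[OF lin_additive[OF bilinearD(2)[OF pb y]] kahler_group WA_group u]) auto
  then show "sw WA (\<lambda>x z. ?p (act x (\<theta> z)) y) u = ?p (d u) y" by (simp add: d_via_\<theta>[OF u])
 qed
 finally show "sw WA (\<lambda>u v. ract (\<Delta> u) (translate S A (\<theta> v))) b = sw WA (\<lambda>u v. ract (\<Delta> u) (?p (\<theta> v) \<one>\<^sub>A)) b"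
  by (simp add: L)
qed

abbreviation "Inv \<equiv> invariant_differentials S A"

lemma Inv_simps:
 "carrier Inv = {w \<in> carrier \<Omega>. translate S A w = pure S \<Omega> A w \<one>\<^sub>A}"
 "add Inv = add \<Omega>" "zero Inv = zero \<Omega>" "smult Inv = smult \<Omega>"
 by (simp_all add: invariant_differentials_def)

lemma \<theta>_invariant: "b <: A ==> \<theta> b <: Inv"
 by (simp add: Inv_simps translate_\<theta>)

text \<open>Pulling the translate of \<open>w\<close> back along the antidiagonal evaluates \<open>w\<close> at the origin.\<close>

lemma inv_proj_invariant:
 assumes w: "w <: Inv" shows "inv_proj w = w"
proof -
 have w\<Omega>: "w <: \<Omega>" and tw: "translate S A w = pure S \<Omega> A w \<one>\<^sub>A" using w by (simp_all add: Inv_simps)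
 note G = kahler_group
 have bil: "bilinear S \<Omega> A \<Omega> (\<lambda>w c. act (\<sigma> c) w)"
  by (rule bilinear_flip[OF bilinear_compose[OF act_bilinear antipode_linear linear_id]])
 define L where "L = fs_lift \<Omega> (\<lambda>(w, c). act (\<sigma> c) w)"
 have L_add: "additive WA \<Omega> L"
  unfolding L_def by (rule tensor_lift_additive[OF G A_group G bilinear_balanced[OF bil]])
 have L_pure: "L (pure S \<Omega> A v c) = act (\<sigma> c) v" if "v <: \<Omega>" "c <: A" for v c
  unfolding L_def by (rule tensor_lift_pure[OF G A_group G bilinear_balanced[OF bil] that])
 have "L (translate S A w) = inv_proj w"
 proof (rule kahler_map_eqI[OF additive_comp[OF translate_additive L_add] inv_proj_additive G _ w\<Omega>])
  fix a b assume a: "a <: A" and b: "b <: A"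
  have rdb: "rel_d S A A (\<Delta> b) = sw WA (\<lambda>x y. pure S \<Omega> A (d x) y) b" by (simp add: rel_d_def sweedler_def)
  have rd_cl: "rel_d S A A (\<Delta> b) <: WA" by (rule rel_d_closed[OF comult_closed[OF b]])
  have inner: "L (ract (pure S A A x y) (rel_d S A A (\<Delta> b))) = act (x \<otimes>\<^sub>A \<sigma> y) (\<theta> b)"
   if x: "x <: A" and y: "y <: A" for x y
  proof -
   have pcl: "pure S A A x y <: AA" using x y by (auto intro!: tclass_closed)
   have "L (ract (pure S A A x y) (rel_d S A A (\<Delta> b)))
    = sw \<Omega> (\<lambda>x' y'. L (ract (pure S A A x y) (pure S \<Omega> A (d x') y'))) b"
    unfolding rdb
    by (rule sw_map[OF additive_comp[OF lin_additive[OF bilinearD(1)[OF rel_act_bilinear[OF algebra] pcl]] L_add] WA_group G b])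
     (auto intro!: tclass_closed)
   also have "\<dots> = sw \<Omega> (\<lambda>x' y'. act (x \<otimes>\<^sub>A \<sigma> y) (act (\<sigma> y') (d x'))) b"
    by (rule sw_cong[OF b])
     (simp add: x y rel_act_pure[OF algebra] L_pure ring_hom_mult[OF antipode_hom] kahler_act_assoc[symmetric] m_ac)
   also have "\<dots> = act (x \<otimes>\<^sub>A \<sigma> y) (sw \<Omega> (\<lambda>x' y'. act (\<sigma> y') (d x')) b)"
    by (rule sw_map[OF kahler_act_additive G G b, symmetric]) (use x y in auto)
   also have "sw \<Omega> (\<lambda>x' y'. act (\<sigma> y') (d x')) b = \<theta> b"
    unfolding \<theta>_def
    by (rule sw_comm[OF G bilinear_balanced[OF bilinear_compose[OF act_bilinear antipode_linear kahler_d_linear]] b])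
   finally show ?thesis .
  qed
  have "L (translate S A (act a (d b))) = L (ract (sw AA (pure S A A) a) (rel_d S A A (\<Delta> b)))"
   using a b comult_sweedler[OF a] by (simp add: translate_gen)
  also have "\<dots> = sw \<Omega> (\<lambda>x y. L (ract (pure S A A x y) (rel_d S A A (\<Delta> b)))) a"
   by (rule sw_map[OF additive_comp[OF lin_additive[OF bilinearD(2)[OF rel_act_bilinear[OF algebra] rd_cl]] L_add] AA_group G a])
    (auto intro!: tclass_closed)
  also have "\<dots> = sw \<Omega> (\<lambda>x y. act (x \<otimes>\<^sub>A \<sigma> y) (\<theta> b)) a"
   by (rule sw_cong[OF a]) (simp add: inner)
  also have "\<dots> = inv_proj (act a (d b))"
   using a b by (simp add: sw_act sw_antipode_right act_scalar inv_proj_gen)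
  finally show "L (translate S A (act a (d b))) = inv_proj (act a (d b))" .
 qed
 moreover have "L (translate S A w) = w"
  by (simp add: tw L_pure w\<Omega> ring_hom_one[OF antipode_hom] kahler_act_one)
 ultimately show ?thesis by simp
qed

lemma inv_proj_\<theta>:
 assumes "w <: \<Omega>" obtains b where "b <: A" "inv_proj w = \<theta> b"
proof -
 interpret W: module S \<Omega> by (rule kahler_module)
 have "\<exists>b\<in>carrier A. inv_proj w = \<theta> b" using assms
 proof (induction rule: kahler_induct)
  case zero
  show ?case
   by (intro bexI[of _ "\<zero>\<^sub>A"])
    (simp_all add: additive_zero[OF inv_proj_additive] additive_zero[OF \<theta>_additive] kahler_group A_group)
 next
  case (gen a b)
  then show ?case by (intro bexI[of _ "\<epsilon> a \<odot>\<^sub>A b"]) (auto simp: inv_proj_gen lin_smult[OF \<theta>_linear])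
 next
  case (add t u)
  then obtain b c where "b <: A" "c <: A" "inv_proj t = \<theta> b" "inv_proj u = \<theta> c" by auto
  then show ?case using add
   by (intro bexI[of _ "b \<oplus>\<^sub>A c"]) (auto simp: additive_add[OF inv_proj_additive] additive_add[OF \<theta>_additive])
 qed
 then show ?thesis using that by auto
qed

lemma invariant_\<theta>:
 assumes "w <: Inv" obtains b where "b <: A" "w = \<theta> b"
 using inv_proj_\<theta>[of w] inv_proj_invariant[OF assms] assms by (metis (no_types, lifting) Inv_simps(1) mem_Collect_eq)

subsection \<open>Multiplication by an integer\<close>

lemma nat_mult_linear: "linear_map S A A (nat_mult A m)"
proof (induction m)
 case 0
 show ?case using linear_comp[OF counit_linear linear_smult_left[OF A_module]] by simp
next
 case (Suc m)
 show ?case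
  using sw_linear[OF A_module bilinear_compose[OF mult_bilinear linear_id Suc]]
  by (simp add: sweedler_def[abs_def])
qed

lemma counit_nat_mult: "b <: A ==> \<epsilon> (nat_mult A m b) = \<epsilon> b"
proof (induction m arbitrary: b)
 case 0
 then show ?case by (simp add: lin_smult[OF counit_linear] ring_hom_one[OF counit_hom])
next
 case (Suc m)
 note nc = lin_closed[OF nat_mult_linear]
 have "\<epsilon> (nat_mult A (Suc m) b) = \<epsilon> (sw A (\<lambda>x y. x \<otimes>\<^sub>A nat_mult A m y) b)" by (simp add: sweedler_def)
 also have "\<dots> = sw S (\<lambda>x y. \<epsilon> (x \<otimes>\<^sub>A nat_mult A m y)) b"
  by (rule sw_map[OF ring_hom_additive[OF counit_hom] A_group R.abelian_group_axioms Suc.prems]) (auto simp: nc)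
 also have "\<dots> = sw S (\<lambda>x y. \<epsilon> (\<epsilon> x \<odot>\<^sub>A y)) b"
  by (rule sw_cong[OF Suc.prems])
   (simp add: nc ring_hom_mult[OF counit_hom] Suc.IH lin_smult[OF counit_linear])
 also have "\<dots> = \<epsilon> b" by (rule sw_counit_left[OF ring_hom_additive[OF counit_hom] R.abelian_group_axioms Suc.prems])
 finally show ?case .
qed

text \<open>Multiplication by \<open>m\<close> on a commutative group induces multiplication by \<open>m\<close> on the cotangent space at the origin.\<close>

lemma \<theta>_nat_mult:
 "b <: A ==> \<theta> (nat_mult A m b) = [m] \<cdot>\<^sub>\<Omega> \<theta> b"
proof (induction m arbitrary: b)
 case 0
 interpret W: module S \<Omega> by (rule kahler_module)
 show ?case using 0 by (simp add: lin_smult[OF \<theta>_linear] \<theta>_one)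
next
 case (Suc m)
 interpret W: module S \<Omega> by (rule kahler_module)
 note nc = lin_closed[OF nat_mult_linear]
 note G = kahler_group
 have "\<theta> (nat_mult A (Suc m) b) = \<theta> (sw A (\<lambda>x y. x \<otimes>\<^sub>A nat_mult A m y) b)" by (simp add: sweedler_def)
 also have "\<dots> = sw \<Omega> (\<lambda>x y. \<theta> (x \<otimes>\<^sub>A nat_mult A m y)) b"
  by (rule sw_map[OF \<theta>_additive A_group G Suc.prems]) (auto simp: nc)
 also have "\<dots> = sw \<Omega> (\<lambda>x y. \<theta> (nat_mult A m (\<epsilon> x \<odot>\<^sub>A y)) \<oplus>\<^sub>\<Omega> \<theta> (\<epsilon> y \<odot>\<^sub>A x)) b"
  by (rule sw_cong[OF Suc.prems])
   (simp add: nc \<theta>_mult counit_nat_mult lin_smult[OF \<theta>_linear] lin_smult[OF nat_mult_linear])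
 also have "\<dots> = sw \<Omega> (\<lambda>x y. \<theta> (nat_mult A m (\<epsilon> x \<odot>\<^sub>A y))) b \<oplus>\<^sub>\<Omega> sw \<Omega> (\<lambda>x y. \<theta> (\<epsilon> y \<odot>\<^sub>A x)) b"
  by (rule sw_add[OF G Suc.prems]) (auto simp: nc)
 also have "sw \<Omega> (\<lambda>x y. \<theta> (nat_mult A m (\<epsilon> x \<odot>\<^sub>A y))) b = \<theta> (nat_mult A m b)"
  by (rule sw_counit_left[OF additive_comp[OF lin_additive[OF nat_mult_linear] \<theta>_additive] G Suc.prems])
 also have "sw \<Omega> (\<lambda>x y. \<theta> (\<epsilon> y \<odot>\<^sub>A x)) b = \<theta> (sw A (\<lambda>x y. \<epsilon> y \<odot>\<^sub>A x) b)"
  by (rule sw_map[OF \<theta>_additive A_group G Suc.prems, symmetric]) auto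
 also have "\<dots> = \<theta> b" by (simp add: sw_counit_right[OF Suc.prems])
 finally show ?case using Suc by simp
qed

end

subsection \<open>Homomorphisms\<close>

lemma hopf_homD:
 assumes "hopf_hom S S' h A B f"
 shows "f \<in> ring_hom A B" "semilinear S h A B f"
  and "\<And>a. a <: A ==> comult B (f a) = fs_lift (tensor S' B B) (\<lambda>(x, y). pure S' B B (f x) (f y)) (comult A a)"
  and "\<And>a. a <: A ==> counit B (f a) = h (counit A a)"
 using assms by (auto simp: hopf_hom_def)

lemma sweedler_hom:
 assumes A: "hopf_alg S A" and B: "hopf_alg S' B" and f: "hopf_hom S S' h A B f"
  and P: "abelian_group P" and \<beta>: "balanced S' B B P \<beta>" and a: "a <: A"
 shows "sweedler B P \<beta> (f a) = sweedler A P (\<lambda>x y. \<beta> (f x) (f y)) a"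
proof -
 interpret A: hopf_alg S A by fact
 interpret B: hopf_alg S' B by fact
 have cl: "f x <: B" if "x <: A" for x using ring_hom_closed[OF hopf_homD(1)[OF f] that] .
 note lift = tensor_lift_additive[OF B.A_group B.A_group P \<beta>]
 have "sweedler B P \<beta> (f a) = fs_lift P (\<lambda>(x, y). \<beta> x y) (sweedler A B.AA (\<lambda>x y. pure S' B B (f x) (f y)) a)"
  by (simp add: sweedler_def hopf_homD(3)[OF f a])
 also have "\<dots> = sweedler A P (\<lambda>x y. fs_lift P (\<lambda>(x, y). \<beta> x y) (pure S' B B (f x) (f y))) a"
  by (rule A.sw_map[OF lift B.AA_group P a]) (auto intro!: tclass_closed simp: cl)
 also have "\<dots> = sweedler A P (\<lambda>x y. \<beta> (f x) (f y)) a"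
  by (rule A.sw_cong[OF a]) (simp add: tensor_lift_pure[OF B.A_group B.A_group P \<beta>] cl)
 finally show ?thesis .
qed

text \<open>Both sides, convolved with \<open>f\<close> acting on differentials, give \<open>d (f b)\<close>.\<close>

lemma kahler_map_\<theta>:
 assumes A: "hopf_alg S A" and B: "hopf_alg S' B" and f: "hopf_hom S S' h A B f"
  and h: "h \<in> ring_hom S S'" and b: "b <: A"
 shows "kahler_map S' B f (hopf_alg.\<theta> S A b) = hopf_alg.\<theta> S' B (f b)"
proof -
 interpret A: hopf_alg S A by fact
 interpret B: hopf_alg S' B by fact
 note fr = hopf_homD(1)[OF f] and fs = hopf_homD(2)[OF f]
 have cl [simp]: "f x <: B" if "x <: A" for x using ring_hom_closed[OF fr that] .
 have hcl [simp]: "h r <: S'" if "r <: S" for r using ring_hom_closed[OF h that] .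
 have hS: "h ` carrier S \<subseteq> carrier S'" by auto
 note km = kahler_map_semilinear[OF A.algebra B.algebra fr fs hS] kahler_map_act[OF A.algebra B.algebra fr fs hS]
  kahler_map_d[OF A.algebra B.algebra fr fs hS]
 define P where "P = restr h B.\<Omega>"
 have P: "module S P" unfolding P_def by (rule restr_module[OF A.R_cring B.kahler_module h])
 have add: "additive G P g \<longleftrightarrow> additive G B.\<Omega> g" for G :: "('z, 'w) ring_scheme" and g by (simp add: additive_def P_def)
 have addP: "additive P P g \<longleftrightarrow> additive B.\<Omega> B.\<Omega> g" for g by (simp add: additive_def P_def)
 have lin: "linear_map S M P g" if "semilinear S h M B.\<Omega> g" for M g
  using that by (simp add: semilinear_def P_def)
 have fl: "linear_map S A (restr h B) f" using fs by (simp add: semilinear_def)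
 have actP: "bilinear S (restr h B) P P B.act"
  by (intro bilinearI semilinearI)
   (auto simp: P_def additive_def B.kahler_smult_act additive_add[OF B.kahler_act_additive]
     additive_add[OF B.kahler_act_coeff_additive])
 have lf: "linear_map S A P (\<lambda>b. B.\<theta> (f b))"
  by (rule lin) (use additive_comp[OF lin_additive[OF fs] B.\<theta>_additive]
    in "auto intro!: semilinearI simp: lin_smult[OF fs] lin_smult[OF B.\<theta>_linear]")
 have lk: "linear_map S A P (\<lambda>b. kahler_map S' B f (A.\<theta> b))"
  by (rule lin)
   (use additive_comp[OF A.\<theta>_additive lin_additive[OF km(1)]]
    in "auto intro!: semilinearI simp: lin_smult[OF A.\<theta>_linear] lin_smult[OF km(1)]")
 have G: "abelian_group B.\<Omega>" by (rule B.kahler_group)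
 have swP: "sweedler A P = sweedler A B.\<Omega>" by (simp add: P_def)
 have \<alpha>: "bilinear S A P P (\<lambda>x m. B.act (f x) m)" by (rule bilinear_compose[OF actP fl linear_id])
 have \<alpha>': "bilinear S A P P (\<lambda>x m. B.act (f (A.\<sigma> x)) m)"
  by (rule bilinear_compose[OF actP linear_comp[OF A.antipode_linear fl] linear_id])
 show ?thesis
 proof (rule A.convolution_cancel_eq[OF P \<alpha> \<alpha>' _ lk lf _ b])
  fix x m assume x: "x <: A" and "m <: P"
  then have m: "m <: B.\<Omega>" by (simp add: P_def)
  have "sweedler A B.\<Omega> (\<lambda>u v. B.act (f (A.\<sigma> u)) (B.act (f v) m)) x
    = sweedler A B.\<Omega> (\<lambda>u v. B.act (f (A.\<sigma> u \<otimes>\<^sub>A v)) m) x"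
   by (rule A.sw_cong[OF x]) (simp add: m ring_hom_mult[OF fr] B.kahler_act_assoc)
  also have "\<dots> = B.act (f (A.sw A (\<lambda>u v. A.\<sigma> u \<otimes>\<^sub>A v) x)) m"
   by (rule A.sw_map[OF additive_comp[OF lin_additive[OF fs] B.kahler_act_coeff_additive[OF m]] A.A_group G x, symmetric])
    auto
  also have "\<dots> = A.\<epsilon> x \<odot>\<^sub>P m"
   using x m by (simp add: A.sw_antipode_left lin_smult[OF fs] ring_hom_one[OF fr] B.act_scalar P_def)
  finally show "sweedler A P (\<lambda>u v. B.act (f (A.\<sigma> u)) (B.act (f v) m)) x = A.\<epsilon> x \<odot>\<^sub>P m" by (simp add: swP)
 next
  fix b assume b: "b <: A"
  have "sweedler A B.\<Omega> (\<lambda>u v. B.act (f u) (kahler_map S' B f (A.\<theta> v))) b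
    = sweedler A B.\<Omega> (\<lambda>u v. kahler_map S' B f (A.act u (A.\<theta> v))) b"
   by (rule A.sw_cong[OF b]) (simp add: km(2))
  also have "\<dots> = kahler_map S' B f (A.d b)"
   using A.sw_map[OF lin_additive[OF km(1)] A.kahler_group G b, of "\<lambda>u v. A.act u (A.\<theta> v)"]
   by (simp add: A.d_via_\<theta>[OF b])
  also have "\<dots> = sweedler B B.\<Omega> (\<lambda>x y. B.act x (B.\<theta> y)) (f b)" using b by (simp add: km(3) B.d_via_\<theta>)
  also have "\<dots> = sweedler A B.\<Omega> (\<lambda>u v. B.act (f u) (B.\<theta> (f v))) b"
   by (rule sweedler_hom[OF A B f G bilinear_balanced[OF bilinear_compose[OF B.act_bilinear linear_id B.\<theta>_linear]] b])
  finally show "sweedler A P (\<lambda>u v. B.act (f u) (kahler_map S' B f (A.\<theta> v))) b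
    = sweedler A P (\<lambda>u v. B.act (f u) (B.\<theta> (f v))) b" by (simp add: swP)
 qed
qed

section \<open>Derivations from tangent vectors at the origin\<close>

context hopf_alg
begin

definition tangent :: "('a \<Rightarrow> 's) \<Rightarrow> bool" where
 "tangent \<delta> \<longleftrightarrow> linear_map S A (ring_module S) \<delta>
  \<and> (\<forall>b\<in>carrier A. \<forall>c\<in>carrier A. \<delta> (b \<otimes>\<^sub>A c) = \<epsilon> b \<otimes>\<^sub>S \<delta> c \<oplus>\<^sub>S \<epsilon> c \<otimes>\<^sub>S \<delta> b)"

definition deriv :: "('a \<Rightarrow> 's) \<Rightarrow> 'a \<Rightarrow> 'a" where
 "deriv \<delta> b = sw A (\<lambda>x y. \<delta> y \<odot>\<^sub>A x) b"

lemma S_module: "module S (ring_module S)"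
 by (rule algebra_module[OF algebra_ring_module[OF R_cring]])

lemma S_group: "abelian_group S" by (rule R.abelian_group_axioms)

lemma form_closed: "linear_map S A (ring_module S) \<phi> ==> x <: A ==> \<phi> x <: S"
 using lin_closed[of S _ A "ring_module S"] by simp

lemma smult_flip_bilinear:
 assumes "linear_map S A (ring_module S) \<delta>" shows "bilinear S A A A (\<lambda>x y. \<delta> y \<odot>\<^sub>A x)"
 by (rule bilinear_flip[OF bilinear_compose[OF smult_bilinear[OF A_module] assms linear_id]])

lemma deriv_linear: "linear_map S A (ring_module S) \<delta> ==> linear_map S A A (deriv \<delta>)"
 unfolding deriv_def[abs_def] by (rule sw_linear[OF A_module smult_flip_bilinear])

lemma tangentD:
 assumes "tangent \<delta>"
 shows "linear_map S A (ring_module S) \<delta>" "b <: A ==> \<delta> b <: S"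
  "b <: A ==> c <: A ==> \<delta> (b \<otimes>\<^sub>A c) = \<epsilon> b \<otimes>\<^sub>S \<delta> c \<oplus>\<^sub>S \<epsilon> c \<otimes>\<^sub>S \<delta> b"
 using assms form_closed by (auto simp: tangent_def)

lemma deriv_mult:
 assumes \<delta>: "tangent \<delta>" and b: "b <: A" and c: "c <: A"
 shows "deriv \<delta> (b \<otimes>\<^sub>A c) = b \<otimes>\<^sub>A deriv \<delta> c \<oplus>\<^sub>A c \<otimes>\<^sub>A deriv \<delta> b"
proof -
 note [simp] = tangentD(2)[OF \<delta>] algebra_smult_right[OF algebra] smult_assoc2
 have dcl [simp]: "x <: A ==> deriv \<delta> x <: A" for x
  by (rule lin_closed[OF deriv_linear[OF tangentD(1)[OF \<delta>]]])
 have sm: "r \<odot>\<^sub>A (s \<odot>\<^sub>A x) = s \<odot>\<^sub>A (r \<odot>\<^sub>A x)" if "r <: S" "s <: S" "x <: A" for r s x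
  using that by (simp add: smult_assoc1[symmetric] R.m_comm)
 have mulr: "additive A A (\<lambda>z. u \<otimes>\<^sub>A z)" if "u <: A" for u
  using that by (intro additive_mapI) (auto simp: r_distr)
 have mull: "additive A A (\<lambda>z. z \<otimes>\<^sub>A u)" if "u <: A" for u
  using that by (intro additive_mapI) (auto simp: l_distr)
 have inner: "sw A (\<lambda>x' y'. \<delta> (y \<otimes>\<^sub>A y') \<odot>\<^sub>A (x \<otimes>\<^sub>A x')) c
   = (\<epsilon> y \<odot>\<^sub>A x) \<otimes>\<^sub>A deriv \<delta> c \<oplus>\<^sub>A c \<otimes>\<^sub>A (\<delta> y \<odot>\<^sub>A x)"
  if x: "x <: A" and y: "y <: A" for x y
 proof -
  have "sw A (\<lambda>x' y'. \<delta> (y \<otimes>\<^sub>A y') \<odot>\<^sub>A (x \<otimes>\<^sub>A x')) c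
   = sw A (\<lambda>x' y'. (\<epsilon> y \<odot>\<^sub>A x) \<otimes>\<^sub>A (\<delta> y' \<odot>\<^sub>A x') \<oplus>\<^sub>A (\<epsilon> y' \<odot>\<^sub>A x') \<otimes>\<^sub>A (\<delta> y \<odot>\<^sub>A x)) c"
   by (rule sw_cong[OF c])
    (simp add: x y tangentD(3)[OF \<delta>] smult_l_distr smult_assoc1 m_comm sm M.a_comm)
  also have "\<dots> = sw A (\<lambda>x' y'. (\<epsilon> y \<odot>\<^sub>A x) \<otimes>\<^sub>A (\<delta> y' \<odot>\<^sub>A x')) c
    \<oplus>\<^sub>A sw A (\<lambda>x' y'. (\<epsilon> y' \<odot>\<^sub>A x') \<otimes>\<^sub>A (\<delta> y \<odot>\<^sub>A x)) c"
   by (rule sw_add[OF A_group c]) (use x y in auto)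
  also have "sw A (\<lambda>x' y'. (\<epsilon> y \<odot>\<^sub>A x) \<otimes>\<^sub>A (\<delta> y' \<odot>\<^sub>A x')) c = (\<epsilon> y \<odot>\<^sub>A x) \<otimes>\<^sub>A deriv \<delta> c"
   unfolding deriv_def by (rule sw_map[OF mulr A_group A_group c, symmetric]) (use x y in auto)
  also have "sw A (\<lambda>x' y'. (\<epsilon> y' \<odot>\<^sub>A x') \<otimes>\<^sub>A (\<delta> y \<odot>\<^sub>A x)) c
    = sw A (\<lambda>x' y'. \<epsilon> y' \<odot>\<^sub>A x') c \<otimes>\<^sub>A (\<delta> y \<odot>\<^sub>A x)"
   by (rule sw_map[OF mull A_group A_group c, symmetric]) (use x y in auto)
  finally show ?thesis by (simp add: sw_counit_right[OF c])
 qed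
 have "deriv \<delta> (b \<otimes>\<^sub>A c) = sw A (\<lambda>x y. sw A (\<lambda>x' y'. \<delta> (y \<otimes>\<^sub>A y') \<odot>\<^sub>A (x \<otimes>\<^sub>A x')) c) b"
  unfolding deriv_def by (rule sw_mult[OF A_group bilinear_balanced[OF smult_flip_bilinear[OF tangentD(1)[OF \<delta>]]] b c])
 also have "\<dots> = sw A (\<lambda>x y. (\<epsilon> y \<odot>\<^sub>A x) \<otimes>\<^sub>A deriv \<delta> c \<oplus>\<^sub>A c \<otimes>\<^sub>A (\<delta> y \<odot>\<^sub>A x)) b"
  by (rule sw_cong[OF b]) (rule inner)
 also have "\<dots> = sw A (\<lambda>x y. (\<epsilon> y \<odot>\<^sub>A x) \<otimes>\<^sub>A deriv \<delta> c) b \<oplus>\<^sub>A sw A (\<lambda>x y. c \<otimes>\<^sub>A (\<delta> y \<odot>\<^sub>A x)) b"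
  by (rule sw_add[OF A_group b]) (use c in auto)
 also have "sw A (\<lambda>x y. (\<epsilon> y \<odot>\<^sub>A x) \<otimes>\<^sub>A deriv \<delta> c) b = sw A (\<lambda>x y. \<epsilon> y \<odot>\<^sub>A x) b \<otimes>\<^sub>A deriv \<delta> c"
  by (rule sw_map[OF mull A_group A_group b, symmetric]) (use c in auto)
 also have "sw A (\<lambda>x y. c \<otimes>\<^sub>A (\<delta> y \<odot>\<^sub>A x)) b = c \<otimes>\<^sub>A deriv \<delta> b"
  unfolding deriv_def by (rule sw_map[OF mulr A_group A_group b, symmetric]) (use c in auto)
 finally show ?thesis by (simp add: sw_counit_right[OF b])
qed

text \<open>An invariant vector field, seen as the linear form on differentials that extends its derivation.\<close>

definition vfield :: "('a \<Rightarrow> 's) \<Rightarrow> ('a \<times> 'a) list set \<Rightarrow> 'a" where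
 "vfield \<delta> = fs_lift A (\<lambda>(a, b). a \<otimes>\<^sub>A deriv \<delta> b)"

lemma
 assumes \<delta>: "tangent \<delta>"
 shows vfield_additive: "additive \<Omega> A (vfield \<delta>)"
  and vfield_gen: "\<And>a b. a <: A ==> b <: A ==> vfield \<delta> (act a (d b)) = a \<otimes>\<^sub>A deriv \<delta> b"
proof -
 have "derivation_form A (\<lambda>a b. a \<otimes>\<^sub>A deriv \<delta> b)"
  unfolding derivation_form_def
  using bilinear_balanced[OF bilinear_compose[OF mult_bilinear linear_id deriv_linear[OF tangentD(1)[OF \<delta>]]]]
   lin_closed[OF deriv_linear[OF tangentD(1)[OF \<delta>]]]
  by (auto simp: deriv_mult[OF \<delta>] r_distr m_assoc)
 from kahler_lift[OF A_group this]
 show "additive \<Omega> A (vfield \<delta>)"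
  "\<And>a b. a <: A ==> b <: A ==> vfield \<delta> (act a (d b)) = a \<otimes>\<^sub>A deriv \<delta> b"
  by (simp_all add: vfield_def)
qed

lemma vfield_act:
 assumes \<delta>: "tangent \<delta>" and c: "c <: A" and w: "w <: \<Omega>"
 shows "vfield \<delta> (act c w) = c \<otimes>\<^sub>A vfield \<delta> w"
proof (rule kahler_map_eqI[OF additive_comp[OF kahler_act_additive[OF c] vfield_additive[OF \<delta>]] _ A_group _ w])
 show "additive \<Omega> A (\<lambda>w. c \<otimes>\<^sub>A vfield \<delta> w)"
  by (rule additive_comp[OF vfield_additive[OF \<delta>] lin_additive[OF bilinearD(1)[OF mult_bilinear c]]])
qed (use c lin_closed[OF deriv_linear[OF tangentD(1)[OF \<delta>]]]
   in "auto simp: vfield_gen[OF \<delta>] kahler_act_assoc[symmetric] m_assoc")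

lemma vfield_\<theta>:
 assumes \<delta>: "tangent \<delta>" and b: "b <: A"
 shows "vfield \<delta> (\<theta> b) = \<delta> b \<odot>\<^sub>A \<one>\<^sub>A"
proof -
 note [simp] = tangentD(2)[OF \<delta>]
 have "vfield \<delta> (\<theta> b) = sw A (\<lambda>x y. vfield \<delta> (act (\<sigma> x) (d y))) b"
  unfolding \<theta>_def by (rule sw_map[OF vfield_additive[OF \<delta>] kahler_group A_group b]) auto
 also have "\<dots> = sw A (\<lambda>x y. \<sigma> x \<otimes>\<^sub>A sw A (\<lambda>u v. u \<otimes>\<^sub>A (\<delta> v \<odot>\<^sub>A \<one>\<^sub>A)) y) b"
 proof (rule sw_cong[OF b])
  fix x y assume "x <: A" "y <: A"
  moreover have "deriv \<delta> y = sw A (\<lambda>u v. u \<otimes>\<^sub>A (\<delta> v \<odot>\<^sub>A \<one>\<^sub>A)) y"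
   unfolding deriv_def
   by (rule sw_cong[OF \<open>y <: A\<close>]) (simp add: algebra_smult_right[OF algebra])
  ultimately show "vfield \<delta> (act (\<sigma> x) (d y)) = \<sigma> x \<otimes>\<^sub>A sw A (\<lambda>u v. u \<otimes>\<^sub>A (\<delta> v \<odot>\<^sub>A \<one>\<^sub>A)) y"
   by (simp add: vfield_gen[OF \<delta>])
 qed
 also have "\<dots> = \<delta> b \<odot>\<^sub>A \<one>\<^sub>A"
 proof (rule convolution_cancel[OF A_module mult_bilinear bilinear_compose[OF mult_bilinear antipode_linear linear_id]
    _ linear_comp[OF tangentD(1)[OF \<delta>] linear_smult_left[OF A_module one_closed]] b])
  fix x m assume x: "x <: A" and m: "m <: A"
  have "sw A (\<lambda>u v. \<sigma> u \<otimes>\<^sub>A (v \<otimes>\<^sub>A m)) x = sw A (\<lambda>u v. (\<sigma> u \<otimes>\<^sub>A v) \<otimes>\<^sub>A m) x"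
   by (rule sw_cong[OF x]) (simp add: m m_assoc)
  also have "\<dots> = sw A (\<lambda>u v. \<sigma> u \<otimes>\<^sub>A v) x \<otimes>\<^sub>A m"
   by (rule sw_map[OF lin_additive[OF bilinearD(2)[OF mult_bilinear m]] A_group A_group x, symmetric]) auto
  finally show "sw A (\<lambda>u v. \<sigma> u \<otimes>\<^sub>A (v \<otimes>\<^sub>A m)) x = \<epsilon> x \<odot>\<^sub>A m"
   using x m by (simp add: sw_antipode_left smult_assoc2)
 qed
 finally show ?thesis .
qed

end


section \<open>Cartier duality\<close>

lemma lin_dual_simps:
 "carrier (lin_dual S M) = {\<phi> \<in> carrier M \<rightarrow>\<^sub>E carrier S. linear_map S M (ring_module S) \<phi>}"
 "zero (lin_dual S M) = (\<lambda>x\<in>carrier M. \<zero>\<^sub>S)"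
 "add (lin_dual S M) = (\<lambda>\<phi> \<psi>. \<lambda>x\<in>carrier M. \<phi> x \<oplus>\<^sub>S \<psi> x)"
 "smult (lin_dual S M) = (\<lambda>r \<phi>. \<lambda>x\<in>carrier M. r \<otimes>\<^sub>S \<phi> x)"
 by (simp_all add: lin_dual_def)

lemma lin_dual_linear: "\<phi> <: lin_dual S M ==> linear_map S M (ring_module S) \<phi>"
 by (simp add: lin_dual_simps)

lemma lin_dual_closed: "\<phi> <: lin_dual S M ==> x <: M ==> \<phi> x <: S"
 by (auto simp: lin_dual_simps)

lemma lin_dual_eqI:
 "\<phi> <: lin_dual S M ==> \<psi> <: lin_dual S M ==>
  (\<And>x. x <: M ==> \<phi> x = \<psi> x) ==> \<phi> = \<psi>"
 by (auto simp: lin_dual_simps intro: PiE_ext)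

lemma restrict_semilinear [simp]:
 assumes "module S M"
 shows "semilinear S h M N (restrict f (carrier M)) \<longleftrightarrow> semilinear S h M N f"
proof -
 interpret M: module S M by fact
 show ?thesis by (auto simp: semilinear_def Pi_iff)
qed

lemma lin_dual_restrict:
 "module S M ==> linear_map S M (ring_module S) f ==> (\<lambda>x\<in>carrier M. f x) <: lin_dual S M"
 by (auto simp: lin_dual_simps dest: lin_closed)

lemma lin_dual_module:
 assumes M: "module S M" shows "module S (lin_dual S M)"
proof -
 interpret M: module S M by fact
 note Sm = algebra_module[OF algebra_ring_module[OF M.R.is_cring]]
 have add: "(\<lambda>x\<in>carrier M. \<phi> x \<oplus>\<^sub>S \<psi> x) <: lin_dual S M"
  if "\<phi> <: lin_dual S M" "\<psi> <: lin_dual S M" for \<phi> \<psi>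
  using linear_sum[OF Sm lin_dual_linear[OF that(1)] lin_dual_linear[OF that(2)]]
  by (intro lin_dual_restrict[OF M]) simp
 have smult: "(\<lambda>x\<in>carrier M. r \<otimes>\<^sub>S \<phi> x) <: lin_dual S M"
  if "\<phi> <: lin_dual S M" "r <: S" for r \<phi>
  using linear_comp[OF lin_dual_linear[OF that(1)] linear_smult_right[OF Sm that(2)]]
  by (intro lin_dual_restrict[OF M]) simp
 have zero: "(\<lambda>x\<in>carrier M. \<zero>\<^sub>S) <: lin_dual S M"
  by (intro lin_dual_restrict[OF M]) (auto intro!: semilinearI additive_mapI)
 note cl = lin_dual_closed[of _ S M]
 have ext: "\<phi> = (\<lambda>x\<in>carrier M. \<phi> x)" if "\<phi> <: lin_dual S M" for \<phi>
  using that PiE_restrict[of \<phi> "carrier M" "\<lambda>_. carrier S"] by (simp add: lin_dual_simps)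
 have "abelian_group (lin_dual S M)"
 proof (rule abelian_groupI; (unfold lin_dual_simps(2,3))?)
  fix \<phi> assume p: "\<phi> <: lin_dual S M"
  show "(\<lambda>x\<in>carrier M. (\<lambda>x\<in>carrier M. \<zero>\<^sub>S) x \<oplus>\<^sub>S \<phi> x) = \<phi>"
   by (subst (2) ext[OF p]) (auto intro!: restrict_ext simp: cl[OF p])
  show "\<exists>\<psi>\<in>carrier (lin_dual S M). (\<lambda>x\<in>carrier M. \<psi> x \<oplus>\<^sub>S \<phi> x) = (\<lambda>x\<in>carrier M. \<zero>\<^sub>S)"
   by (rule bexI[OF _ smult[OF p, of "\<ominus>\<^sub>S \<one>\<^sub>S"]])
    (auto intro!: restrict_ext simp: cl[OF p] M.R.l_minus M.R.l_neg)
 next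
  fix \<phi> \<psi> \<chi> assume p: "\<phi> <: lin_dual S M" "\<psi> <: lin_dual S M" "\<chi> <: lin_dual S M"
  show "(\<lambda>x\<in>carrier M. (\<lambda>x\<in>carrier M. \<phi> x \<oplus>\<^sub>S \<psi> x) x \<oplus>\<^sub>S \<chi> x)
    = (\<lambda>x\<in>carrier M. \<phi> x \<oplus>\<^sub>S (\<lambda>x\<in>carrier M. \<psi> x \<oplus>\<^sub>S \<chi> x) x)"
   by (auto intro!: restrict_ext simp: p[THEN cl] M.R.a_assoc)
 next
  fix \<phi> \<psi> assume p: "\<phi> <: lin_dual S M" "\<psi> <: lin_dual S M"
  show "(\<lambda>x\<in>carrier M. \<phi> x \<oplus>\<^sub>S \<psi> x) = (\<lambda>x\<in>carrier M. \<psi> x \<oplus>\<^sub>S \<phi> x)"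
   by (auto intro!: restrict_ext simp: p[THEN cl] M.R.a_comm)
 qed (auto intro: add zero)
 then show ?thesis
 proof (rule moduleI[OF M.R.is_cring]; (unfold lin_dual_simps(2-4))?)
  fix \<phi> assume p: "\<phi> <: lin_dual S M"
  show "(\<lambda>x\<in>carrier M. \<one>\<^sub>S \<otimes>\<^sub>S \<phi> x) = \<phi>"
   by (subst (2) ext[OF p]) (auto intro!: restrict_ext simp: cl[OF p])
  show "(\<lambda>x\<in>carrier M. (r \<oplus>\<^sub>S s) \<otimes>\<^sub>S \<phi> x)
   = (\<lambda>x\<in>carrier M. (\<lambda>x\<in>carrier M. r \<otimes>\<^sub>S \<phi> x) x \<oplus>\<^sub>S (\<lambda>x\<in>carrier M. s \<otimes>\<^sub>S \<phi> x) x)"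
   "(\<lambda>x\<in>carrier M. (r \<otimes>\<^sub>S s) \<otimes>\<^sub>S \<phi> x) = (\<lambda>x\<in>carrier M. r \<otimes>\<^sub>S (\<lambda>x\<in>carrier M. s \<otimes>\<^sub>S \<phi> x) x)"
   if "r <: S" "s <: S" for r s
   using that by (auto intro!: restrict_ext simp: cl[OF p] M.R.l_distr M.R.m_assoc)
  fix \<psi> r assume p': "\<psi> <: lin_dual S M" "r <: S"
  show "(\<lambda>x\<in>carrier M. r \<otimes>\<^sub>S (\<lambda>x\<in>carrier M. \<phi> x \<oplus>\<^sub>S \<psi> x) x)
   = (\<lambda>x\<in>carrier M. (\<lambda>x\<in>carrier M. r \<otimes>\<^sub>S \<phi> x) x \<oplus>\<^sub>S (\<lambda>x\<in>carrier M. r \<otimes>\<^sub>S \<psi> x) x)"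
   using p'(2) by (auto intro!: restrict_ext simp: cl[OF p] cl[OF p'(1)] M.R.r_distr)
 qed (auto intro: smult)
qed

context hopf_alg
begin

abbreviation "D \<equiv> cartier_dual S A"

lemma D_simps:
 "carrier D = carrier (lin_dual S A)" "zero D = zero (lin_dual S A)" "add D = add (lin_dual S A)"
 "smult D = smult (lin_dual S A)" "one D = (\<lambda>a\<in>carrier A. \<epsilon> a)"
 "mult D = (\<lambda>\<phi> \<psi>. \<lambda>a\<in>carrier A. sw S (\<lambda>x y. \<phi> x \<otimes>\<^sub>S \<psi> y) a)"
 by (simp_all add: cartier_dual_def Let_def sweedler_def)

lemma D_linear: "\<phi> <: D ==> linear_map S A (ring_module S) \<phi>"
 by (simp add: D_simps lin_dual_linear)

lemma D_closed: "\<phi> <: D ==> x <: A ==> \<phi> x <: S"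
 by (simp add: D_simps lin_dual_closed)

lemma D_additive: "\<phi> <: D ==> additive A S \<phi>"
 using lin_additive[OF D_linear] by (simp add: additive_def)

lemma D_smult: "\<phi> <: D ==> r <: S ==> x <: A ==> \<phi> (r \<odot>\<^sub>A x) = r \<otimes>\<^sub>S \<phi> x"
 using lin_smult[OF D_linear] by simp

lemma D_eqI: "\<phi> <: D ==> \<psi> <: D ==> (\<And>x. x <: A ==> \<phi> x = \<psi> x) ==> \<phi> = \<psi>"
 unfolding D_simps by (rule lin_dual_eqI)

lemma D_restrict: "linear_map S A (ring_module S) f ==> (\<lambda>x\<in>carrier A. f x) <: D"
 unfolding D_simps by (rule lin_dual_restrict[OF A_module])

lemma D_apply:
 "x <: A ==> (\<phi> \<oplus>\<^sub>D \<psi>) x = \<phi> x \<oplus>\<^sub>S \<psi> x"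
 "x <: A ==> (r \<odot>\<^sub>D \<phi>) x = r \<otimes>\<^sub>S \<phi> x"
 "x <: A ==> (\<phi> \<otimes>\<^sub>D \<psi>) x = sw S (\<lambda>x y. \<phi> x \<otimes>\<^sub>S \<psi> y) x"
 "x <: A ==> \<one>\<^sub>D x = \<epsilon> x"
 "x <: A ==> \<zero>\<^sub>D x = \<zero>\<^sub>S"
 by (simp_all add: D_simps lin_dual_simps)

lemma D_prod_bilinear:
 "\<phi> <: D ==> \<psi> <: D ==> bilinear S A A (ring_module S) (\<lambda>x y. \<phi> x \<otimes>\<^sub>S \<psi> y)"
 using bilinear_compose[OF algebra_mult_bilinear[OF algebra_ring_module[OF R_cring]] D_linear D_linear] by simp

lemma D_prod_linear:
 "\<phi> <: D ==> \<psi> <: D ==> linear_map S A (ring_module S) (\<lambda>a. sw S (\<lambda>x y. \<phi> x \<otimes>\<^sub>S \<psi> y) a)"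
 using sw_linear[OF S_module D_prod_bilinear] by simp

lemma D_algebra: "algebra S D"
proof -
 have mod: "module S (lin_dual S A)" by (rule lin_dual_module[OF A_module])
 interpret L: module S "lin_dual S A" by fact
 note cl [simp] = D_closed
 have Dm: "module S D"
 proof -
  have "abelian_group D"
   by (rule abelian_groupI) (use L.M.a_assoc L.M.a_comm L.M.l_neg in \<open>auto simp: D_simps intro!: bexI[of _ "\<ominus>\<^bsub>lin_dual S A\<^esub> _"]\<close>)
  then show ?thesis
   by (rule_tac moduleI[OF R_cring])
    (auto simp: D_simps L.smult_l_distr L.smult_r_distr L.smult_assoc1)
 qed
 interpret D: module S D by (rule Dm)
 have mcl [simp]: "\<phi> \<otimes>\<^sub>D \<psi> <: D" if "\<phi> <: D" "\<psi> <: D" for \<phi> \<psi>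
  using D_restrict[OF D_prod_linear[OF that]] by (simp add: D_simps)
 have ocl [simp]: "\<one>\<^sub>D <: D" using D_restrict[OF counit_linear] by (simp add: D_simps)
 have comm: "\<phi> \<otimes>\<^sub>D \<psi> = \<psi> \<otimes>\<^sub>D \<phi>" if p: "\<phi> <: D" "\<psi> <: D" for \<phi> \<psi>
 proof (rule D_eqI)
  fix a assume a: "a <: A"
  have "sw S (\<lambda>x y. \<phi> x \<otimes>\<^sub>S \<psi> y) a = sw S (\<lambda>x y. \<phi> y \<otimes>\<^sub>S \<psi> x) a"
   using sw_comm[OF module_group[OF S_module] bilinear_balanced[OF D_prod_bilinear[OF p]] a] by simp
  also have "\<dots> = sw S (\<lambda>x y. \<psi> x \<otimes>\<^sub>S \<phi> y) a"
   by (rule sw_cong[OF a]) (simp add: p R.m_comm)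
  finally show "(\<phi> \<otimes>\<^sub>D \<psi>) a = (\<psi> \<otimes>\<^sub>D \<phi>) a" using a by (simp add: D_apply)
 qed (use p in auto)
 have assoc: "\<phi> \<otimes>\<^sub>D \<psi> \<otimes>\<^sub>D \<chi> = \<phi> \<otimes>\<^sub>D (\<psi> \<otimes>\<^sub>D \<chi>)"
  if p: "\<phi> <: D" "\<psi> <: D" "\<chi> <: D" for \<phi> \<psi> \<chi>
 proof (rule D_eqI)
  fix a assume a: "a <: A"
  have mS: "additive S S (\<lambda>r. r \<otimes>\<^sub>S s)" "additive S S (\<lambda>r. s \<otimes>\<^sub>S r)" if "s <: S" for s
   using that by (auto intro!: additive_mapI simp: R.l_distr R.r_distr)
  have mSl: "linear_map S (ring_module S) (ring_module S) (\<lambda>r. r \<otimes>\<^sub>S s)" if "s <: S" for s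
   using linear_smult_left[OF S_module, of s] that by simp
  have tri: "trilinear S A (ring_module S) (\<lambda>x y z. \<phi> x \<otimes>\<^sub>S (\<psi> y \<otimes>\<^sub>S \<chi> z))"
   using trilinear_compose[OF bilinear_compose[OF algebra_mult_bilinear[OF algebra_ring_module[OF R_cring]] D_linear[OF p(1)] linear_id]
     D_prod_bilinear[OF p(2,3)]] by simp
  have "(\<phi> \<otimes>\<^sub>D \<psi> \<otimes>\<^sub>D \<chi>) a = sw S (\<lambda>x z. (\<phi> \<otimes>\<^sub>D \<psi>) x \<otimes>\<^sub>S \<chi> z) a" by (simp add: D_apply a)
  also have "\<dots> = sw S (\<lambda>x z. sw S (\<lambda>x1 x2. \<phi> x1 \<otimes>\<^sub>S (\<psi> x2 \<otimes>\<^sub>S \<chi> z)) x) a"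
  proof (rule sw_cong[OF a])
   fix x z assume x: "x <: A" and z: "z <: A"
   have "(\<phi> \<otimes>\<^sub>D \<psi>) x \<otimes>\<^sub>S \<chi> z = sw S (\<lambda>x1 x2. \<phi> x1 \<otimes>\<^sub>S \<psi> x2 \<otimes>\<^sub>S \<chi> z) x"
    unfolding D_apply(3)[OF x]
    by (rule sw_map[OF mS(1) S_group S_group x]) (use p z in auto)
   also have "\<dots> = sw S (\<lambda>x1 x2. \<phi> x1 \<otimes>\<^sub>S (\<psi> x2 \<otimes>\<^sub>S \<chi> z)) x"
    by (rule sw_cong[OF x]) (simp add: p z R.m_assoc)
   finally show "(\<phi> \<otimes>\<^sub>D \<psi>) x \<otimes>\<^sub>S \<chi> z = sw S (\<lambda>x1 x2. \<phi> x1 \<otimes>\<^sub>S (\<psi> x2 \<otimes>\<^sub>S \<chi> z)) x" .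
  qed
  also have "\<dots> = sw S (\<lambda>x z. sw S (\<lambda>z1 z2. \<phi> x \<otimes>\<^sub>S (\<psi> z1 \<otimes>\<^sub>S \<chi> z2)) z) a"
   using sw_coassoc[OF S_module tri a] by simp
  also have "\<dots> = sw S (\<lambda>x z. \<phi> x \<otimes>\<^sub>S (\<psi> \<otimes>\<^sub>D \<chi>) z) a"
  proof (rule sw_cong[OF a])
   fix x z assume x: "x <: A" and z: "z <: A"
   show "sw S (\<lambda>z1 z2. \<phi> x \<otimes>\<^sub>S (\<psi> z1 \<otimes>\<^sub>S \<chi> z2)) z = \<phi> x \<otimes>\<^sub>S (\<psi> \<otimes>\<^sub>D \<chi>) z"
    unfolding D_apply(3)[OF z]
    by (rule sw_map[OF mS(2) S_group S_group z, symmetric]) (use p x in auto)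
  qed
  finally show "(\<phi> \<otimes>\<^sub>D \<psi> \<otimes>\<^sub>D \<chi>) a = (\<phi> \<otimes>\<^sub>D (\<psi> \<otimes>\<^sub>D \<chi>)) a" by (simp add: D_apply a)
 qed (use p in auto)
 have one: "\<one>\<^sub>D \<otimes>\<^sub>D \<phi> = \<phi>" if p: "\<phi> <: D" for \<phi>
 proof (rule D_eqI)
  fix a assume a: "a <: A"
  have "(\<one>\<^sub>D \<otimes>\<^sub>D \<phi>) a = sw S (\<lambda>x y. \<phi> (\<epsilon> x \<odot>\<^sub>A y)) a"
   unfolding D_apply(3)[OF a] by (rule sw_cong[OF a]) (simp add: D_apply D_smult[OF p])
  then show "(\<one>\<^sub>D \<otimes>\<^sub>D \<phi>) a = \<phi> a" using sw_counit_left[OF D_additive[OF p] S_group a] by simp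
 qed (use p in auto)
 have distr: "(\<phi> \<oplus>\<^sub>D \<psi>) \<otimes>\<^sub>D \<chi> = \<phi> \<otimes>\<^sub>D \<chi> \<oplus>\<^sub>D \<psi> \<otimes>\<^sub>D \<chi>"
  if p: "\<phi> <: D" "\<psi> <: D" "\<chi> <: D" for \<phi> \<psi> \<chi>
 proof (rule D_eqI)
  fix a assume a: "a <: A"
  have "((\<phi> \<oplus>\<^sub>D \<psi>) \<otimes>\<^sub>D \<chi>) a = sw S (\<lambda>x y. \<phi> x \<otimes>\<^sub>S \<chi> y \<oplus>\<^sub>S \<psi> x \<otimes>\<^sub>S \<chi> y) a"
   unfolding D_apply(3)[OF a] by (rule sw_cong[OF a]) (simp add: p D_apply R.l_distr)
  also have "\<dots> = (\<phi> \<otimes>\<^sub>D \<chi>) a \<oplus>\<^sub>S (\<psi> \<otimes>\<^sub>D \<chi>) a"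
   unfolding D_apply(3)[OF a] by (rule sw_add[OF S_group a]) (use p in auto)
  finally show "((\<phi> \<oplus>\<^sub>D \<psi>) \<otimes>\<^sub>D \<chi>) a = (\<phi> \<otimes>\<^sub>D \<chi> \<oplus>\<^sub>D \<psi> \<otimes>\<^sub>D \<chi>) a" by (simp add: a D_apply)
 qed (use p in auto)
 have sm2: "(r \<odot>\<^sub>D \<phi>) \<otimes>\<^sub>D \<psi> = r \<odot>\<^sub>D (\<phi> \<otimes>\<^sub>D \<psi>)"
  if p: "\<phi> <: D" "\<psi> <: D" and r: "r <: S" for r \<phi> \<psi>
 proof (rule D_eqI)
  fix a assume a: "a <: A"
  have mS: "additive S S (\<lambda>s. r \<otimes>\<^sub>S s)" using r by (auto intro!: additive_mapI simp: R.r_distr)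
  have "((r \<odot>\<^sub>D \<phi>) \<otimes>\<^sub>D \<psi>) a = sw S (\<lambda>x y. r \<otimes>\<^sub>S (\<phi> x \<otimes>\<^sub>S \<psi> y)) a"
   unfolding D_apply(3)[OF a] by (rule sw_cong[OF a]) (simp add: p r D_apply R.m_assoc)
  also have "\<dots> = r \<otimes>\<^sub>S sw S (\<lambda>x y. \<phi> x \<otimes>\<^sub>S \<psi> y) a"
   by (rule sw_map[OF mS S_group S_group a, symmetric]) (use p in auto)
  finally show "((r \<odot>\<^sub>D \<phi>) \<otimes>\<^sub>D \<psi>) a = (r \<odot>\<^sub>D (\<phi> \<otimes>\<^sub>D \<psi>)) a" by (simp add: a D_apply)
 qed (use p r in auto)
 have "cring D"
  by (rule cringI[OF D.M.abelian_group_axioms comm_monoidI]) (auto simp: assoc one distr intro: comm)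
 then show ?thesis
  by (intro algebraI[OF R_cring])
   (auto simp: D.smult_l_distr D.smult_r_distr D.smult_assoc1 sm2)
qed

lemma D_module: "module S D" by (rule algebra_module[OF D_algebra])
lemma D_group: "abelian_group D" by (rule module_group[OF D_module])

lemma D_lsum: "set \<phi>s \<subseteq> carrier D ==> x <: A ==> lsum D \<phi>s x = lsum S (map (\<lambda>\<phi>. \<phi> x) \<phi>s)"
 by (induction \<phi>s) (simp_all add: D_apply)

text \<open>Functionals are distributions on the group, their product is convolution, and derivation along \<open>\<delta>\<close> is the transpose of convolution with \<open>\<delta>\<close>.\<close>

lemma D_deriv:
 assumes "\<phi> <: D" "\<delta> <: D" "b <: A"
 shows "\<phi> (deriv \<delta> b) = (\<phi> \<otimes>\<^sub>D \<delta>) b"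
proof -
 have "\<phi> (deriv \<delta> b) = sw S (\<lambda>x y. \<phi> (\<delta> y \<odot>\<^sub>A x)) b"
  unfolding deriv_def using assms by (intro sw_map[OF D_additive A_group S_group]) (auto simp: D_closed)
 also have "\<dots> = sw S (\<lambda>x y. \<phi> x \<otimes>\<^sub>S \<delta> y) b"
  using assms by (intro sw_cong) (auto simp: D_smult D_closed R.m_comm)
 finally show ?thesis using assms by (simp add: D_apply)
qed

end

subsection \<open>Dual bases\<close>

locale fp_hopf = hopf_alg S A for S :: "('s, 'e) ring_scheme" and A :: "('s, 'a) hopf" +
 assumes fp: "finite_projective S A"
begin

definition bs :: "('a \<times> ('a \<Rightarrow> 's)) list" where
 "bs = (SOME bs. set bs \<subseteq> carrier A \<times> carrier (lin_dual S A) \<and>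
   (\<forall>x\<in>carrier A. x = lsum A (map (\<lambda>(e, \<phi>). \<phi> x \<odot>\<^sub>A e) bs)))"

lemma bs_props: "set bs \<subseteq> carrier A \<times> carrier (lin_dual S A) \<and>
   (\<forall>x\<in>carrier A. x = lsum A (map (\<lambda>(e, \<phi>). \<phi> x \<odot>\<^sub>A e) bs))"
 unfolding bs_def by (rule someI_ex) (use fp in "simp add: finite_projective_def")

lemma bs_closed [simp]: "z \<in> set bs ==> fst z <: A" "z \<in> set bs ==> snd z <: D"
 using bs_props by (auto simp: D_simps)

lemma bs_pair_closed [simp]: "(e, \<phi>) \<in> set bs ==> e <: A" "(e, \<phi>) \<in> set bs ==> \<phi> <: D"
 using bs_closed[of "(e, \<phi>)"] by simp_all

lemma bs_expand: "x <: A ==> lsum A (map (\<lambda>z. snd z x \<odot>\<^sub>A fst z) bs) = x"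
 using bs_props by (simp add: case_prod_unfold)

lemma bs_apply_closed [simp]: "z \<in> set bs ==> x <: A ==> snd z x <: S"
 by (rule D_closed) auto

lemma linear_expand:
 assumes W: "module S W" and L: "linear_map S A W L" and x: "x <: A"
 shows "L x = lsum W (map (\<lambda>z. snd z x \<odot>\<^sub>W L (fst z)) bs)"
proof -
 have "L x = L (lsum A (map (\<lambda>z. snd z x \<odot>\<^sub>A fst z) bs))" by (simp add: bs_expand x)
 also have "\<dots> = lsum W (map (\<lambda>z. L (snd z x \<odot>\<^sub>A fst z)) bs)"
  by (rule additive_lsum_map[OF lin_additive[OF L] A_group module_group[OF W]]) (simp add: x)
 also have "\<dots> = lsum W (map (\<lambda>z. snd z x \<odot>\<^sub>W L (fst z)) bs)"
  by (rule lsum_cong) (simp add: lin_smult[OF L] x)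
 finally show ?thesis .
qed

lemma D_separates:
 assumes "a <: A" "a' <: A" "\<And>\<phi>. \<phi> <: D ==> \<phi> a = \<phi> a'"
 shows "a = a'"
proof -
 have "lsum A (map (\<lambda>z. snd z a \<odot>\<^sub>A fst z) bs) = lsum A (map (\<lambda>z. snd z a' \<odot>\<^sub>A fst z) bs)"
  by (rule lsum_cong) (simp add: assms(3))
 then show ?thesis using assms(1,2) by (simp add: bs_expand)
qed

lemma D_expand:
 assumes \<psi>: "\<psi> <: D" shows "lsum D (map (\<lambda>z. \<psi> (fst z) \<odot>\<^sub>D snd z) bs) = \<psi>"
proof (rule D_eqI[OF _ \<psi>])
 interpret D: module S D by (rule D_module)
 have cl: "set (map (\<lambda>z. \<psi> (fst z) \<odot>\<^sub>D snd z) bs) \<subseteq> carrier D" using \<psi> by (auto simp: D_closed)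
 then show "lsum D (map (\<lambda>z. \<psi> (fst z) \<odot>\<^sub>D snd z) bs) <: D" by (rule D.M.lsum_closed)
 fix x assume x: "x <: A"
 have "lsum D (map (\<lambda>z. \<psi> (fst z) \<odot>\<^sub>D snd z) bs) x = lsum S (map (\<lambda>z. \<psi> (fst z) \<otimes>\<^sub>S snd z x) bs)"
  by (simp only: D_lsum[OF cl x] map_map comp_def D_apply(2)[OF x])
 also have "\<dots> = lsum (ring_module S) (map (\<lambda>z. snd z x \<odot>\<^bsub>ring_module S\<^esub> \<psi> (fst z)) bs)"
  unfolding lsum_ring_module by (rule lsum_cong) (simp add: D_closed[OF \<psi>] x R.m_comm)
 also have "\<dots> = \<psi> x" by (rule linear_expand[OF S_module D_linear[OF \<psi>] x, symmetric])
 finally show "lsum D (map (\<lambda>z. \<psi> (fst z) \<odot>\<^sub>D snd z) bs) x = \<psi> x" .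
qed

text \<open>The double dual of a finitely generated projective module: \<open>a\<close> is the sum of the \<open>e\<^sub>i\<close> with coefficients \<open>g \<phi>\<^sub>i\<close>.\<close>

lemma D_reflexive:
 assumes g: "linear_map S D (ring_module S) g"
 obtains a where "a <: A" "\<And>\<phi>. \<phi> <: D ==> \<phi> a = g \<phi>"
proof
 have gcl: "g \<phi> <: S" if "\<phi> <: D" for \<phi> using lin_closed[OF g that] by simp
 have gadd: "additive D S g" using lin_additive[OF g] by (simp add: additive_def)
 let ?a = "lsum A (map (\<lambda>z. g (snd z) \<odot>\<^sub>A fst z) bs)"
 show "?a <: A" by (rule M.lsum_map_closed) (simp add: gcl)
 fix \<phi> assume \<phi>: "\<phi> <: D"
 interpret D: module S D by (rule D_module)
 have "\<phi> ?a = lsum S (map (\<lambda>z. \<phi> (g (snd z) \<odot>\<^sub>A fst z)) bs)"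
  by (rule additive_lsum_map[OF D_additive[OF \<phi>] A_group S_group]) (simp add: gcl)
 also have "\<dots> = lsum S (map (\<lambda>z. g (\<phi> (fst z) \<odot>\<^sub>D snd z)) bs)"
  by (rule lsum_cong) (simp add: gcl D_smult[OF \<phi>] lin_smult[OF g] D_closed[OF \<phi>] R.m_comm)
 also have "\<dots> = g (lsum D (map (\<lambda>z. \<phi> (fst z) \<odot>\<^sub>D snd z) bs))"
  by (rule additive_lsum_map[OF gadd D_group S_group, symmetric]) (simp add: D_closed[OF \<phi>])
 finally show "\<phi> ?a = g \<phi>" by (simp add: D_expand[OF \<phi>])
qed

subsection \<open>The universal character\<close>

definition contr where
 "contr N \<phi> = fs_lift N (\<lambda>(a, n). \<phi> a \<odot>\<^sub>N n)"

lemma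
 assumes N: "module S N" and \<phi>: "\<phi> <: D"
 shows contr_additive: "additive (tensor S A N) N (contr N \<phi>)"
  and contr_pure: "\<And>a n. a <: A ==> n <: N ==> contr N \<phi> (pure S A N a n) = \<phi> a \<odot>\<^sub>N n"
proof -
 note b = bilinear_balanced[OF bilinear_compose[OF smult_bilinear[OF N] D_linear[OF \<phi>] linear_id]]
 show "additive (tensor S A N) N (contr N \<phi>)"
  unfolding contr_def by (rule tensor_lift_additive[OF A_group module_group[OF N] module_group[OF N] b])
 show "contr N \<phi> (pure S A N a n) = \<phi> a \<odot>\<^sub>N n" if "a <: A" "n <: N" for a n
  unfolding contr_def by (rule tensor_lift_pure[OF A_group module_group[OF N] module_group[OF N] b that])
qed

lemma tensor_expand:
 assumes N: "module S N" and t: "t <: tensor S A N"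
 shows "lsum (tensor S A N) (map (\<lambda>z. pure S A N (fst z) (contr N (snd z) t)) bs) = t"
proof -
 note Ng = module_group[OF N] and pb = pure_bilinear[OF A_module N]
 note T = tensor_group[OF A_group Ng, of S]
 have 1: "additive (tensor S A N) (tensor S A N) (\<lambda>t. lsum (tensor S A N) (map (\<lambda>z. pure S A N (fst z) (contr N (snd z) t)) bs))"
  by (intro additive_lsum_fun T additive_comp[OF contr_additive[OF N]] lin_additive[OF bilinearD(1)[OF pb]]) auto
 show ?thesis
 proof (rule tensor_map_eqI[OF 1 lin_additive[OF linear_id[of S]] A_group Ng T _ t])
  fix a n assume a: "a <: A" and n: "n <: N"
  have "pure S A N a n = pure S A N (lsum A (map (\<lambda>z. snd z a \<odot>\<^sub>A fst z) bs)) n" by (simp add: bs_expand a)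
  also have "\<dots> = lsum (tensor S A N) (map (\<lambda>z. pure S A N (snd z a \<odot>\<^sub>A fst z) n) bs)"
   by (rule additive_lsum_map[OF lin_additive[OF bilinearD(2)[OF pb n]] A_group T]) (simp add: a)
  also have "\<dots> = lsum (tensor S A N) (map (\<lambda>z. pure S A N (fst z) (contr N (snd z) (pure S A N a n))) bs)"
   by (rule lsum_cong) (simp add: contr_pure[OF N] a n balancedD(3)[OF bilinear_balanced[OF pb]])
  finally show "lsum (tensor S A N) (map (\<lambda>z. pure S A N (fst z) (contr N (snd z) (pure S A N a n))) bs) = pure S A N a n"
   by simp
 qed
qed

text \<open>The condition defining the universal character says that it is the canonical element of \<open>A \<otimes> Hom(A, S)\<close>, which any dual basis computes.\<close>

lemma pairing_unit_eq: "pairing_unit S A = tclass S A D bs"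
proof -
 have cl: "set bs \<subseteq> carrier A \<times> carrier D" using bs_props by (simp add: D_simps)
 have bsum: "tclass S A D bs = lsum (tensor S A D) (map (\<lambda>z. pure S A D (fst z) (snd z)) bs)"
  using tclass_eq_lsum[OF cl, of S] by (simp add: case_prod_unfold)
 note T = tensor_group[OF A_group D_group, of S]
 show ?thesis unfolding pairing_unit_def contr_def[symmetric]
 proof (rule the_equality)
  show "tclass S A D bs <: tensor S A D \<and> (\<forall>\<phi>\<in>carrier D. contr D \<phi> (tclass S A D bs) = \<phi>)"
  proof (intro conjI ballI tclass_closed[OF cl])
   fix \<phi> assume \<phi>: "\<phi> <: D"
   have "contr D \<phi> (tclass S A D bs) = lsum D (map (\<lambda>z. contr D \<phi> (pure S A D (fst z) (snd z))) bs)"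
    unfolding bsum
    by (rule additive_lsum_map[OF contr_additive[OF D_module \<phi>] T D_group]) (auto intro!: tclass_closed)
   also have "\<dots> = lsum D (map (\<lambda>z. \<phi> (fst z) \<odot>\<^sub>D snd z) bs)"
    by (rule lsum_cong, rule contr_pure[OF D_module \<phi>]) simp_all
   finally show "contr D \<phi> (tclass S A D bs) = \<phi>" by (simp add: D_expand[OF \<phi>])
  qed
 next
  fix t assume t: "t <: tensor S A D \<and> (\<forall>\<phi>\<in>carrier D. contr D \<phi> t = \<phi>)"
  have "t = lsum (tensor S A D) (map (\<lambda>z. pure S A D (fst z) (contr D (snd z) t)) bs)"
   using t tensor_expand[OF D_module, of t] by simp
  also have "\<dots> = tclass S A D bs"
   unfolding bsum by (rule lsum_cong) (simp add: t)
  finally show "t = tclass S A D bs" .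
 qed
qed

end

text \<open>
 For an algebra \<open>B\<close> with a point \<open>j\<close> of the dual, linear maps \<open>L : A \<rightarrow> W\<close> give elements
 \<open>\<Sum> L(e\<^sub>i) \<otimes> j(\<phi>\<^sub>i)\<close> of \<open>W \<otimes> B\<close>, and products of such elements correspond to convolution.  The
 universal character is the element of the identity, so its inverse is that of the antipode, and
 \<open>\<kappa>\<^sup>-\<^sup>1 d\<kappa>\<close> is the element of \<open>b \<mapsto> \<Sum> \<sigma>(b\<^sub>1) db\<^sub>2\<close>.
\<close>

locale dual_point = fp_hopf S A for S :: "('s, 'e) ring_scheme" and A :: "('s, 'a) hopf" +
 fixes B :: "('s, 'b, 'z) module_scheme" and j :: "('a \<Rightarrow> 's) \<Rightarrow> 'b"
 assumes B: "algebra S B" and j_hom: "j \<in> ring_hom D B" and j_linear: "linear_map S D B j"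
begin

lemma B_module: "module S B" by (rule algebra_module[OF B])
lemma B_group: "abelian_group B" by (rule module_group[OF B_module])
lemma j_closed [simp]: "\<phi> <: D ==> j \<phi> <: B" by (rule ring_hom_closed[OF j_hom])

definition copair where
 "copair W L = lsum (tensor S W B) (map (\<lambda>z. pure S W B (L (fst z)) (j (snd z))) bs)"

lemma copair_closed:
 assumes W: "module S W" and L: "\<And>a. a <: A ==> L a <: W"
 shows "copair W L <: tensor S W B"
proof -
 interpret T: abelian_group "tensor S W B" by (rule tensor_group[OF module_group[OF W] B_group])
 show ?thesis unfolding copair_def by (rule T.lsum_map_closed) (auto intro!: tclass_closed L)
qed

lemma copair_cong: "(\<And>a. a <: A ==> L a = L' a) ==> copair W L = copair W L'"
 unfolding copair_def by (rule lsum_cong) simp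

lemma copair_rank_one:
 assumes W: "module S W" and \<psi>: "\<psi> <: D" and w: "w <: W"
 shows "copair W (\<lambda>a. \<psi> a \<odot>\<^sub>W w) = pure S W B w (j \<psi>)"
proof -
 interpret D: module S D by (rule D_module)
 note pb = pure_bilinear[OF W B_module]
 note T = tensor_group[OF module_group[OF W] B_group, of S]
 have "copair W (\<lambda>a. \<psi> a \<odot>\<^sub>W w) = lsum (tensor S W B) (map (\<lambda>z. pure S W B w (j (\<psi> (fst z) \<odot>\<^sub>D snd z))) bs)"
  unfolding copair_def
  by (rule lsum_cong) (simp add: balancedD(3)[OF bilinear_balanced[OF pb]] D_closed[OF \<psi>] w lin_smult[OF j_linear])
 also have "\<dots> = pure S W B w (j (lsum D (map (\<lambda>z. \<psi> (fst z) \<odot>\<^sub>D snd z) bs)))"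
  by (rule additive_lsum_map[OF additive_comp[OF lin_additive[OF j_linear] lin_additive[OF bilinearD(1)[OF pb w]]] D_group T, symmetric])
   (simp add: D_closed[OF \<psi>])
 finally show ?thesis by (simp add: D_expand[OF \<psi>])
qed

lemma copair_lsum:
 assumes W: "module S W" and L: "\<And>z a. z \<in> set zs ==> a <: A ==> L z a <: W"
 shows "copair W (\<lambda>a. lsum W (map (\<lambda>z. L z a) zs)) = lsum (tensor S W B) (map (\<lambda>z. copair W (L z)) zs)"
proof -
 note pb = pure_bilinear[OF W B_module]
 interpret T: abelian_group "tensor S W B" by (rule tensor_group[OF module_group[OF W] B_group])
 have "copair W (\<lambda>a. lsum W (map (\<lambda>z. L z a) zs))
   = lsum (tensor S W B) (map (\<lambda>b. lsum (tensor S W B) (map (\<lambda>z. pure S W B (L z (fst b)) (j (snd b))) zs)) bs)"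
  unfolding copair_def
  by (rule lsum_cong, rule additive_lsum_map[OF lin_additive[OF bilinearD(2)[OF pb]] module_group[OF W] T.abelian_group_axioms])
   (simp_all add: L)
 also have "\<dots> = lsum (tensor S W B) (map (\<lambda>z. copair W (L z)) zs)"
  unfolding copair_def by (rule T.lsum_swap) (auto intro!: tclass_closed L)
 finally show ?thesis .
qed

lemma sw_expand:
 assumes U: "module S U" and W: "module S W" and Z: "module S Z" and opn: "bilinear S U W Z opn"
  and f: "linear_map S A U f" and L: "linear_map S A W L" and a: "a <: A"
 shows "sw Z (\<lambda>x y. opn (f x) (L y)) a
  = lsum Z (map (\<lambda>z. lsum Z (map (\<lambda>z'. (snd z \<otimes>\<^sub>D snd z') a \<odot>\<^sub>Z opn (f (fst z)) (L (fst z'))) bs)) bs)"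
proof -
 interpret Z: module S Z by fact
 interpret U: module S U by fact
 interpret W: module S W by fact
 note fc = lin_closed[OF f] and Lc = lin_closed[OF L] and oc = bilinear_closed[OF opn]
 have zc [simp]: "opn (f (fst z)) (L (fst z')) <: Z" if "z \<in> set bs" "z' \<in> set bs" for z z'
  using that by (auto intro!: oc fc Lc)
 have exp: "opn (f x) (L y) = lsum Z (map (\<lambda>z. lsum Z (map (\<lambda>z'. (snd z x \<otimes>\<^sub>S snd z' y) \<odot>\<^sub>Z opn (f (fst z)) (L (fst z'))) bs)) bs)"
  if x: "x <: A" and y: "y <: A" for x y
 proof -
  have "opn (f x) (L y) = opn (lsum U (map (\<lambda>z. snd z x \<odot>\<^sub>U f (fst z)) bs)) (L y)"
   using linear_expand[OF U f x] by simp
  also have "\<dots> = lsum Z (map (\<lambda>z. opn (snd z x \<odot>\<^sub>U f (fst z)) (L y)) bs)"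
   by (rule additive_lsum_map[OF lin_additive[OF bilinearD(2)[OF opn Lc[OF y]]] U.M.abelian_group_axioms Z.M.abelian_group_axioms])
    (simp add: x fc)
  also have "\<dots> = lsum Z (map (\<lambda>z. lsum Z (map (\<lambda>z'. (snd z x \<otimes>\<^sub>S snd z' y) \<odot>\<^sub>Z opn (f (fst z)) (L (fst z'))) bs)) bs)"
  proof (rule lsum_cong)
   fix z assume z: "z \<in> set bs"
   have c: "snd z x \<odot>\<^sub>U f (fst z) <: U" using z x by (simp add: fc)
   have "opn (snd z x \<odot>\<^sub>U f (fst z)) (L y) = opn (snd z x \<odot>\<^sub>U f (fst z)) (lsum W (map (\<lambda>z'. snd z' y \<odot>\<^sub>W L (fst z')) bs))"
    using linear_expand[OF W L y] by simp
   also have "\<dots> = lsum Z (map (\<lambda>z'. opn (snd z x \<odot>\<^sub>U f (fst z)) (snd z' y \<odot>\<^sub>W L (fst z'))) bs)"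
    by (rule additive_lsum_map[OF lin_additive[OF bilinearD(1)[OF opn c]] W.M.abelian_group_axioms Z.M.abelian_group_axioms])
     (simp add: y Lc)
   also have "\<dots> = lsum Z (map (\<lambda>z'. (snd z x \<otimes>\<^sub>S snd z' y) \<odot>\<^sub>Z opn (f (fst z)) (L (fst z'))) bs)"
    by (rule lsum_cong) (simp add: bilinear_smult[OF opn] z x y fc Lc Z.smult_assoc1[symmetric] R.m_comm)
   finally show "opn (snd z x \<odot>\<^sub>U f (fst z)) (L y)
    = lsum Z (map (\<lambda>z'. (snd z x \<otimes>\<^sub>S snd z' y) \<odot>\<^sub>Z opn (f (fst z)) (L (fst z'))) bs)" .
  qed
  finally show ?thesis .
 qed
 have sw_lsum: "sw Z (\<lambda>x y. lsum Z (map (\<lambda>z. \<beta> z x y) zs)) a = lsum Z (map (\<lambda>z. sw Z (\<beta> z) a) zs)"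
  if "\<And>z x y. z \<in> set zs ==> x <: A ==> y <: A ==> \<beta> z x y <: Z"
  for \<beta> :: "('a \<times> ('a \<Rightarrow> 's)) \<Rightarrow> _" and zs
  using Z.M.lsum_swap[of "rep (\<Delta> a)" zs "\<lambda>u z. \<beta> z (fst u) (snd u)"] that a comult_rep[OF a]
  by (force simp: sweedler_lsum case_prod_unfold)
 have "sw Z (\<lambda>x y. opn (f x) (L y)) a = sw Z (\<lambda>x y. lsum Z (map (\<lambda>z. lsum Z (map (\<lambda>z'. (snd z x \<otimes>\<^sub>S snd z' y) \<odot>\<^sub>Z opn (f (fst z)) (L (fst z'))) bs)) bs)) a"
  by (rule sw_cong[OF a exp])
 also have "\<dots> = lsum Z (map (\<lambda>z. sw Z (\<lambda>x y. lsum Z (map (\<lambda>z'. (snd z x \<otimes>\<^sub>S snd z' y) \<odot>\<^sub>Z opn (f (fst z)) (L (fst z'))) bs)) a) bs)"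
  by (rule sw_lsum) (intro Z.M.lsum_map_closed Z.smult_closed R.m_closed D_closed bs_closed zc; assumption)
 also have "\<dots> = lsum Z (map (\<lambda>z. lsum Z (map (\<lambda>z'. sw Z (\<lambda>x y. (snd z x \<otimes>\<^sub>S snd z' y) \<odot>\<^sub>Z opn (f (fst z)) (L (fst z'))) a) bs)) bs)"
  by (rule lsum_cong, rule sw_lsum) simp
 also have "\<dots> = lsum Z (map (\<lambda>z. lsum Z (map (\<lambda>z'. (snd z \<otimes>\<^sub>D snd z') a \<odot>\<^sub>Z opn (f (fst z)) (L (fst z'))) bs)) bs)"
 proof (rule lsum_cong, rule lsum_cong)
  fix z z' assume z: "z \<in> set bs" "z' \<in> set bs"
  have sc: "additive S Z (\<lambda>r. r \<odot>\<^sub>Z opn (f (fst z)) (L (fst z')))"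
   using lin_additive[OF linear_smult_left[OF Z zc[OF z]]] by (simp add: additive_def)
  show "sw Z (\<lambda>x y. (snd z x \<otimes>\<^sub>S snd z' y) \<odot>\<^sub>Z opn (f (fst z)) (L (fst z'))) a
    = (snd z \<otimes>\<^sub>D snd z') a \<odot>\<^sub>Z opn (f (fst z)) (L (fst z'))"
   unfolding D_apply(3)[OF a]
   by (rule sw_map[OF sc S_group Z.M.abelian_group_axioms a, symmetric]) (simp add: z)
 qed
 finally show ?thesis .
qed

lemma copair_prod:
 assumes U: "module S U" and W: "module S W" and Z: "module S Z" and opn: "bilinear S U W Z opn"
  and f: "linear_map S A U f" and L: "linear_map S A W L"
 shows "tensor_prod S Z B opn (mult B) (copair U f) (copair W L) = copair Z (\<lambda>a. sw Z (\<lambda>x y. opn (f x) (L y)) a)"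
proof -
 interpret Z: module S Z by fact
 interpret D: algebra S D by (rule D_algebra)
 note fc = lin_closed[OF f] and Lc = lin_closed[OF L] and oc = bilinear_closed[OF opn]
 note mods = U B_module W B_module Z B_module opn algebra_mult_bilinear[OF B]
 note TU = tensor_group[OF module_group[OF U] B_group, of S]
  and TW = tensor_group[OF module_group[OF W] B_group, of S]
  and TZ = tensor_group[OF module_group[OF Z] B_group, of S]
 let ?T = "tensor S Z B" and ?p = "tensor_prod S Z B opn (mult B)"
 note cW = copair_closed[OF W Lc]
 have zc [simp]: "opn (f (fst z)) (L (fst z')) <: Z" if "z \<in> set bs" "z' \<in> set bs" for z z'
  using that by (auto intro!: oc fc Lc)
 have "?p (copair U f) (copair W L) = lsum ?T (map (\<lambda>z. ?p (pure S U B (f (fst z)) (j (snd z))) (copair W L)) bs)"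
  unfolding copair_def[of U]
  by (rule additive_lsum_map[OF tensor_prod_additive_left[OF mods cW] TU TZ]) (auto intro!: tclass_closed fc)
 also have "\<dots> = lsum ?T (map (\<lambda>z. lsum ?T (map (\<lambda>z'. pure S Z B (opn (f (fst z)) (L (fst z'))) (j (snd z \<otimes>\<^sub>D snd z'))) bs)) bs)"
 proof (rule lsum_cong)
  fix z assume z: "z \<in> set bs"
  have c: "pure S U B (f (fst z)) (j (snd z)) <: tensor S U B" using z by (auto intro!: tclass_closed fc)
  have "?p (pure S U B (f (fst z)) (j (snd z))) (copair W L)
   = lsum ?T (map (\<lambda>z'. ?p (pure S U B (f (fst z)) (j (snd z))) (pure S W B (L (fst z')) (j (snd z')))) bs)"
   unfolding copair_def
   by (rule additive_lsum_map[OF tensor_prod_additive_right[OF mods c] TW TZ]) (auto intro!: tclass_closed Lc)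
  also have "\<dots> = lsum ?T (map (\<lambda>z'. pure S Z B (opn (f (fst z)) (L (fst z'))) (j (snd z \<otimes>\<^sub>D snd z'))) bs)"
   by (rule lsum_cong) (simp add: tensor_prod_pure[OF mods] z fc Lc ring_hom_mult[OF j_hom])
  finally show "?p (pure S U B (f (fst z)) (j (snd z))) (copair W L)
   = lsum ?T (map (\<lambda>z'. pure S Z B (opn (f (fst z)) (L (fst z'))) (j (snd z \<otimes>\<^sub>D snd z'))) bs)" .
 qed
 also have "\<dots> = lsum ?T (map (\<lambda>z. lsum ?T (map (\<lambda>z'. copair Z (\<lambda>a. (snd z \<otimes>\<^sub>D snd z') a \<odot>\<^sub>Z opn (f (fst z)) (L (fst z')))) bs)) bs)"
  by (rule lsum_cong, rule lsum_cong) (simp add: copair_rank_one[OF Z])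
 also have "\<dots> = lsum ?T (map (\<lambda>z. copair Z (\<lambda>a. lsum Z (map (\<lambda>z'. (snd z \<otimes>\<^sub>D snd z') a \<odot>\<^sub>Z opn (f (fst z)) (L (fst z'))) bs))) bs)"
  by (rule lsum_cong, rule copair_lsum[OF Z, symmetric]) (simp add: D_closed)
 also have "\<dots> = copair Z (\<lambda>a. lsum Z (map (\<lambda>z. lsum Z (map (\<lambda>z'. (snd z \<otimes>\<^sub>D snd z') a \<odot>\<^sub>Z opn (f (fst z)) (L (fst z'))) bs)) bs))"
  by (rule copair_lsum[OF Z, symmetric])
   (intro Z.M.lsum_map_closed Z.smult_closed D_closed D.m_closed bs_closed zc; assumption)
 also have "\<dots> = copair Z (\<lambda>a. sw Z (\<lambda>x y. opn (f x) (L y)) a)"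
  by (rule copair_cong, rule sw_expand[OF U W Z opn f L, symmetric])
 finally show ?thesis .
qed

lemma copair_lift:
 assumes W: "module S W" and P: "abelian_group P" and \<beta>: "balanced S W B P \<beta>"
  and L: "\<And>a. a <: A ==> L a <: W"
 shows "fs_lift P (\<lambda>(w, b). \<beta> w b) (copair W L) = lsum P (map (\<lambda>z. \<beta> (L (fst z)) (j (snd z))) bs)"
proof -
 note Wg = module_group[OF W]
 have "fs_lift P (\<lambda>(w, b). \<beta> w b) (copair W L)
  = lsum P (map (\<lambda>z. fs_lift P (\<lambda>(w, b). \<beta> w b) (pure S W B (L (fst z)) (j (snd z)))) bs)"
  unfolding copair_def
  by (rule additive_lsum_map[OF tensor_lift_additive[OF Wg B_group P \<beta>] tensor_group[OF Wg B_group] P])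
   (auto intro!: tclass_closed L)
 also have "\<dots> = lsum P (map (\<lambda>z. \<beta> (L (fst z)) (j (snd z))) bs)"
  by (rule lsum_cong) (simp add: tensor_lift_pure[OF Wg B_group P \<beta>] L)
 finally show ?thesis .
qed

definition \<kappa> where
 "\<kappa> = fs_lift (tensor S A B) (\<lambda>(a, \<phi>). pure S A B a (j \<phi>)) (pairing_unit S A)"

lemma \<kappa>_eq: "\<kappa> = copair A (\<lambda>a. a)"
proof -
 have cl: "set bs \<subseteq> carrier A \<times> carrier D" using bs_props by (simp add: D_simps)
 have "balanced S A D (tensor S A B) (\<lambda>a \<phi>. pure S A B a (j \<phi>))"
  by (rule bilinear_balanced[OF bilinear_compose[OF pure_bilinear[OF A_module B_module] linear_id j_linear]])
 from tensor_lift[OF A_group D_group tensor_group[OF A_group B_group] this cl]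
 show ?thesis by (simp add: \<kappa>_def pairing_unit_eq copair_def case_prod_unfold)
qed

text \<open>
 That \<open>b \<mapsto> \<Sum> \<sigma>(b\<^sub>1) db\<^sub>2\<close> gives a solution is the formula \<open>\<Sum> b\<^sub>1 \<theta>(b\<^sub>2) = db\<close>, as products are convolutions; it is the only one
 because the element of the antipode is an inverse of \<open>\<kappa>\<close>.
\<close>

lemma log_derivative_unique:
 "t <: tensor S \<Omega> B \<and> rel_act S A B \<kappa> t = rel_d S A B \<kappa> \<longleftrightarrow> t = copair \<Omega> \<theta>"
proof -
 note Wm = kahler_module
 have \<kappa>cl: "\<kappa> <: tensor S A B" unfolding \<kappa>_eq by (rule copair_closed[OF A_module])
 have scl: "copair A \<sigma> <: tensor S A B" by (rule copair_closed[OF A_module]) auto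
 have \<theta>cl: "copair \<Omega> \<theta> <: tensor S \<Omega> B" by (rule copair_closed[OF Wm]) auto
 have "rel_act S A B \<kappa> (copair \<Omega> \<theta>) = copair \<Omega> (\<lambda>a. sw \<Omega> (\<lambda>x y. act x (\<theta> y)) a)"
  unfolding rel_act_eq \<kappa>_eq by (rule copair_prod[OF A_module Wm Wm act_bilinear linear_id \<theta>_linear])
 also have "\<dots> = copair \<Omega> d" by (rule copair_cong) (rule d_via_\<theta>)
 also have "\<dots> = rel_d S A B \<kappa>"
 proof -
  have "rel_d S A B \<kappa> = lsum (tensor S \<Omega> B) (map (\<lambda>z. rel_d S A B (pure S A B (fst z) (j (snd z)))) bs)"
   unfolding \<kappa>_eq copair_def
   by (rule additive_lsum_map[OF rel_d_additive[OF B] tensor_group[OF A_group B_group]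
      tensor_group[OF kahler_group B_group]]) (auto intro!: tclass_closed)
  also have "\<dots> = copair \<Omega> d" unfolding copair_def by (rule lsum_cong) (simp add: rel_d_pure[OF B])
  finally show ?thesis by simp
 qed
 finally have ex: "rel_act S A B \<kappa> (copair \<Omega> \<theta>) = rel_d S A B \<kappa>" .
 have "copair A \<sigma> \<otimes>\<^bsub>tensor S A B\<^esub> \<kappa> = copair A (\<lambda>a. sw A (\<lambda>x y. \<sigma> x \<otimes>\<^sub>A y) a)"
  unfolding tensor_mult_eq \<kappa>_eq by (rule copair_prod[OF A_module A_module A_module mult_bilinear antipode_linear linear_id])
 also have "\<dots> = copair A (\<lambda>a. \<one>\<^sub>D a \<odot>\<^sub>A \<one>\<^sub>A)"
  by (rule copair_cong) (simp add: sw_antipode_left D_apply)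
 also have "\<dots> = pure S A B \<one>\<^sub>A (j \<one>\<^sub>D)"
 proof (rule copair_rank_one[OF A_module])
  interpret D: algebra S D by (rule D_algebra)
  show "\<one>\<^sub>D <: D" by (rule D.one_closed)
 qed simp
 finally have inv: "copair A \<sigma> \<otimes>\<^bsub>tensor S A B\<^esub> \<kappa> = pure S A B \<one>\<^sub>A \<one>\<^sub>B"
  by (simp add: ring_hom_one[OF j_hom])
 have cancel: "rel_act S A B (copair A \<sigma>) (rel_act S A B \<kappa> t) = t" if t: "t <: tensor S \<Omega> B" for t
  using rel_act_assoc[OF B scl \<kappa>cl t] rel_act_one[OF B t] by (simp add: inv)
 show ?thesis
 proof
  assume t: "t <: tensor S \<Omega> B \<and> rel_act S A B \<kappa> t = rel_d S A B \<kappa>"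
  have "t = rel_act S A B (copair A \<sigma>) (rel_act S A B \<kappa> t)" by (rule cancel[symmetric]) (use t in simp)
  also have "\<dots> = rel_act S A B (copair A \<sigma>) (rel_act S A B \<kappa> (copair \<Omega> \<theta>))" using t ex by simp
  also have "\<dots> = copair \<Omega> \<theta>" by (rule cancel[OF \<theta>cl])
  finally show "t = copair \<Omega> \<theta>" .
 qed (use ex \<theta>cl in auto)
qed

end

section \<open>Limits and colimits\<close>

lemma additive_add_pow:
 fixes n :: nat
 assumes f: "additive G H f" "abelian_group G" "abelian_group H" and x: "x <: G"
 shows "f ([n] \<cdot>\<^sub>G x) = [n] \<cdot>\<^sub>H f x"
proof -
 interpret G: abelian_group G by fact
 interpret H: abelian_group H by fact
 show ?thesis using x
  by (induction n) (simp_all add: additive_zero[OF f] additive_add[OF f(1)] additive_closed[OF f(1)])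
qed

lemma (in module) add_pow_smult:
 fixes n :: nat
 assumes "x <: M" shows "[n] \<cdot>\<^sub>M x = ([n] \<cdot>\<^sub>R \<one>\<^sub>R) \<odot>\<^sub>M x"
 using assms by (induction n) (simp_all add: smult_l_distr)

text \<open>Lift one transition map at a time upwards from the given stage, and apply the transition maps downwards.\<close>

lemma tower_lift:
 assumes "\<And>k. f k ` C (Suc k) = C k" and "c \<in> C k0"
 shows "\<exists>x. (\<forall>k. x k \<in> C k \<and> f k (x (Suc k)) = x k) \<and> x k0 = c"
 using assms
proof (induction k0 arbitrary: f C)
 case 0
 have "\<exists>x. x 0 = c \<and> (\<forall>k. x k \<in> C k \<and> f k (x (Suc k)) = x k)"
 proof -
  have "\<exists>x. \<forall>k. (x k \<in> C k \<and> (k = 0 \<longrightarrow> x k = c)) \<and> f k (x (Suc k)) = x k"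
  proof (rule dependent_nat_choice)
   show "\<exists>x. x \<in> C 0 \<and> (0 = (0::nat) \<longrightarrow> x = c)" using 0(2) by auto
   fix x k assume "x \<in> C k \<and> (k = 0 \<longrightarrow> x = c)"
   then have "x \<in> f k ` C (Suc k)" using 0(1) by simp
   then show "\<exists>y. (y \<in> C (Suc k) \<and> (Suc k = 0 \<longrightarrow> y = c)) \<and> f k y = x" by auto
  qed
  then show ?thesis by blast
 qed
 then show ?case by blast
next
 case (Suc k0)
 have "\<exists>x. (\<forall>k. x k \<in> C (Suc k) \<and> f (Suc k) (x (Suc k)) = x k) \<and> x k0 = c"
  using Suc.prems by (intro Suc.IH) auto
 then obtain x where x: "\<And>k. x k \<in> C (Suc k)" "\<And>k. f (Suc k) (x (Suc k)) = x k" "x k0 = c" by blast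
 define y where "y k = (case k of 0 \<Rightarrow> f 0 (x 0) | Suc k \<Rightarrow> x k)" for k
 have "f 0 (x 0) \<in> C 0" using x(1)[of 0] Suc.prems(1)[of 0] by blast
 then have "y k \<in> C k \<and> f k (y (Suc k)) = y k" for k
  using x by (cases k) (auto simp: y_def)
 moreover have "y (Suc k0) = c" using x(3) by (simp add: y_def)
 ultimately show ?case by blast
qed

text \<open>
 Division by \<open>p\<^sup>k\<close> in a complete filtered group: if \<open>F\<^sub>i\<close> consists of multiples of \<open>p\<^sup>i\<close> modulo \<open>F\<^bsub>i+1\<^esub>\<close>,
 successive approximation shows that it consists of multiples of \<open>p\<^sup>i\<close>.
\<close>

lemma p_adic_division:
 fixes G :: "('a, 'e) ring_scheme" (structure) and p :: nat
 assumes G: "abelian_group G"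
  and F_sub: "\<And>i. F i \<subseteq> carrier G" and F_zero: "\<And>i. \<zero> \<in> F i"
  and F_add: "\<And>i x y. x \<in> F i ==> y \<in> F i ==> x \<oplus> y \<in> F i"
  and F_diff: "\<And>i x y. x \<in> F i ==> y \<in> F i ==> x \<ominus> y \<in> F i"
  and F_mono: "\<And>i. F (Suc i) \<subseteq> F i"
  and F_sep: "\<And>x. (\<And>i. x \<in> F i) ==> x = \<zero>"
  and F_p: "\<And>i x. x <: G ==> [(p ^ i)] \<cdot> x \<in> F i"
  and F_complete: "\<And>s. (\<And>m. s m <: G) ==> (\<And>m. s (Suc m) \<ominus> s m \<in> F m) ==>
    \<exists>t\<in>carrier G. \<forall>m. t \<ominus> s m \<in> F m"
  and F_approx: "\<And>i g. k \<le> i ==> g \<in> F i ==> \<exists>x\<in>carrier G. g \<ominus> [(p ^ i)] \<cdot> x \<in> F (Suc i)"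
  and g: "g \<in> F k"
 shows "\<exists>h\<in>carrier G. g = [(p ^ k)] \<cdot> h"
proof -
 interpret abelian_group G by fact
 have gG: "g <: G" using g F_sub by auto
 have F_antimono: "F j \<subseteq> F i" if "i \<le> j" for i j
  using that by (induction rule: dec_induct) (use F_mono in auto)
 have F_mult: "[n] \<cdot> x \<in> F i" if "x \<in> F i" for n :: nat and x i
  using that by (induction n) (auto simp: F_zero F_add)
 have "\<exists>s. \<forall>m. (s m <: G \<and> g \<ominus> [(p ^ k)] \<cdot> s m \<in> F (k + m)) \<and> s (Suc m) \<ominus> s m \<in> F m"
 proof (rule dependent_nat_choice)
  have "\<ominus> \<zero> = \<zero>" by (rule minus_equality) auto
  moreover have "[(p ^ k)] \<cdot> \<zero> = \<zero>" by simp
  ultimately have "g \<ominus> [(p ^ k)] \<cdot> \<zero> = g" using gG by (simp only: a_minus_def r_zero)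
  then show "\<exists>s. s <: G \<and> g \<ominus> [(p ^ k)] \<cdot> s \<in> F (k + 0)"
   using g by (intro exI[of _ \<zero>]) simp
  fix s m assume s: "s <: G \<and> g \<ominus> [(p ^ k)] \<cdot> s \<in> F (k + m)"
  then obtain x where x: "x <: G" "(g \<ominus> [(p ^ k)] \<cdot> s) \<ominus> [(p ^ (k + m))] \<cdot> x \<in> F (Suc (k + m))"
   using F_approx[of "k + m"] by auto
  have "[(p ^ k)] \<cdot> (s \<oplus> [(p ^ m)] \<cdot> x) = [(p ^ k)] \<cdot> s \<oplus> [(p ^ (k + m))] \<cdot> x"
   using s x by (simp add: add.nat_pow_distrib add.nat_pow_pow power_add mult.commute)
  then have "g \<ominus> [(p ^ k)] \<cdot> (s \<oplus> [(p ^ m)] \<cdot> x) \<in> F (k + Suc m)"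
   using s x gG by (simp add: a_minus_def minus_add a_assoc)
  moreover have "(s \<oplus> [(p ^ m)] \<cdot> x) \<ominus> s \<in> F m"
  proof -
   have "(s \<oplus> [(p ^ m)] \<cdot> x) \<ominus> s = [(p ^ m)] \<cdot> x" using s x by (simp add: a_minus_def a_ac r_neg1 r_neg2 r_neg)
   then show ?thesis using F_p[OF x(1)] by simp
  qed
  ultimately show "\<exists>s'. (s' <: G \<and> g \<ominus> [(p ^ k)] \<cdot> s' \<in> F (k + Suc m)) \<and> s' \<ominus> s \<in> F m"
   using s x by (intro exI[of _ "s \<oplus> [(p ^ m)] \<cdot> x"]) auto
 qed
 then obtain s where s: "\<And>m. s m <: G" "\<And>m. g \<ominus> [(p ^ k)] \<cdot> s m \<in> F (k + m)" "\<And>m. s (Suc m) \<ominus> s m \<in> F m"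
  by blast
 obtain t where t: "t <: G" "\<And>m. t \<ominus> s m \<in> F m" using F_complete[OF s(1,3)] by blast
 have "g \<ominus> [(p ^ k)] \<cdot> t \<in> F m" for m
 proof -
  have "[(p ^ k)] \<cdot> t = [(p ^ k)] \<cdot> s m \<oplus> [(p ^ k)] \<cdot> (t \<ominus> s m)"
   using s(1) t(1) by (subst add.nat_pow_distrib[symmetric]) (auto simp: a_minus_def a_ac r_neg1 r_neg2 r_neg)
  then have "g \<ominus> [(p ^ k)] \<cdot> t = (g \<ominus> [(p ^ k)] \<cdot> s m) \<ominus> [(p ^ k)] \<cdot> (t \<ominus> s m)"
   using s(1) t(1) gG by (simp add: a_minus_def minus_add a_assoc)
  also have "\<dots> \<in> F m"
   by (rule F_diff[OF subsetD[OF F_antimono s(2)] F_mult[OF t(2)]]) simp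
  finally show ?thesis .
 qed
 then have "g \<ominus> [(p ^ k)] \<cdot> t = \<zero>" by (rule F_sep)
 then have "g \<oplus> \<ominus> ([(p ^ k)] \<cdot> t) \<oplus> [(p ^ k)] \<cdot> t = [(p ^ k)] \<cdot> t" using t(1) by (simp add: a_minus_def)
 then have "g = [(p ^ k)] \<cdot> t" using gG t(1) by (simp add: a_assoc l_neg)
 then show ?thesis using t(1) by auto
qed

subsection \<open>Inverse limits of modules and algebras\<close>

lemma invlim_simps:
 "x <: invlim C f h \<longleftrightarrow> (\<forall>k. x k <: C k \<and> f k (x (Suc k)) = x k)"
 "(x \<oplus>\<^bsub>invlim C f h\<^esub> y) k = x k \<oplus>\<^bsub>C k\<^esub> y k"
 "(x \<otimes>\<^bsub>invlim C f h\<^esub> y) k = x k \<otimes>\<^bsub>C k\<^esub> y k"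
 "(r \<odot>\<^bsub>invlim C f h\<^esub> x) k = h k r \<odot>\<^bsub>C k\<^esub> x k"
 "\<zero>\<^bsub>invlim C f h\<^esub> k = \<zero>\<^bsub>C k\<^esub>" "\<one>\<^bsub>invlim C f h\<^esub> k = \<one>\<^bsub>C k\<^esub>"
 by (simp_all add: invlim_def)

lemma invlim_module:
 assumes R: "cring R" and C: "\<And>k. module (S k) (C k)" and h: "\<And>k. h k \<in> ring_hom R (S k)"
  and f: "\<And>k. additive (C (Suc k)) (C k) (f k)"
  and fs: "\<And>k r x. r <: R ==> x <: C (Suc k) ==>
     f k (h (Suc k) r \<odot>\<^bsub>C (Suc k)\<^esub> x) = h k r \<odot>\<^bsub>C k\<^esub> f k x"
 shows "module R (invlim C f h)"
proof -
 let ?L = "invlim C f h"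
 interpret C: module "S k" "C k" for k by (rule C)
 note hc = ring_hom_closed[OF h]
 note gr = C.M.abelian_group_axioms
 have grp: "abelian_group ?L"
 proof (rule abelian_groupI)
  fix x assume x: "x <: ?L"
  show "\<exists>y\<in>carrier ?L. y \<oplus>\<^bsub>?L\<^esub> x = \<zero>\<^bsub>?L\<^esub>"
   using x by (intro bexI[of _ "\<lambda>k. \<ominus>\<^bsub>C k\<^esub> x k"])
    (auto simp: invlim_simps fun_eq_iff C.M.l_neg additive_minus[OF f gr gr])
 qed (auto simp: invlim_simps fun_eq_iff C.M.a_ac additive_add[OF f] additive_zero[OF f gr gr])
 show ?thesis
  by (rule moduleI[OF R grp])
   (auto simp: invlim_simps fun_eq_iff fs hc C.smult_l_distr C.smult_r_distr C.smult_assoc1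
     ring_hom_add[OF h] ring_hom_mult[OF h] ring_hom_one[OF h])
qed

lemma invlim_algebra:
 assumes R: "cring R" and C: "\<And>k. algebra (S k) (C k)" and h: "\<And>k. h k \<in> ring_hom R (S k)"
  and f: "\<And>k. f k \<in> ring_hom (C (Suc k)) (C k)"
  and fs: "\<And>k r x. r <: R ==> x <: C (Suc k) ==>
     f k (h (Suc k) r \<odot>\<^bsub>C (Suc k)\<^esub> x) = h k r \<odot>\<^bsub>C k\<^esub> f k x"
 shows "algebra R (invlim C f h)"
proof -
 let ?L = "invlim C f h"
 interpret C: algebra "S k" "C k" for k by (rule C)
 interpret L: module R ?L
  by (rule invlim_module[where S = S, OF R _ h]) (auto intro: C.module ring_hom_additive[OF f] fs)
 note hc = ring_hom_closed[OF h]
 have "cring ?L"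
  by (rule cringI[OF L.M.abelian_group_axioms comm_monoidI])
   (auto simp: invlim_simps fun_eq_iff C.m_assoc C.l_distr ring_hom_mult[OF f] ring_hom_one[OF f] intro: C.m_comm)
 then show ?thesis
  by (rule algebraI[OF R])
   (simp_all add: L.smult_l_distr L.smult_r_distr L.smult_assoc1, simp_all add: invlim_simps fun_eq_iff hc C.smult_assoc2)
qed

subsection \<open>Direct limits of algebras\<close>

lemma push_refl [simp]: "push f n n x = x"
 by (simp add: push_def)

lemma push_Suc: "n \<le> l ==> push f n (Suc l) x = f l (push f n l x)"
 by (simp add: push_def)

lemma push_push:
 assumes "n \<le> m" "m \<le> l" shows "push f m l (push f n m x) = push f n l x"
 using assms(2) by (induction rule: dec_induct) (use assms(1) in "auto simp: push_Suc")

locale direct_system =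
 fixes S :: "('s, 'e) ring_scheme" and C :: "nat \<Rightarrow> ('s, 'c, 'z) module_scheme" and f :: "nat \<Rightarrow> 'c \<Rightarrow> 'c"
 assumes alg: "\<And>n. algebra S (C n)" and hom: "\<And>n. f n \<in> ring_hom (C n) (C (Suc n))"
  and lin: "\<And>n. linear_map S (C n) (C (Suc n)) (f n)"
begin

abbreviation "cls \<equiv> dl_class C f"
abbreviation "L \<equiv> dirlim C f"

lemma push_hom:
 assumes "n \<le> l"
 shows "push f n l \<in> ring_hom (C n) (C l) \<and> linear_map S (C n) (C l) (push f n l)"
 using assms
proof (induction rule: dec_induct)
 case base
 have "push f n n = (\<lambda>x. x)" by (simp add: fun_eq_iff)
 then show ?case by (auto simp: ring_hom_def linear_id)
next
 case (step l)
 have "push f n (Suc l) = (\<lambda>x. f l (push f n l x))" using step(1) by (simp add: fun_eq_iff push_Suc)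
 moreover have "(\<lambda>x. f l (push f n l x)) \<in> ring_hom (C n) (C (Suc l))"
  using ring_hom_trans[of "push f n l" "C n" "C l" "f l" "C (Suc l)"] hom step.IH by (simp add: comp_def)
 ultimately show ?case using linear_comp[of S "C n" "C l" "push f n l" "C (Suc l)" "f l"] lin step.IH by simp
qed

lemma push_closed: "n \<le> l ==> x <: C n ==> push f n l x <: C l"
 using push_hom ring_hom_closed by metis

lemma cls_eq_iff:
 assumes "x <: C n" "y <: C m"
 shows "cls (n, x) = cls (m, y) \<longleftrightarrow> (\<exists>l\<ge>max n m. push f n l x = push f m l y)"
proof
 assume "cls (n, x) = cls (m, y)"
 moreover have "(n, x) \<in> cls (n, x)" using assms by (auto simp: dl_class_def)
 ultimately have "(n, x) \<in> cls (m, y)" by simp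
 then obtain l where "m \<le> l" "n \<le> l" "push f m l y = push f n l x" unfolding dl_class_def by auto
 then show "\<exists>l\<ge>max n m. push f n l x = push f m l y" by (intro exI[of _ l]) auto
next
 assume "\<exists>l\<ge>max n m. push f n l x = push f m l y"
 then obtain l where l: "n \<le> l" "m \<le> l" "push f n l x = push f m l y" by auto
 have move: "push f a i z = push f b i w"
  if "push f a l z = push f b l w" "a \<le> l" "b \<le> l" "l \<le> i" for a b i z w
  using push_push[of a l i f z] push_push[of b l i f w] that by simp
 have tr: "\<exists>i. a \<le> i \<and> c \<le> i \<and> push f a i z = push f c i v"
  if "a \<le> i" "b \<le> i" "push f a i z = push f b i w" "b \<le> l'" "c \<le> l'" "push f b l' w = push f c l' v"
  for a b c i l' and z w v
  using that push_push[of a i "max i l'" f z] push_push[of b i "max i l'" f w]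
   push_push[of b l' "max i l'" f w] push_push[of c l' "max i l'" f v]
  by (intro exI[of _ "max i l'"]) auto
 show "cls (n, x) = cls (m, y)"
  unfolding dl_class_def using l tr[of m _ n _ _ l] tr[of n _ m _ _ l] tr by (auto; metis)
qed

lemma cls_push: "n \<le> l ==> x <: C n ==> cls (l, push f n l x) = cls (n, x)"
 by (subst cls_eq_iff) (auto simp: push_closed intro!: exI[of _ l])

lemma cls_f: "x <: C n ==> cls (Suc n, f n x) = cls (n, x)"
 using cls_push[of n "Suc n" x] by (simp add: push_Suc)

lemma cls_closed: "x <: C n ==> cls (n, x) <: L"
 by (auto simp: dirlim_def)

lemma cls_rep:
 assumes "x <: C n"
 obtains m y where "rep (cls (n, x)) = (m, y)" "y <: C m" "cls (m, y) = cls (n, x)"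
proof -
 have "(n, x) \<in> cls (n, x)" using assms by (auto simp: dl_class_def)
 then have "rep (cls (n, x)) \<in> cls (n, x)" unfolding rep_def by (rule someI)
 then obtain m y l where "rep (cls (n, x)) = (m, y)" "y <: C m" "n \<le> l" "m \<le> l" "push f n l x = push f m l y"
  unfolding dl_class_def by auto
 moreover from this have "cls (m, y) = cls (n, x)" using assms by (subst cls_eq_iff) (auto intro!: exI[of _ l])
 ultimately show ?thesis using that by blast
qed

lemma cls_binop:
 assumes opn: "\<And>l x y. x <: C l ==> y <: C l ==> opn l x y <: C l"
  and compat: "\<And>l x y. x <: C l ==> y <: C l ==> f l (opn l x y) = opn (Suc l) (f l x) (f l y)"
  and x: "x <: C n" and y: "y <: C n"
 shows "dl_binop C f opn (cls (n, x)) (cls (n, y)) = cls (n, opn n x y)"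
proof -
 have push_op: "push f n l (opn n u v) = opn l (push f n l u) (push f n l v)"
  if "n \<le> l" "u <: C n" "v <: C n" for n l u v
  using that by (induction rule: dec_induct) (auto simp: push_Suc compat push_closed)
 obtain a u where u: "rep (cls (n, x)) = (a, u)" "u <: C a" "cls (a, u) = cls (n, x)" by (rule cls_rep[OF x])
 obtain b v where v: "rep (cls (n, y)) = (b, v)" "v <: C b" "cls (b, v) = cls (n, y)" by (rule cls_rep[OF y])
 obtain i where i: "a \<le> i" "n \<le> i" "push f a i u = push f n i x" using u(3) cls_eq_iff[OF u(2) x] by auto
 obtain l where l: "b \<le> l" "n \<le> l" "push f b l v = push f n l y" using v(3) cls_eq_iff[OF v(2) y] by auto
 define m where "m = max (max a b) (max i l)"
 have m: "a \<le> m" "b \<le> m" "i \<le> m" "l \<le> m" "n \<le> m" "max a b \<le> m" using i by (auto simp: m_def)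
 have pu: "push f a m u = push f n m x" using push_push[of a i m f u] push_push[of n i m f x] i m by simp
 have pv: "push f b m v = push f n m y" using push_push[of b l m f v] push_push[of n l m f y] l m by simp
 let ?c = "max a b"
 have cl: "push f a ?c u <: C ?c" "push f b ?c v <: C ?c" using u v by (auto intro!: push_closed)
 have "dl_binop C f opn (cls (n, x)) (cls (n, y)) = cls (?c, opn ?c (push f a ?c u) (push f b ?c v))"
  by (simp add: dl_binop_def u(1) v(1) Let_def)
 also have "\<dots> = cls (m, push f ?c m (opn ?c (push f a ?c u) (push f b ?c v)))"
  by (rule cls_push[symmetric]) (use m opn cl in auto)
 also have "push f ?c m (opn ?c (push f a ?c u) (push f b ?c v)) = push f n m (opn n x y)"
  using m x y cl by (simp add: push_op push_push pu pv)
 also have "cls (m, push f n m (opn n x y)) = cls (n, opn n x y)"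
  by (rule cls_push) (use m opn x y in auto)
 finally show ?thesis .
qed

lemma
 assumes x: "x <: C n" and y: "y <: C n"
 shows cls_add: "cls (n, x) \<oplus>\<^sub>L cls (n, y) = cls (n, x \<oplus>\<^bsub>C n\<^esub> y)"
  and cls_mult: "cls (n, x) \<otimes>\<^sub>L cls (n, y) = cls (n, x \<otimes>\<^bsub>C n\<^esub> y)"
proof -
 interpret C: algebra S "C i" for i by (rule alg)
 show "cls (n, x) \<oplus>\<^sub>L cls (n, y) = cls (n, x \<oplus>\<^bsub>C n\<^esub> y)"
  unfolding dirlim_def by simp (rule cls_binop, auto simp: x y ring_hom_add[OF hom])
 show "cls (n, x) \<otimes>\<^sub>L cls (n, y) = cls (n, x \<otimes>\<^bsub>C n\<^esub> y)"
  unfolding dirlim_def by simp (rule cls_binop, auto simp: x y ring_hom_mult[OF hom])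
qed

lemma cls_smult:
 assumes r: "r <: S" and x: "x <: C n"
 shows "r \<odot>\<^sub>L cls (n, x) = cls (n, r \<odot>\<^bsub>C n\<^esub> x)"
proof -
 interpret C: algebra S "C i" for i by (rule alg)
 obtain a u where u: "rep (cls (n, x)) = (a, u)" "u <: C a" "cls (a, u) = cls (n, x)" by (rule cls_rep[OF x])
 obtain l where l: "a \<le> l" "n \<le> l" "push f a l u = push f n l x" using u(3) cls_eq_iff[OF u(2) x] by auto
 have "r \<odot>\<^sub>L cls (n, x) = cls (a, r \<odot>\<^bsub>C a\<^esub> u)" by (simp add: dirlim_def u(1))
 also have "\<dots> = cls (n, r \<odot>\<^bsub>C n\<^esub> x)"
  using l u x r by (subst cls_eq_iff) (auto intro!: exI[of _ l] simp: lin_smult[OF conjunct2[OF push_hom]])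
 finally show ?thesis .
qed

lemma cls_zero: "cls (n, \<zero>\<^bsub>C n\<^esub>) = \<zero>\<^sub>L"
proof -
 interpret C: algebra S "C i" for i by (rule alg)
 have "push f 0 n \<zero>\<^bsub>C 0\<^esub> = \<zero>\<^bsub>C n\<^esub>"
  by (rule additive_zero[OF lin_additive[OF conjunct2[OF push_hom]] C.M.abelian_group_axioms C.M.abelian_group_axioms]) simp
 then have "cls (n, \<zero>\<^bsub>C n\<^esub>) = cls (0, \<zero>\<^bsub>C 0\<^esub>)" using cls_push[of 0 n "\<zero>\<^bsub>C 0\<^esub>"] by simp
 also have "\<dots> = \<zero>\<^sub>L" by (simp add: dirlim_def)
 finally show ?thesis .
qed

lemma cls_one: "cls (n, \<one>\<^bsub>C n\<^esub>) = \<one>\<^sub>L"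
proof -
 interpret C: algebra S "C i" for i by (rule alg)
 have "cls (n, \<one>\<^bsub>C n\<^esub>) = cls (0, \<one>\<^bsub>C 0\<^esub>)"
  using cls_push[of 0 n "\<one>\<^bsub>C 0\<^esub>"] ring_hom_one[OF conjunct1[OF push_hom[of 0 n]]] by simp
 also have "\<dots> = \<one>\<^sub>L" by (simp add: dirlim_def)
 finally show ?thesis .
qed

lemma L_carrierE:
 assumes "u <: L" obtains n x where "x <: C n" "u = cls (n, x)"
 using assms by (auto simp: dirlim_def)

lemma L_stage:
 assumes "u <: L" shows "\<exists>n0. \<forall>n\<ge>n0. \<exists>x\<in>carrier (C n). u = cls (n, x)"
proof -
 obtain n x where x: "x <: C n" "u = cls (n, x)" using assms by (rule L_carrierE)
 then have "\<exists>y\<in>carrier (C l). u = cls (l, y)" if "n \<le> l" for l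
  using that by (intro bexI[of _ "push f n l x"]) (auto simp: cls_push push_closed)
 then show ?thesis by blast
qed

lemma L_stage3:
 assumes "u <: L" "v <: L" "w <: L"
 obtains n x y z where "x <: C n" "y <: C n" "z <: C n"
  "u = cls (n, x)" "v = cls (n, y)" "w = cls (n, z)"
proof -
 obtain a b c where abc: "\<forall>n\<ge>a. \<exists>x\<in>carrier (C n). u = cls (n, x)"
  "\<forall>n\<ge>b. \<exists>x\<in>carrier (C n). v = cls (n, x)" "\<forall>n\<ge>c. \<exists>x\<in>carrier (C n). w = cls (n, x)"
  using L_stage[OF assms(1)] L_stage[OF assms(2)] L_stage[OF assms(3)] by blast
 define m where "m = max a (max b c)"
 have "a \<le> m" "b \<le> m" "c \<le> m" by (auto simp: m_def)
 then obtain x y z where "x <: C m" "u = cls (m, x)" "y <: C m" "v = cls (m, y)"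
  "z <: C m" "w = cls (m, z)" using abc by meson
 then show ?thesis using that by blast
qed

lemma L_stage2:
 assumes "u <: L" "v <: L"
 obtains n x y where "x <: C n" "y <: C n" "u = cls (n, x)" "v = cls (n, y)"
 using L_stage3[OF assms assms(2)] that by blast

lemma L_algebra: "algebra S L"
proof -
 interpret C: algebra S "C i" for i by (rule alg)
 have grp: "abelian_group L"
 proof (rule abelian_groupI)
  fix u v assume "u <: L" "v <: L"
  then obtain n x y where "x <: C n" "y <: C n" "u = cls (n, x)" "v = cls (n, y)" by (rule L_stage2)
  then show "u \<oplus>\<^sub>L v <: L" "u \<oplus>\<^sub>L v = v \<oplus>\<^sub>L u"
   by (simp_all add: cls_add cls_closed C.M.a_comm)
 next
  show "\<zero>\<^sub>L <: L" using cls_closed[OF C.M.zero_closed] cls_zero by metis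
 next
  fix u v w assume "u <: L" "v <: L" "w <: L"
  then obtain n x y z where "x <: C n" "y <: C n" "z <: C n"
   "u = cls (n, x)" "v = cls (n, y)" "w = cls (n, z)" by (rule L_stage3)
  then show "u \<oplus>\<^sub>L v \<oplus>\<^sub>L w = u \<oplus>\<^sub>L (v \<oplus>\<^sub>L w)"
   by (simp add: cls_add C.M.a_assoc)
 next
  fix u assume "u <: L"
  then obtain n x where x: "x <: C n" "u = cls (n, x)" by (rule L_carrierE)
  then show "\<zero>\<^sub>L \<oplus>\<^sub>L u = u" by (simp add: cls_zero[of n, symmetric] cls_add)
  show "\<exists>v\<in>carrier L. v \<oplus>\<^sub>L u = \<zero>\<^sub>L"
   by (rule bexI[of _ "cls (n, \<ominus>\<^bsub>C n\<^esub> x)"]) (use x in "auto simp: cls_add C.M.l_neg cls_zero cls_closed")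
 qed
 have ring: "cring L"
 proof (rule cringI[OF grp comm_monoidI])
  fix u v assume "u <: L" "v <: L"
  then obtain n x y where "x <: C n" "y <: C n" "u = cls (n, x)" "v = cls (n, y)" by (rule L_stage2)
  then show "u \<otimes>\<^sub>L v <: L" "u \<otimes>\<^sub>L v = v \<otimes>\<^sub>L u"
   by (simp_all add: cls_mult cls_closed C.m_comm)
 next
  show "\<one>\<^sub>L <: L" using cls_closed[OF C.one_closed] cls_one by metis
 next
  fix u v w assume "u <: L" "v <: L" "w <: L"
  then obtain n x y z where "x <: C n" "y <: C n" "z <: C n"
   "u = cls (n, x)" "v = cls (n, y)" "w = cls (n, z)" by (rule L_stage3)
  then show "u \<otimes>\<^sub>L v \<otimes>\<^sub>L w = u \<otimes>\<^sub>L (v \<otimes>\<^sub>L w)" "(u \<oplus>\<^sub>L v) \<otimes>\<^sub>L w = u \<otimes>\<^sub>L w \<oplus>\<^sub>L v \<otimes>\<^sub>L w"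
   by (simp_all add: cls_add cls_mult C.m_assoc C.l_distr)
 next
  fix u assume "u <: L"
  then obtain n x where x: "x <: C n" "u = cls (n, x)" by (rule L_carrierE)
  then show "\<one>\<^sub>L \<otimes>\<^sub>L u = u" by (simp add: cls_one[of n, symmetric] cls_mult)
 qed
 show ?thesis
 proof (rule algebraI[OF C.R_cring ring])
  fix r u assume r: "r <: S" and "u <: L"
  then obtain n x where x: "x <: C n" "u = cls (n, x)" by (auto elim: L_carrierE)
  then show "r \<odot>\<^sub>L u <: L" using r by (simp add: cls_smult cls_closed)
  fix s assume "s <: S"
  then show "(r \<oplus>\<^sub>S s) \<odot>\<^sub>L u = r \<odot>\<^sub>L u \<oplus>\<^sub>L s \<odot>\<^sub>L u" "(r \<otimes>\<^sub>S s) \<odot>\<^sub>L u = r \<odot>\<^sub>L (s \<odot>\<^sub>L u)"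
   using r x by (simp_all add: cls_smult cls_add C.smult_l_distr C.smult_assoc1)
 next
  fix r u v assume r: "r <: S" and "u <: L" "v <: L"
  then obtain n x y where "x <: C n" "y <: C n" "u = cls (n, x)" "v = cls (n, y)" by (auto elim: L_stage2)
  with r show "r \<odot>\<^sub>L (u \<oplus>\<^sub>L v) = r \<odot>\<^sub>L u \<oplus>\<^sub>L r \<odot>\<^sub>L v" "(r \<odot>\<^sub>L u) \<otimes>\<^sub>L v = r \<odot>\<^sub>L (u \<otimes>\<^sub>L v)"
   by (simp_all add: cls_smult cls_add cls_mult C.smult_r_distr C.smult_assoc2)
 next
  fix u assume "u <: L"
  then show "\<one>\<^sub>S \<odot>\<^sub>L u = u" by (elim L_carrierE) (simp add: cls_smult)
 qed
qed

lemma cls_hom: "(\<lambda>x. cls (n, x)) \<in> ring_hom (C n) L"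
 by (rule ring_hom_memI) (auto simp: cls_closed cls_add cls_mult cls_one)

lemma cls_linear: "linear_map S (C n) L (\<lambda>x. cls (n, x))"
 by (rule semilinearI[OF ring_hom_additive[OF cls_hom]]) (simp add: cls_smult)

text \<open>A map defined on representatives, compatible with the transition maps, is well defined.\<close>

lemma rep_map:
 assumes compat: "\<And>n x. x <: C n ==> F (Suc n) (f n x) = F n x"
  and x: "x <: C n"
 shows "(case rep (cls (n, x)) of (m, y) \<Rightarrow> F m y) = F n x"
proof -
 have pF: "F l (push f n l x) = F n x" if "n \<le> l" "x <: C n" for n l x
  using that by (induction rule: dec_induct) (auto simp: push_Suc compat push_closed)
 obtain a u where u: "rep (cls (n, x)) = (a, u)" "u <: C a" "cls (a, u) = cls (n, x)" by (rule cls_rep[OF x])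
 obtain l where l: "a \<le> l" "n \<le> l" "push f a l u = push f n l x" using u(3) cls_eq_iff[OF u(2) x] by auto
 show ?thesis using pF[of a l u] pF[of n l x] l u x by simp
qed

end

section \<open>The tower of rings modulo powers of \<open>p\<close>\<close>

locale p_complete_ring =
 fixes R :: "('r, 'm) ring_scheme" (structure) and p :: nat
 assumes R: "cring R" and complete: "p_adically_complete R p"
begin

sublocale cring R by (rule R)

abbreviation "I \<equiv> p_ideal R p"
abbreviation "Sk \<equiv> R_mod R p"
abbreviation "to \<equiv> to_mod R p"
abbreviation "red \<equiv> mod_red R p"
abbreviation "pn k \<equiv> [(p ^ k)] \<cdot> \<one>"

lemma I_ideal: "ideal (I k) R"
 unfolding p_ideal_def by (rule cgenideal_ideal) simp

lemma I_eq: "I k = {x \<otimes> pn k | x. x <: R}"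
 by (simp add: p_ideal_def cgenideal_def)

lemma pn_mult: "x <: R ==> [(p ^ k)] \<cdot> x = x \<otimes> pn k"
proof -
 interpret M: algebra R "ring_module R" by (rule algebra_ring_module[OF R])
 assume x: "x <: R"
 have "[n] \<cdot> x = x \<otimes> ([n] \<cdot> \<one>)" for n :: nat using x by (induction n) (simp_all add: r_distr)
 then show ?thesis .
qed

lemma I_eq_multiples: "I k = p_multiples p R k"
proof -
 have "I k = (\<lambda>x. x \<otimes> pn k) ` carrier R" by (auto simp: I_eq)
 also have "\<dots> = (\<lambda>x. [(p ^ k)] \<cdot> x) ` carrier R" by (rule image_cong) (simp_all only: pn_mult)
 finally show ?thesis by (simp add: p_multiples_def)
qed

lemma I_mono: "j \<le> k ==> I k \<subseteq> I j"
proof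
 fix x assume jk: "j \<le> k" and "x \<in> I k"
 then obtain r where r: "r <: R" "x = [(p ^ k)] \<cdot> r" by (auto simp: I_eq_multiples p_multiples_def)
 have "[(p ^ k)] \<cdot> r = [(p ^ j)] \<cdot> ([(p ^ (k - j))] \<cdot> r)"
  using r(1) jk by (simp add: add.nat_pow_pow power_add[symmetric])
 then show "x \<in> I j" using r by (auto simp: I_eq_multiples p_multiples_def)
qed

lemma Sk_cring: "cring (Sk k)"
 unfolding R_mod_def by (rule ideal.quotient_is_cring[OF I_ideal R])

lemma Sk_group: "abelian_group (Sk k)"
proof -
 interpret S: cring "Sk k" by (rule Sk_cring)
 show ?thesis ..
qed

lemma to_hom: "to k \<in> ring_hom R (Sk k)"
 using ideal.rcos_ring_hom[OF I_ideal, of k] by (simp add: R_mod_def to_mod_def[abs_def])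

lemmas to_closed [simp, intro] = ring_hom_closed[OF to_hom]

lemma to_additive: "additive R (Sk k) (to k)"
 by (rule ring_hom_additive[OF to_hom])

lemma to_surj: "to k ` carrier R = carrier (Sk k)"
 by (auto simp: R_mod_def to_mod_def FactRing_def A_RCOSETS_def')

lemma SkE: assumes "c <: Sk k" obtains r where "r <: R" "c = to k r"
 using assms to_surj[of k] by auto

lemma to_zero_iff: "r <: R ==> to k r = \<zero>\<^bsub>Sk k\<^esub> \<longleftrightarrow> r \<in> p_multiples p R k"
proof -
 assume r: "r <: R"
 interpret Ik: ideal "I k" R by (rule I_ideal)
 have "to k r = \<zero>\<^bsub>Sk k\<^esub> \<longleftrightarrow> r \<in> I k"
  using Ik.a_rcos_self[OF r] Ik.a_rcos_const[of r] by (auto simp: R_mod_def to_mod_def FactRing_def)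
 then show ?thesis by (simp add: I_eq_multiples)
qed

lemma red_to: "j \<le> k ==> r <: R ==> red j (to k r) = to j r"
proof -
 assume jk: "j \<le> k" and r: "r <: R"
 interpret Ij: ideal "I j" R by (rule I_ideal)
 interpret Ik: ideal "I k" R by (rule I_ideal)
 note sub = I_mono[OF jk]
 have "x \<in> red j (to k r) \<longleftrightarrow> x \<in> to j r" for x
 proof
  assume "x \<in> red j (to k r)"
  then obtain a i where a: "a \<in> I j" "i \<in> I k" "x = a \<oplus> (i \<oplus> r)"
   by (auto simp: mod_red_def to_mod_def set_add_def' a_r_coset_def')
  then have "a \<oplus> i \<in> I j" "x = (a \<oplus> i) \<oplus> r" using sub r by (auto simp: a_assoc)
  then show "x \<in> to j r" by (auto simp: to_mod_def a_r_coset_def')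
 next
  assume "x \<in> to j r"
  then obtain a where a: "a \<in> I j" "x = a \<oplus> r" by (auto simp: to_mod_def a_r_coset_def')
  then have "x = a \<oplus> (\<zero> \<oplus> r)" using r by simp
  then show "x \<in> red j (to k r)" using a(1) Ik.zero_closed
   by (force simp: mod_red_def to_mod_def set_add_def' a_r_coset_def')
 qed
 then show ?thesis by auto
qed

lemma red_hom: assumes "j \<le> k" shows "red j \<in> ring_hom (Sk k) (Sk j)"
proof (rule ring_hom_memI)
 fix x y assume "x <: Sk k" "y <: Sk k"
 then obtain r s where rs: "r <: R" "s <: R" "x = to k r" "y = to k s" by (auto elim!: SkE)
 then show "red j x <: Sk j" using assms by (simp add: red_to)
 show "red j (x \<otimes>\<^bsub>Sk k\<^esub> y) = red j x \<otimes>\<^bsub>Sk j\<^esub> red j y" "red j (x \<oplus>\<^bsub>Sk k\<^esub> y) = red j x \<oplus>\<^bsub>Sk j\<^esub> red j y"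
  using rs assms by (simp_all add: ring_hom_mult[OF to_hom, symmetric] ring_hom_add[OF to_hom, symmetric] red_to)
next
 show "red j \<one>\<^bsub>Sk k\<^esub> = \<one>\<^bsub>Sk j\<^esub>" using assms red_to[of j k \<one>] by (simp add: ring_hom_one[OF to_hom])
qed

lemma red_closed: "j \<le> k ==> x <: Sk k ==> red j x <: Sk j"
 by (rule ring_hom_closed[OF red_hom])

lemma red_surj: "red k ` carrier (Sk (Suc k)) = carrier (Sk k)"
proof
 show "red k ` carrier (Sk (Suc k)) \<subseteq> carrier (Sk k)" using red_closed[of k "Suc k"] by auto
 show "carrier (Sk k) \<subseteq> red k ` carrier (Sk (Suc k))"
 proof
  fix x assume "x <: Sk k"
  then obtain r where "r <: R" "x = to k r" by (rule SkE)
  then show "x \<in> red k ` carrier (Sk (Suc k))" by (intro image_eqI[of _ _ "to (Suc k) r"]) (auto simp: red_to)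
 qed
qed

lemma R_limit:
 assumes "\<And>k. c k <: Sk k" "\<And>k. red k (c (Suc k)) = c k"
 shows "\<exists>!r. r <: R \<and> (\<forall>k. to k r = c k)"
 using complete assms by (simp add: p_adically_complete_def)

lemma R_eqI: "r <: R ==> s <: R ==> (\<And>k. to k r = to k s) ==> r = s"
 using R_limit[of "\<lambda>k. to k s"] by (auto simp: red_to)

lemma Sk_kills: assumes "x <: Sk j" shows "[(p ^ j)] \<cdot>\<^bsub>Sk j\<^esub> x = \<zero>\<^bsub>Sk j\<^esub>"
proof -
 obtain r where r: "r <: R" "x = to j r" using assms by (rule SkE)
 then have "[(p ^ j)] \<cdot>\<^bsub>Sk j\<^esub> x = to j ([(p ^ j)] \<cdot> r)"
  using additive_add_pow[OF to_additive abelian_group_axioms Sk_group r(1)] by simp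
 also have "\<dots> = \<zero>\<^bsub>Sk j\<^esub>" using r(1) by (subst to_zero_iff) (auto simp: p_multiples_def)
 finally show ?thesis .
qed

lemma pn_zero: assumes "j \<le> k" shows "[(p ^ k)] \<cdot>\<^bsub>Sk j\<^esub> \<one>\<^bsub>Sk j\<^esub> = \<zero>\<^bsub>Sk j\<^esub>"
proof -
 have "[(p ^ k)] \<cdot>\<^bsub>Sk j\<^esub> \<one>\<^bsub>Sk j\<^esub> = to j (pn k)"
  using additive_add_pow[OF to_additive abelian_group_axioms Sk_group, of \<one>] by (simp add: ring_hom_one[OF to_hom])
 moreover have "pn k \<in> p_multiples p R j"
  using I_mono[OF assms] I_eq_multiples by (force simp: p_multiples_def)
 ultimately show ?thesis by (simp add: to_zero_iff)
qed

lemma pn_kills: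
 assumes "module (Sk j) M" "x <: M" "j \<le> k" shows "[(p ^ k)] \<cdot>\<^sub>M x = \<zero>\<^sub>M"
proof -
 interpret M: module "Sk j" M by fact
 show ?thesis using M.add_pow_smult[OF assms(2), of "p ^ k"] pn_zero[OF assms(3)] assms(2) by simp
qed

text \<open>
 A functional with values in \<open>R/p\<^sup>j\<close> on a module descends to any quotient, defined over \<open>R/p\<^sup>k\<close> with \<open>j \<le> k\<close>, whose
 kernel it annihilates.
\<close>

lemma factor_functional:
 assumes le: "j \<le> k" and M: "module R M" and Q: "module (Sk k) Q"
  and \<pi>: "additive M Q \<pi>" and \<pi>_smult: "\<And>r f. \<pi> (r \<odot>\<^sub>M f) = to k r \<odot>\<^sub>Q \<pi> f"
  and \<pi>_surj: "\<And>a. a <: Q ==> \<exists>f\<in>carrier M. \<pi> f = a"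
  and add: "additive M (Sk j) \<mu>"
  and sm: "\<And>r f. r <: R ==> f <: M ==> \<mu> (r \<odot>\<^sub>M f) = to j r \<otimes>\<^bsub>Sk j\<^esub> \<mu> f"
  and N: "\<And>f. f <: M ==> \<pi> f = \<zero>\<^sub>Q ==> \<mu> f = \<zero>\<^bsub>Sk j\<^esub>"
 obtains \<phi> where "semilinear (Sk k) (red j) Q (ring_module (Sk j)) \<phi>"
  "\<And>f. f <: M ==> \<phi> (\<pi> f) = \<mu> f"
proof -
 interpret M: module R M by fact
 interpret Q: module "Sk k" Q by fact
 interpret Sj: cring "Sk j" by (rule Sk_cring)
 note Mg = M.M.abelian_group_axioms and Qg = Q.M.abelian_group_axioms
 define l where "l a = (SOME f. f <: M \<and> \<pi> f = a)" for a
 have l: "l a <: M" "\<pi> (l a) = a" if "a <: Q" for a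
  using someI_ex[of "\<lambda>f. f <: M \<and> \<pi> f = a"] \<pi>_surj[OF that] unfolding l_def by blast+
 have eq: "\<mu> f = \<mu> g" if fg: "f <: M" "g <: M" "\<pi> f = \<pi> g" for f g
 proof -
  have "\<pi> (f \<ominus>\<^sub>M g) = \<zero>\<^sub>Q"
   unfolding additive_diff[OF \<pi> Mg Qg fg(1,2)] fg(3)
   using Q.M.r_neg[OF additive_closed[OF \<pi> fg(2)]] by (simp only: a_minus_def)
  then have "\<mu> (f \<ominus>\<^sub>M g) = \<zero>\<^bsub>Sk j\<^esub>" using fg by (intro N) auto
  then have "\<mu> f \<oplus>\<^bsub>Sk j\<^esub> \<ominus>\<^bsub>Sk j\<^esub> \<mu> g = \<zero>\<^bsub>Sk j\<^esub>"
   using additive_diff[OF add Mg Sk_group fg(1,2)] by (simp add: a_minus_def)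
  then have "\<mu> f \<oplus>\<^bsub>Sk j\<^esub> \<ominus>\<^bsub>Sk j\<^esub> \<mu> g \<oplus>\<^bsub>Sk j\<^esub> \<mu> g = \<mu> g" using additive_closed[OF add] fg by simp
  then show ?thesis using additive_closed[OF add] fg by (simp add: Sj.a_assoc Sj.l_neg)
 qed
 have lin: "semilinear (Sk k) (red j) Q (ring_module (Sk j)) (\<lambda>a. \<mu> (l a))"
 proof (intro semilinearI additive_mapI)
  fix a b assume ab: "a <: Q" "b <: Q"
  have "\<mu> (l (a \<oplus>\<^sub>Q b)) = \<mu> (l a \<oplus>\<^sub>M l b)"
   by (rule eq) (use ab l Q.M.a_closed[OF ab] in "auto simp: additive_add[OF \<pi>]")
  then show "\<mu> (l (a \<oplus>\<^sub>Q b)) = \<mu> (l a) \<oplus>\<^bsub>ring_module (Sk j)\<^esub> \<mu> (l b)"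
   using ab l by (simp add: additive_add[OF add])
 next
  fix c a assume c: "c <: Sk k" and a: "a <: Q"
  obtain r where r: "r <: R" "c = to k r" using c by (rule SkE)
  have "\<mu> (l (c \<odot>\<^sub>Q a)) = \<mu> (r \<odot>\<^sub>M l a)"
   by (rule eq) (use a l r Q.smult_closed[OF c a] in "auto simp: \<pi>_smult")
  then show "\<mu> (l (c \<odot>\<^sub>Q a)) = red j c \<odot>\<^bsub>ring_module (Sk j)\<^esub> \<mu> (l a)"
   using r a l le by (simp add: sm red_to)
 qed (use l additive_closed[OF add] in auto)
 have "\<mu> (l (\<pi> f)) = \<mu> f" if f: "f <: M" for f
  by (rule eq[OF l(1)[OF additive_closed[OF \<pi> f]] f l(2)[OF additive_closed[OF \<pi> f]]])
 then show ?thesis using that lin by blast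
qed

end


section \<open>The group and its functions\<close>

locale p_div_group = p_complete_ring R p for R :: "('r, 'm) ring_scheme" (structure) and p :: nat +
 fixes H :: "('r set, 'a) pdiv"
 assumes pdiv: "p_divisible_group R p H"
begin

abbreviation "Ak k n \<equiv> lev H k n"
abbreviation "res \<equiv> incl H"
abbreviation "bch \<equiv> bc H"

lemma A_fp: "fp_hopf (Sk k) (Ak k n)"
 using pdiv unfolding p_divisible_group_def p_divisible_over_def
 by (auto simp: fp_hopf_def hopf_alg_def fp_hopf_axioms_def)

sublocale A: fp_hopf "Sk k" "Ak k n" for k n
 by (rule A_fp)

lemma A_hopf: "hopf_alg (Sk k) (Ak k n)"
 by (rule A.hopf_alg_axioms)

lemma res_hom: "hopf_hom (Sk k) (Sk k) (\<lambda>r. r) (Ak k (Suc n)) (Ak k n) (res k n)"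
 and res_surj: "res k n ` carrier (Ak k (Suc n)) = carrier (Ak k n)"
 and res_kernel: "a_kernel (Ak k (Suc n)) (Ak k n) (res k n)
   = Idl\<^bsub>Ak k (Suc n)\<^esub> (nat_mult (Ak k (Suc n)) (p ^ n) ` a_kernel (Ak k (Suc n)) (Sk k) (counit (Ak k (Suc n))))"
 using pdiv unfolding p_divisible_group_def p_divisible_over_def by blast+

lemma bc_hom: "hopf_hom (Sk (Suc k)) (Sk k) (red k) (Ak (Suc k) n) (Ak k n) (bch k n)"
 and bc_surj: "bch k n ` carrier (Ak (Suc k) n) = carrier (Ak k n)"
 and bc_kernel: "a_kernel (Ak (Suc k) n) (Ak k n) (bch k n) = p_multiples p (Ak (Suc k) n) k"
 and bc_res: "a <: Ak (Suc k) (Suc n) ==> res k n (bch k (Suc n) a) = bch k n (res (Suc k) n a)"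
 using pdiv unfolding p_divisible_group_def by blast+

lemmas res_ring_hom = hopf_homD(1)[OF res_hom] and res_linear = hopf_homD(2)[OF res_hom]
lemmas bc_ring_hom = hopf_homD(1)[OF bc_hom] and bc_semilinear = hopf_homD(2)[OF bc_hom]
lemmas res_closed [simp] = ring_hom_closed[OF res_ring_hom] and bc_closed [simp] = ring_hom_closed[OF bc_ring_hom]
lemmas res_additive = ring_hom_additive[OF res_ring_hom] and bc_additive = ring_hom_additive[OF bc_ring_hom]

lemma bc_zeroD:
 assumes "a <: Ak (Suc k) n" "bch k n a = \<zero>\<^bsub>Ak k n\<^esub>"
 obtains b where "b <: Ak (Suc k) n" "a = [(p ^ k)] \<cdot>\<^bsub>Ak (Suc k) n\<^esub> b"
proof -
 have "a \<in> p_multiples p (Ak (Suc k) n) k"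
  unfolding bc_kernel[symmetric] a_kernel_def' using assms by simp
 then show ?thesis using that by (auto simp: p_multiples_def)
qed

text \<open>
 The square of restriction and reduction maps is a pullback up to surjectivity: the kernel of
 reduction consists of multiples of \<open>p\<^sup>k\<close>, and these lift along the restriction maps.
\<close>

lemma square_lift:
 assumes y: "y <: Ak (Suc k) n" and x: "x <: Ak k (Suc n)" and eq: "bch k n y = res k n x"
 obtains z where "z <: Ak (Suc k) (Suc n)" "res (Suc k) n z = y" "bch k (Suc n) z = x"
proof -
 let ?A = "Ak (Suc k) (Suc n)" and ?B = "Ak (Suc k) n" and ?C = "Ak k (Suc n)" and ?D = "Ak k n"
 have "x \<in> bch k (Suc n) ` carrier ?A" using x bc_surj by simp
 then obtain z0 where z0: "z0 <: ?A" "bch k (Suc n) z0 = x" by auto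
 have rz: "res (Suc k) n z0 <: ?B" using z0 by simp
 have "bch k n (res (Suc k) n z0 \<ominus>\<^bsub>?B\<^esub> y) = bch k n (res (Suc k) n z0) \<ominus>\<^bsub>?D\<^esub> bch k n y"
  by (rule additive_diff[OF bc_additive A.A_group A.A_group rz y])
 also have "bch k n (res (Suc k) n z0) = bch k n y" using bc_res[OF z0(1)] z0(2) eq by simp
 finally have "bch k n (res (Suc k) n z0 \<ominus>\<^bsub>?B\<^esub> y) = \<zero>\<^bsub>?D\<^esub>" using y by (simp add: a_minus_def A.M.r_neg)
 then obtain b where b: "b <: ?B" "res (Suc k) n z0 \<ominus>\<^bsub>?B\<^esub> y = [(p ^ k)] \<cdot>\<^bsub>?B\<^esub> b"
  by (rule bc_zeroD[rotated]) (use rz y in auto)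
 have "b \<in> res (Suc k) n ` carrier ?A" using b(1) res_surj by simp
 then obtain u where u: "u <: ?A" "res (Suc k) n u = b" by auto
 let ?v = "[(p ^ k)] \<cdot>\<^bsub>?A\<^esub> u"
 have v: "?v <: ?A" using u by simp
 have "bch k (Suc n) ?v = [(p ^ k)] \<cdot>\<^bsub>?C\<^esub> bch k (Suc n) u"
  by (rule additive_add_pow[OF bc_additive A.A_group A.A_group u(1)])
 also have "\<dots> = \<zero>\<^bsub>?C\<^esub>" by (rule pn_kills[OF A.A_module]) (use u in auto)
 finally have bv: "bch k (Suc n) ?v = \<zero>\<^bsub>?C\<^esub>" .
 have rv: "res (Suc k) n ?v = res (Suc k) n z0 \<ominus>\<^bsub>?B\<^esub> y"
  unfolding b(2) u(2)[symmetric] by (rule additive_add_pow[OF res_additive A.A_group A.A_group u(1)])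
 have "res (Suc k) n (z0 \<ominus>\<^bsub>?A\<^esub> ?v) = res (Suc k) n z0 \<ominus>\<^bsub>?B\<^esub> (res (Suc k) n z0 \<ominus>\<^bsub>?B\<^esub> y)"
  using additive_diff[OF res_additive A.A_group A.A_group z0(1) v] by (simp add: rv)
 also have "\<dots> = y" using rz y by (simp add: a_minus_def A.M.minus_add A.M.minus_minus A.M.r_neg2 A.M.a_ac A.M.r_neg1 A.M.r_neg)
 finally have r: "res (Suc k) n (z0 \<ominus>\<^bsub>?A\<^esub> ?v) = y" .
 have "bch k (Suc n) (z0 \<ominus>\<^bsub>?A\<^esub> ?v) = x \<ominus>\<^bsub>?C\<^esub> \<zero>\<^bsub>?C\<^esub>"
  using additive_diff[OF bc_additive A.A_group A.A_group z0(1) v] by (simp add: bv z0)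
 moreover have "\<ominus>\<^bsub>?C\<^esub> \<zero>\<^bsub>?C\<^esub> = \<zero>\<^bsub>?C\<^esub>" by (rule A.M.minus_equality) auto
 ultimately have "bch k (Suc n) (z0 \<ominus>\<^bsub>?A\<^esub> ?v) = x" using x by (simp only: a_minus_def A.M.r_zero)
 then show ?thesis using that[OF _ r] z0 v by simp
qed

abbreviation "OH \<equiv> O_H R p H"

lemma OH_iff: "f <: OH \<longleftrightarrow> (\<forall>k n. f k n <: Ak k n \<and> res k n (f k (Suc n)) = f k n)
  \<and> (\<forall>k n. bch k n (f (Suc k) n) = f k n)"
 by (auto simp: O_H_def invlim_simps fun_eq_iff)

lemma OH_closed [simp]: "f <: OH ==> f k n <: Ak k n"
 and OH_res [simp]: "f <: OH ==> res k n (f k (Suc n)) = f k n"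
 and OH_bc [simp]: "f <: OH ==> bch k n (f (Suc k) n) = f k n"
 by (auto simp: OH_iff)

lemma OH_apply:
 "(f \<oplus>\<^bsub>OH\<^esub> g) k n = f k n \<oplus>\<^bsub>Ak k n\<^esub> g k n" "(f \<otimes>\<^bsub>OH\<^esub> g) k n = f k n \<otimes>\<^bsub>Ak k n\<^esub> g k n"
 "(r \<odot>\<^bsub>OH\<^esub> f) k n = to k r \<odot>\<^bsub>Ak k n\<^esub> f k n"
 "\<zero>\<^bsub>OH\<^esub> k n = \<zero>\<^bsub>Ak k n\<^esub>" "\<one>\<^bsub>OH\<^esub> k n = \<one>\<^bsub>Ak k n\<^esub>"
 by (simp_all add: O_H_def invlim_simps)

lemma OH_algebra: "algebra R OH"
 unfolding O_H_def
proof (rule invlim_algebra[where S = Sk, OF R _ to_hom])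
 fix k
 have id: "(\<lambda>r. r) \<in> ring_hom (Sk k) (Sk k)" by (rule ring_hom_memI) auto
 show alg: "algebra (Sk k) (invlim (Ak k) (res k) (\<lambda>n r. r))" for k
 proof (rule invlim_algebra[where S = "\<lambda>n. Sk k"])
  show "(\<lambda>r. r) \<in> ring_hom (Sk k) (Sk k)" by (rule ring_hom_memI) auto
 qed (auto simp: lin_smult[OF res_linear] intro: A.algebra res_ring_hom Sk_cring)
 show "(\<lambda>x n. bch k n (x n)) \<in> ring_hom (invlim (Ak (Suc k)) (res (Suc k)) (\<lambda>n r. r)) (invlim (Ak k) (res k) (\<lambda>n r. r))"
  by (rule ring_hom_memI)
   (auto simp: invlim_simps fun_eq_iff bc_res ring_hom_add[OF bc_ring_hom] ring_hom_mult[OF bc_ring_hom] ring_hom_one[OF bc_ring_hom])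
 fix r x assume "r <: R" "x <: (invlim (Ak (Suc k)) (res (Suc k)) (\<lambda>n r. r))"
 then show "(\<lambda>n. bch k n ((to (Suc k) r \<odot>\<^bsub>invlim (Ak (Suc k)) (res (Suc k)) (\<lambda>n r. r)\<^esub> x) n))
   = to k r \<odot>\<^bsub>invlim (Ak k) (res k) (\<lambda>n r. r)\<^esub> (\<lambda>n. bch k n (x n))"
  by (auto simp: invlim_simps fun_eq_iff lin_smult[OF bc_semilinear] red_to)
qed

sublocale OH: algebra R OH
 by (rule OH_algebra)

lemma OH_group: "abelian_group OH" by (rule OH.M.abelian_group_axioms)

lemma OH_proj_additive: "additive OH (Ak k n) (\<lambda>f. f k n)"
 by (rule additive_mapI) (auto simp: OH_apply)

lemma OH_apply_pow: "f <: OH ==> ([(m::nat)] \<cdot>\<^bsub>OH\<^esub> f) k n = [m] \<cdot>\<^bsub>Ak k n\<^esub> f k n"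
 using additive_add_pow[OF OH_proj_additive OH_group A.A_group] by simp

lemma OH_apply_diff: "f <: OH ==> g <: OH ==> (f \<ominus>\<^bsub>OH\<^esub> g) k n = f k n \<ominus>\<^bsub>Ak k n\<^esub> g k n"
 using additive_diff[OF OH_proj_additive OH_group A.A_group] by simp

lemma OH_apply_minus: "f <: OH ==> (\<ominus>\<^bsub>OH\<^esub> f) k n = \<ominus>\<^bsub>Ak k n\<^esub> f k n"
 using additive_minus[OF OH_proj_additive OH_group A.A_group] by simp

text \<open>
 Both transition maps are surjective, but a lift has to be compatible with both; lifting a whole row from \<open>k\<close> to
 \<open>k + 1\<close> is possible by the lifting property of the squares.
\<close>

lemma OH_lift:
 assumes "a <: Ak k n" obtains f where "f <: OH" "f k n = a"
proof -
 define C where "C k = {x. \<forall>n. x n <: Ak k n \<and> res k n (x (Suc n)) = x n}" for k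
 have surj: "(\<lambda>x n. bch k n (x n)) ` C (Suc k) = C k" for k
 proof
  show "(\<lambda>x n. bch k n (x n)) ` C (Suc k) \<subseteq> C k" by (auto simp: C_def bc_res)
  show "C k \<subseteq> (\<lambda>x n. bch k n (x n)) ` C (Suc k)"
  proof
   fix x assume x: "x \<in> C k"
   have "\<exists>y. \<forall>n. (y n <: Ak (Suc k) n \<and> bch k n (y n) = x n) \<and> res (Suc k) n (y (Suc n)) = y n"
   proof (rule dependent_nat_choice)
    have "x 0 \<in> bch k 0 ` carrier (Ak (Suc k) 0)" using x bc_surj by (simp add: C_def)
    then show "\<exists>y. y <: Ak (Suc k) 0 \<and> bch k 0 y = x 0" by auto
    fix y n assume y: "y <: Ak (Suc k) n \<and> bch k n y = x n"
    have xn: "x (Suc n) <: Ak k (Suc n)" "res k n (x (Suc n)) = x n" using x by (auto simp: C_def)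
    obtain z where "z <: Ak (Suc k) (Suc n)" "res (Suc k) n z = y" "bch k (Suc n) z = x (Suc n)"
     by (rule square_lift[of y k n "x (Suc n)"]) (use y xn in auto)
    then show "\<exists>z. (z <: Ak (Suc k) (Suc n) \<and> bch k (Suc n) z = x (Suc n)) \<and> res (Suc k) n z = y" by auto
   qed
   then obtain y where "\<And>n. y n <: Ak (Suc k) n" "\<And>n. bch k n (y n) = x n" "\<And>n. res (Suc k) n (y (Suc n)) = y n" by blast
   then show "x \<in> (\<lambda>x n. bch k n (x n)) ` C (Suc k)" by (intro image_eqI[of _ _ y]) (auto simp: C_def)
  qed
 qed
 have "\<exists>x. (\<forall>m. x m <: Ak k m \<and> res k m (x (Suc m)) = x m) \<and> x n = a"
  by (rule tower_lift[where f = "res k" and C = "\<lambda>m. carrier (Ak k m)", OF res_surj assms])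
 then obtain x where x: "\<And>m. x m <: Ak k m" "\<And>m. res k m (x (Suc m)) = x m" "x n = a" by blast
 have xC: "x \<in> C k" using x by (auto simp: C_def)
 obtain f where f: "\<forall>j. f j \<in> C j \<and> (\<lambda>n. bch j n (f (Suc j) n)) = f j" "f k = x"
  using tower_lift[where f = "\<lambda>k x n. bch k n (x n)" and C = C, OF surj xC] by (elim exE conjE)
 have "bch i n (f (Suc i) n) = f i n" for i n
  by (rule fun_cong[OF conjunct2[OF spec[OF f(1)]]])
 moreover have "f i n <: Ak i n \<and> res i n (f i (Suc n)) = f i n" for i n
  using conjunct1[OF spec[OF f(1), of i]] unfolding C_def by blast
 ultimately have "f <: OH" unfolding OH_iff by blast
 then show ?thesis using that f(2) x(3) by simp
qed

lemma OH_mono: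
 assumes f: "f <: OH" and g: "g <: OH" and eq: "f k n = g k n" and le: "j \<le> k" "m \<le> n"
 shows "f j m = g j m"
proof -
 have "f k m = g k m" using le(2) eq
 proof (induction rule: inc_induct)
  case (step i)
  then show ?case using OH_res[OF f, of k i] OH_res[OF g, of k i] by metis
 qed
 with le(1) show ?thesis
 proof (induction rule: inc_induct)
  case (step i)
  then show ?case using OH_bc[OF f, of i m] OH_bc[OF g, of i m] by metis
 qed
qed

lemma OH_zero_mono: "f <: OH ==> f k n = \<zero>\<^bsub>Ak k n\<^esub> ==> j \<le> k ==> m \<le> n ==> f j m = \<zero>\<^bsub>Ak j m\<^esub>"
 using OH_mono[of f "\<zero>\<^bsub>OH\<^esub>" k n j m] by (simp add: OH_apply)

lemma OH_eqI: "f <: OH ==> g <: OH ==> (\<And>k n. f k n = g k n) ==> f = g"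
 by (simp add: fun_eq_iff)

text \<open>
 Reduction from \<open>R/p\<^sup>i\<^sup>+\<^sup>1\<close> to \<open>R/p\<^sup>i\<close> has the multiples of \<open>p\<^sup>i\<close> as its kernel, so \<open>x\<close> can be corrected stage by stage from \<open>j\<close> up to \<open>k\<close>.
\<close>

lemma OH_divide:
 assumes f: "f <: OH" and z: "f j n = \<zero>\<^bsub>Ak j n\<^esub>" and le: "j \<le> k"
 obtains x where "x <: OH" "f k n = ([(p ^ j)] \<cdot>\<^bsub>OH\<^esub> x) k n"
proof -
 have "\<exists>x\<in>carrier OH. f k n = ([(p ^ j)] \<cdot>\<^bsub>OH\<^esub> x) k n"
  using le
 proof (induction rule: dec_induct)
  case base
  have "[(p ^ j)] \<cdot>\<^bsub>OH\<^esub> \<zero>\<^bsub>OH\<^esub> = \<zero>\<^bsub>OH\<^esub>" by simp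
  then have "f j n = ([(p ^ j)] \<cdot>\<^bsub>OH\<^esub> \<zero>\<^bsub>OH\<^esub>) j n" using z OH_apply(4)[of j n] by simp
  then show ?case by (intro bexI[of _ "\<zero>\<^bsub>OH\<^esub>"]) auto
 next
  case (step k)
  then obtain x where x: "x <: OH" "f k n = ([(p ^ j)] \<cdot>\<^bsub>OH\<^esub> x) k n" by auto
  let ?px = "[(p ^ j)] \<cdot>\<^bsub>OH\<^esub> x"
  have px: "?px <: OH" using x by simp
  let ?h = "f \<ominus>\<^bsub>OH\<^esub> ?px"
  have h: "?h <: OH" using f px by simp
  have "?h k n = \<zero>\<^bsub>Ak k n\<^esub>"
   unfolding OH_apply_diff[OF f px] x(2) using A.M.r_neg[OF OH_closed[OF px]] by (simp only: a_minus_def)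
  then have "bch k n (?h (Suc k) n) = \<zero>\<^bsub>Ak k n\<^esub>" using h by simp
  then obtain b where b: "b <: Ak (Suc k) n" "?h (Suc k) n = [(p ^ k)] \<cdot>\<^bsub>Ak (Suc k) n\<^esub> b"
   by (rule bc_zeroD[rotated]) (use h in auto)
  obtain y where y: "y <: OH" "y (Suc k) n = b" using b(1) by (rule OH_lift)
  let ?y = "[(p ^ (k - j))] \<cdot>\<^bsub>OH\<^esub> y"
  have y': "?y <: OH" using y by simp
  have "([(p ^ j)] \<cdot>\<^bsub>OH\<^esub> (x \<oplus>\<^bsub>OH\<^esub> ?y)) = ?px \<oplus>\<^bsub>OH\<^esub> [(p ^ k)] \<cdot>\<^bsub>OH\<^esub> y"
   using x(1) y(1) step(1) by (simp add: OH.M.add.nat_pow_distrib OH.M.add.nat_pow_pow power_add[symmetric])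
  then have "([(p ^ j)] \<cdot>\<^bsub>OH\<^esub> (x \<oplus>\<^bsub>OH\<^esub> ?y)) (Suc k) n = ?px (Suc k) n \<oplus>\<^bsub>Ak (Suc k) n\<^esub> ?h (Suc k) n"
   using y by (simp add: OH_apply OH_apply_pow[OF y(1)] b(2))
  also have "\<dots> = f (Suc k) n"
   using f px OH_closed[OF f, of "Suc k" n] OH_closed[OF px, of "Suc k" n]
   by (simp add: OH_apply OH_apply_minus a_minus_def A.M.a_ac A.M.r_neg1 A.M.r_neg2 A.M.r_neg)
  finally show ?case using x y' by (intro bexI[of _ "x \<oplus>\<^bsub>OH\<^esub> ?y"]) auto
 qed
 then show ?thesis using that by blast
qed

text \<open>
 If \<open>f\<close> vanishes modulo \<open>p\<^sup>j\<close> on the \<open>p\<^sup>N\<close>-torsion, then there it agrees with a multiple of \<open>p\<^sup>j\<close>, on which \<open>\<mu>\<close> vanishes, so only the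
 torsion level of the neighbourhood matters.
\<close>

lemma functional_level:
 assumes add: "additive OH (Sk j) \<mu>"
  and N: "\<And>f. f <: OH ==> f K N = \<zero>\<^bsub>Ak K N\<^esub> ==> \<mu> f = \<zero>\<^bsub>Sk j\<^esub>"
  and f: "f <: OH" "f j N = \<zero>\<^bsub>Ak j N\<^esub>"
 shows "\<mu> f = \<zero>\<^bsub>Sk j\<^esub>"
proof -
 let ?K = "max j K"
 obtain x where x: "x <: OH" "f ?K N = ([(p ^ j)] \<cdot>\<^bsub>OH\<^esub> x) ?K N"
  by (rule OH_divide[OF f, of ?K]) (rule max.cobounded1)
 let ?px = "[(p ^ j)] \<cdot>\<^bsub>OH\<^esub> x"
 have px: "?px <: OH" using x by simp
 have "(f \<ominus>\<^bsub>OH\<^esub> ?px) ?K N = \<zero>\<^bsub>Ak ?K N\<^esub>"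
  unfolding OH_apply_diff[OF f(1) px] x(2) using A.M.r_neg[OF OH_closed[OF px]] by (simp only: a_minus_def)
 then have "(f \<ominus>\<^bsub>OH\<^esub> ?px) K N = \<zero>\<^bsub>Ak K N\<^esub>" by (rule OH_zero_mono[rotated]) (use f px in simp_all)
 then have "\<mu> (f \<ominus>\<^bsub>OH\<^esub> ?px) = \<zero>\<^bsub>Sk j\<^esub>" using f px by (intro N) auto
 moreover have "\<mu> (f \<ominus>\<^bsub>OH\<^esub> ?px) = \<mu> f \<ominus>\<^bsub>Sk j\<^esub> \<mu> ?px"
  by (rule additive_diff[OF add OH_group Sk_group f(1) px])
 moreover have "\<mu> ?px = \<zero>\<^bsub>Sk j\<^esub>"
  using additive_add_pow[OF add OH_group Sk_group x(1), of "p ^ j"]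
   Sk_kills additive_closed[OF add x(1)] by simp
 moreover have "\<ominus>\<^bsub>Sk j\<^esub> \<zero>\<^bsub>Sk j\<^esub> = \<zero>\<^bsub>Sk j\<^esub>" by (rule A.R.minus_equality) auto
 ultimately show ?thesis using additive_closed[OF add f(1)] by (simp add: a_minus_def)
qed

abbreviation "Dk k n \<equiv> dual_lev R p H k n"

lemma Dk_eq: "Dk k n = cartier_dual (Sk k) (Ak k n)"
 by (simp add: dual_lev_def)

lemma functional_factor:
 assumes le: "j \<le> k" and add: "additive OH (Sk j) \<mu>"
  and sm: "\<And>r f. r <: R ==> f <: OH ==> \<mu> (r \<odot>\<^bsub>OH\<^esub> f) = to j r \<otimes>\<^bsub>Sk j\<^esub> \<mu> f"
  and N: "\<And>f. f <: OH ==> f k n = \<zero>\<^bsub>Ak k n\<^esub> ==> \<mu> f = \<zero>\<^bsub>Sk j\<^esub>"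
 obtains \<phi> where "semilinear (Sk k) (red j) (Ak k n) (ring_module (Sk j)) \<phi>"
  "\<And>f. f <: OH ==> \<phi> (f k n) = \<mu> f"
proof -
 have "\<exists>f\<in>carrier OH. f k n = a" if "a <: Ak k n" for a using OH_lift[OF that] by blast
 then show ?thesis
  using factor_functional[where \<pi> = "\<lambda>f. f k n", OF le OH.module A.A_module OH_proj_additive OH_apply(3) _ add sm N] that by blast
qed

lemma functional_dual:
 assumes add: "additive OH (Sk j) \<mu>"
  and sm: "\<And>r f. r <: R ==> f <: OH ==> \<mu> (r \<odot>\<^bsub>OH\<^esub> f) = to j r \<otimes>\<^bsub>Sk j\<^esub> \<mu> f"
  and N: "\<And>f. f <: OH ==> f K N = \<zero>\<^bsub>Ak K N\<^esub> ==> \<mu> f = \<zero>\<^bsub>Sk j\<^esub>"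
 obtains \<phi> where "\<phi> <: Dk j N" "\<And>f. f <: OH ==> \<phi> (f j N) = \<mu> f"
proof -
 have lev: "\<mu> f = \<zero>\<^bsub>Sk j\<^esub>" if "f <: OH" "f j N = \<zero>\<^bsub>Ak j N\<^esub>" for f
  using add N that by (rule functional_level)
 obtain \<phi> where \<phi>: "semilinear (Sk j) (red j) (Ak j N) (ring_module (Sk j)) \<phi>"
  "\<And>f. f <: OH ==> \<phi> (f j N) = \<mu> f"
  using functional_factor[where n = N, OF order_refl add sm lev] by blast
 have "red j c = c" if "c <: Sk j" for c
  using that by (elim SkE) (simp add: red_to)
 then have "linear_map (Sk j) (Ak j N) (ring_module (Sk j)) \<phi>" using \<phi>(1) by (simp add: semilinear_def)
 then have "(\<lambda>a\<in>carrier (Ak j N). \<phi> a) <: Dk j N" unfolding Dk_eq by (rule A.D_restrict)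
 moreover have "(\<lambda>a\<in>carrier (Ak j N). \<phi> a) (f j N) = \<mu> f" if f: "f <: OH" for f
  using \<phi>(2)[OF f] OH_closed[OF f] by (simp only: restrict_apply')
 ultimately show ?thesis using that by blast
qed

end

section \<open>Functions on the Tate module of the dual\<close>

context p_div_group
begin

lemma Dk_algebra: "algebra (Sk k) (Dk k n)"
 unfolding Dk_eq by (rule A.D_algebra)

lemma Dk_closed: "\<phi> <: Dk k n ==> a <: Ak k n ==> \<phi> a <: Sk k"
 unfolding Dk_eq by (rule A.D_closed)

lemma Dk_additive: "\<phi> <: Dk k n ==> additive (Ak k n) (Sk k) \<phi>"
 unfolding Dk_eq by (rule A.D_additive)

lemma Dk_eqI:
 "\<phi> <: Dk k n ==> \<psi> <: Dk k n ==> (\<And>a. a <: Ak k n ==> \<phi> a = \<psi> a) ==> \<phi> = \<psi>"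
 unfolding Dk_eq by (rule A.D_eqI)

lemmas Dk_apply = A.D_apply[folded Dk_eq]

lemma dual_trans_apply: "a <: Ak k (Suc n) ==> dual_trans H k n \<phi> a = \<phi> (res k n a)"
 by (simp add: dual_trans_def)

lemma dual_trans_closed: "\<phi> <: Dk k n ==> dual_trans H k n \<phi> <: Dk k (Suc n)"
 unfolding dual_trans_def Dk_eq
 by (rule A.D_restrict, rule linear_comp[OF res_linear A.D_linear])

lemma sw_res:
 assumes "balanced (Sk k) (Ak k n) (Ak k n) P \<beta>" "abelian_group P" "a <: Ak k (Suc n)"
 shows "sweedler (Ak k n) P \<beta> (res k n a) = sweedler (Ak k (Suc n)) P (\<lambda>x y. \<beta> (res k n x) (res k n y)) a"
 by (rule sweedler_hom[OF A_hopf A_hopf res_hom assms(2,1,3)])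

lemma dual_trans_hom: "dual_trans H k n \<in> ring_hom (Dk k n) (Dk k (Suc n))"
proof -
 interpret D: algebra "Sk k" "Dk k i" for i by (rule Dk_algebra)
 show ?thesis
 proof (rule ring_hom_memI)
  fix \<phi> \<psi> assume p: "\<phi> <: Dk k n" "\<psi> <: Dk k n"
  show "dual_trans H k n \<phi> <: Dk k (Suc n)" by (rule dual_trans_closed[OF p(1)])
  note c = dual_trans_closed[OF p(1)] dual_trans_closed[OF p(2)]
  have bal: "balanced (Sk k) (Ak k n) (Ak k n) (Sk k) (\<lambda>x y. \<phi> x \<otimes>\<^bsub>Sk k\<^esub> \<psi> y)"
   using bilinear_balanced[OF A.D_prod_bilinear[OF p[unfolded Dk_eq]]] by (simp add: balanced_def additive_def)
  show "dual_trans H k n (\<phi> \<otimes>\<^bsub>Dk k n\<^esub> \<psi>) = dual_trans H k n \<phi> \<otimes>\<^bsub>Dk k (Suc n)\<^esub> dual_trans H k n \<psi>"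
  proof (rule Dk_eqI[OF dual_trans_closed[OF D.m_closed[OF p]] D.m_closed[OF c]])
   fix a assume a: "a <: Ak k (Suc n)"
   have "dual_trans H k n (\<phi> \<otimes>\<^bsub>Dk k n\<^esub> \<psi>) a = sweedler (Ak k n) (Sk k) (\<lambda>x y. \<phi> x \<otimes>\<^bsub>Sk k\<^esub> \<psi> y) (res k n a)"
    by (simp add: dual_trans_apply a Dk_apply)
   also have "\<dots> = sweedler (Ak k (Suc n)) (Sk k) (\<lambda>x y. \<phi> (res k n x) \<otimes>\<^bsub>Sk k\<^esub> \<psi> (res k n y)) a"
    by (rule sw_res[OF bal Sk_group a])
   also have "\<dots> = (dual_trans H k n \<phi> \<otimes>\<^bsub>Dk k (Suc n)\<^esub> dual_trans H k n \<psi>) a"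
    unfolding Dk_apply(3)[OF a] by (rule A.sw_cong[OF a]) (simp add: dual_trans_apply)
   finally show "dual_trans H k n (\<phi> \<otimes>\<^bsub>Dk k n\<^esub> \<psi>) a = (dual_trans H k n \<phi> \<otimes>\<^bsub>Dk k (Suc n)\<^esub> dual_trans H k n \<psi>) a" .
  qed
  show "dual_trans H k n (\<phi> \<oplus>\<^bsub>Dk k n\<^esub> \<psi>) = dual_trans H k n \<phi> \<oplus>\<^bsub>Dk k (Suc n)\<^esub> dual_trans H k n \<psi>"
   by (rule Dk_eqI[OF dual_trans_closed[OF D.M.a_closed[OF p]] D.M.a_closed[OF c]])
    (simp add: dual_trans_apply Dk_apply)
 next
  show "dual_trans H k n \<one>\<^bsub>Dk k n\<^esub> = \<one>\<^bsub>Dk k (Suc n)\<^esub>"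
   by (rule Dk_eqI[OF dual_trans_closed[OF D.one_closed] D.one_closed])
    (simp add: dual_trans_apply Dk_apply hopf_homD(4)[OF res_hom])
 qed
qed

lemma dual_trans_linear: "linear_map (Sk k) (Dk k n) (Dk k (Suc n)) (dual_trans H k n)"
proof (rule semilinearI[OF ring_hom_additive[OF dual_trans_hom]])
 interpret D: algebra "Sk k" "Dk k i" for i by (rule Dk_algebra)
 fix r \<phi> assume r: "r <: Sk k" and p: "\<phi> <: Dk k n"
 show "dual_trans H k n (r \<odot>\<^bsub>Dk k n\<^esub> \<phi>) = r \<odot>\<^bsub>Dk k (Suc n)\<^esub> dual_trans H k n \<phi>"
  by (rule Dk_eqI[OF dual_trans_closed[OF D.smult_closed[OF r p]] D.smult_closed[OF r dual_trans_closed[OF p]]])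
   (simp add: dual_trans_apply Dk_apply)
qed

lemma DT_system: "direct_system (Sk k) (dual_lev R p H k) (dual_trans H k)"
 by (rule direct_system.intro) (rule Dk_algebra, rule dual_trans_hom, rule dual_trans_linear)

abbreviation "B \<equiv> O_T_mod R p H"
abbreviation "cl k \<equiv> dl_class (dual_lev R p H k) (dual_trans H k)"

lemmas B_algebra = direct_system.L_algebra[OF DT_system, folded O_T_mod_def]
lemmas cl_closed = direct_system.cls_closed[OF DT_system, folded O_T_mod_def]
lemmas cl_add = direct_system.cls_add[OF DT_system, folded O_T_mod_def]
lemmas cl_mult = direct_system.cls_mult[OF DT_system, folded O_T_mod_def]
lemmas cl_smult = direct_system.cls_smult[OF DT_system, folded O_T_mod_def]
lemmas cl_one = direct_system.cls_one[OF DT_system, folded O_T_mod_def]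
lemmas cl_hom = direct_system.cls_hom[OF DT_system, folded O_T_mod_def]
lemmas cl_linear = direct_system.cls_linear[OF DT_system, folded O_T_mod_def]
lemmas cl_trans = direct_system.cls_f[OF DT_system]
lemmas cl_rep_map = direct_system.rep_map[OF DT_system]
lemmas B_carrierE = direct_system.L_carrierE[OF DT_system, folded O_T_mod_def]
lemmas B_stage2 = direct_system.L_stage2[OF DT_system, folded O_T_mod_def]

lemma B_module: "module (Sk k) (B k)" by (rule algebra_module[OF B_algebra])
lemma B_group: "abelian_group (B k)" by (rule module_group[OF B_module])

lemma P_point: "dual_point (Sk k) (Ak k n) (B k) (\<lambda>\<phi>. cl k (n, \<phi>))"
 by (intro dual_point.intro A_fp dual_point_axioms.intro B_algebra; fold Dk_eq; rule cl_hom cl_linear)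

subsection \<open>Evaluation of functionals\<close>

text \<open>
 An element of \<open>B k\<close>, represented by a functional on the \<open>p\<^sup>n\<close>-torsion, is determined by its values on
 functions on the whole group; this turns identities in the colimit into identities in \<open>R/p\<^sup>k\<close>.
\<close>

definition ev where
 "ev k u f = (case rep u of (n, \<phi>) \<Rightarrow> \<phi> (f k n))"

lemma ev_cl:
 assumes "\<phi> <: Dk k n" "f <: OH" shows "ev k (cl k (n, \<phi>)) f = \<phi> (f k n)"
proof -
 have "\<psi> (res k m (f k (Suc m))) = \<psi> (f k m)" for m and \<psi> :: "'a \<Rightarrow> 'r set" using assms(2) by (metis OH_res)
 then show ?thesis unfolding ev_def
  using cl_rep_map[of k "\<lambda>n \<phi>. \<phi> (f k n)", OF _ assms(1)] OH_closed[OF assms(2)]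
  by (simp add: dual_trans_apply)
qed

lemma ev_additive_left:
 assumes f: "f <: OH" shows "additive (B k) (Sk k) (\<lambda>u. ev k u f)"
proof (rule additive_mapI)
 fix u assume "u <: B k"
 then obtain n \<phi> where "\<phi> <: Dk k n" "u = cl k (n, \<phi>)" by (rule B_carrierE)
 then show "ev k u f <: Sk k" using f by (simp add: ev_cl Dk_closed)
next
 interpret D: algebra "Sk k" "Dk k i" for i by (rule Dk_algebra)
 fix u v assume "u <: B k" "v <: B k"
 then obtain n \<phi> \<psi> where "\<phi> <: Dk k n" "\<psi> <: Dk k n" "u = cl k (n, \<phi>)" "v = cl k (n, \<psi>)"
  by (rule B_stage2)
 then show "ev k (u \<oplus>\<^bsub>B k\<^esub> v) f = ev k u f \<oplus>\<^bsub>Sk k\<^esub> ev k v f"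
  using f by (simp add: ev_cl cl_add Dk_apply)
qed

lemmas ev_closed [simp] = additive_closed[OF ev_additive_left]

lemma ev_smult_left:
 assumes f: "f <: OH" and u: "u <: B k" and c: "c <: Sk k"
 shows "ev k (c \<odot>\<^bsub>B k\<^esub> u) f = c \<otimes>\<^bsub>Sk k\<^esub> ev k u f"
proof -
 interpret D: algebra "Sk k" "Dk k i" for i by (rule Dk_algebra)
 obtain n \<phi> where "\<phi> <: Dk k n" "u = cl k (n, \<phi>)" using u by (rule B_carrierE)
 then show ?thesis using f c by (simp add: ev_cl cl_smult Dk_apply)
qed

lemma ev_additive_right:
 assumes u: "u <: B k" shows "additive OH (Sk k) (ev k u)"
proof -
 obtain n \<phi> where p: "\<phi> <: Dk k n" "u = cl k (n, \<phi>)" using u by (rule B_carrierE)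
 show ?thesis
  by (rule additive_mapI)
   (simp_all add: p ev_cl Dk_closed[OF p(1)] OH_apply additive_add[OF Dk_additive[OF p(1)]])
qed

lemma ev_smult_right:
 assumes u: "u <: B k" and f: "f <: OH" and r: "r <: R"
 shows "ev k u (r \<odot>\<^bsub>OH\<^esub> f) = to k r \<otimes>\<^bsub>Sk k\<^esub> ev k u f"
proof -
 obtain n \<phi> where p: "\<phi> <: Dk k n" "u = cl k (n, \<phi>)" using u by (rule B_carrierE)
 have "r \<odot>\<^bsub>OH\<^esub> f <: OH" using r f by simp
 then show ?thesis using p f r OH_closed[OF f]
  by (simp add: ev_cl OH_apply A.D_smult[folded Dk_eq])
qed

lemma ev_level:
 assumes "u <: B k"
 obtains n where "\<And>f. f <: OH ==> f k n = \<zero>\<^bsub>Ak k n\<^esub> ==> ev k u f = \<zero>\<^bsub>Sk k\<^esub>"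
proof -
 obtain n \<phi> where p: "\<phi> <: Dk k n" "u = cl k (n, \<phi>)" using assms by (rule B_carrierE)
 then show ?thesis
  using that[of n] additive_zero[OF Dk_additive A.A_group Sk_group] by (simp add: ev_cl)
qed

lemma ev_inj:
 assumes "u <: B k" "v <: B k" "\<And>f. f <: OH ==> ev k u f = ev k v f"
 shows "u = v"
proof -
 obtain n \<phi> \<psi> where p: "\<phi> <: Dk k n" "\<psi> <: Dk k n" "u = cl k (n, \<phi>)" "v = cl k (n, \<psi>)"
  using assms(1,2) by (rule B_stage2)
 have "\<phi> = \<psi>"
 proof (rule Dk_eqI[OF p(1,2)])
  fix a assume "a <: Ak k n"
  then obtain f where f: "f <: OH" "f k n = a" by (rule OH_lift)
  then show "\<phi> a = \<psi> a" using assms(3)[OF f(1)] p by (simp add: ev_cl)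
 qed
 then show ?thesis using p by simp
qed

subsection \<open>Reduction\<close>

lemma dual_bc_apply:
 assumes \<phi>: "\<phi> <: Dk (Suc k) n" and a: "a <: Ak (Suc k) n"
 shows "dual_bc R p H k n \<phi> (bch k n a) = red k (\<phi> a)"
proof -
 define a' where "a' = (SOME b. b <: Ak (Suc k) n \<and> bch k n b = bch k n a)"
 have a': "a' <: Ak (Suc k) n" "bch k n a' = bch k n a"
  using someI[of "\<lambda>b. b <: Ak (Suc k) n \<and> bch k n b = bch k n a" a] a by (auto simp: a'_def)
 note rh = red_hom[of k "Suc k", simplified]
 note ra = ring_hom_additive[OF rh]
 note pa = Dk_additive[OF \<phi>]
 have d: "a' \<ominus>\<^bsub>Ak (Suc k) n\<^esub> a <: Ak (Suc k) n" using a a' by simp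
 have "bch k n (a' \<ominus>\<^bsub>Ak (Suc k) n\<^esub> a) = \<zero>\<^bsub>Ak k n\<^esub>"
  unfolding additive_diff[OF bc_additive A.A_group A.A_group a'(1) a] a'(2)
  using A.M.r_neg[OF bc_closed[OF a]] by (simp only: a_minus_def)
 then obtain b where b: "b <: Ak (Suc k) n" "a' \<ominus>\<^bsub>Ak (Suc k) n\<^esub> a = [(p ^ k)] \<cdot>\<^bsub>Ak (Suc k) n\<^esub> b"
  using bc_zeroD[OF d] by blast
 have "red k (\<phi> (a' \<ominus>\<^bsub>Ak (Suc k) n\<^esub> a)) = [(p ^ k)] \<cdot>\<^bsub>Sk k\<^esub> red k (\<phi> b)"
  unfolding b(2) using additive_add_pow[OF additive_comp[OF pa ra] A.A_group Sk_group b(1)] .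
 also have "\<dots> = \<zero>\<^bsub>Sk k\<^esub>" by (rule Sk_kills, rule ring_hom_closed[OF rh], rule Dk_closed[OF \<phi> b(1)])
 finally have z: "red k (\<phi> a') \<ominus>\<^bsub>Sk k\<^esub> red k (\<phi> a) = \<zero>\<^bsub>Sk k\<^esub>"
  using additive_diff[OF additive_comp[OF pa ra] A.A_group Sk_group a'(1) a] by simp
 have c: "red k (\<phi> a') <: Sk k" "red k (\<phi> a) <: Sk k"
  using a a' \<phi> by (auto intro!: ring_hom_closed[OF rh] Dk_closed)
 have "red k (\<phi> a') = red k (\<phi> a') \<oplus>\<^bsub>Sk k\<^esub> \<ominus>\<^bsub>Sk k\<^esub> red k (\<phi> a) \<oplus>\<^bsub>Sk k\<^esub> red k (\<phi> a)"
  using c by (simp add: A.R.a_assoc A.R.l_neg)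
 also have "\<dots> = red k (\<phi> a)" using z c by (simp add: a_minus_def)
 finally have "red k (\<phi> a') = red k (\<phi> a)" .
 then show ?thesis using a by (simp add: dual_bc_def a'_def)
qed

lemma dual_bc_closed:
 assumes \<phi>: "\<phi> <: Dk (Suc k) n" shows "dual_bc R p H k n \<phi> <: Dk k n"
proof -
 note rh = red_hom[of k "Suc k", simplified]
 have lift: "\<exists>b\<in>carrier (Ak (Suc k) n). a = bch k n b" if "a <: Ak k n" for a
  using that unfolding bc_surj[of k n, symmetric] by blast
 have "linear_map (Sk k) (Ak k n) (ring_module (Sk k)) (dual_bc R p H k n \<phi>)"
 proof (intro semilinearI additive_mapI)
  fix a assume "a <: Ak k n"
  then obtain b where b: "b <: Ak (Suc k) n" "a = bch k n b" using lift by blast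
  show "dual_bc R p H k n \<phi> a <: ring_module (Sk k)"
   unfolding b(2) dual_bc_apply[OF \<phi> b(1)] using ring_hom_closed[OF rh Dk_closed[OF \<phi> b(1)]] by simp
 next
  fix a a' assume a: "a <: Ak k n" "a' <: Ak k n"
  obtain b where b1: "b <: Ak (Suc k) n" "a = bch k n b" using lift[OF a(1)] by (elim bexE)
  obtain b' where b2: "b' <: Ak (Suc k) n" "a' = bch k n b'" using lift[OF a(2)] by (elim bexE)
  note b = b1 b2
  have "a \<oplus>\<^bsub>Ak k n\<^esub> a' = bch k n (b \<oplus>\<^bsub>Ak (Suc k) n\<^esub> b')" using b by (simp add: additive_add[OF bc_additive])
  then show "dual_bc R p H k n \<phi> (a \<oplus>\<^bsub>Ak k n\<^esub> a')
   = dual_bc R p H k n \<phi> a \<oplus>\<^bsub>ring_module (Sk k)\<^esub> dual_bc R p H k n \<phi> a'"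
   using b by (simp add: dual_bc_apply[OF \<phi>] additive_add[OF Dk_additive[OF \<phi>]] ring_hom_add[OF rh] Dk_closed[OF \<phi>])
 next
  fix c a assume c: "c <: Sk k" and a: "a <: Ak k n"
  have "c \<in> red k ` carrier (Sk (Suc k))" using c by (simp only: red_surj)
  then obtain e where e: "c = red k e" "e <: Sk (Suc k)" by (rule imageE)
  from lift[OF a] obtain b where "b <: Ak (Suc k) n" "a = bch k n b" by blast
  with e have b: "b <: Ak (Suc k) n" "a = bch k n b" "e <: Sk (Suc k)" "c = red k e" by simp_all
  have "c \<odot>\<^bsub>Ak k n\<^esub> a = bch k n (e \<odot>\<^bsub>Ak (Suc k) n\<^esub> b)"
   unfolding b(2,4) by (rule lin_smult[OF bc_semilinear b(3,1), symmetric])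
  then have "dual_bc R p H k n \<phi> (c \<odot>\<^bsub>Ak k n\<^esub> a) = red k (\<phi> (e \<odot>\<^bsub>Ak (Suc k) n\<^esub> b))"
   using dual_bc_apply[OF \<phi> A.smult_closed[OF b(3,1)]] by simp
  also have "\<dots> = c \<otimes>\<^bsub>Sk k\<^esub> dual_bc R p H k n \<phi> a"
   unfolding A.D_smult[folded Dk_eq, OF \<phi> b(3,1)] ring_hom_mult[OF rh b(3) Dk_closed[OF \<phi> b(1)]]
    b(2,4) dual_bc_apply[OF \<phi> b(1)] ..
  finally show "dual_bc R p H k n \<phi> (c \<odot>\<^bsub>Ak k n\<^esub> a) = c \<odot>\<^bsub>ring_module (Sk k)\<^esub> dual_bc R p H k n \<phi> a" by simp
 qed
 then have "(\<lambda>x\<in>carrier (Ak k n). dual_bc R p H k n \<phi> x) <: Dk k n"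
  unfolding Dk_eq by (rule A.D_restrict)
 moreover have "(\<lambda>x\<in>carrier (Ak k n). dual_bc R p H k n \<phi> x) = dual_bc R p H k n \<phi>"
  by (simp add: dual_bc_def fun_eq_iff)
 ultimately show ?thesis by simp
qed

lemma dual_bc_eqI:
 assumes \<phi>: "\<phi> <: Dk (Suc k) n" and \<psi>: "\<psi> <: Dk k n"
  and eq: "\<And>a. a <: Ak (Suc k) n ==> red k (\<phi> a) = \<psi> (bch k n a)"
 shows "dual_bc R p H k n \<phi> = \<psi>"
proof (rule Dk_eqI[OF dual_bc_closed[OF \<phi>] \<psi>])
 fix a assume "a <: Ak k n"
 then have "a \<in> bch k n ` carrier (Ak (Suc k) n)" by (simp only: bc_surj)
 then obtain b where "b <: Ak (Suc k) n" "a = bch k n b" by blast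
 then show "dual_bc R p H k n \<phi> a = \<psi> a" by (simp add: dual_bc_apply[OF \<phi>] eq)
qed

definition tr where
 "tr k u = (case rep u of (n, \<phi>) \<Rightarrow> cl k (n, dual_bc R p H k n \<phi>))"

lemma tr_cl:
 assumes \<phi>: "\<phi> <: Dk (Suc k) n"
 shows "tr k (cl (Suc k) (n, \<phi>)) = cl k (n, dual_bc R p H k n \<phi>)"
 unfolding tr_def
proof (rule cl_rep_map[OF _ \<phi>])
 fix n \<psi> assume \<psi>: "\<psi> <: Dk (Suc k) n"
 have "dual_bc R p H k (Suc n) (dual_trans H (Suc k) n \<psi>) = dual_trans H k n (dual_bc R p H k n \<psi>)"
  by (rule dual_bc_eqI[OF dual_trans_closed[OF \<psi>] dual_trans_closed[OF dual_bc_closed[OF \<psi>]]])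
   (simp add: dual_trans_apply bc_res dual_bc_apply[OF \<psi>])
 then show "cl k (Suc n, dual_bc R p H k (Suc n) (dual_trans H (Suc k) n \<psi>)) = cl k (n, dual_bc R p H k n \<psi>)"
  by (simp add: cl_trans[OF dual_bc_closed[OF \<psi>]])
qed

lemma tr_closed: "u <: B (Suc k) ==> tr k u <: B k"
 by (elim B_carrierE) (simp add: tr_cl cl_closed dual_bc_closed)

lemma ev_tr:
 assumes u: "u <: B (Suc k)" and f: "f <: OH"
 shows "ev k (tr k u) f = red k (ev (Suc k) u f)"
proof -
 obtain n \<phi> where p: "\<phi> <: Dk (Suc k) n" "u = cl (Suc k) (n, \<phi>)" using u by (rule B_carrierE)
 have "ev k (tr k u) f = dual_bc R p H k n \<phi> (bch k n (f (Suc k) n))"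
  unfolding p(2) tr_cl[OF p(1)] ev_cl[OF dual_bc_closed[OF p(1)] f] OH_bc[OF f] ..
 then show ?thesis using p f dual_bc_apply[OF p(1) OH_closed[OF f]] by (simp add: ev_cl)
qed

lemma tr_hom: "tr k \<in> ring_hom (B (Suc k)) (B k)"
proof -
 interpret Bk: algebra "Sk i" "B i" for i by (rule B_algebra)
 interpret D: algebra "Sk i" "Dk i m" for i m by (rule Dk_algebra)
 note rh = red_hom[of k "Suc k", simplified]
 show ?thesis
 proof (rule ring_hom_memI)
  fix u v assume uv: "u <: B (Suc k)" "v <: B (Suc k)"
  show "tr k u <: B k" by (rule tr_closed[OF uv(1)])
  show "tr k (u \<oplus>\<^bsub>B (Suc k)\<^esub> v) = tr k u \<oplus>\<^bsub>B k\<^esub> tr k v"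
   by (rule ev_inj[where k = k]) (use uv in "simp_all add: tr_closed ev_tr additive_add[OF ev_additive_left] ring_hom_add[OF rh]")
  obtain n \<phi> \<psi> where p: "\<phi> <: Dk (Suc k) n" "\<psi> <: Dk (Suc k) n"
   "u = cl (Suc k) (n, \<phi>)" "v = cl (Suc k) (n, \<psi>)" using uv by (rule B_stage2)
  note c = dual_bc_closed[OF p(1)] dual_bc_closed[OF p(2)]
  have bal: "balanced (Sk k) (Ak k n) (Ak k n) (Sk k) (\<lambda>x y. dual_bc R p H k n \<phi> x \<otimes>\<^bsub>Sk k\<^esub> dual_bc R p H k n \<psi> y)"
   using bilinear_balanced[OF A.D_prod_bilinear[OF c[unfolded Dk_eq]]] by (simp add: balanced_def additive_def)
  have "dual_bc R p H k n (\<phi> \<otimes>\<^bsub>Dk (Suc k) n\<^esub> \<psi>) = dual_bc R p H k n \<phi> \<otimes>\<^bsub>Dk k n\<^esub> dual_bc R p H k n \<psi>"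
  proof (rule dual_bc_eqI[OF D.m_closed[OF p(1,2)] D.m_closed[OF c]])
   fix a assume a: "a <: Ak (Suc k) n"
   have "red k ((\<phi> \<otimes>\<^bsub>Dk (Suc k) n\<^esub> \<psi>) a) = sweedler (Ak (Suc k) n) (Sk k) (\<lambda>x y. red k (\<phi> x \<otimes>\<^bsub>Sk (Suc k)\<^esub> \<psi> y)) a"
    unfolding Dk_apply(3)[OF a]
    by (rule A.sw_map[OF ring_hom_additive[OF rh] Sk_group Sk_group a]) (simp add: Dk_closed[OF p(1)] Dk_closed[OF p(2)])
   also have "\<dots> = sweedler (Ak (Suc k) n) (Sk k) (\<lambda>x y. dual_bc R p H k n \<phi> (bch k n x) \<otimes>\<^bsub>Sk k\<^esub> dual_bc R p H k n \<psi> (bch k n y)) a"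
    by (rule A.sw_cong[OF a]) (simp add: p Dk_closed[OF p(1)] Dk_closed[OF p(2)] dual_bc_apply ring_hom_mult[OF rh])
   also have "\<dots> = sweedler (Ak k n) (Sk k) (\<lambda>x y. dual_bc R p H k n \<phi> x \<otimes>\<^bsub>Sk k\<^esub> dual_bc R p H k n \<psi> y) (bch k n a)"
    by (rule sweedler_hom[OF A_hopf A_hopf bc_hom Sk_group bal a, symmetric])
   finally show "red k ((\<phi> \<otimes>\<^bsub>Dk (Suc k) n\<^esub> \<psi>) a) = (dual_bc R p H k n \<phi> \<otimes>\<^bsub>Dk k n\<^esub> dual_bc R p H k n \<psi>) (bch k n a)"
    using a by (simp add: Dk_apply)
  qed
  then show "tr k (u \<otimes>\<^bsub>B (Suc k)\<^esub> v) = tr k u \<otimes>\<^bsub>B k\<^esub> tr k v"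
   using p c by (simp add: cl_mult tr_cl)
 next
  have "dual_bc R p H k 0 \<one>\<^bsub>Dk (Suc k) 0\<^esub> = \<one>\<^bsub>Dk k 0\<^esub>"
   by (rule dual_bc_eqI[OF D.one_closed D.one_closed]) (simp add: Dk_apply hopf_homD(4)[OF bc_hom])
  then show "tr k \<one>\<^bsub>B (Suc k)\<^esub> = \<one>\<^bsub>B k\<^esub>" using tr_cl[OF D.one_closed, of k 0] by (simp add: cl_one)
 qed
qed

lemma tr_smult:
 assumes r: "r <: R" and u: "u <: B (Suc k)"
 shows "tr k (to (Suc k) r \<odot>\<^bsub>B (Suc k)\<^esub> u) = to k r \<odot>\<^bsub>B k\<^esub> tr k u"
proof -
 interpret Bk: algebra "Sk i" "B i" for i by (rule B_algebra)
 show ?thesis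
  by (rule ev_inj[where k = k])
   (use r u in \<open>simp_all add: tr_closed ev_tr ev_smult_left ring_hom_mult[OF red_hom[of k "Suc k"]] red_to\<close>)
qed

text \<open>A functional on a level lifts to \<open>R/p\<^sup>k\<^sup>+\<^sup>1\<close> because it is a combination of the dual basis, whose coefficients can be lifted.\<close>

lemma tr_surj: "tr k ` carrier (B (Suc k)) = carrier (B k)"
proof
 show "tr k ` carrier (B (Suc k)) \<subseteq> carrier (B k)" using tr_closed by auto
 show "carrier (B k) \<subseteq> tr k ` carrier (B (Suc k))"
 proof
  fix u assume "u <: B k"
  then obtain n \<psi> where p: "\<psi> <: Dk k n" "u = cl k (n, \<psi>)" by (rule B_carrierE)
  interpret D: algebra "Sk i" "Dk i m" for i m by (rule Dk_algebra)
  note rh = red_hom[of k "Suc k", simplified]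
  let ?bs = "fp_hopf.bs (Sk (Suc k)) (Ak (Suc k) n)"
  define s where "s z = inv_into (carrier (Sk (Suc k))) (red k) (\<psi> (bch k n (fst z)))" for z :: "'a \<times> ('a \<Rightarrow> 'r set)"
  have s: "s z <: Sk (Suc k)" "red k (s z) = \<psi> (bch k n (fst z))" if "z \<in> set ?bs" for z
  proof -
   have "\<psi> (bch k n (fst z)) \<in> red k ` carrier (Sk (Suc k))"
    using that p(1) by (simp add: red_surj Dk_closed)
   then show "s z <: Sk (Suc k)" "red k (s z) = \<psi> (bch k n (fst z))"
    by (simp_all add: s_def inv_into_into f_inv_into_f)
  qed
  have bD: "snd z <: Dk (Suc k) n" if "z \<in> set ?bs" for z unfolding Dk_eq using that by simp
  let ?\<phi> = "lsum (Dk (Suc k) n) (map (\<lambda>z. s z \<odot>\<^bsub>Dk (Suc k) n\<^esub> snd z) ?bs)"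
  have sub: "set (map (\<lambda>z. s z \<odot>\<^bsub>Dk (Suc k) n\<^esub> snd z) ?bs) \<subseteq> carrier (Dk (Suc k) n)" using s bD by auto
  have \<phi>: "?\<phi> <: Dk (Suc k) n" by (rule D.M.lsum_closed[OF sub])
  have "dual_bc R p H k n ?\<phi> = \<psi>"
  proof (rule dual_bc_eqI[OF \<phi> p(1)])
   fix a assume a: "a <: Ak (Suc k) n"
   have "?\<phi> a = lsum (Sk (Suc k)) (map (\<lambda>z. s z \<otimes>\<^bsub>Sk (Suc k)\<^esub> snd z a) ?bs)"
    unfolding A.D_lsum[OF sub[unfolded Dk_eq] a, folded Dk_eq] map_map comp_def Dk_apply(2)[OF a] ..
   then have "red k (?\<phi> a) = lsum (Sk k) (map (\<lambda>z. red k (s z \<otimes>\<^bsub>Sk (Suc k)\<^esub> snd z a)) ?bs)"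
    using additive_lsum_map[OF ring_hom_additive[OF rh] Sk_group Sk_group, of ?bs "\<lambda>z. s z \<otimes>\<^bsub>Sk (Suc k)\<^esub> snd z a"]
     s(1) Dk_closed[OF bD a] by simp
   also have "\<dots> = lsum (Sk k) (map (\<lambda>z. \<psi> (bch k n (snd z a \<odot>\<^bsub>Ak (Suc k) n\<^esub> fst z))) ?bs)"
    by (rule lsum_cong)
     (simp add: s a ring_hom_mult[OF rh] ring_hom_closed[OF rh] lin_smult[OF bc_semilinear]
       A.D_smult[folded Dk_eq, OF p(1)] Dk_closed[OF p(1)] A.R.m_comm)
   also have "\<dots> = \<psi> (bch k n (lsum (Ak (Suc k) n) (map (\<lambda>z. snd z a \<odot>\<^bsub>Ak (Suc k) n\<^esub> fst z) ?bs)))"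
    by (rule additive_lsum_map[OF additive_comp[OF bc_additive Dk_additive[OF p(1)]] A.A_group Sk_group, symmetric])
     (simp add: a)
   finally show "red k (?\<phi> a) = \<psi> (bch k n a)" by (simp add: A.bs_expand a)
  qed
  then have "u = tr k (cl (Suc k) (n, ?\<phi>))" unfolding tr_cl[OF \<phi>] p(2) by simp
  then show "u \<in> tr k ` carrier (B (Suc k))" by (rule image_eqI[OF _ cl_closed[OF \<phi>]])
 qed
qed

lemma red_zeroD:
 assumes "c <: Sk (Suc k)" "red k c = \<zero>\<^bsub>Sk k\<^esub>"
 shows "\<exists>s\<in>carrier (Sk (Suc k)). c = [(p ^ k)] \<cdot>\<^bsub>Sk (Suc k)\<^esub> s"
proof -
 obtain r where r: "r <: R" "c = to (Suc k) r" using assms(1) by (rule SkE)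
 then have "r \<in> p_multiples p R k" using assms(2) by (simp add: red_to to_zero_iff)
 then obtain s where s: "s <: R" "r = [(p ^ k)] \<cdot> s" by (auto simp: p_multiples_def)
 then show ?thesis using r
  by (intro bexI[of _ "to (Suc k) s"])
   (simp_all add: additive_add_pow[OF to_additive abelian_group_axioms Sk_group])
qed

text \<open>The coefficients of the functional in a dual basis vanish modulo \<open>p\<^sup>k\<close>, so each is a multiple of \<open>p\<^sup>k\<close>.\<close>

lemma tr_kernel:
 assumes u: "u <: B (Suc k)" and z: "tr k u = \<zero>\<^bsub>B k\<^esub>"
 shows "\<exists>v\<in>carrier (B (Suc k)). u = [(p ^ k)] \<cdot>\<^bsub>B (Suc k)\<^esub> v"
proof -
 interpret D: algebra "Sk i" "Dk i m" for i m by (rule Dk_algebra)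
 obtain n \<phi> where p: "\<phi> <: Dk (Suc k) n" "u = cl (Suc k) (n, \<phi>)" using u by (rule B_carrierE)
 let ?bs = "fp_hopf.bs (Sk (Suc k)) (Ak (Suc k) n)" and ?S = "Sk (Suc k)" and ?D = "Dk (Suc k) n"
 have "red k (\<phi> a) = \<zero>\<^bsub>Sk k\<^esub>" if a: "a <: Ak (Suc k) n" for a
 proof -
  obtain f where f: "f <: OH" "f (Suc k) n = a" using a by (rule OH_lift)
  have "red k (\<phi> a) = ev k (tr k u) f" using f p u by (simp add: ev_tr ev_cl)
  then show ?thesis using additive_zero[OF ev_additive_left[OF f(1)] B_group Sk_group] z by simp
 qed
 then have "\<exists>s\<in>carrier ?S. \<phi> (fst z) = [(p ^ k)] \<cdot>\<^bsub>?S\<^esub> s" if "z \<in> set ?bs" for z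
  using that p(1) by (intro red_zeroD Dk_closed) auto
 then obtain s where s: "\<And>z. z \<in> set ?bs ==> s z <: ?S"
  "\<And>z. z \<in> set ?bs ==> \<phi> (fst z) = [(p ^ k)] \<cdot>\<^bsub>?S\<^esub> s z" by metis
 have bD: "snd z <: ?D" if "z \<in> set ?bs" for z unfolding Dk_eq using that by simp
 have pow: "additive ?D ?D (\<lambda>\<psi>. [(p ^ k)] \<cdot>\<^bsub>?D\<^esub> \<psi>)"
  by (rule additive_mapI) (auto simp: D.M.add.nat_pow_distrib)
 let ?\<psi> = "lsum ?D (map (\<lambda>z. s z \<odot>\<^bsub>?D\<^esub> snd z) ?bs)"
 have \<psi>: "?\<psi> <: ?D" by (rule D.M.lsum_map_closed) (simp add: s bD)
 have "\<phi> = lsum ?D (map (\<lambda>z. \<phi> (fst z) \<odot>\<^bsub>?D\<^esub> snd z) ?bs)" using A.D_expand[OF p(1)[unfolded Dk_eq]] by (simp add: Dk_eq)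
 also have "\<dots> = lsum ?D (map (\<lambda>z. [(p ^ k)] \<cdot>\<^bsub>?D\<^esub> (s z \<odot>\<^bsub>?D\<^esub> snd z)) ?bs)"
 proof (rule lsum_cong)
  fix z assume z: "z \<in> set ?bs"
  have "additive ?S ?D (\<lambda>r. r \<odot>\<^bsub>?D\<^esub> snd z)" using bD[OF z] by (intro additive_mapI) (auto simp: D.smult_l_distr)
  from additive_add_pow[OF this Sk_group D.M.abelian_group_axioms s(1)[OF z]]
  show "\<phi> (fst z) \<odot>\<^bsub>?D\<^esub> snd z = [(p ^ k)] \<cdot>\<^bsub>?D\<^esub> (s z \<odot>\<^bsub>?D\<^esub> snd z)" by (simp add: s(2)[OF z])
 qed
 also have "\<dots> = [(p ^ k)] \<cdot>\<^bsub>?D\<^esub> ?\<psi>"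
  by (rule additive_lsum_map[OF pow D.M.abelian_group_axioms D.M.abelian_group_axioms, symmetric]) (simp add: s bD)
 finally have "u = cl (Suc k) (n, [(p ^ k)] \<cdot>\<^bsub>?D\<^esub> ?\<psi>)" using p(2) by simp
 also have "\<dots> = [(p ^ k)] \<cdot>\<^bsub>B (Suc k)\<^esub> cl (Suc k) (n, ?\<psi>)"
  by (rule additive_add_pow[OF ring_hom_additive[OF cl_hom] D.M.abelian_group_axioms B_group \<psi>])
 finally show ?thesis using cl_closed[OF \<psi>] by blast
qed

subsection \<open>The pairing\<close>

abbreviation "T \<equiv> O_T R p H"

lemma T_eq: "T = invlim B tr to"
 by (simp add: O_T_def tr_def[abs_def])

lemma T_algebra: "algebra R T"
 unfolding T_eq by (rule invlim_algebra[where S = Sk, OF R B_algebra to_hom tr_hom tr_smult])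

sublocale T: algebra R T
 by (rule T_algebra)

lemma T_group: "abelian_group T" by (rule T.M.abelian_group_axioms)

lemma T_iff: "g <: T \<longleftrightarrow> (\<forall>k. g k <: B k \<and> tr k (g (Suc k)) = g k)"
 by (simp add: T_eq invlim_simps)

lemma T_closed: "g <: T ==> g k <: B k"
 and T_tr: "g <: T ==> tr k (g (Suc k)) = g k"
 by (simp_all add: T_iff)

lemma T_apply:
 "(g \<oplus>\<^sub>T h) k = g k \<oplus>\<^bsub>B k\<^esub> h k" "(g \<otimes>\<^sub>T h) k = g k \<otimes>\<^bsub>B k\<^esub> h k"
 "(r \<odot>\<^sub>T g) k = to k r \<odot>\<^bsub>B k\<^esub> g k" "\<zero>\<^sub>T k = \<zero>\<^bsub>B k\<^esub>"
 by (simp_all add: T_eq invlim_simps)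

lemma T_proj_additive: "additive T (B k) (\<lambda>g. g k)"
 by (rule additive_mapI) (auto simp: T_apply T_closed)

lemma T_apply_diff: "g <: T ==> h <: T ==> (g \<ominus>\<^sub>T h) k = g k \<ominus>\<^bsub>B k\<^esub> h k"
 by (rule additive_diff[OF T_proj_additive T_group B_group])

lemma T_apply_pow: "g <: T ==> ([(m::nat)] \<cdot>\<^sub>T g) k = [m] \<cdot>\<^bsub>B k\<^esub> g k"
 by (rule additive_add_pow[OF T_proj_additive T_group B_group])

lemma T_lift: assumes "u <: B k" obtains g where "g <: T" "g k = u"
proof -
 have "\<exists>g. (\<forall>i. g i <: B i \<and> tr i (g (Suc i)) = g i) \<and> g k = u"
  by (rule tower_lift[where f = tr and C = "\<lambda>i. carrier (B i)", OF tr_surj assms])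
 then show ?thesis using that unfolding T_iff by blast
qed

lemma T_mono:
 assumes "g <: T" "g k = \<zero>\<^bsub>B k\<^esub>" "j \<le> k" shows "g j = \<zero>\<^bsub>B j\<^esub>"
 using assms(3,2)
proof (induction rule: inc_induct)
 case (step i)
 have "g i = tr i (g (Suc i))" by (rule T_tr[OF assms(1), symmetric])
 also have "g (Suc i) = \<zero>\<^bsub>B (Suc i)\<^esub>" by (rule step.IH[OF step.prems])
 also have "tr i \<zero>\<^bsub>B (Suc i)\<^esub> = \<zero>\<^bsub>B i\<^esub>" by (rule additive_zero[OF ring_hom_additive[OF tr_hom] B_group B_group])
 finally show ?case .
qed

text \<open>As the kernels of the transition maps consist of multiples of \<open>p\<^sup>k\<close>, the \<open>p\<close>-adic topology is that of the inverse limit.\<close>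

lemma T_multiples: "p_multiples p T k = {g \<in> carrier T. g k = \<zero>\<^bsub>B k\<^esub>}"
proof
 show "p_multiples p T k \<subseteq> {g \<in> carrier T. g k = \<zero>\<^bsub>B k\<^esub>}"
  by (auto simp: p_multiples_def T_apply_pow pn_kills[OF B_module T_closed])
 show "{g \<in> carrier T. g k = \<zero>\<^bsub>B k\<^esub>} \<subseteq> p_multiples p T k"
 proof
  fix g assume g: "g \<in> {g \<in> carrier T. g k = \<zero>\<^bsub>B k\<^esub>}"
  interpret Bk: algebra "Sk i" "B i" for i by (rule B_algebra)
  let ?F = "\<lambda>i. {g \<in> carrier T. g i = \<zero>\<^bsub>B i\<^esub>}"
  have mz: "\<ominus>\<^bsub>B i\<^esub> \<zero>\<^bsub>B i\<^esub> = \<zero>\<^bsub>B i\<^esub>" for i by (rule Bk.M.minus_equality) auto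
  have "\<exists>h\<in>carrier T. g = [(p ^ k)] \<cdot>\<^sub>T h"
  proof (rule p_adic_division[OF T_group, where F = ?F])
   show "\<zero>\<^sub>T \<in> ?F i" for i using T_apply(4)[of i] by simp
   show "x \<oplus>\<^sub>T y \<in> ?F i" if "x \<in> ?F i" "y \<in> ?F i" for i x y using that by (simp add: T_apply)
   show "x \<ominus>\<^sub>T y \<in> ?F i" if "x \<in> ?F i" "y \<in> ?F i" for i x y
   proof -
    have "(x \<ominus>\<^sub>T y) i = \<zero>\<^bsub>B i\<^esub> \<ominus>\<^bsub>B i\<^esub> \<zero>\<^bsub>B i\<^esub>" using that T_apply_diff[of x y i] by simp
    then show ?thesis using that mz by (simp add: a_minus_def)
   qed
   show "?F (Suc i) \<subseteq> ?F i" for i using T_mono[of _ "Suc i" i] by auto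
   show "x = \<zero>\<^sub>T" if "\<And>i. x \<in> ?F i" for x
   proof
    fix i show "x i = \<zero>\<^sub>T i" using that[of i] T_apply(4)[of i] by simp
   qed
   show "[(p ^ i)] \<cdot>\<^sub>T x \<in> ?F i" if "x <: T" for i x
    using that by (simp add: T_apply_pow pn_kills[OF B_module T_closed])
   show "g \<in> ?F k" by (rule g)
   show "?F i \<subseteq> carrier T" for i by auto
  next
   fix s assume s: "\<And>m. s m <: T" "\<And>m. s (Suc m) \<ominus>\<^sub>T s m \<in> ?F m"
   have eq: "s (Suc m) m = s m m" for m
   proof -
    have c: "s (Suc m) m <: B m" "s m m <: B m" using s(1) T_closed by auto
    have "s (Suc m) m \<oplus>\<^bsub>B m\<^esub> \<ominus>\<^bsub>B m\<^esub> s m m = \<zero>\<^bsub>B m\<^esub>"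
     using s(2)[of m] T_apply_diff[OF s(1) s(1), of "Suc m" m m] by (simp add: a_minus_def)
    then have "s (Suc m) m \<oplus>\<^bsub>B m\<^esub> \<ominus>\<^bsub>B m\<^esub> s m m \<oplus>\<^bsub>B m\<^esub> s m m = s m m" using c by simp
    then show ?thesis using c by (simp add: Bk.M.a_assoc Bk.M.l_neg)
   qed
   let ?t = "\<lambda>m. s m m"
   have t: "?t <: T" unfolding T_iff
    using T_closed[OF s(1)] T_tr[OF s(1)] eq by metis
   have "?t \<ominus>\<^sub>T s m \<in> ?F m" for m
    using t s(1) T_closed[OF s(1)] by (simp add: T_apply_diff[OF t s(1)]) (simp add: a_minus_def Bk.M.r_neg)
   then show "\<exists>t\<in>carrier T. \<forall>m. t \<ominus>\<^sub>T s m \<in> ?F m" using t by blast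
  next
   fix i h assume "k \<le> i" and h: "h \<in> ?F i"
   then have hT: "h <: T" by simp
   have "tr i (h (Suc i)) = \<zero>\<^bsub>B i\<^esub>" using T_tr[OF hT, of i] h by simp
   then obtain v where v: "v <: B (Suc i)" "h (Suc i) = [(p ^ i)] \<cdot>\<^bsub>B (Suc i)\<^esub> v"
    using tr_kernel[OF T_closed[OF hT]] by blast
   obtain x where x: "x <: T" "x (Suc i) = v" using v(1) by (rule T_lift)
   have px: "[(p ^ i)] \<cdot>\<^sub>T x <: T" using x by simp
   have "(h \<ominus>\<^sub>T [(p ^ i)] \<cdot>\<^sub>T x) (Suc i) = h (Suc i) \<ominus>\<^bsub>B (Suc i)\<^esub> h (Suc i)"
    unfolding T_apply_diff[OF hT px] T_apply_pow[OF x(1)] x(2) v(2) ..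
   also have "\<dots> = \<zero>\<^bsub>B (Suc i)\<^esub>" using Bk.M.r_neg[OF T_closed[OF hT]] by (simp only: a_minus_def)
   finally show "\<exists>x\<in>carrier T. h \<ominus>\<^sub>T [(p ^ i)] \<cdot>\<^sub>T x \<in> ?F (Suc i)"
    using x(1) px hT by (intro bexI[of _ x]) auto
  qed
  then show "g \<in> p_multiples p T k" by (auto simp: p_multiples_def)
 qed
qed

text \<open>The values of \<open>g k\<close> on \<open>f\<close> are compatible in \<open>k\<close> and define an element of \<open>R\<close> by completeness.\<close>

definition pair where
 "pair f g = (THE r. r <: R \<and> (\<forall>k. to k r = ev k (g k) f))"

lemma
 assumes f: "f <: OH" and g: "g <: T"
 shows pair_closed [simp]: "pair f g <: R" and to_pair: "\<And>k. to k (pair f g) = ev k (g k) f"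
proof -
 have ex: "\<exists>!r. r <: R \<and> (\<forall>k. to k r = ev k (g k) f)"
 proof (rule R_limit)
  show "ev k (g k) f <: Sk k" for k by (rule ev_closed[OF f T_closed[OF g]])
  show "red k (ev (Suc k) (g (Suc k)) f) = ev k (g k) f" for k
   using ev_tr[OF T_closed[OF g] f, of k] T_tr[OF g, of k] by simp
 qed
 then have "pair f g <: R \<and> (\<forall>k. to k (pair f g) = ev k (g k) f)"
  unfolding pair_def by (rule theI')
 then show "pair f g <: R" "\<And>k. to k (pair f g) = ev k (g k) f" by auto
qed

end

section \<open>Duality between functions on the group and on the Tate module\<close>

context p_div_group
begin

lemma pair_eqI:
 "f <: OH ==> g <: T ==> r <: R ==> (\<And>k. ev k (g k) f = to k r) ==> pair f g = r"
 by (rule R_eqI) (simp_all add: to_pair)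

lemma pair_additive_left: "g <: T ==> additive OH R (\<lambda>f. pair f g)"
 by (rule additive_mapI, simp, rule pair_eqI)
  (simp_all add: ring_hom_add[OF to_hom] to_pair additive_add[OF ev_additive_right] T_closed)

lemma pair_additive_right: "f <: OH ==> additive T R (\<lambda>g. pair f g)"
 by (rule additive_mapI, simp, rule pair_eqI)
  (simp_all add: ring_hom_add[OF to_hom] to_pair additive_add[OF ev_additive_left] T_closed T_apply)

lemma pair_smult_left:
 "f <: OH ==> g <: T ==> r <: R ==> pair (r \<odot>\<^bsub>OH\<^esub> f) g = r \<otimes> pair f g"
 by (rule pair_eqI) (simp_all add: ring_hom_mult[OF to_hom] to_pair ev_smult_right T_closed)

lemma pair_smult_right:
 "f <: OH ==> g <: T ==> r <: R ==> pair f (r \<odot>\<^sub>T g) = r \<otimes> pair f g"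
 by (rule pair_eqI) (simp_all add: ring_hom_mult[OF to_hom] to_pair ev_smult_left T_closed T_apply)

lemma T_component_eqI:
 assumes "g <: T" "h <: T" "\<And>f. f <: OH ==> to k (pair f g) = to k (pair f h)"
 shows "g k = h k"
 by (rule ev_inj[OF T_closed[OF assms(1)] T_closed[OF assms(2)]])
  (use assms in "simp add: to_pair")

abbreviation "OHd \<equiv> O_H_dual R p H"
abbreviation "Td \<equiv> O_T_dual R p H"

lemma OHd_iff:
 "\<mu> <: OHd \<longleftrightarrow> \<mu> <: lin_dual R OH
  \<and> (\<forall>j. \<exists>K N. \<forall>f\<in>carrier OH. f K N = \<zero>\<^bsub>Ak K N\<^esub> \<longrightarrow> \<mu> f \<in> p_multiples p R j)"
proof -
 have nhds: "(\<exists>U\<in>limit_nhds OH. Q U) \<longleftrightarrow> (\<exists>K N. Q {f \<in> carrier OH. f K N = \<zero>\<^bsub>OH\<^esub> K N})" for Q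
  unfolding limit_nhds_def by auto
 have nhds': "(\<forall>V\<in>p_adic_nhds p R. Q V) \<longleftrightarrow> (\<forall>j. Q (p_multiples p R j))" for Q
  by (simp add: p_adic_nhds_def)
 have "continuous_at_zero (limit_nhds OH) (p_adic_nhds p R) \<mu>
  \<longleftrightarrow> (\<forall>j. \<exists>K N. \<mu> ` {f \<in> carrier OH. f K N = \<zero>\<^bsub>OH\<^esub> K N} \<subseteq> p_multiples p R j)"
  unfolding continuous_at_zero_def nhds nhds' ..
 also have "\<dots> \<longleftrightarrow> (\<forall>j. \<exists>K N. \<forall>f\<in>carrier OH. f K N = \<zero>\<^bsub>Ak K N\<^esub> \<longrightarrow> \<mu> f \<in> p_multiples p R j)"
  unfolding OH_apply(4) image_subset_iff by (simp add: Ball_def imp_conjL)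
 finally show ?thesis by (simp add: O_H_dual_def cont_dual_def)
qed

lemma Td_iff:
 "\<nu> <: Td \<longleftrightarrow> \<nu> <: lin_dual R T
  \<and> (\<forall>j. \<exists>i. \<nu> ` p_multiples p T i \<subseteq> p_multiples p R j)"
 by (simp add: O_T_dual_def cont_dual_def continuous_at_zero_def p_adic_nhds_def)

lemma dual_simps:
 "add OHd = add (lin_dual R OH)" "smult OHd = smult (lin_dual R OH)"
 "add Td = add (lin_dual R T)" "smult Td = smult (lin_dual R T)"
 by (simp_all add: O_H_dual_def O_T_dual_def cont_dual_def)

lemma pair_in_OHd: assumes g: "g <: T" shows "(\<lambda>f\<in>carrier OH. pair f g) <: OHd"
 unfolding OHd_iff
proof (intro conjI allI)
 have "linear_map R OH (ring_module R) (\<lambda>f. pair f g)"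
  using pair_additive_left[OF g] by (auto intro!: semilinearI simp: additive_def pair_smult_left g)
 then show "(\<lambda>f\<in>carrier OH. pair f g) <: lin_dual R OH" by (rule lin_dual_restrict[OF OH.module])
 fix j
 obtain n where n: "\<And>f. f <: OH ==> f j n = \<zero>\<^bsub>Ak j n\<^esub> ==> ev j (g j) f = \<zero>\<^bsub>Sk j\<^esub>"
  using ev_level[OF T_closed[OF g]] by blast
 have "(\<lambda>f\<in>carrier OH. pair f g) f \<in> p_multiples p R j" if f: "f <: OH" "f j n = \<zero>\<^bsub>Ak j n\<^esub>" for f
 proof -
  have "to j (pair f g) = \<zero>\<^bsub>Sk j\<^esub>" using n[OF f] to_pair[OF f(1) g, of j] by simp
  then show ?thesis using f(1) g by (simp add: to_zero_iff)
 qed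
 then show "\<exists>K N. \<forall>f\<in>carrier OH. f K N = \<zero>\<^bsub>Ak K N\<^esub> \<longrightarrow> (\<lambda>f\<in>carrier OH. pair f g) f \<in> p_multiples p R j" by blast
qed

text \<open>By continuity \<open>\<mu>\<close> modulo \<open>p\<^sup>j\<close> is a functional on a finite level, that is, an element of \<open>B j\<close>.\<close>

lemma OHd_pair:
 assumes \<mu>: "\<mu> <: OHd"
 obtains g where "g <: T" "\<And>f. f <: OH ==> pair f g = \<mu> f"
proof -
 have lin: "linear_map R OH (ring_module R) \<mu>" using \<mu> unfolding OHd_iff by (blast intro: lin_dual_linear)
 have cl: "\<mu> f <: R" if "f <: OH" for f using lin_closed[OF lin that] by simp
 have add: "additive OH (Sk j) (\<lambda>f. to j (\<mu> f))" for j
  using additive_comp[OF lin_additive[OF lin, unfolded additive_def ring_module_simps, folded additive_def] to_additive] .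
 have "\<exists>u\<in>carrier (B j). \<forall>f\<in>carrier OH. ev j u f = to j (\<mu> f)" for j
 proof -
  obtain K N where KN: "\<And>f. f <: OH ==> f K N = \<zero>\<^bsub>Ak K N\<^esub> ==> \<mu> f \<in> p_multiples p R j"
   using \<mu> unfolding OHd_iff by blast
  obtain \<phi> where \<phi>: "\<phi> <: Dk j N" "\<And>f. f <: OH ==> \<phi> (f j N) = to j (\<mu> f)"
  proof (rule functional_dual[OF add, of j K N])
   show "to j (\<mu> (r \<odot>\<^bsub>OH\<^esub> f)) = to j r \<otimes>\<^bsub>Sk j\<^esub> to j (\<mu> f)" if "r <: R" "f <: OH" for r f
    using lin_smult[OF lin that] that cl by (simp add: ring_hom_mult[OF to_hom])
   show "to j (\<mu> f) = \<zero>\<^bsub>Sk j\<^esub>" if "f <: OH" "f K N = \<zero>\<^bsub>Ak K N\<^esub>" for f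
    using KN[OF that] cl[OF that(1)] by (simp add: to_zero_iff)
  qed blast
  then show ?thesis by (intro bexI[OF _ cl_closed[OF \<phi>(1)]]) (simp add: ev_cl)
 qed
 then obtain g where g: "\<And>j. g j <: B j" "\<And>j f. f <: OH ==> ev j (g j) f = to j (\<mu> f)" by metis
 have "tr j (g (Suc j)) = g j" for j
  by (rule ev_inj[where k = j]) (simp_all add: g tr_closed ev_tr red_to cl)
 then have gT: "g <: T" using g(1) unfolding T_iff by blast
 have "pair f g = \<mu> f" if "f <: OH" for f by (rule pair_eqI) (simp_all add: that gT cl g)
 then show ?thesis using that gT by blast
qed

lemma Td_restrict: assumes \<nu>: "linear_map R T (ring_module R) \<nu>" shows "(\<lambda>g\<in>carrier T. \<nu> g) <: Td"
 unfolding Td_iff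
proof (intro conjI allI)
 show "(\<lambda>g\<in>carrier T. \<nu> g) <: lin_dual R T" by (rule lin_dual_restrict[OF T.module \<nu>])
 fix j
 have add: "additive T R \<nu>" using lin_additive[OF \<nu>] by (simp add: additive_def)
 have "\<nu> ([(p ^ j)] \<cdot>\<^sub>T g) = [(p ^ j)] \<cdot> \<nu> g" if "g <: T" for g
  by (rule additive_add_pow[OF add T_group abelian_group_axioms that])
 then show "\<exists>i. (\<lambda>g\<in>carrier T. \<nu> g) ` p_multiples p T i \<subseteq> p_multiples p R j"
  using additive_closed[OF add] by (intro exI[of _ j]) (auto simp: p_multiples_def)
qed

lemma pair_linear_right: "f <: OH ==> linear_map R T (ring_module R) (pair f)"
 using pair_additive_right[of f] by (auto intro!: semilinearI simp: additive_def pair_smult_right)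

lemma pair_in_Td: "f <: OH ==> (\<lambda>g\<in>carrier T. pair f g) <: Td"
 by (rule Td_restrict[OF pair_linear_right])

text \<open>Each finite level is reflexive, so a functional on \<open>T\<close> is evaluation at a function on each level.\<close>

lemma Td_pair:
 assumes \<nu>: "\<nu> <: Td"
 obtains f where "f <: OH" "\<And>g. g <: T ==> pair f g = \<nu> g"
proof -
 have lin: "linear_map R T (ring_module R) \<nu>" using \<nu> unfolding Td_iff by (blast intro: lin_dual_linear)
 have cl: "\<nu> g <: R" if "g <: T" for g using lin_closed[OF lin that] by simp
 have add: "additive T R \<nu>" using lin_additive[OF lin] by (simp add: additive_def)
 have "\<exists>\<psi>. linear_map (Sk k) (B k) (ring_module (Sk k)) \<psi> \<and> (\<forall>g\<in>carrier T. \<psi> (g k) = to k (\<nu> g))" for k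
 proof -
  have addk: "additive T (Sk k) (\<lambda>g. to k (\<nu> g))" by (rule additive_comp[OF add to_additive])
  obtain \<psi> where \<psi>: "semilinear (Sk k) (red k) (B k) (ring_module (Sk k)) \<psi>"
   "\<And>g. g <: T ==> \<psi> (g k) = to k (\<nu> g)"
  proof (rule factor_functional[where \<pi> = "\<lambda>g. g k", OF order_refl T.module B_module T_proj_additive T_apply(3) _ addk])
   show "\<exists>g\<in>carrier T. g k = u" if "u <: B k" for u using T_lift[OF that] by blast
   show "to k (\<nu> (r \<odot>\<^sub>T g)) = to k r \<otimes>\<^bsub>Sk k\<^esub> to k (\<nu> g)" if "r <: R" "g <: T" for r g
    using lin_smult[OF lin that] that cl by (simp add: ring_hom_mult[OF to_hom])
   show "to k (\<nu> g) = \<zero>\<^bsub>Sk k\<^esub>" if "g <: T" "g k = \<zero>\<^bsub>B k\<^esub>" for g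
   proof -
    have "g \<in> p_multiples p T k" using that by (simp add: T_multiples)
    then obtain x where x: "x <: T" "g = [(p ^ k)] \<cdot>\<^sub>T x" by (auto simp: p_multiples_def)
    show ?thesis
     unfolding x(2) additive_add_pow[OF addk T_group Sk_group x(1)] by (rule Sk_kills) (simp add: cl x)
   qed
  qed blast+
  have "red k c = c" if "c <: Sk k" for c using that by (elim SkE) (simp add: red_to)
  then have "linear_map (Sk k) (B k) (ring_module (Sk k)) \<psi>" using \<psi>(1) by (simp add: semilinear_def)
  then show ?thesis using \<psi>(2) by blast
 qed
 then obtain \<nu>k where \<nu>k_lin: "\<And>k. linear_map (Sk k) (B k) (ring_module (Sk k)) (\<nu>k k)"
  and \<nu>k: "\<And>k g. g <: T ==> \<nu>k k (g k) = to k (\<nu> g)" by metis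
 have "\<exists>a\<in>carrier (Ak k n). \<forall>\<phi>\<in>carrier (Dk k n). \<phi> a = \<nu>k k (cl k (n, \<phi>))" for k n
 proof -
  obtain a where "a <: Ak k n"
   "\<And>\<phi>. \<phi> <: cartier_dual (Sk k) (Ak k n) ==> \<phi> a = \<nu>k k (cl k (n, \<phi>))"
   using A.D_reflexive[OF linear_comp[OF cl_linear[of k n, unfolded Dk_eq[of k n]] \<nu>k_lin]] by blast
  then show ?thesis unfolding Dk_eq by (intro bexI[of _ a] ballI)
 qed
 then obtain f where f: "\<And>k n. f k n <: Ak k n"
  "\<And>k n \<phi>. \<phi> <: Dk k n ==> \<phi> (f k n) = \<nu>k k (cl k (n, \<phi>))" by metis
 have fres: "res k n (f k (Suc n)) = f k n" for k n
 proof (rule A.D_separates[OF res_closed[OF f(1)] f(1)], fold Dk_eq)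
  fix \<phi> assume \<phi>: "\<phi> <: Dk k n"
  have "\<phi> (res k n (f k (Suc n))) = dual_trans H k n \<phi> (f k (Suc n))" by (simp add: dual_trans_apply f)
  also have "\<dots> = \<nu>k k (cl k (n, \<phi>))" unfolding f(2)[OF dual_trans_closed[OF \<phi>]] cl_trans[OF \<phi>] ..
  finally show "\<phi> (res k n (f k (Suc n))) = \<phi> (f k n)" unfolding f(2)[OF \<phi>] .
 qed
 have fbc: "bch k n (f (Suc k) n) = f k n" for k n
 proof (rule A.D_separates[OF bc_closed[OF f(1)] f(1)], fold Dk_eq)
  fix \<phi> assume \<phi>: "\<phi> <: Dk k n"
  obtain g where g: "g <: T" "g k = cl k (n, \<phi>)" using T_lift[OF cl_closed[OF \<phi>]] by blast
  obtain m \<psi> where \<psi>: "\<psi> <: Dk (Suc k) m" "g (Suc k) = cl (Suc k) (m, \<psi>)" using T_closed[OF g(1)] by (rule B_carrierE)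
  \<comment> \<open>The stage \<open>m\<close> of the lift need not be \<open>n\<close>; evaluation at a function with the given component compares them.\<close>
  obtain h where h: "h <: OH" "h (Suc k) (max m n) = f (Suc k) (max m n)" using OH_lift[OF f(1)] by blast
  have down: "h (Suc k) i = f (Suc k) i" if "i \<le> max m n" for i
   using that
  proof (induction rule: inc_induct)
   case base then show ?case by (rule h(2))
  next
   case (step i) then show ?case using OH_res[OF h(1), of "Suc k" i] fres[of "Suc k" i] by metis
  qed
  have "\<phi> (bch k n (f (Suc k) n)) = \<phi> (h k n)" using down[of n] OH_bc[OF h(1), of k n] by simp
  also have "\<dots> = ev k (g k) h" unfolding g(2) ev_cl[OF \<phi> h(1)] ..
  also have "\<dots> = red k (ev (Suc k) (g (Suc k)) h)" using ev_tr[OF T_closed[OF g(1)] h(1), of k] T_tr[OF g(1), of k] by simp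
  also have "ev (Suc k) (g (Suc k)) h = \<psi> (f (Suc k) m)" unfolding \<psi>(2) ev_cl[OF \<psi>(1) h(1)] using down[of m] by simp
  also have "\<dots> = to (Suc k) (\<nu> g)" unfolding f(2)[OF \<psi>(1)] \<psi>(2)[symmetric] \<nu>k[OF g(1)] ..
  also have "red k (to (Suc k) (\<nu> g)) = \<nu>k k (g k)" unfolding \<nu>k[OF g(1)] by (simp add: red_to cl g)
  also have "\<dots> = \<phi> (f k n)" unfolding f(2)[OF \<phi>] g(2) ..
  finally show "\<phi> (bch k n (f (Suc k) n)) = \<phi> (f k n)" .
 qed
 have fOH: "f <: OH" unfolding OH_iff using f(1) fres fbc by blast
 have "pair f g = \<nu> g" if g: "g <: T" for g
 proof (rule pair_eqI[OF fOH g cl[OF g]])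
  fix k
  obtain n \<phi> where \<phi>: "\<phi> <: Dk k n" "g k = cl k (n, \<phi>)" using T_closed[OF g] by (rule B_carrierE)
  have "ev k (g k) f = \<phi> (f k n)" unfolding \<phi>(2) ev_cl[OF \<phi>(1) fOH] ..
  also have "\<dots> = \<nu>k k (g k)" unfolding f(2)[OF \<phi>(1)] \<phi>(2) ..
  finally show "ev k (g k) f = to k (\<nu> g)" by (simp only: \<nu>k[OF g])
 qed
 then show ?thesis using that fOH by blast
qed

end

section \<open>Contractions\<close>

text \<open>
 When the neighbourhoods of zero are the kernels of jointly injective projections \<open>\<pi> i\<close>, convergence means that each projection is
 eventually constant; limits are unique as approximations exist arbitrarily far out.
\<close>

lemma contraction_eqI:
 assumes P: "abelian_group P" and Q: "\<And>i. abelian_group (Q i)" and \<pi>: "\<And>i. additive P (Q i) (\<pi> i)"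
  and \<U>: "\<U> = range (\<lambda>i. {x \<in> carrier P. \<pi> i x = \<zero>\<^bsub>Q i\<^esub>})"
  and sep: "\<And>x y. x <: P ==> y <: P ==> (\<And>i. \<pi> i x = \<pi> i y) ==> x = y"
  and ex: "\<And>N. \<exists>k\<ge>N. \<exists>n\<ge>N. \<exists>zs. appr k n zs"
  and cl: "\<And>k n zs. appr k n zs ==> lsum P (map F zs) <: P" and g: "g <: P"
  and conv: "\<And>i. \<exists>N. \<forall>k\<ge>N. \<forall>n\<ge>N. \<forall>zs. appr k n zs \<longrightarrow> \<pi> i (lsum P (map F zs)) = \<pi> i g"
 shows "contraction P \<U> F appr = g"
proof -
 interpret P: abelian_group P by fact
 have diff: "x \<ominus>\<^sub>P y \<in> {x \<in> carrier P. \<pi> i x = \<zero>\<^bsub>Q i\<^esub>} \<longleftrightarrow> \<pi> i x = \<pi> i y"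
  if xy: "x <: P" "y <: P" for x y i
 proof -
  interpret Qi: abelian_group "Q i" by (rule Q)
  have c: "\<pi> i x <: Q i" "\<pi> i y <: Q i" using xy additive_closed[OF \<pi>] by auto
  have "\<pi> i x = \<pi> i y" if "\<pi> i x \<ominus>\<^bsub>Q i\<^esub> \<pi> i y = \<zero>\<^bsub>Q i\<^esub>"
  proof -
   have "\<pi> i x \<ominus>\<^bsub>Q i\<^esub> \<pi> i y \<oplus>\<^bsub>Q i\<^esub> \<pi> i y = \<pi> i y" using that c by simp
   then show ?thesis using c by (simp add: a_minus_def Qi.a_assoc Qi.l_neg)
  qed
  moreover have "\<pi> i y \<ominus>\<^bsub>Q i\<^esub> \<pi> i y = \<zero>\<^bsub>Q i\<^esub>" using c by (simp add: a_minus_def Qi.r_neg)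
  ultimately show ?thesis using xy additive_diff[OF \<pi> P Q xy, of i] by auto
 qed
 have lim: "(\<forall>U\<in>\<U>. \<exists>N. \<forall>k\<ge>N. \<forall>n\<ge>N. \<forall>zs. appr k n zs \<longrightarrow> lsum P (map F zs) \<ominus>\<^sub>P h \<in> U) \<longleftrightarrow>
   (\<forall>i. \<exists>N. \<forall>k\<ge>N. \<forall>n\<ge>N. \<forall>zs. appr k n zs \<longrightarrow> \<pi> i (lsum P (map F zs)) = \<pi> i h)"
  if "h <: P" for h
  unfolding \<U> ball_simps using diff[OF cl that] by (simp cong: imp_cong)
 show ?thesis
  unfolding contraction_def
 proof (rule the_equality)
  show "g <: P \<and> (\<forall>U\<in>\<U>. \<exists>N. \<forall>k\<ge>N. \<forall>n\<ge>N. \<forall>zs. appr k n zs \<longrightarrow> lsum P (map F zs) \<ominus>\<^sub>P g \<in> U)"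
   by (intro conjI g iffD2[OF lim[OF g]] allI conv)
  fix h assume h: "h <: P \<and> (\<forall>U\<in>\<U>. \<exists>N. \<forall>k\<ge>N. \<forall>n\<ge>N. \<forall>zs. appr k n zs \<longrightarrow> lsum P (map F zs) \<ominus>\<^sub>P h \<in> U)"
  show "h = g"
  proof (rule sep)
   fix i
   obtain N1 where N1: "\<And>k n zs. N1 \<le> k ==> N1 \<le> n ==> appr k n zs ==> \<pi> i (lsum P (map F zs)) = \<pi> i h"
    using spec[OF iffD1[OF lim[OF conjunct1[OF h]] conjunct2[OF h]], of i] by (elim exE) blast
   obtain N2 where N2: "\<And>k n zs. N2 \<le> k ==> N2 \<le> n ==> appr k n zs ==> \<pi> i (lsum P (map F zs)) = \<pi> i g"
    using conv[of i] by (elim exE) blast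
   obtain k n zs where "max N1 N2 \<le> k" "max N1 N2 \<le> n" "appr k n zs" using ex by blast
   then show "\<pi> i h = \<pi> i g" using N1[of k n zs] N2[of k n zs] by simp
  qed (use h g in auto)
 qed
qed

context p_div_group
begin

lemma T_contraction_eqI:
 assumes ex: "\<And>N. \<exists>k\<ge>N. \<exists>n\<ge>N. \<exists>zs. appr k n zs"
  and cl: "\<And>k n zs. appr k n zs ==> lsum T (map F zs) <: T" and g: "g <: T"
  and conv: "\<And>j. \<exists>N. \<forall>k\<ge>N. \<forall>n\<ge>N. \<forall>zs. appr k n zs \<longrightarrow> lsum T (map F zs) j = g j"
 shows "contraction T (p_adic_nhds p T) F appr = g"
proof (rule contraction_eqI[where \<pi> = "\<lambda>j g. g j", OF T_group B_group T_proj_additive _ _ ex cl g conv])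
 show "p_adic_nhds p T = range (\<lambda>j. {g \<in> carrier T. g j = \<zero>\<^bsub>B j\<^esub>})"
  unfolding p_adic_nhds_def T_multiples ..
qed (rule ext)

lemma OH_contraction_eqI:
 assumes ex: "\<And>N. \<exists>k\<ge>N. \<exists>n\<ge>N. \<exists>zs. appr k n zs"
  and cl: "\<And>k n zs. appr k n zs ==> lsum OH (map F zs) <: OH" and g: "g <: OH"
  and conv: "\<And>K M. \<exists>N. \<forall>k\<ge>N. \<forall>n\<ge>N. \<forall>zs. appr k n zs \<longrightarrow> lsum OH (map F zs) K M = g K M"
 shows "contraction OH (limit_nhds OH) F appr = g"
proof (rule contraction_eqI[where \<pi> = "\<lambda>i f. f (fst i) (snd i)", OF OH_group A.A_group OH_proj_additive _ _ ex cl g conv])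
 show "limit_nhds OH = range (\<lambda>i. {f \<in> carrier OH. f (fst i) (snd i) = \<zero>\<^bsub>Ak (fst i) (snd i)\<^esub>})"
  (is "_ = range ?S")
 proof (intro equalityI subsetI)
  fix U assume "U \<in> limit_nhds OH"
  then obtain k n where "U = ?S (k, n)" unfolding limit_nhds_def OH_apply(4) by auto
  then show "U \<in> range ?S" by (rule range_eqI)
 next
  fix U assume "U \<in> range ?S"
  then show "U \<in> limit_nhds OH" unfolding limit_nhds_def OH_apply(4) by blast
 qed
 show "x = y" if "x <: OH" "y <: OH" "\<And>i. x (fst i) (snd i) = y (fst i) (snd i)" for x y
  using OH_eqI[OF that(1,2)] that(3)[of "(_, _)"] by simp
qed

abbreviation "cop k n \<equiv> dual_point.copair (Sk k) (Ak k n) (B k) (\<lambda>\<phi>. cl k (n, \<phi>))"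

lemma kappa_copair: "kappa R p H k n = cop k n (Ak k n) (\<lambda>a. a)"
 using dual_point.\<kappa>_eq[OF P_point, of k n]
 by (simp add: kappa_def Let_def dual_point.\<kappa>_def[OF P_point])

lemma approximation_exists:
 assumes t: "t k n <: tensor (Sk k) (Q k n) (B k)"
  and lift: "\<And>w. w <: Q k n ==> \<exists>x\<in>carrier M. x k n = w"
 shows "\<exists>zs. approximates R p H Q t M k n zs"
proof -
 have lifts: "\<exists>zs. set zs \<subseteq> carrier M \<times> carrier T \<and> map (\<lambda>(x, y). (x k n, y k)) zs = us"
  if "set us \<subseteq> carrier (Q k n) \<times> carrier (B k)" for us
  using that
 proof (induction us)
  case (Cons u us)
  then obtain zs where zs: "set zs \<subseteq> carrier M \<times> carrier T" "map (\<lambda>(x, y). (x k n, y k)) zs = us" by auto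
  have u: "fst u <: Q k n" "snd u <: B k" using Cons.prems by auto
  obtain x where x: "x <: M" "x k n = fst u" using lift[OF u(1)] by blast
  obtain y where y: "y <: T" "y k = snd u" using u(2) by (rule T_lift)
  show ?case using zs x y by (intro exI[of _ "(x, y) # zs"]) auto
 qed simp
 obtain zs where "set zs \<subseteq> carrier M \<times> carrier T" "map (\<lambda>(x, y). (x k n, y k)) zs = rep (t k n)"
  using lifts[OF tensor_rep(1)[OF t]] by blast
 then show ?thesis using tensor_rep(2)[OF t] by (auto simp: approximates_def)
qed

text \<open>
 Sums approximating \<open>\<Sum> L(e\<^sub>i) \<otimes> \<phi>\<^sub>i\<close> compute \<open>\<psi>(L f)\<close> when contracted with a functional on the left factor
 and evaluation at \<open>f\<close> on the right, as \<open>f = \<Sum> \<phi>\<^sub>i(f) e\<^sub>i\<close>.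
\<close>

lemma approximation_eval:
 assumes le: "j \<le> k" and Q: "module (Sk k) (Q k n)" and L: "linear_map (Sk k) (Ak k n) (Q k n) L"
  and M: "\<And>x. x <: M ==> x k n <: Q k n"
  and \<psi>: "semilinear (Sk k) (red j) (Q k n) (ring_module (Sk j)) \<psi>"
  and f: "f <: OH" and t: "t k n = cop k n (Q k n) L"
  and zs: "approximates R p H Q t M k n zs"
 shows "lsum (Sk j) (map (\<lambda>(x, y). \<psi> (x k n) \<otimes>\<^bsub>Sk j\<^esub> to j (pair f y)) zs) = \<psi> (L (f k n))"
proof -
 interpret DP: dual_point "Sk k" "Ak k n" "B k" "\<lambda>\<phi>. cl k (n, \<phi>)" by (rule P_point)
 interpret Q: module "Sk k" "Q k n" by (rule Q)
 interpret Sj: cring "Sk j" by (rule Sk_cring)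
 note Qg = Q.M.abelian_group_axioms
 note rh = red_hom[OF le]
 have \<psi>cl: "\<psi> w <: Sk j" if "w <: Q k n" for w using lin_closed[OF \<psi> that] by simp
 have \<psi>add: "additive (Q k n) (Sk j) \<psi>" using lin_additive[OF \<psi>] by (simp add: additive_def)
 have ecl: "red j (ev k u f) <: Sk j" if "u <: B k" for u
  using that f by (intro ring_hom_closed[OF rh]) simp
 let ?\<beta> = "\<lambda>w u. \<psi> w \<otimes>\<^bsub>Sk j\<^esub> red j (ev k u f)"
 have bal: "balanced (Sk k) (Q k n) (B k) (Sk j) ?\<beta>"
 proof (intro balancedI additive_mapI)
  fix w w' u assume "w <: Q k n" "w' <: Q k n" "u <: B k"
  then show "?\<beta> (w \<oplus>\<^bsub>Q k n\<^esub> w') u = ?\<beta> w u \<oplus>\<^bsub>Sk j\<^esub> ?\<beta> w' u"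
   by (simp add: additive_add[OF \<psi>add] A.R.l_distr \<psi>cl ecl)
 next
  fix w u u' assume "w <: Q k n" "u <: B k" "u' <: B k"
  then show "?\<beta> w (u \<oplus>\<^bsub>B k\<^esub> u') = ?\<beta> w u \<oplus>\<^bsub>Sk j\<^esub> ?\<beta> w u'"
   using f by (simp add: additive_add[OF ev_additive_left] ring_hom_add[OF rh] A.R.r_distr \<psi>cl ecl)
 next
  fix c w u assume "c <: Sk k" "w <: Q k n" "u <: B k"
  then show "?\<beta> (c \<odot>\<^bsub>Q k n\<^esub> w) u = ?\<beta> w (c \<odot>\<^bsub>B k\<^esub> u)"
   using f ring_hom_closed[OF rh, of c]
   by (simp add: lin_smult[OF \<psi>] ev_smult_left ring_hom_mult[OF rh] A.R.m_ac \<psi>cl ecl)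
 qed (auto simp: \<psi>cl ecl)
 have zsub: "set zs \<subseteq> carrier M \<times> carrier T"
  and zt: "tclass (Sk k) (Q k n) (B k) (map (\<lambda>(x, y). (x k n, y k)) zs) = cop k n (Q k n) L"
  using zs t by (simp_all add: approximates_def)
 have sub: "set (map (\<lambda>(x, y). (x k n, y k)) zs) \<subseteq> carrier (Q k n) \<times> carrier (B k)"
  using zsub M T_closed by auto
 have "lsum (Sk j) (map (\<lambda>(x, y). \<psi> (x k n) \<otimes>\<^bsub>Sk j\<^esub> to j (pair f y)) zs)
   = lsum (Sk j) (map (\<lambda>(w, u). ?\<beta> w u) (map (\<lambda>(x, y). (x k n, y k)) zs))"
  unfolding map_map
 proof (rule lsum_cong)
  fix z assume "z \<in> set zs"
  then obtain x y where z: "z = (x, y)" "y <: T" using zsub by auto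
  have "to j (pair f y) = red j (ev k (y k) f)"
   unfolding to_pair[OF f z(2), symmetric] using z(2) f le by (simp add: red_to)
  then show "(\<lambda>(x, y). \<psi> (x k n) \<otimes>\<^bsub>Sk j\<^esub> to j (pair f y)) z = ((\<lambda>(w, u). ?\<beta> w u) \<circ> (\<lambda>(x, y). (x k n, y k))) z"
   by (simp add: z)
 qed
 also have "\<dots> = fs_lift (Sk j) (\<lambda>(w, u). ?\<beta> w u) (cop k n (Q k n) L)"
  unfolding zt[symmetric] by (rule tensor_lift[OF Qg B_group Sk_group bal sub, symmetric])
 also have "\<dots> = lsum (Sk j) (map (\<lambda>z. ?\<beta> (L (fst z)) (cl k (n, snd z))) (A.bs k n))"
  by (rule DP.copair_lift[OF Q Sk_group bal lin_closed[OF L]])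
 also have "\<dots> = lsum (Sk j) (map (\<lambda>z. \<psi> (snd z (f k n) \<odot>\<^bsub>Q k n\<^esub> L (fst z))) (A.bs k n))"
 proof (rule lsum_cong)
  fix z assume z: "z \<in> set (A.bs k n)"
  have sz: "snd z <: Dk k n" unfolding Dk_eq using z by simp
  have c: "snd z (f k n) <: Sk k" using Dk_closed[OF sz OH_closed[OF f]] .
  have Lz: "L (fst z) <: Q k n" using z by (simp add: lin_closed[OF L])
  show "?\<beta> (L (fst z)) (cl k (n, snd z)) = \<psi> (snd z (f k n) \<odot>\<^bsub>Q k n\<^esub> L (fst z))"
   unfolding ev_cl[OF sz f] lin_smult[OF \<psi> c Lz]
   using ring_hom_closed[OF rh c] \<psi>cl[OF Lz] by (simp add: A.R.m_comm)
 qed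
 also have "\<dots> = \<psi> (lsum (Q k n) (map (\<lambda>z. snd z (f k n) \<odot>\<^bsub>Q k n\<^esub> L (fst z)) (A.bs k n)))"
  by (rule additive_lsum_map[OF \<psi>add Qg Sk_group, symmetric])
   (use OH_closed[OF f] lin_closed[OF L] in simp)
 also have "\<dots> = \<psi> (L (f k n))" using A.linear_expand[OF Q L OH_closed[OF f]] by simp
 finally show ?thesis .
qed

subsection \<open>The Fourier transforms invert the pairing\<close>

lemma kappa_approximation: "\<exists>zs. approximates R p H Ak (kappa R p H) OH k n zs"
proof (rule approximation_exists)
 show "kappa R p H k n <: tensor (Sk k) (Ak k n) (B k)"
  unfolding kappa_copair by (rule dual_point.copair_closed[OF P_point A.A_module])
 show "\<exists>x\<in>carrier OH. x k n = w" if "w <: Ak k n" for w using OH_lift[OF that] by blast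
qed

lemma lsum_smult_closed:
 assumes "module R P" "\<And>z. z \<in> set zs ==> c z <: R" "\<And>z. z \<in> set zs ==> v z <: P"
 shows "lsum P (map (\<lambda>z. c z \<odot>\<^sub>P v z) zs) <: P"
proof -
 interpret P: module R P by fact
 show ?thesis by (rule P.M.lsum_map_closed) (simp add: assms(2,3))
qed

text \<open>
 An element \<open>\<Sum> L(e\<^sub>i) \<otimes> \<phi>\<^sub>i\<close> on each level contracts with \<open>\<mu>\<close> to the \<open>g\<close> that pairs with \<open>f\<close> to \<open>\<mu>(L f)\<close>, provided
 that \<open>\<mu>\<close> modulo \<open>p\<^sup>j\<close> extends from the given elements to all of \<open>Q k n\<close> when \<open>k\<close> and \<open>n\<close> are large.  Both \<open>\<kappa>\<close> and its logarithmic
 derivative have this form.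
\<close>

lemma T_contraction:
 assumes Q: "\<And>k n. module (Sk k) (Q k n)" and L: "\<And>k n. linear_map (Sk k) (Ak k n) (Q k n) (L k n)"
  and M: "\<And>k n x. x <: M ==> x k n <: Q k n" and t: "\<And>k n. t k n = cop k n (Q k n) (L k n)"
  and ex: "\<And>k n. \<exists>zs. approximates R p H Q t M k n zs"
  and \<mu>: "\<And>x. x <: M ==> \<mu> x <: R" and g: "g <: T"
  and ext: "\<And>j. \<exists>N. \<forall>k\<ge>N. \<forall>n\<ge>N. j \<le> k \<and> (\<exists>\<psi>. semilinear (Sk k) (red j) (Q k n) (ring_module (Sk j)) \<psi>
    \<and> (\<forall>x\<in>carrier M. \<psi> (x k n) = to j (\<mu> x)) \<and> (\<forall>f\<in>carrier OH. \<psi> (L k n (f k n)) = to j (pair f g)))"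
 shows "contraction T (p_adic_nhds p T) (\<lambda>(x, y). \<mu> x \<odot>\<^sub>T y) (approximates R p H Q t M) = g"
proof (rule T_contraction_eqI[OF _ _ g])
 let ?appr = "approximates R p H Q t M"
 show "\<exists>k\<ge>N. \<exists>n\<ge>N. \<exists>zs. ?appr k n zs" for N using ex by blast
 have sub: "fst z <: M" "snd z <: T" if "?appr k n zs" "z \<in> set zs" for k n zs z
  using that by (auto simp: approximates_def)
 show cl: "lsum T (map (\<lambda>(x, y). \<mu> x \<odot>\<^sub>T y) zs) <: T" if "?appr k n zs" for k n zs
  unfolding case_prod_unfold using sub[OF that] by (intro lsum_smult_closed T.module) (auto simp: \<mu>)
 fix j
 obtain N where N: "\<forall>k\<ge>N. \<forall>n\<ge>N. j \<le> k \<and> (\<exists>\<psi>. semilinear (Sk k) (red j) (Q k n) (ring_module (Sk j)) \<psi>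
    \<and> (\<forall>x\<in>carrier M. \<psi> (x k n) = to j (\<mu> x)) \<and> (\<forall>f\<in>carrier OH. \<psi> (L k n (f k n)) = to j (pair f g)))"
  using ext[of j] by (elim exE)
 have "lsum T (map (\<lambda>(x, y). \<mu> x \<odot>\<^sub>T y) zs) j = g j" if k: "N \<le> k" "N \<le> n" and zs: "?appr k n zs" for k n zs
 proof (rule T_component_eqI[OF cl[OF zs] g])
  fix f assume f: "f <: OH"
  obtain \<psi> where le: "j \<le> k" and \<psi>: "semilinear (Sk k) (red j) (Q k n) (ring_module (Sk j)) \<psi>"
   and \<psi>_M: "\<forall>x\<in>carrier M. \<psi> (x k n) = to j (\<mu> x)" and \<psi>_L: "\<forall>f\<in>carrier OH. \<psi> (L k n (f k n)) = to j (pair f g)"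
   using mp[OF spec[OF mp[OF spec[OF N] k(1)]] k(2)] by (elim conjE exE)
  have "to j (pair f (lsum T (map (\<lambda>(x, y). \<mu> x \<odot>\<^sub>T y) zs)))
   = lsum (Sk j) (map (\<lambda>z. to j (pair f (\<mu> (fst z) \<odot>\<^sub>T snd z))) zs)"
   unfolding case_prod_unfold
   by (rule additive_lsum_map[OF additive_comp[OF pair_additive_right[OF f] to_additive] T_group Sk_group])
    (simp add: sub[OF zs] \<mu>)
  also have "\<dots> = lsum (Sk j) (map (\<lambda>(x, y). \<psi> (x k n) \<otimes>\<^bsub>Sk j\<^esub> to j (pair f y)) zs)"
   using f sub[OF zs]
   by (intro lsum_cong) (simp add: case_prod_unfold bspec[OF \<psi>_M] pair_smult_right \<mu> ring_hom_mult[OF to_hom])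
  also have "\<dots> = \<psi> (L k n (f k n))" by (rule approximation_eval[where Q = Q and M = M and L = "L k n" and t = t and k = k and n = n, OF le Q[of k n] L[of k n] _ \<psi> f t[of k n] zs]) (rule M)
  finally show "to j (pair f (lsum T (map (\<lambda>(x, y). \<mu> x \<odot>\<^sub>T y) zs))) = to j (pair f g)" by (simp only: bspec[OF \<psi>_L f])
 qed
 then show "\<exists>N. \<forall>k\<ge>N. \<forall>n\<ge>N. \<forall>zs. ?appr k n zs \<longrightarrow> lsum T (map (\<lambda>(x, y). \<mu> x \<odot>\<^sub>T y) zs) j = g j" by blast
qed

lemma fourier_upper_eqI:
 assumes \<mu>: "\<mu> <: OHd" and g: "g <: T" and eq: "\<And>f. f <: OH ==> pair f g = \<mu> f"
 shows "fourier_upper R p H \<mu> = g"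
 unfolding fourier_upper_def
proof (rule T_contraction[where Q = Ak and L = "\<lambda>k n a. a" and M = OH and t = "kappa R p H" and g = g])
 have lin: "linear_map R OH (ring_module R) \<mu>" using \<mu> unfolding OHd_iff by (blast intro: lin_dual_linear)
 show "\<mu> f <: R" if "f <: OH" for f using lin_closed[OF lin that] by simp
 fix j
 obtain N where N: "\<And>f. f <: OH ==> f j N = \<zero>\<^bsub>Ak j N\<^esub> ==> ev j (g j) f = \<zero>\<^bsub>Sk j\<^esub>"
  using ev_level[OF T_closed[OF g]] by blast
 have "\<exists>\<psi>. semilinear (Sk k) (red j) (Ak k n) (ring_module (Sk j)) \<psi>
    \<and> (\<forall>x\<in>carrier OH. \<psi> (x k n) = to j (\<mu> x)) \<and> (\<forall>f\<in>carrier OH. \<psi> (f k n) = to j (pair f g))"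
  if k: "max j N \<le> k" "max j N \<le> n" for k n
 proof -
  obtain \<psi> where \<psi>: "semilinear (Sk k) (red j) (Ak k n) (ring_module (Sk j)) \<psi>"
   "\<And>x. x <: OH ==> \<psi> (x k n) = ev j (g j) x"
  proof (rule functional_factor[OF _ ev_additive_right[OF T_closed[OF g]] ev_smult_right[OF T_closed[OF g]], of j k n])
   show "ev j (g j) x = \<zero>\<^bsub>Sk j\<^esub>" if "x <: OH" "x k n = \<zero>\<^bsub>Ak k n\<^esub>" for x
    by (rule N[OF that(1) OH_zero_mono[OF that]]) (use k in auto)
  qed (use k in "blast | simp")+
  then show ?thesis using eq by (intro exI[of _ \<psi>]) (simp add: to_pair[OF _ g, symmetric])
 qed
 then show "\<exists>N. \<forall>k\<ge>N. \<forall>n\<ge>N. j \<le> k \<and> (\<exists>\<psi>. semilinear (Sk k) (red j) (Ak k n) (ring_module (Sk j)) \<psi>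
    \<and> (\<forall>x\<in>carrier OH. \<psi> (x k n) = to j (\<mu> x)) \<and> (\<forall>f\<in>carrier OH. \<psi> (f k n) = to j (pair f g)))"
  by (intro exI[of _ "max j N"]) auto
qed (simp_all add: A.A_module linear_id kappa_copair kappa_approximation g)

lemma fourier_lower_eqI:
 assumes \<nu>: "\<nu> <: Td" and f: "f <: OH" and eq: "\<And>g. g <: T ==> pair f g = \<nu> g"
 shows "fourier_lower R p H \<nu> = f"
 unfolding fourier_lower_def
proof (rule OH_contraction_eqI)
 have lin: "linear_map R T (ring_module R) \<nu>" using \<nu> unfolding Td_iff by (blast intro: lin_dual_linear)
 have \<nu>cl: "\<nu> g <: R" if "g <: T" for g using lin_closed[OF lin that] by simp
 show "\<exists>k\<ge>N. \<exists>n\<ge>N. \<exists>zs. approximates R p H Ak (kappa R p H) OH k n zs" for N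
  using kappa_approximation by blast
 show "f <: OH" by (rule f)
 have sub: "fst z <: OH \<and> snd z <: T"
  if "approximates R p H Ak (kappa R p H) OH k n zs" "z \<in> set zs" for k n zs z
  using that by (auto simp: approximates_def)
 show cl: "lsum OH (map (\<lambda>(x, y). \<nu> y \<odot>\<^bsub>OH\<^esub> x) zs) <: OH"
  if "approximates R p H Ak (kappa R p H) OH k n zs" for k n zs
  unfolding case_prod_unfold using sub[OF that] by (intro lsum_smult_closed OH.module) (auto simp: \<nu>cl)
 fix K M
 have "lsum OH (map (\<lambda>(x, y). \<nu> y \<odot>\<^bsub>OH\<^esub> x) zs) K M = f K M"
  if k: "max K M \<le> k" and n: "max K M \<le> n" and zs: "approximates R p H Ak (kappa R p H) OH k n zs" for k n zs
 proof (rule A.D_separates[OF OH_closed[OF cl[OF zs]] OH_closed[OF f]], fold Dk_eq)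
  fix \<phi> assume \<phi>: "\<phi> <: Dk K M"
  have \<phi>add: "additive OH (Sk K) (\<lambda>x. \<phi> (x K M))"
   by (rule additive_comp[OF OH_proj_additive Dk_additive[OF \<phi>]])
  have \<phi>sm: "\<phi> ((r \<odot>\<^bsub>OH\<^esub> x) K M) = to K r \<otimes>\<^bsub>Sk K\<^esub> \<phi> (x K M)" if "r <: R" "x <: OH" for r x
   unfolding OH_apply(3) using A.D_smult[folded Dk_eq, OF \<phi> to_closed[OF that(1)] OH_closed[OF that(2)]] .
  obtain \<psi> where \<psi>: "semilinear (Sk k) (red K) (Ak k n) (ring_module (Sk K)) \<psi>"
   "\<And>x. x <: OH ==> \<psi> (x k n) = \<phi> (x K M)"
  proof (rule functional_factor[OF _ \<phi>add \<phi>sm, of k n])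
   show "K \<le> k" using k by simp
   show "\<phi> (x K M) = \<zero>\<^bsub>Sk K\<^esub>" if x: "x <: OH" "x k n = \<zero>\<^bsub>Ak k n\<^esub>" for x
   proof -
    have "x K M = \<zero>\<^bsub>Ak K M\<^esub>" by (rule OH_zero_mono[OF x]) (use k n in auto)
    then show ?thesis using additive_zero[OF Dk_additive[OF \<phi>] A.A_group Sk_group] by simp
   qed
  qed blast+
  have zsT: "snd z <: T" "fst z <: OH" if "z \<in> set zs" for z using sub[OF zs that] by auto
  have "\<phi> (lsum OH (map (\<lambda>(x, y). \<nu> y \<odot>\<^bsub>OH\<^esub> x) zs) K M)
   = lsum (Sk K) (map (\<lambda>z. \<phi> ((\<nu> (snd z) \<odot>\<^bsub>OH\<^esub> fst z) K M)) zs)"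
   unfolding case_prod_unfold
   by (rule additive_lsum_map[OF \<phi>add OH_group Sk_group]) (simp add: zsT \<nu>cl)
  also have "\<dots> = lsum (Sk K) (map (\<lambda>(x, y). \<psi> (x k n) \<otimes>\<^bsub>Sk K\<^esub> to K (pair f y)) zs)"
  proof (rule lsum_cong)
   fix z assume z: "z \<in> set zs"
   note zT = zsT[OF z]
   have c: "\<phi> (fst z K M) <: Sk K" by (rule Dk_closed[OF \<phi> OH_closed[OF zT(2)]])
   show "\<phi> ((\<nu> (snd z) \<odot>\<^bsub>OH\<^esub> fst z) K M) = (\<lambda>(x, y). \<psi> (x k n) \<otimes>\<^bsub>Sk K\<^esub> to K (pair f y)) z"
    unfolding case_prod_unfold \<phi>sm[OF \<nu>cl[OF zT(1)] zT(2)] \<psi>(2)[OF zT(2)] eq[OF zT(1)]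
    using c \<nu>cl[OF zT(1)] by (simp add: A.R.m_comm)
  qed
  also have "\<dots> = \<psi> (f k n)"
   by (rule approximation_eval[where Q = Ak, OF _ A.A_module linear_id _ \<psi>(1) f kappa_copair zs]) (use k in auto)
  also have "\<dots> = \<phi> (f K M)" by (rule \<psi>(2)[OF f])
  finally show "\<phi> (lsum OH (map (\<lambda>(x, y). \<nu> y \<odot>\<^bsub>OH\<^esub> x) zs) K M) = \<phi> (f K M)" .
 qed
 then show "\<exists>N. \<forall>k\<ge>N. \<forall>n\<ge>N. \<forall>zs. approximates R p H Ak (kappa R p H) OH k n zs \<longrightarrow>
   lsum OH (map (\<lambda>(x, y). \<nu> y \<odot>\<^bsub>OH\<^esub> x) zs) K M = f K M" by blast
qed

lemma
 assumes "\<mu> <: OHd"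
 shows fourier_upper_closed: "fourier_upper R p H \<mu> <: T"
  and pair_fourier_upper: "\<And>f. f <: OH ==> pair f (fourier_upper R p H \<mu>) = \<mu> f"
proof -
 obtain g where g: "g <: T" "\<And>f. f <: OH ==> pair f g = \<mu> f" using OHd_pair[OF assms] by blast
 have "fourier_upper R p H \<mu> = g" by (rule fourier_upper_eqI[OF assms g])
 then show "fourier_upper R p H \<mu> <: T" "\<And>f. f <: OH ==> pair f (fourier_upper R p H \<mu>) = \<mu> f"
  using g by auto
qed

lemma
 assumes "\<nu> <: Td"
 shows fourier_lower_closed: "fourier_lower R p H \<nu> <: OH"
  and pair_fourier_lower: "\<And>g. g <: T ==> pair (fourier_lower R p H \<nu>) g = \<nu> g"
proof -
 obtain f where f: "f <: OH" "\<And>g. g <: T ==> pair f g = \<nu> g" using Td_pair[OF assms] by blast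
 have "fourier_lower R p H \<nu> = f" by (rule fourier_lower_eqI[OF assms f])
 then show "fourier_lower R p H \<nu> <: OH" "\<And>g. g <: T ==> pair (fourier_lower R p H \<nu>) g = \<nu> g"
  using f by auto
qed

text \<open>Here \<open>F\<close> sends a functional to the element that represents it for the pairing \<open>\<beta>\<close>; its inverse is given by pairing.\<close>

lemma representing_iso:
 assumes M: "module R M" and N: "module R N" and sub: "carrier X \<subseteq> carrier (lin_dual R M)"
  and ops: "add X = add (lin_dual R M)" "smult X = smult (lin_dual R M)"
  and \<beta>: "\<And>x. x <: M ==> linear_map R N (ring_module R) (\<lambda>y. \<beta> y x)"
  and restr: "\<And>y. y <: N ==> (\<lambda>x\<in>carrier M. \<beta> y x) <: X"
  and F: "\<And>\<mu>. \<mu> <: X ==> F \<mu> <: N" "\<And>\<mu> x. \<mu> <: X ==> x <: M ==> \<beta> (F \<mu>) x = \<mu> x"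
  and uniq: "\<And>\<mu> y. \<mu> <: X ==> y <: N ==> (\<And>x. x <: M ==> \<beta> y x = \<mu> x) ==> F \<mu> = y"
 shows "linear_iso R X N F"
proof -
 interpret N: module R N by fact
 interpret D: module R "lin_dual R M" by (rule lin_dual_module[OF M])
 have Xeq: "\<mu> = (\<lambda>x\<in>carrier M. \<beta> y x)"
  if "\<mu> <: lin_dual R M" "y <: N" "\<And>x. x <: M ==> \<beta> y x = \<mu> x" for \<mu> y
  using restr[OF that(2)] that sub by (intro lin_dual_eqI[of _ R M]) auto
 have rep: "\<mu> <: X \<and> F \<mu> = y"
  if "\<mu> <: lin_dual R M" "y <: N" "\<And>x. x <: M ==> \<beta> y x = \<mu> x" for \<mu> y
  using Xeq[OF that] restr[OF that(2)] uniq[OF _ that(2,3)] by metis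
 have "F (\<mu> \<oplus>\<^sub>X \<mu>') = F \<mu> \<oplus>\<^sub>N F \<mu>'" if \<mu>: "\<mu> <: X" "\<mu>' <: X" for \<mu> \<mu>'
 proof (rule conjunct2[OF rep])
  show "\<mu> \<oplus>\<^sub>X \<mu>' <: lin_dual R M" unfolding ops by (rule D.M.a_closed) (use \<mu> sub in blast)+
 qed (use \<mu> F in "simp_all add: ops lin_dual_simps(3) additive_add[OF lin_additive[OF \<beta>]]")
 moreover have "F (r \<odot>\<^sub>X \<mu>) = r \<odot>\<^sub>N F \<mu>" if "r <: R" "\<mu> <: X" for r \<mu>
 proof (rule conjunct2[OF rep])
  show "r \<odot>\<^sub>X \<mu> <: lin_dual R M" unfolding ops by (rule D.smult_closed) (use that sub in blast)+
 qed (use that F in "simp_all add: ops lin_dual_simps(4) lin_smult[OF \<beta>]")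
 moreover have "bij_betw F (carrier X) (carrier N)"
 proof (rule bij_betw_imageI)
  show "inj_on F (carrier X)"
  proof (rule inj_onI)
   fix \<mu> \<mu>' assume \<mu>: "\<mu> <: X" "\<mu>' <: X" "F \<mu> = F \<mu>'"
   show "\<mu> = \<mu>'" by (rule lin_dual_eqI[of _ R M]) (use \<mu> sub in blast, use \<mu> sub in blast, metis F(2) \<mu>)
  qed
  show "F ` carrier X = carrier N"
  proof (intro equalityI subsetI)
   fix y assume y: "y <: N"
   have "F (\<lambda>x\<in>carrier M. \<beta> y x) = y" by (rule uniq[OF restr[OF y] y]) simp
   then show "y \<in> F ` carrier X" using restr[OF y] by (metis image_eqI)
  qed (use F(1) in auto)
 qed
 ultimately show ?thesis using F(1) by (auto simp: linear_iso_def semilinear_def)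
qed

lemma pair_linear_left: "g <: T ==> linear_map R OH (ring_module R) (\<lambda>f. pair f g)"
 using pair_additive_left[of g] by (auto intro!: semilinearI simp: additive_def pair_smult_left)

theorem fourier_upper_iso: "linear_iso R OHd T (fourier_upper R p H)"
proof (rule representing_iso[where \<beta> = "\<lambda>g f. pair f g", OF OH.module T.module _ dual_simps(1,2) pair_linear_right])
 show "carrier OHd \<subseteq> carrier (lin_dual R OH)" using OHd_iff by blast
qed (simp_all only: pair_in_OHd fourier_upper_closed pair_fourier_upper fourier_upper_eqI)

theorem fourier_lower_iso: "linear_iso R Td OH (fourier_lower R p H)"
proof (rule representing_iso[where \<beta> = pair, OF T.module OH.module _ dual_simps(3,4) pair_linear_left])
 show "carrier Td \<subseteq> carrier (lin_dual R T)" using Td_iff by blast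
qed (simp_all only: pair_in_Td fourier_lower_closed pair_fourier_lower fourier_lower_eqI)

end

section \<open>Differentials on the group\<close>

context hopf_alg
begin

lemma Inv_eq: "carrier Inv = \<theta> ` carrier A"
proof
 show "carrier Inv \<subseteq> \<theta> ` carrier A" by (auto elim!: invariant_\<theta>)
 show "\<theta> ` carrier A \<subseteq> carrier Inv" using \<theta>_invariant by blast
qed

lemma A_cring: "cring A"
 using algebra by (simp add: algebra_def)

lemma A_ring: "ring A"
 by (rule cring.axioms(1)[OF A_cring])

lemma Inv_closed: "w <: Inv ==> w <: \<Omega>"
 by (simp add: Inv_simps)

lemma Inv_module: "module S Inv"
proof -
 interpret W: module S \<Omega> by (rule kahler_module)
 note \<theta>_add = additive_add[OF \<theta>_additive] and \<theta>_smult = lin_smult[OF \<theta>_linear]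
 have add: "v \<oplus>\<^sub>\<Omega> w <: Inv" if "v <: Inv" "w <: Inv" for v w
  using that M.a_closed unfolding Inv_eq by (auto simp: \<theta>_add[symmetric])
 have smult: "r \<odot>\<^sub>\<Omega> w <: Inv" if "r <: S" "w <: Inv" for r w
  using that smult_closed unfolding Inv_eq by (auto simp: \<theta>_smult[symmetric])
 have zero: "\<zero>\<^sub>\<Omega> <: Inv"
  using imageI[OF M.zero_closed, of \<theta>] additive_zero[OF \<theta>_additive A_group kahler_group] by (simp add: Inv_eq)
 have neg: "\<ominus>\<^sub>\<Omega> w <: Inv" if "w <: Inv" for w
  using that M.a_inv_closed unfolding Inv_eq
  by (auto simp: additive_minus[OF \<theta>_additive A_group kahler_group, symmetric])
 have "abelian_group Inv"
 proof (rule abelian_groupI)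
  fix w assume w: "w <: Inv"
  show "\<exists>v\<in>carrier Inv. v \<oplus>\<^bsub>Inv\<^esub> w = \<zero>\<^bsub>Inv\<^esub>"
   by (rule bexI[OF _ neg[OF w]]) (simp add: Inv_simps(2,3) W.M.l_neg Inv_closed w)
 qed (simp_all add: Inv_simps(2,3) Inv_closed W.M.a_ac add zero)
 then show ?thesis
  by (intro moduleI R.is_cring)
   (use smult in "auto simp: Inv_simps(2,4) Inv_closed W.smult_l_distr W.smult_r_distr W.smult_assoc1")
qed

text \<open>This ideal consists of the functions that vanish to second order at the origin.\<close>

lemma second_order_ideal: "ideal {b \<in> carrier A. \<epsilon> b = \<zero>\<^sub>S \<and> \<theta> b = \<zero>\<^sub>\<Omega>} A" (is "ideal ?J A")
proof -
 interpret W: module S \<Omega> by (rule kahler_module)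
 note e = ring_hom_additive[OF counit_hom]
 note ez = additive_zero[OF e A_group R.abelian_group_axioms] and tz = additive_zero[OF \<theta>_additive A_group kahler_group]
 have mz: "\<ominus>\<^sub>S \<zero>\<^sub>S = \<zero>\<^sub>S" "\<ominus>\<^sub>\<Omega> \<zero>\<^sub>\<Omega> = \<zero>\<^sub>\<Omega>"
  by (rule R.minus_equality; simp) (rule W.M.minus_equality; simp)
 have l: "x \<otimes>\<^sub>A a \<in> ?J" if "a \<in> ?J" "x <: A" for a x
  using that by (simp add: \<theta>_mult ring_hom_mult[OF counit_hom])
 show ?thesis
 proof (rule idealI)
  show "ring A" by (rule A_ring)
  show "subgroup ?J (add_monoid A)"
  proof (rule group.subgroupI[OF M.a_group])
   show "?J \<noteq> {}" using ez tz by auto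
   show "inv\<^bsub>add_monoid A\<^esub> a \<in> ?J" if "a \<in> ?J" for a
    using that mz by (simp add: a_inv_def[symmetric] additive_minus[OF e A_group R.abelian_group_axioms]
      additive_minus[OF \<theta>_additive A_group kahler_group])
  qed (auto simp: additive_add[OF e] additive_add[OF \<theta>_additive])
  show "x \<otimes>\<^sub>A a \<in> ?J" if "a \<in> ?J" "x <: A" for a x by (rule l[OF that])
  show "a \<otimes>\<^sub>A x \<in> ?J" if "a \<in> ?J" "x <: A" for a x
   using l[OF that] that by (simp add: m_comm)
 qed
qed

text \<open>
 A derivation \<open>f\<close> at the origin extends to differentials by \<open>a db \<mapsto> \<epsilon>(a) f(b)\<close>, and \<open>\<theta>(b)\<close> agrees with \<open>db\<close> at the origin.
\<close>

lemma origin_lift: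
 assumes P: "module S P" and f: "linear_map S A P f"
  and leib: "\<And>b c. b <: A ==> c <: A ==>
    f (b \<otimes>\<^sub>A c) = \<epsilon> b \<odot>\<^sub>P f c \<oplus>\<^sub>P \<epsilon> c \<odot>\<^sub>P f b"
 shows "\<exists>G. additive \<Omega> P G \<and> (\<forall>b\<in>carrier A. G (\<theta> b) = f b)"
proof -
 interpret P: module S P by fact
 note Pg = P.M.abelian_group_axioms
 let ?G = "fs_lift P (\<lambda>(a, b). \<epsilon> a \<odot>\<^sub>P f b)"
 note G = kahler_lift[OF Pg origin_form[OF P f leib]]
 note fc = lin_closed[OF f] and Gc = additive_closed[OF G(1)]
 have act: "?G (act x w) = \<epsilon> x \<odot>\<^sub>P ?G w" if x: "x <: A" and w: "w <: \<Omega>" for x w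
 proof (rule kahler_map_eqI[OF additive_comp[OF kahler_act_additive[OF x] G(1)]
    additive_comp[OF G(1) lin_additive[OF linear_smult_right[OF P counit_closed[OF x]]]] Pg _ w])
  fix a b assume ab: "a <: A" "b <: A"
  have "act x (act a (d b)) = act (x \<otimes>\<^sub>A a) (d b)" using x ab by (simp add: kahler_act_assoc)
  then show "?G (act x (act a (d b))) = \<epsilon> x \<odot>\<^sub>P ?G (act a (d b))"
   using x ab by (simp add: G(2) fc ring_hom_mult[OF counit_hom] P.smult_assoc1)
 qed
 have "?G (\<theta> b) = f b" if b: "b <: A" for b
 proof -
  have "f b = ?G (act \<one>\<^sub>A (d b))" using b by (simp add: G(2) fc ring_hom_one[OF counit_hom])
  also have "act \<one>\<^sub>A (d b) = sw \<Omega> (\<lambda>x y. act x (\<theta> y)) b" using b by (simp add: d_via_\<theta> kahler_act_one)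
  also have "?G \<dots> = sw P (\<lambda>x y. ?G (act x (\<theta> y))) b" by (rule sw_map[OF G(1) kahler_group Pg b]) auto
  also have "\<dots> = sw P (\<lambda>x y. ?G (\<theta> (\<epsilon> x \<odot>\<^sub>A y))) b"
  proof (rule sw_cong[OF b])
   fix x y assume xy: "x <: A" "y <: A"
   have e: "\<epsilon> (\<epsilon> x \<odot>\<^sub>A \<one>\<^sub>A) = \<epsilon> x"
    using lin_smult[OF counit_linear, of "\<epsilon> x" "\<one>\<^sub>A"] xy by (simp add: ring_hom_one[OF counit_hom])
   have "\<theta> (\<epsilon> x \<odot>\<^sub>A y) = act (\<epsilon> x \<odot>\<^sub>A \<one>\<^sub>A) (\<theta> y)"
    using xy by (simp add: act_scalar lin_smult[OF \<theta>_linear])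
   then show "?G (act x (\<theta> y)) = ?G (\<theta> (\<epsilon> x \<odot>\<^sub>A y))" using xy by (simp add: act e)
  qed
  also have "\<dots> = ?G (\<theta> b)" by (rule sw_counit_left[OF additive_comp[OF \<theta>_additive G(1)] Pg b])
  finally show ?thesis by simp
 qed
 with G(1) show ?thesis by blast
qed

end

text \<open>
 The module of values at the origin is the cotangent space \<open>I/I\<^sup>2\<close> with \<open>I\<close> the ideal of the origin.  So if \<open>\<theta>(f b) = 0\<close>
 then \<open>f b\<close> is constant up to \<open>I\<^sup>2\<close>, and elements of \<open>I\<^sup>2\<close> lift along \<open>f\<close>.
\<close>

lemma \<theta>_kernel:
 assumes A: "hopf_alg S A" and B: "hopf_alg S' B" and f: "hopf_hom S S' h A B f" and h: "h \<in> ring_hom S S'"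
  and surj: "f ` carrier A = carrier B" and b: "b <: A" and z: "hopf_alg.\<theta> S' B (f b) = \<zero>\<^bsub>kahler S' B\<^esub>"
 shows "\<exists>c\<in>carrier A. hopf_alg.\<theta> S A c = \<zero>\<^bsub>kahler S A\<^esub> \<and> f c = f b"
proof -
 interpret A: hopf_alg S A by fact
 interpret B: hopf_alg S' B by fact
 interpret W: module S "kahler S A" by (rule A.kahler_module)
 note fr = hopf_homD(1)[OF f] and fs = hopf_homD(2)[OF f]
 note fadd = ring_hom_additive[OF fr] and fcl = ring_hom_closed[OF fr]
 let ?J0 = "{b \<in> carrier A. A.\<epsilon> b = \<zero>\<^sub>S \<and> A.\<theta> b = \<zero>\<^bsub>kahler S A\<^esub>}"
 define J where "J = f ` ?J0"
 have JE: "\<exists>c. c \<in> ?J0 \<and> x = f c" if "x \<in> J" for x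
  using that unfolding J_def by (elim imageE) (intro exI conjI)
 have J_sub: "x <: B" if "x \<in> J" for x using JE[OF that] fcl by (elim exE conjE) simp
 note J0 = A.second_order_ideal and J0_sub = ideal.axioms(1)[OF A.second_order_ideal]
 interpret J: ideal J B
 proof (rule idealI)
  show "ring B" by (rule B.A_ring)
  show "subgroup J (add_monoid B)"
  proof (rule group.subgroupI[OF B.M.a_group])
   show "J \<subseteq> carrier (add_monoid B)" by (rule subsetI) (simp add: J_sub)
   show "J \<noteq> {}" unfolding J_def image_is_empty by (rule ex_in_conv[THEN iffD1, OF exI, OF additive_subgroup.zero_closed[OF J0_sub]])
   show "inv\<^bsub>add_monoid B\<^esub> x \<in> J" if xJ: "x \<in> J" for x
   proof -
    obtain c where c: "c \<in> ?J0" "x = f c" using JE[OF xJ] by (elim exE conjE)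
    have "\<ominus>\<^sub>B x = f (\<ominus>\<^sub>A c)" using additive_minus[OF fadd A.A_group B.A_group] c by simp
    then show ?thesis using imageI[OF additive_subgroup.a_inv_closed[OF J0_sub c(1)], of f] by (simp add: J_def a_inv_def)
   qed
   show "x \<otimes>\<^bsub>add_monoid B\<^esub> y \<in> J" if xy: "x \<in> J" "y \<in> J" for x y
   proof -
    obtain c c' where c: "c \<in> ?J0" "x = f c" "c' \<in> ?J0" "y = f c'" using JE[OF xy(1)] JE[OF xy(2)] by (elim exE conjE)
    have "x \<oplus>\<^sub>B y = f (c \<oplus>\<^sub>A c')" using c by (simp add: additive_add[OF fadd])
    then show ?thesis using imageI[OF additive_subgroup.a_closed[OF J0_sub c(1,3)], of f] by (simp only: J_def monoid.simps)
   qed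
  qed
  show l: "x \<otimes>\<^sub>B a \<in> J" if ax: "a \<in> J" "x <: B" for a x
  proof -
   obtain c where c: "c \<in> ?J0" "a = f c" using JE[OF ax(1)] by (elim exE conjE)
   have "x \<in> f ` carrier A" using ax(2) by (simp only: surj)
   then obtain y where y: "y <: A" "x = f y" by (elim imageE)
   have "x \<otimes>\<^sub>B a = f (y \<otimes>\<^sub>A c)" using c y by (simp add: ring_hom_mult[OF fr])
   then show ?thesis using imageI[OF ideal.I_l_closed[OF J0 c(1) y(1)], of f] by (simp only: J_def)
  qed
  show "a \<otimes>\<^sub>B x \<in> J" if ax: "a \<in> J" "x <: B" for a x
  proof -
   have "a <: B" by (rule J_sub[OF ax(1)])
   then show ?thesis using l[OF ax] ax by (simp add: B.m_comm)
  qed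
 qed
 let ?Q = "B Quot J"
 define \<pi> where "\<pi> x = J +>\<^sub>B x" for x
 have \<pi>: "\<pi> \<in> ring_hom B ?Q" using J.rcos_ring_hom by (simp add: \<pi>_def[abs_def])
 have \<pi>z: "\<pi> x = \<zero>\<^bsub>?Q\<^esub> \<longleftrightarrow> x \<in> J" if "x <: B" for x
  using J.a_rcos_self[OF that] J.a_rcos_const[of x] by (auto simp: \<pi>_def FactRing_def)
 have cQ: "cring ?Q" by (rule J.quotient_is_cring[OF B.A_cring])
 interpret Q: cring ?Q by (rule cQ)
 note Qm = algebra_module[OF algebra_ring_module[OF cQ]]
 define u where "u r = \<pi> (r \<odot>\<^sub>B \<one>\<^sub>B)" for r
 have sc: "(r \<odot>\<^sub>B \<one>\<^sub>B) \<otimes>\<^sub>B x = r \<odot>\<^sub>B x" if "r <: S'" "x <: B" for r x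
  using that by (simp add: B.smult_assoc2)
 have u: "u \<in> ring_hom S' ?Q"
  unfolding u_def
  by (rule ring_hom_memI)
   (simp_all add: ring_hom_closed[OF \<pi>] ring_hom_add[OF \<pi>, symmetric] ring_hom_mult[OF \<pi>, symmetric] ring_hom_one[OF \<pi>]
     B.smult_l_distr B.smult_assoc1 sc)
 \<comment> \<open>\<open>x \<mapsto> x - \<epsilon>(x)\<close> becomes a derivation at the origin modulo products of functions vanishing there, which lie in \<open>J\<close>.\<close>
 let ?P = "restr u (ring_module ?Q)"
 have P: "module S' ?P" by (rule restr_module[OF B.R.is_cring Qm u])
 let ?c = "\<lambda>x. B.\<epsilon> x \<odot>\<^sub>B \<one>\<^sub>B"
 define q where "q x = x \<ominus>\<^sub>B ?c x" for x
 have qcl: "q x <: B" if "x <: B" for x using that by (simp add: q_def)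
 have q: "linear_map S' B B q"
  using B.counit_linear unfolding q_def
  by (intro semilinearI additive_mapI)
   (simp_all add: ring_hom_add[OF B.counit_hom] lin_smult[OF B.counit_linear] B.smult_l_distr B.smult_assoc1
    a_minus_def B.smult_r_distr B.smult_r_minus B.M.minus_add B.M.a_ac)
 have decomp: "x = q x \<oplus>\<^sub>B ?c x" if "x <: B" for x
  using that by (simp add: q_def a_minus_def B.M.a_assoc B.M.l_neg)
 have lift0: "\<exists>y\<in>carrier A. A.\<epsilon> y = \<zero>\<^sub>S \<and> f y = q x" if x: "x <: B" for x
 proof -
  have "x \<in> f ` carrier A" using x by (simp only: surj)
  then obtain y where y: "y <: A" "x = f y" by (elim imageE)
  let ?y = "y \<ominus>\<^sub>A A.\<epsilon> y \<odot>\<^sub>A \<one>\<^sub>A"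
  have k: "A.\<epsilon> y \<odot>\<^sub>A \<one>\<^sub>A <: A" using y by simp
  have "A.\<epsilon> ?y = A.\<epsilon> y \<ominus>\<^sub>S A.\<epsilon> y"
   unfolding additive_diff[OF ring_hom_additive[OF A.counit_hom] A.A_group A.R.abelian_group_axioms y(1) k]
   using lin_smult[OF A.counit_linear A.counit_closed[OF y(1)] A.one_closed] y(1)
   by (simp add: ring_hom_one[OF A.counit_hom])
  then have "A.\<epsilon> ?y = \<zero>\<^sub>S" using y(1) by (simp add: a_minus_def A.R.r_neg)
  moreover have "f ?y = q x"
   unfolding additive_diff[OF fadd A.A_group B.A_group y(1) k]
   using y by (simp add: q_def hopf_homD(4)[OF f] lin_smult[OF fs] ring_hom_one[OF fr])
  ultimately show ?thesis using y(1) k by (intro bexI[of _ ?y]) auto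
 qed
 have prod: "q x \<otimes>\<^sub>B q y \<in> J" if xy: "x <: B" "y <: B" for x y
 proof -
  obtain x0 y0 where 0: "x0 <: A" "A.\<epsilon> x0 = \<zero>\<^sub>S" "f x0 = q x" "y0 <: A" "A.\<epsilon> y0 = \<zero>\<^sub>S" "f y0 = q y"
   using lift0[OF xy(1)] lift0[OF xy(2)] by blast
  have m: "x0 \<otimes>\<^sub>A y0 \<in> ?J0" using 0 by (simp add: A.\<theta>_mult ring_hom_mult[OF A.counit_hom])
  have e: "f (x0 \<otimes>\<^sub>A y0) = q x \<otimes>\<^sub>B q y" using 0 by (simp add: ring_hom_mult[OF fr])
  show ?thesis unfolding J_def e[symmetric] by (rule imageI[OF m])
 qed
 have lin: "linear_map S' B ?P (\<lambda>x. \<pi> (q x))"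
 proof (rule semilinearI)
  show "additive B ?P (\<lambda>x. \<pi> (q x))"
   using additive_comp[OF lin_additive[OF q] ring_hom_additive[OF \<pi>]] by (simp add: additive_def)
  show "\<pi> (q (r \<odot>\<^sub>B x)) = r \<odot>\<^bsub>?P\<^esub> \<pi> (q x)" if "r <: S'" "x <: B" for r x
   using that qcl by (simp add: lin_smult[OF q] u_def ring_hom_mult[OF \<pi>, symmetric] sc)
 qed
 have leib: "\<pi> (q (x \<otimes>\<^sub>B y)) = B.\<epsilon> x \<odot>\<^bsub>?P\<^esub> \<pi> (q y) \<oplus>\<^bsub>?P\<^esub> B.\<epsilon> y \<odot>\<^bsub>?P\<^esub> \<pi> (q x)"
  if xy: "x <: B" "y <: B" for x y
 proof -
  have c: "?c x <: B" "?c y <: B" "q x <: B" "q y <: B" using xy qcl by auto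
  have cc: "?c (x \<otimes>\<^sub>B y) = ?c x \<otimes>\<^sub>B ?c y"
   using xy by (simp add: ring_hom_mult[OF B.counit_hom] sc B.smult_assoc1)
  have "x \<otimes>\<^sub>B y = (q x \<oplus>\<^sub>B ?c x) \<otimes>\<^sub>B (q y \<oplus>\<^sub>B ?c y)"
   using decomp[OF xy(1)] decomp[OF xy(2)] by simp
  then have "q (x \<otimes>\<^sub>B y) = (q x \<oplus>\<^sub>B ?c x) \<otimes>\<^sub>B (q y \<oplus>\<^sub>B ?c y) \<ominus>\<^sub>B ?c x \<otimes>\<^sub>B ?c y"
   unfolding q_def[of "x \<otimes>\<^sub>B y"] cc by (rule arg_cong)
  also have "\<dots> = q x \<otimes>\<^sub>B q y \<oplus>\<^sub>B (?c x \<otimes>\<^sub>B q y \<oplus>\<^sub>B ?c y \<otimes>\<^sub>B q x)"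
   using c by (simp add: a_minus_def B.l_distr B.r_distr B.M.a_ac B.m_comm B.M.r_neg B.M.r_neg1 B.M.r_neg2)
  finally show ?thesis
   using c \<pi>z[of "q x \<otimes>\<^sub>B q y"] prod[OF xy] by (simp add: u_def ring_hom_add[OF \<pi>] ring_hom_mult[OF \<pi>] ring_hom_closed[OF \<pi>])
 qed
 obtain G where G: "additive (kahler S' B) ?P G" "\<And>x. x <: B ==> G (B.\<theta> x) = \<pi> (q x)"
  using B.origin_lift[OF P lin leib] by blast
 have fb: "f b <: B" using fcl[OF b] .
 have "\<pi> (q (f b)) = \<zero>\<^bsub>?Q\<^esub>"
  using G(2)[OF fb] z additive_zero[OF G(1) B.kahler_group module_group[OF P]] by simp
 then obtain c where c: "c \<in> ?J0" "q (f b) = f c" using \<pi>z[OF qcl[OF fb]] JE by blast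
 let ?c = "c \<oplus>\<^sub>A A.\<epsilon> b \<odot>\<^sub>A \<one>\<^sub>A"
 have "A.\<theta> ?c = \<zero>\<^bsub>kahler S A\<^esub>"
  using c(1) b by (simp add: additive_add[OF A.\<theta>_additive] lin_smult[OF A.\<theta>_linear] A.\<theta>_one)
 moreover have "f ?c = f b"
  using c b decomp[OF fb] by (simp add: additive_add[OF fadd] lin_smult[OF fs] ring_hom_one[OF fr] hopf_homD(4)[OF f])
 ultimately show ?thesis using c(1) b by (intro bexI[of _ ?c]) auto
qed

context p_div_group
begin

abbreviation "Om k n \<equiv> kahler (Sk k) (Ak k n)"
abbreviation "In k n \<equiv> invariant_differentials (Sk k) (Ak k n)"
abbreviation "th k n \<equiv> hopf_alg.\<theta> (Sk k) (Ak k n)"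
abbreviation "Res k n \<equiv> kahler_map (Sk k) (Ak k n) (res k n)"
abbreviation "Bc k n \<equiv> kahler_map (Sk k) (Ak k n) (bch k n)"
abbreviation "WH \<equiv> Omega_H R p H"
abbreviation "wH \<equiv> omega_H R p H"

lemma id_hom: "(\<lambda>r. r) \<in> ring_hom S S"
 by (rule ring_hom_memI) auto

lemma red_Suc_hom: "red k \<in> ring_hom (Sk (Suc k)) (Sk k)"
 by (rule red_hom) simp

lemma red_image: "red k ` carrier (Sk (Suc k)) \<subseteq> carrier (Sk k)"
 by (simp only: red_surj order_refl)

lemmas Res_semilinear = kahler_map_semilinear[OF A.algebra A.algebra res_ring_hom res_linear, simplified]
lemmas Res_act = kahler_map_act[OF A.algebra A.algebra res_ring_hom res_linear, simplified]
lemmas Res_d = kahler_map_d[OF A.algebra A.algebra res_ring_hom res_linear, simplified]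
lemmas Bc_semilinear = kahler_map_semilinear[OF A.algebra A.algebra bc_ring_hom bc_semilinear red_image]
lemmas Bc_act = kahler_map_act[OF A.algebra A.algebra bc_ring_hom bc_semilinear red_image]
lemmas Bc_d = kahler_map_d[OF A.algebra A.algebra bc_ring_hom bc_semilinear red_image]
lemmas Res_\<theta> = kahler_map_\<theta>[OF A_hopf A_hopf res_hom id_hom]
lemmas Bc_\<theta> = kahler_map_\<theta>[OF A_hopf A_hopf bc_hom red_Suc_hom]
lemmas Res_additive = lin_additive[OF Res_semilinear]
lemmas Bc_additive = lin_additive[OF Bc_semilinear]
lemmas Om_module = A.kahler_module
lemmas Om_group = A.kahler_group

lemma Bc_Res:
 assumes "w <: Om (Suc k) (Suc n)"
 shows "Res k n (Bc k (Suc n) w) = Bc k n (Res (Suc k) n w)"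
proof (rule A.kahler_map_eqI[OF _ _ Om_group _ assms])
 show "additive (Om (Suc k) (Suc n)) (Om k n) (\<lambda>w. Res k n (Bc k (Suc n) w))"
  by (rule additive_comp[OF Bc_additive Res_additive])
 show "additive (Om (Suc k) (Suc n)) (Om k n) (\<lambda>w. Bc k n (Res (Suc k) n w))"
  by (rule additive_comp[OF Res_additive Bc_additive])
 show "Res k n (Bc k (Suc n) (A.act (Suc k) (Suc n) a (A.d (Suc k) (Suc n) b)))
   = Bc k n (Res (Suc k) n (A.act (Suc k) (Suc n) a (A.d (Suc k) (Suc n) b)))"
  if "a <: Ak (Suc k) (Suc n)" "b <: Ak (Suc k) (Suc n)" for a b
  using that by (simp add: Res_act Res_d Bc_act Bc_d bc_res)
qed

lemma In_closed: "w <: In k n ==> w <: Om k n"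
 by (rule A.Inv_closed)

lemma In_Res: "w <: In k (Suc n) ==> Res k n w <: In k n"
 unfolding A.Inv_eq by (auto simp: Res_\<theta>)

lemma In_Bc: "w <: In (Suc k) n ==> Bc k n w <: In k n"
 unfolding A.Inv_eq by (auto simp: Bc_\<theta>)

lemma WH_iff: "w <: WH \<longleftrightarrow> (\<forall>k n. w k n <: Om k n \<and> Res k n (w k (Suc n)) = w k n)
  \<and> (\<forall>k n. Bc k n (w (Suc k) n) = w k n)"
 by (auto simp: Omega_H_def invlim_simps fun_eq_iff)

lemma wH_iff: "w <: wH \<longleftrightarrow> w <: WH \<and> (\<forall>k n. w k n <: In k n)"
 by (auto simp: omega_H_def WH_iff invlim_simps fun_eq_iff In_closed)

lemma WH_apply:
 "(v \<oplus>\<^bsub>WH\<^esub> w) k n = v k n \<oplus>\<^bsub>Om k n\<^esub> w k n" "(r \<odot>\<^bsub>WH\<^esub> w) k n = to k r \<odot>\<^bsub>Om k n\<^esub> w k n"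
 "\<zero>\<^bsub>WH\<^esub> k n = \<zero>\<^bsub>Om k n\<^esub>"
 by (simp_all add: Omega_H_def invlim_simps)

lemma wH_apply:
 "(v \<oplus>\<^bsub>wH\<^esub> w) k n = v k n \<oplus>\<^bsub>Om k n\<^esub> w k n" "(r \<odot>\<^bsub>wH\<^esub> w) k n = to k r \<odot>\<^bsub>Om k n\<^esub> w k n"
 "\<zero>\<^bsub>wH\<^esub> k n = \<zero>\<^bsub>Om k n\<^esub>"
 by (simp_all add: omega_H_def invlim_simps A.Inv_simps)

lemma WH_module: "module R WH"
 unfolding Omega_H_def
proof (rule invlim_module[where S = Sk, OF R _ to_hom])
 let ?L = "\<lambda>k. invlim (Om k) (Res k) (\<lambda>n r. r)"
 show "module (Sk k) (?L k)" for k
 proof (rule invlim_module[where S = "\<lambda>n. Sk k", OF Sk_cring Om_module id_hom])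
  show "additive (Om k (Suc n)) (Om k n) (Res k n)" for n by (rule Res_additive)
  show "Res k n (r \<odot>\<^bsub>Om k (Suc n)\<^esub> x) = r \<odot>\<^bsub>Om k n\<^esub> Res k n x"
   if "r <: Sk k" "x <: Om k (Suc n)" for n r x
   by (rule lin_smult[OF Res_semilinear that])
 qed
 show "additive (?L (Suc k)) (?L k) (\<lambda>w n. Bc k n (w n))" for k
  by (rule additive_mapI)
   (auto simp: invlim_simps fun_eq_iff additive_closed[OF Bc_additive] additive_add[OF Bc_additive] Bc_Res)
 show "(\<lambda>n. Bc k n ((to (Suc k) r \<odot>\<^bsub>?L (Suc k)\<^esub> w) n)) = to k r \<odot>\<^bsub>?L k\<^esub> (\<lambda>n. Bc k n (w n))"
  if "r <: R" "w <: ?L (Suc k)" for k r w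
  using that by (auto simp: invlim_simps fun_eq_iff lin_smult[OF Bc_semilinear] red_to)
qed

lemma wH_module: "module R wH"
 unfolding omega_H_def
proof (rule invlim_module[where S = Sk, OF R _ to_hom])
 let ?L = "\<lambda>k. invlim (In k) (Res k) (\<lambda>n r. r)"
 show "module (Sk k) (?L k)" for k
 proof (rule invlim_module[where S = "\<lambda>n. Sk k", OF Sk_cring A.Inv_module id_hom])
  show "additive (In k (Suc n)) (In k n) (Res k n)" for n
   by (rule additive_mapI) (auto simp: In_Res A.Inv_simps(2) In_closed additive_add[OF Res_additive])
  show "Res k n (r \<odot>\<^bsub>In k (Suc n)\<^esub> x) = r \<odot>\<^bsub>In k n\<^esub> Res k n x"
   if "r <: Sk k" "x <: In k (Suc n)" for n r x
   using that by (simp add: A.Inv_simps(4) In_closed lin_smult[OF Res_semilinear])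
 qed
 show "additive (?L (Suc k)) (?L k) (\<lambda>w n. Bc k n (w n))" for k
  by (rule additive_mapI)
   (auto simp: invlim_simps fun_eq_iff In_Bc A.Inv_simps(2) In_closed additive_add[OF Bc_additive] Bc_Res)
 show "(\<lambda>n. Bc k n ((to (Suc k) r \<odot>\<^bsub>?L (Suc k)\<^esub> w) n)) = to k r \<odot>\<^bsub>?L k\<^esub> (\<lambda>n. Bc k n (w n))"
  if "r <: R" "w <: ?L (Suc k)" for k r w
  using that by (auto simp: invlim_simps fun_eq_iff A.Inv_simps(4) In_closed lin_smult[OF Bc_semilinear] red_to)
qed

sublocale WH: module R WH by (rule WH_module)
sublocale wH: module R wH by (rule wH_module)

lemma WH_group: "abelian_group WH" by (rule WH.M.abelian_group_axioms)
lemma wH_group: "abelian_group wH" by (rule wH.M.abelian_group_axioms)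

lemma wH_WH: "w <: wH ==> w <: WH" by (simp add: wH_iff)
lemma wH_In: "w <: wH ==> w k n <: In k n" by (simp add: wH_iff)
lemma WH_Om: "w <: WH ==> w k n <: Om k n" by (simp add: WH_iff)
lemma WH_Res: "w <: WH ==> Res k n (w k (Suc n)) = w k n" by (simp add: WH_iff)
lemma WH_Bc: "w <: WH ==> Bc k n (w (Suc k) n) = w k n" by (simp add: WH_iff)

lemma WH_proj_additive: "additive WH (Om k n) (\<lambda>w. w k n)"
 by (rule additive_mapI) (auto simp: WH_apply WH_Om)

lemma wH_proj_additive: "additive wH (Om k n) (\<lambda>w. w k n)"
 by (rule additive_mapI) (auto simp: wH_apply WH_Om wH_WH)

lemmas WH_apply_diff = additive_diff[OF WH_proj_additive WH_group Om_group]
lemmas wH_apply_diff = additive_diff[OF wH_proj_additive wH_group Om_group]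
lemmas wH_apply_pow = additive_add_pow[OF wH_proj_additive wH_group Om_group]

lemma WH_zero_mono:
 assumes w: "w <: WH" "w k n = \<zero>\<^bsub>Om k n\<^esub>" and le: "j \<le> k" "m \<le> n"
 shows "w j m = \<zero>\<^bsub>Om j m\<^esub>"
proof -
 have "w k m = \<zero>\<^bsub>Om k m\<^esub>" using le(2) w(2)
 proof (induction rule: inc_induct)
  case (step i)
  show ?case
   unfolding WH_Res[OF w(1), of k i, symmetric] step.IH[OF step.prems]
   by (rule additive_zero[OF Res_additive Om_group Om_group])
 qed
 with le(1) show ?thesis
 proof (induction rule: inc_induct)
  case (step i)
  show ?case
   unfolding WH_Bc[OF w(1), of i m, symmetric] step.IH[OF step.prems]
   by (rule additive_zero[OF Bc_additive Om_group Om_group])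
 qed
qed

subsection \<open>The invariant differential with a given value at the origin\<close>

definition Theta where
 "Theta f = (\<lambda>k n. th k n (f k n))"

lemma Theta_closed [simp, intro]: assumes f: "f <: OH" shows "Theta f <: wH"
proof -
 have "Theta f k n <: In k n" for k n unfolding Theta_def by (rule A.\<theta>_invariant[OF OH_closed[OF f]])
 moreover have "Res k n (Theta f k (Suc n)) = Theta f k n" for k n
  unfolding Theta_def Res_\<theta>[OF OH_closed[OF f]] OH_res[OF f] ..
 moreover have "Bc k n (Theta f (Suc k) n) = Theta f k n" for k n
  unfolding Theta_def Bc_\<theta>[OF OH_closed[OF f]] OH_bc[OF f] ..
 ultimately show ?thesis unfolding wH_iff WH_iff using In_closed by blast
qed

lemma Theta_linear: "linear_map R OH wH Theta"
proof (intro semilinearI additive_mapI)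
 show "Theta (f \<oplus>\<^bsub>OH\<^esub> g) = Theta f \<oplus>\<^bsub>wH\<^esub> Theta g" if "f <: OH" "g <: OH" for f g
 proof (intro ext)
  fix k n
  show "Theta (f \<oplus>\<^bsub>OH\<^esub> g) k n = (Theta f \<oplus>\<^bsub>wH\<^esub> Theta g) k n"
   unfolding Theta_def OH_apply wH_apply by (rule additive_add[OF A.\<theta>_additive OH_closed OH_closed]) (rule that)+
 qed
 show "Theta (r \<odot>\<^bsub>OH\<^esub> f) = r \<odot>\<^bsub>wH\<^esub> Theta f" if "r <: R" "f <: OH" for r f
 proof (intro ext)
  fix k n
  show "Theta (r \<odot>\<^bsub>OH\<^esub> f) k n = (r \<odot>\<^bsub>wH\<^esub> Theta f) k n"
   unfolding Theta_def OH_apply wH_apply by (rule lin_smult[OF A.\<theta>_linear to_closed[OF that(1)] OH_closed[OF that(2)]])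
 qed
qed simp

lemma wH_component:
 assumes "w <: wH" obtains f where "f <: OH" "w k n = Theta f k n"
proof -
 obtain b where b: "b <: Ak k n" "w k n = th k n b"
  using wH_In[OF assms, of k n] unfolding A.Inv_eq by blast
 obtain f where "f <: OH" "f k n = b" using b(1) by (rule OH_lift)
 then show ?thesis using that b(2) by (simp add: Theta_def)
qed

subsection \<open>Invariant differentials are determined on a finite level\<close>

text \<open>
 The \<open>p\<^sup>n\<close>-torsion contains the infinitesimal neighbourhood of the origin modulo \<open>p\<^sup>n\<close>: its ideal is generated by
 functions pulled back along \<open>p\<^sup>n\<close>, and these have differential divisible by \<open>p\<^sup>n\<close> at the origin.
\<close>

lemma invariant_res_zero:
 assumes w: "w <: In k (Suc n)" and z: "Res k n w = \<zero>\<^bsub>Om k n\<^esub>" and le: "k \<le> n"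
 shows "w = \<zero>\<^bsub>Om k (Suc n)\<^esub>"
proof -
 let ?A = "Ak k (Suc n)"
 let ?J = "{b \<in> carrier ?A. A.\<epsilon> k (Suc n) b = \<zero>\<^bsub>Sk k\<^esub> \<and> th k (Suc n) b = \<zero>\<^bsub>Om k (Suc n)\<^esub>}"
 interpret W: module "Sk k" "Om k (Suc n)" by (rule Om_module)
 have mz: "\<ominus>\<^bsub>Om k (Suc n)\<^esub> \<zero>\<^bsub>Om k (Suc n)\<^esub> = \<zero>\<^bsub>Om k (Suc n)\<^esub>" by (rule W.M.minus_equality) auto
 obtain b where b: "b <: ?A" "w = th k (Suc n) b" using w unfolding A.Inv_eq by blast
 obtain c where c: "c <: ?A" "th k (Suc n) c = \<zero>\<^bsub>Om k (Suc n)\<^esub>" "res k n c = res k n b"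
  using \<theta>_kernel[OF A_hopf A_hopf res_hom id_hom res_surj b(1)] z b Res_\<theta>[OF b(1)] by auto
 have bc: "b \<ominus>\<^bsub>?A\<^esub> c <: ?A" using b c by simp
 have "res k n (b \<ominus>\<^bsub>?A\<^esub> c) = \<zero>\<^bsub>Ak k n\<^esub>"
  unfolding additive_diff[OF res_additive A.A_group A.A_group b(1) c(1)] c(3)
  using A.M.r_neg[OF res_closed[OF b(1)]] by (simp only: a_minus_def)
 then have "b \<ominus>\<^bsub>?A\<^esub> c \<in> a_kernel ?A (Ak k n) (res k n)" using bc by (simp add: a_kernel_def')
 then have "b \<ominus>\<^bsub>?A\<^esub> c \<in> Idl\<^bsub>?A\<^esub> (nat_mult ?A (p ^ n) ` a_kernel ?A (Sk k) (A.\<epsilon> k (Suc n)))"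
  by (simp only: res_kernel)
 moreover have "Idl\<^bsub>?A\<^esub> (nat_mult ?A (p ^ n) ` a_kernel ?A (Sk k) (A.\<epsilon> k (Suc n))) \<subseteq> ?J"
 proof (rule ring.genideal_minimal[OF A.A_ring A.second_order_ideal], rule image_subsetI)
  fix c assume "c \<in> a_kernel ?A (Sk k) (A.\<epsilon> k (Suc n))"
  then have c: "c <: ?A" "A.\<epsilon> k (Suc n) c = \<zero>\<^bsub>Sk k\<^esub>" by (auto simp: a_kernel_def')
  then show "nat_mult ?A (p ^ n) c \<in> ?J"
   using lin_closed[OF A.nat_mult_linear c(1)]
   by (simp add: A.counit_nat_mult A.\<theta>_nat_mult pn_kills[OF Om_module _ le])
 qed
 ultimately have "th k (Suc n) (b \<ominus>\<^bsub>?A\<^esub> c) = \<zero>\<^bsub>Om k (Suc n)\<^esub>" by blast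
 then show ?thesis
  using additive_diff[OF A.\<theta>_additive A.A_group Om_group b(1) c(1)] c(2) b
  by (simp add: a_minus_def mz)
qed

lemma wH_level:
 assumes w: "w <: wH" and z: "w k n = \<zero>\<^bsub>Om k n\<^esub>" and le: "k \<le> n"
 shows "w k m = \<zero>\<^bsub>Om k m\<^esub>"
proof -
 have up: "w k i = \<zero>\<^bsub>Om k i\<^esub>" if "n \<le> i" for i using that
 proof (induction rule: dec_induct)
  case (step i)
  show ?case by (rule invariant_res_zero[OF wH_In[OF w]]) (use step le WH_Res[OF wH_WH[OF w]] in auto)
 qed (rule z)
 show ?thesis using WH_zero_mono[OF wH_WH[OF w] up[of "max m n"], of k m] by simp
qed

lemma invariant_bc_zero:
 assumes w: "w <: In (Suc k) n" and z: "Bc k n w = \<zero>\<^bsub>Om k n\<^esub>"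
 shows "\<exists>b\<in>carrier (Ak (Suc k) n). w = [(p ^ k)] \<cdot>\<^bsub>Om (Suc k) n\<^esub> th (Suc k) n b"
proof -
 let ?A = "Ak (Suc k) n"
 interpret W: module "Sk (Suc k)" "Om (Suc k) n" by (rule Om_module)
 have mz: "\<ominus>\<^bsub>Om (Suc k) n\<^esub> \<zero>\<^bsub>Om (Suc k) n\<^esub> = \<zero>\<^bsub>Om (Suc k) n\<^esub>" by (rule W.M.minus_equality) auto
 note \<theta> = A.\<theta>_additive[of "Suc k" n]
 obtain b where b: "b <: ?A" "w = th (Suc k) n b" using w unfolding A.Inv_eq by blast
 obtain c where c: "c <: ?A" "th (Suc k) n c = \<zero>\<^bsub>Om (Suc k) n\<^esub>" "bch k n c = bch k n b"
  using \<theta>_kernel[OF A_hopf A_hopf bc_hom red_Suc_hom bc_surj b(1)] z b Bc_\<theta>[OF b(1)] by auto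
 have "bch k n (b \<ominus>\<^bsub>?A\<^esub> c) = \<zero>\<^bsub>Ak k n\<^esub>"
  unfolding additive_diff[OF bc_additive A.A_group A.A_group b(1) c(1)] c(3)
  using A.M.r_neg[OF bc_closed[OF b(1)]] by (simp only: a_minus_def)
 then obtain e where e: "e <: ?A" "b \<ominus>\<^bsub>?A\<^esub> c = [(p ^ k)] \<cdot>\<^bsub>?A\<^esub> e"
  using bc_zeroD[of "b \<ominus>\<^bsub>?A\<^esub> c" k n] b c by auto
 have "w = th (Suc k) n (b \<ominus>\<^bsub>?A\<^esub> c)"
  using additive_diff[OF \<theta> A.A_group Om_group b(1) c(1)] c(2) b by (simp add: a_minus_def mz)
 also have "\<dots> = [(p ^ k)] \<cdot>\<^bsub>Om (Suc k) n\<^esub> th (Suc k) n e"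
  unfolding e(2) by (rule additive_add_pow[OF \<theta> A.A_group Om_group e(1)])
 finally show ?thesis using e(1) by blast
qed

text \<open>
 Vanishing modulo \<open>p\<^sup>j\<close> spreads from the level \<open>n \<ge> j\<close> to all levels, since these have the same cotangent space modulo \<open>p\<^sup>j\<close>.  The
 invariant differentials that vanish modulo \<open>p\<^sup>i\<close> form a complete filtration, to which division by \<open>p\<^sup>j\<close> applies.
\<close>

lemma wH_divide:
 assumes w: "w <: wH" and z: "w j n = \<zero>\<^bsub>Om j n\<^esub>" and le: "j \<le> n"
 shows "\<exists>h\<in>carrier wH. w = [(p ^ j)] \<cdot>\<^bsub>wH\<^esub> h"
proof -
 interpret W: module "Sk i" "Om i m" for i m by (rule Om_module)
 let ?F = "\<lambda>i. {w \<in> carrier wH. \<forall>m. w i m = \<zero>\<^bsub>Om i m\<^esub>}"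
 have mz: "\<zero>\<^bsub>Om i m\<^esub> \<ominus>\<^bsub>Om i m\<^esub> \<zero>\<^bsub>Om i m\<^esub> = \<zero>\<^bsub>Om i m\<^esub>" for i m
  using W.M.r_neg[OF W.M.zero_closed, of i m] by (simp add: a_minus_def)
 show ?thesis
 proof (rule p_adic_division[OF wH_group, where F = ?F])
  show "?F i \<subseteq> carrier wH" for i by auto
  show "\<zero>\<^bsub>wH\<^esub> \<in> ?F i" for i using wH_apply(3)[of i] by simp
  show "x \<oplus>\<^bsub>wH\<^esub> y \<in> ?F i" if "x \<in> ?F i" "y \<in> ?F i" for i x y using that by (simp add: wH_apply)
  show "x \<ominus>\<^bsub>wH\<^esub> y \<in> ?F i" if "x \<in> ?F i" "y \<in> ?F i" for i x y
   using that by (simp add: wH_apply_diff mz)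
  show "?F (Suc i) \<subseteq> ?F i" for i
  proof
   fix w assume "w \<in> ?F (Suc i)"
   then have w: "w <: wH" "\<And>m. w (Suc i) m = \<zero>\<^bsub>Om (Suc i) m\<^esub>" by auto
   have "w i m = \<zero>\<^bsub>Om i m\<^esub>" for m by (rule WH_zero_mono[OF wH_WH[OF w(1)] w(2)[of m]]) auto
   with w(1) show "w \<in> ?F i" by simp
  qed
  show "x = \<zero>\<^bsub>wH\<^esub>" if "\<And>i. x \<in> ?F i" for x
  proof (intro ext)
   fix i m show "x i m = \<zero>\<^bsub>wH\<^esub> i m" unfolding wH_apply(3) using that[of i] by simp
  qed
  show "[(p ^ i)] \<cdot>\<^bsub>wH\<^esub> x \<in> ?F i" if "x <: wH" for i x
   using that by (simp add: wH_apply_pow pn_kills[OF Om_module WH_Om[OF wH_WH]])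
  show "w \<in> ?F j" using w wH_level[OF w z le] by blast
 next
  fix s assume s: "\<And>m. s m <: wH" "\<And>m. s (Suc m) \<ominus>\<^bsub>wH\<^esub> s m \<in> ?F m"
  have eq: "s (Suc m) m i = s m m i" for m i
  proof -
   have c: "s (Suc m) m i <: Om m i" "s m m i <: Om m i" using WH_Om[OF wH_WH[OF s(1)]] by auto
   have "s (Suc m) m i \<oplus>\<^bsub>Om m i\<^esub> \<ominus>\<^bsub>Om m i\<^esub> s m m i = \<zero>\<^bsub>Om m i\<^esub>"
    using s(2)[of m] wH_apply_diff[OF s(1) s(1), of "Suc m" m m i] by (simp add: a_minus_def)
   then have "s (Suc m) m i \<oplus>\<^bsub>Om m i\<^esub> \<ominus>\<^bsub>Om m i\<^esub> s m m i \<oplus>\<^bsub>Om m i\<^esub> s m m i = s m m i" using c by simp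
   then show ?thesis using c by (simp add: W.M.a_assoc W.M.l_neg)
  qed
  let ?t = "\<lambda>m. s m m"
  have "Bc m i (s (Suc m) (Suc m) i) = s m m i" for m i
   unfolding WH_Bc[OF wH_WH[OF s(1)]] by (rule eq)
  then have t: "?t <: wH"
   unfolding wH_iff WH_iff using wH_In[OF s(1)] WH_Om[OF wH_WH[OF s(1)]] WH_Res[OF wH_WH[OF s(1)]] by blast
  have "(?t \<ominus>\<^bsub>wH\<^esub> s m) m i = \<zero>\<^bsub>Om m i\<^esub>" for m i
   unfolding wH_apply_diff[OF t s(1)] using W.M.r_neg[OF WH_Om[OF wH_WH[OF s(1)]]] by (simp only: a_minus_def)
  then have "?t \<ominus>\<^bsub>wH\<^esub> s m \<in> ?F m" for m using t s(1) by simp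
  then show "\<exists>t\<in>carrier wH. \<forall>m. t \<ominus>\<^bsub>wH\<^esub> s m \<in> ?F m" using t by blast
 next
  fix i h assume h: "h \<in> ?F i"
  then have hw: "h <: wH" by simp
  \<comment> \<open>The torsion level \<open>i + 1\<close> is the first that detects vanishing modulo \<open>p\<^sup>i\<^sup>+\<^sup>1\<close>.\<close>
  let ?m = "Suc i"
  have "Bc i ?m (h (Suc i) ?m) = \<zero>\<^bsub>Om i ?m\<^esub>" unfolding WH_Bc[OF wH_WH[OF hw]] using h by simp
  then obtain b where b: "b <: Ak (Suc i) ?m" "h (Suc i) ?m = [(p ^ i)] \<cdot>\<^bsub>Om (Suc i) ?m\<^esub> th (Suc i) ?m b"
   using invariant_bc_zero[OF wH_In[OF hw]] by blast
  obtain f where f: "f <: OH" "f (Suc i) ?m = b" using b(1) by (rule OH_lift)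
  let ?px = "[(p ^ i)] \<cdot>\<^bsub>wH\<^esub> Theta f"
  have px: "?px <: wH" using Theta_closed[OF f(1)] by simp
  have "?px (Suc i) ?m = h (Suc i) ?m"
   unfolding wH_apply_pow[OF Theta_closed[OF f(1)]] b(2) by (simp add: Theta_def f(2))
  then have "(h \<ominus>\<^bsub>wH\<^esub> ?px) (Suc i) ?m = \<zero>\<^bsub>Om (Suc i) ?m\<^esub>"
   unfolding wH_apply_diff[OF hw px] using W.M.r_neg[OF WH_Om[OF wH_WH[OF hw]]] by (simp only: a_minus_def)
  then have "h \<ominus>\<^bsub>wH\<^esub> ?px \<in> ?F (Suc i)"
   using wH_level[of "h \<ominus>\<^bsub>wH\<^esub> ?px" "Suc i" ?m] hw px by simp
  then show "\<exists>x\<in>carrier wH. h \<ominus>\<^bsub>wH\<^esub> [(p ^ i)] \<cdot>\<^bsub>wH\<^esub> x \<in> ?F (Suc i)"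
   using Theta_closed[OF f(1)] by blast
 qed
qed

end

section \<open>Invariant vector fields\<close>

context p_div_group
begin

text \<open>The pairs \<open>(k, n)\<close> with \<open>k \<le> n\<close> are cofinal, so a compatible family over them determines a function on the group.\<close>

lemma OH_extend:
 assumes h: "\<And>k n. k \<le> n ==> h k n <: Ak k n"
  and hres: "\<And>k n. k \<le> n ==> res k n (h k (Suc n)) = h k n"
  and hbc: "\<And>k n. Suc k \<le> n ==> bch k n (h (Suc k) n) = h k n"
 shows "\<exists>f\<in>carrier OH. \<forall>k n. k \<le> n \<longrightarrow> f k n = h k n"
proof -
 define l where "l k n = (SOME f. f <: OH \<and> f k n = h k n)" for k n
 have l: "l k n <: OH" "l k n k n = h k n" if "k \<le> n" for k n
  using someI_ex[of "\<lambda>f. f <: OH \<and> f k n = h k n"] OH_lift[OF h[OF that]] unfolding l_def by blast+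
 have step: "l k (Suc m) k i = l k m k i" if "k \<le> m" "i \<le> m" for k m i
 proof (rule OH_mono[where f = "l k (Suc m)" and g = "l k m" and k = k and n = m])
  show "l k (Suc m) k m = l k m k m"
   using OH_res[OF l(1)[of k "Suc m"], of k m] l(2)[of k "Suc m"] l(2)[of k m] hres[of k m] that by simp
 qed (use l(1) that in auto)
 define f where "f k n = l k (n + k) k n" for k n
 have "f k n <: Ak k n" for k n unfolding f_def by (rule OH_closed[OF l(1)]) simp
 moreover have "res k n (f k (Suc n)) = f k n" for k n
  unfolding f_def using OH_res[OF l(1)[of k "Suc n + k"], of k n] step[of k "n + k" n] by simp
 moreover have "bch k n (f (Suc k) n) = f k n" for k n
 proof -
  let ?m = "Suc (n + k)"
  have "l (Suc k) ?m k n = l k ?m k n"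
  proof (rule OH_mono[where f = "l (Suc k) ?m" and g = "l k ?m" and k = k and n = ?m])
   show "l (Suc k) ?m k ?m = l k ?m k ?m"
    using OH_bc[OF l(1)[of "Suc k" ?m], of k ?m] l(2)[of "Suc k" ?m] l(2)[of k ?m] hbc[of k ?m] by simp
  qed (use l(1) in auto)
  then show ?thesis
   unfolding f_def using OH_bc[OF l(1)[of "Suc k" ?m], of k n] step[of k "n + k" n] by simp
 qed
 ultimately have f: "f <: OH" unfolding OH_iff by blast
 have "f k n = h k n" if "k \<le> n" for k n
 proof -
  have "l k m k n = l k n k n" if "n \<le> m" for m using that
  proof (induction rule: dec_induct)
   case (step i)
   then show ?case using \<open>\<And>k m i. k \<le> m ==> i \<le> m ==> l k (Suc m) k i = l k m k i\<close>[of k i n] \<open>k \<le> n\<close> by simp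
  qed simp
  then show ?thesis using l(2)[OF that] by (simp add: f_def)
 qed
 then show ?thesis using f by blast
qed

lemma OH_eqI_large:
 assumes f: "f <: OH" "g <: OH" and eq: "\<And>k n. k \<le> n ==> f k n = g k n"
 shows "f = g"
proof (rule OH_eqI[OF f])
 show "f k n = g k n" for k n by (rule OH_mono[OF f eq, of k "max k n"]) auto
qed

subsection \<open>Invariant differentials span\<close>

lemma WH_act_closed:
 assumes f: "f <: OH" and w: "w <: WH"
 shows "(\<lambda>k n. A.act k n (f k n) (w k n)) <: WH"
 unfolding WH_iff
 using OH_closed[OF f] WH_Om[OF w] by (simp add: Res_act Bc_act OH_res[OF f] OH_bc[OF f] WH_Res[OF w] WH_Bc[OF w])

lemma WH_d_closed:
 assumes f: "f <: OH" shows "(\<lambda>k n. A.d k n (f k n)) <: WH"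
 unfolding WH_iff using OH_closed[OF f] by (simp add: Res_d Bc_d OH_res[OF f] OH_bc[OF f])

lemma act_Theta_closed:
 "f <: OH ==> g <: OH ==> (\<lambda>k n. A.act k n (f k n) (Theta g k n)) <: WH"
 by (rule WH_act_closed[OF _ wH_WH[OF Theta_closed]])

abbreviation "comb zs \<equiv> lsum WH (map (\<lambda>(f, g). (\<lambda>k n. A.act k n (f k n) (Theta g k n))) zs)"

lemma comb_closed:
 assumes "set zs \<subseteq> carrier OH \<times> carrier OH" shows "comb zs <: WH"
 by (rule WH.M.lsum_map_closed) (use assms in "auto intro!: act_Theta_closed")

text \<open>As \<open>db = \<Sum> b\<^sub>1 \<theta>(b\<^sub>2)\<close>, each level of the differentials is spanned by the invariant ones.\<close>

lemma comb_surj: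
 assumes "w <: Om k n"
 shows "\<exists>zs. set zs \<subseteq> carrier OH \<times> carrier OH \<and> comb zs k n = w"
proof -
 let ?Q = "\<lambda>w. \<exists>zs. set zs \<subseteq> carrier OH \<times> carrier OH \<and> comb zs k n = w"
 have zero: "?Q \<zero>\<^bsub>Om k n\<^esub>" by (rule exI[of _ "[]"]) (simp add: WH_apply)
 have add: "?Q (v \<oplus>\<^bsub>Om k n\<^esub> w)" if vw: "?Q v" "?Q w" for v w
 proof -
  obtain xs ys where zs: "set xs \<subseteq> carrier OH \<times> carrier OH" "comb xs k n = v"
   "set ys \<subseteq> carrier OH \<times> carrier OH" "comb ys k n = w" using vw by blast
  have cl: "set (map (\<lambda>(f, g). (\<lambda>k n. A.act k n (f k n) (Theta g k n))) us) \<subseteq> carrier WH"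
   if "set us \<subseteq> carrier OH \<times> carrier OH" for us
   using that by (auto intro!: act_Theta_closed)
  have "comb (xs @ ys) k n = v \<oplus>\<^bsub>Om k n\<^esub> w"
   unfolding map_append WH.M.lsum_append[OF cl[OF zs(1)] cl[OF zs(3)]] WH_apply zs ..
  then show ?thesis using zs by (intro exI[of _ "xs @ ys"]) simp
 qed
 have single: "?Q (A.act k n a (th k n b))" if ab: "a <: Ak k n" "b <: Ak k n" for a b
 proof -
  obtain f where f: "f <: OH" "f k n = a" using ab(1) by (rule OH_lift)
  obtain g where g: "g <: OH" "g k n = b" using ab(2) by (rule OH_lift)
  have "(\<lambda>k n. A.act k n (f k n) (Theta g k n)) <: WH"
   by (rule WH_act_closed[OF f(1) wH_WH[OF Theta_closed[OF g(1)]]])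
  then show ?thesis using f g by (intro exI[of _ "[(f, g)]"]) (simp add: Theta_def)
 qed
 have sum: "?Q (lsum (Om k n) (map F us))" if "\<And>u. u \<in> set us ==> ?Q (F u)" for us :: "('a \<times> 'a) list" and F
  using that
 proof (induction us)
  case Nil show ?case using zero by simp
 next
  case (Cons u us)
  then show ?case using add[of "F u" "lsum (Om k n) (map F us)"] by simp
 qed
 from assms show ?thesis
 proof (induction rule: A.kahler_induct)
  case (gen a b)
  let ?us = "rep (comult (Ak k n) b)"
  have us: "fst u <: Ak k n" "snd u <: Ak k n" if "u \<in> set ?us" for u
   using A.comult_rep[OF gen(2), of "fst u" "snd u"] that by auto
  have "A.act k n a (A.d k n b) = A.act k n a (lsum (Om k n) (map (\<lambda>u. A.act k n (fst u) (th k n (snd u))) ?us))"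
   using A.d_via_\<theta>[OF gen(2)] by (simp add: sweedler_lsum case_prod_unfold)
  also have "\<dots> = lsum (Om k n) (map (\<lambda>u. A.act k n a (A.act k n (fst u) (th k n (snd u)))) ?us)"
   by (rule additive_lsum_map[OF A.kahler_act_additive[OF gen(1)] Om_group Om_group]) (simp add: us)
  also have "\<dots> = lsum (Om k n) (map (\<lambda>u. A.act k n (a \<otimes>\<^bsub>Ak k n\<^esub> fst u) (th k n (snd u))) ?us)"
   by (rule lsum_cong) (simp add: us gen A.kahler_act_assoc)
  finally show ?case using sum[of ?us "\<lambda>u. A.act k n (a \<otimes>\<^bsub>Ak k n\<^esub> fst u) (th k n (snd u))"] single us gen(1) by simp
 qed (use zero add in auto)
qed

definition vector_field where
 "vector_field v X \<longleftrightarrow> X \<in> carrier WH \<rightarrow>\<^sub>E carrier OH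
  \<and> (\<forall>w\<in>carrier WH. \<forall>w'\<in>carrier WH. X (w \<oplus>\<^bsub>WH\<^esub> w') = X w \<oplus>\<^bsub>OH\<^esub> X w')
  \<and> (\<forall>f\<in>carrier OH. \<forall>w\<in>carrier WH. X (\<lambda>k n. A.act k n (f k n) (w k n)) = f \<otimes>\<^bsub>OH\<^esub> X w)
  \<and> continuous_at_zero (limit_nhds WH) (limit_nhds OH) X
  \<and> (\<forall>w\<in>carrier wH. X w = v w \<odot>\<^bsub>OH\<^esub> \<one>\<^bsub>OH\<^esub>)"

lemma vector_fieldD:
 assumes "vector_field v X"
 shows "additive WH OH X"
  and "f <: OH ==> w <: WH ==> X (\<lambda>k n. A.act k n (f k n) (w k n)) = f \<otimes>\<^bsub>OH\<^esub> X w"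
  and "w <: wH ==> X w = v w \<odot>\<^bsub>OH\<^esub> \<one>\<^bsub>OH\<^esub>"
 using assms unfolding vector_field_def additive_def by auto

lemma continuous_WH_OH:
 "continuous_at_zero (limit_nhds WH) (limit_nhds OH) X \<longleftrightarrow>
  (\<forall>k n. \<exists>K N. \<forall>w\<in>carrier WH. w K N = \<zero>\<^bsub>Om K N\<^esub> \<longrightarrow> X w <: OH \<and> X w k n = \<zero>\<^bsub>Ak k n\<^esub>)"
proof -
 have ex: "(\<exists>U\<in>limit_nhds WH. Q U) \<longleftrightarrow> (\<exists>K N. Q {w \<in> carrier WH. w K N = \<zero>\<^bsub>Om K N\<^esub>})" for Q
  unfolding limit_nhds_def WH_apply(3) by auto
 have all: "(\<forall>V\<in>limit_nhds OH. Q V) \<longleftrightarrow> (\<forall>k n. Q {f \<in> carrier OH. f k n = \<zero>\<^bsub>Ak k n\<^esub>})" for Q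
  unfolding limit_nhds_def OH_apply(4) by auto
 show ?thesis unfolding continuous_at_zero_def ex all by (simp add: image_subset_iff Ball_def imp_conjL)
qed

lemma vector_field_level:
 assumes "vector_field v X"
 shows "\<exists>K N. \<forall>w\<in>carrier WH. w K N = \<zero>\<^bsub>Om K N\<^esub> \<longrightarrow> X w k n = \<zero>\<^bsub>Ak k n\<^esub>"
proof -
 have "\<forall>k n. \<exists>K N. \<forall>w\<in>carrier WH. w K N = \<zero>\<^bsub>Om K N\<^esub> \<longrightarrow> X w <: OH \<and> X w k n = \<zero>\<^bsub>Ak k n\<^esub>"
  using assms unfolding vector_field_def continuous_WH_OH by (elim conjE)
 then obtain K N where "\<forall>w\<in>carrier WH. w K N = \<zero>\<^bsub>Om K N\<^esub> \<longrightarrow> X w <: OH \<and> X w k n = \<zero>\<^bsub>Ak k n\<^esub>"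
  by (elim allE exE)
 then show ?thesis by (intro exI[of _ K] exI[of _ N]) simp
qed

text \<open>
 Linearity and the values on invariant differentials determine the field on their \<open>O_H\<close>-span, which meets every
 neighbourhood of a given differential; continuity does the rest.
\<close>

lemma vector_field_unique:
 assumes X: "vector_field v X" and Y: "vector_field v Y"
 shows "X = Y"
proof (rule ext)
 fix w
 show "X w = Y w"
 proof (cases "w <: WH")
  case False
  then show ?thesis using X Y by (auto simp: vector_field_def PiE_def extensional_def)
 next
  case w: True
  have comb: "Z (comb zs) = lsum OH (map (\<lambda>(f, g). f \<otimes>\<^bsub>OH\<^esub> (v (Theta g) \<odot>\<^bsub>OH\<^esub> \<one>\<^bsub>OH\<^esub>)) zs)"
   if Z: "vector_field v Z" and zs: "set zs \<subseteq> carrier OH \<times> carrier OH" for Z zs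
  proof -
   have "Z (comb zs) = lsum OH (map (\<lambda>z. Z (\<lambda>k n. A.act k n (fst z k n) (Theta (snd z) k n))) zs)"
    unfolding case_prod_unfold
    by (rule additive_lsum_map[OF vector_fieldD(1)[OF Z] WH_group OH_group])
     (use zs in "auto intro!: act_Theta_closed")
   also have "\<dots> = lsum OH (map (\<lambda>(f, g). f \<otimes>\<^bsub>OH\<^esub> (v (Theta g) \<odot>\<^bsub>OH\<^esub> \<one>\<^bsub>OH\<^esub>)) zs)"
   proof (rule lsum_cong)
    fix z assume "z \<in> set zs"
    then have z: "fst z <: OH" "snd z <: OH" using zs by auto
    show "Z (\<lambda>k n. A.act k n (fst z k n) (Theta (snd z) k n)) = (\<lambda>(f, g). f \<otimes>\<^bsub>OH\<^esub> (v (Theta g) \<odot>\<^bsub>OH\<^esub> \<one>\<^bsub>OH\<^esub>)) z"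
     using vector_fieldD(2)[OF Z z(1) wH_WH[OF Theta_closed[OF z(2)]]] vector_fieldD(3)[OF Z Theta_closed[OF z(2)]]
     by (simp add: case_prod_unfold)
   qed
   finally show ?thesis .
  qed
  have cl: "X w <: OH" "Y w <: OH"
   using additive_closed[OF vector_fieldD(1)[OF X] w] additive_closed[OF vector_fieldD(1)[OF Y] w] by auto
  show ?thesis
  proof (rule OH_eqI[OF cl])
   fix k n
   obtain K1 N1 where 1: "\<And>u. u <: WH ==> u K1 N1 = \<zero>\<^bsub>Om K1 N1\<^esub> ==> X u k n = \<zero>\<^bsub>Ak k n\<^esub>"
    using vector_field_level[OF X, of k n] by (elim exE) blast
   obtain K2 N2 where 2: "\<And>u. u <: WH ==> u K2 N2 = \<zero>\<^bsub>Om K2 N2\<^esub> ==> Y u k n = \<zero>\<^bsub>Ak k n\<^esub>"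
    using vector_field_level[OF Y, of k n] by (elim exE) blast
   let ?K = "max K1 K2" and ?N = "max N1 N2"
   obtain zs where zs: "set zs \<subseteq> carrier OH \<times> carrier OH" "comb zs ?K ?N = w ?K ?N"
    using comb_surj[OF WH_Om[OF w]] by blast
   note c = comb_closed[OF zs(1)]
   interpret W: abelian_group "Om ?K ?N" by (rule Om_group)
   let ?u = "w \<ominus>\<^bsub>WH\<^esub> comb zs"
   have u: "?u <: WH" using w c by simp
   have u0: "?u ?K ?N = \<zero>\<^bsub>Om ?K ?N\<^esub>"
    unfolding WH_apply_diff[OF w c] zs(2) using W.r_neg[OF WH_Om[OF w]] by (simp only: a_minus_def)
   have eq: "Z w k n = Z (comb zs) k n" if Z: "vector_field v Z" and z: "Z ?u k n = \<zero>\<^bsub>Ak k n\<^esub>" for Z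
   proof -
    note add = vector_fieldD(1)[OF Z]
    have Zc: "Z w <: OH" "Z (comb zs) <: OH" using additive_closed[OF add] w c by auto
    have "Z w k n \<oplus>\<^bsub>Ak k n\<^esub> \<ominus>\<^bsub>Ak k n\<^esub> Z (comb zs) k n = \<zero>\<^bsub>Ak k n\<^esub>"
     using z unfolding additive_diff[OF add WH_group OH_group w c] OH_apply_diff[OF Zc] by (simp add: a_minus_def)
    then have "Z w k n \<oplus>\<^bsub>Ak k n\<^esub> \<ominus>\<^bsub>Ak k n\<^esub> Z (comb zs) k n \<oplus>\<^bsub>Ak k n\<^esub> Z (comb zs) k n = Z (comb zs) k n"
     using Zc by simp
    then show ?thesis using Zc by (simp add: A.M.a_assoc A.M.l_neg)
   qed
   have "X ?u k n = \<zero>\<^bsub>Ak k n\<^esub>" by (rule 1[OF u WH_zero_mono[OF u u0]]) auto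
   moreover have "Y ?u k n = \<zero>\<^bsub>Ak k n\<^esub>" by (rule 2[OF u WH_zero_mono[OF u u0]]) auto
   ultimately show "X w k n = Y w k n" using eq[OF X] eq[OF Y] comb[OF X zs(1)] comb[OF Y zs(1)] by simp
  qed
 qed
qed

lemma invariant_field_eqI: "vector_field v X ==> invariant_field R p H v = X"
 unfolding invariant_field_def vector_field_def[symmetric]
 by (rule the_equality) (auto intro: vector_field_unique)

end

section \<open>A functional on the invariant differentials\<close>

locale lie_vector = p_div_group R p H
 for R :: "('r, 'm) ring_scheme" (structure) and p :: nat and H :: "('r set, 'a) pdiv" +
 fixes v :: "(nat \<Rightarrow> nat \<Rightarrow> ('a \<times> 'a) list set) \<Rightarrow> 'r"
 assumes v: "v <: Lie_H R p H"
begin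

lemma v_linear: "linear_map R wH (ring_module R) v"
 using v unfolding Lie_H_def by (rule lin_dual_linear)

lemma v_additive: "additive wH R v"
 using lin_additive[OF v_linear] by (simp add: additive_def)

lemmas v_closed = additive_closed[OF v_additive]

text \<open>
 No topology is imposed on functionals on the invariant differentials: divisibility makes their values modulo \<open>p\<^sup>j\<close>
 depend on one component only.
\<close>

lemma v_level:
 assumes w: "w <: wH" "w' <: wH" and eq: "w j n = w' j n" and le: "j \<le> n"
 shows "to j (v w) = to j (v w')"
proof -
 interpret W: abelian_group "Om j n" by (rule Om_group)
 have "(w \<ominus>\<^bsub>wH\<^esub> w') j n = \<zero>\<^bsub>Om j n\<^esub>"
  unfolding wH_apply_diff[OF w] eq using W.r_neg[OF WH_Om[OF wH_WH[OF w(2)]]] by (simp only: a_minus_def)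
 then obtain h where h: "h <: wH" "w \<ominus>\<^bsub>wH\<^esub> w' = [(p ^ j)] \<cdot>\<^bsub>wH\<^esub> h"
  using wH_divide[of "w \<ominus>\<^bsub>wH\<^esub> w'" j n] w le by auto
 have "to j (v (w \<ominus>\<^bsub>wH\<^esub> w')) = \<zero>\<^bsub>Sk j\<^esub>"
  unfolding h(2) additive_add_pow[OF additive_comp[OF v_additive to_additive] wH_group Sk_group h(1)]
  by (rule Sk_kills) (simp add: v_closed h)
 then have "to j (v w) \<oplus>\<^bsub>Sk j\<^esub> \<ominus>\<^bsub>Sk j\<^esub> to j (v w') = \<zero>\<^bsub>Sk j\<^esub>"
  using additive_diff[OF additive_comp[OF v_additive to_additive] wH_group Sk_group w] by (simp add: a_minus_def)
 then have "to j (v w) \<oplus>\<^bsub>Sk j\<^esub> \<ominus>\<^bsub>Sk j\<^esub> to j (v w') \<oplus>\<^bsub>Sk j\<^esub> to j (v w') = to j (v w')" using v_closed w by simp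
 then show ?thesis using v_closed w by (simp add: A.R.a_assoc A.R.l_neg)
qed

lemma Theta_zero:
 assumes "f <: OH" "f j n = \<zero>\<^bsub>Ak j n\<^esub>" shows "Theta f j n = \<zero>\<^bsub>wH\<^esub> j n"
 unfolding Theta_def assms(2) wH_apply(3) by (rule additive_zero[OF A.\<theta>_additive A.A_group Om_group])

lemma v_Theta_linear: "linear_map R OH (ring_module R) (\<lambda>f. v (Theta f))"
 by (rule linear_comp[OF Theta_linear v_linear])

lemma v_Theta_additive: "additive OH R (\<lambda>f. v (Theta f))"
 using lin_additive[OF v_Theta_linear] by (simp add: additive_def)

lemma v_Theta_zero:
 assumes "f <: OH" "f j n = \<zero>\<^bsub>Ak j n\<^esub>" "j \<le> n" shows "to j (v (Theta f)) = \<zero>\<^bsub>Sk j\<^esub>"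
proof -
 have "to j (v (Theta f)) = to j (v \<zero>\<^bsub>wH\<^esub>)"
  by (rule v_level[where w = "Theta f" and w' = "\<zero>\<^bsub>wH\<^esub>", OF _ _ Theta_zero[OF assms(1,2)] assms(3)]) (use assms in auto)
 then show ?thesis
  using additive_zero[OF additive_comp[OF v_additive to_additive] wH_group Sk_group] by simp
qed

subsection \<open>The associated function on the Tate module\<close>

lemma v_Theta_dual: "(\<lambda>f\<in>carrier OH. v (Theta f)) <: OHd"
 unfolding OHd_iff
proof (intro conjI allI)
 show "(\<lambda>f\<in>carrier OH. v (Theta f)) <: lin_dual R OH" by (rule lin_dual_restrict[OF OH.module v_Theta_linear])
 fix j
 have "(\<lambda>f\<in>carrier OH. v (Theta f)) f \<in> p_multiples p R j" if "f <: OH" "f j j = \<zero>\<^bsub>Ak j j\<^esub>" for f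
  using v_Theta_zero[OF that order_refl] that(1) v_closed[OF Theta_closed[OF that(1)]] by (simp add: to_zero_iff)
 then show "\<exists>K N. \<forall>f\<in>carrier OH. f K N = \<zero>\<^bsub>Ak K N\<^esub> \<longrightarrow> (\<lambda>f\<in>carrier OH. v (Theta f)) f \<in> p_multiples p R j" by blast
qed

text \<open>The linear functional \<open>v\<close> composed with the Hodge--Tate map, characterized by its pairing with functions.\<close>

definition lin_fun where
 "lin_fun = fourier_upper R p H (\<lambda>f\<in>carrier OH. v (Theta f))"

lemma lin_fun_closed [simp]: "lin_fun <: T"
 unfolding lin_fun_def by (rule fourier_upper_closed[OF v_Theta_dual])

lemma pair_lin_fun: "f <: OH ==> pair f lin_fun = v (Theta f)"
 unfolding lin_fun_def using pair_fourier_upper[OF v_Theta_dual] by simp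

subsection \<open>The associated derivation\<close>

text \<open>The tangent vector at the origin of the \<open>p\<^sup>n\<close>-torsion over \<open>R/p\<^sup>j\<close> given by \<open>v\<close>; it exists when \<open>j \<le> n\<close>.\<close>

definition tanv where
 "tanv j n = (SOME \<delta>. \<delta> <: Dk j n \<and> (\<forall>f\<in>carrier OH. \<delta> (f j n) = to j (v (Theta f))))"

lemma
 assumes le: "j \<le> n"
 shows tan_closed: "tanv j n <: Dk j n"
  and tan_apply: "\<And>f. f <: OH ==> tanv j n (f j n) = to j (v (Theta f))"
proof -
 have sm: "to j (v (Theta (r \<odot>\<^bsub>OH\<^esub> f))) = to j r \<otimes>\<^bsub>Sk j\<^esub> to j (v (Theta f))" if "r <: R" "f <: OH" for r f
  using lin_smult[OF v_Theta_linear that] that v_closed by (simp add: ring_hom_mult[OF to_hom])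
 have "\<exists>\<delta>. \<delta> <: Dk j n \<and> (\<forall>f\<in>carrier OH. \<delta> (f j n) = to j (v (Theta f)))"
 proof -
  obtain \<delta> where "\<delta> <: Dk j n" "\<And>f. f <: OH ==> \<delta> (f j n) = to j (v (Theta f))"
  proof (rule functional_dual[OF additive_comp[OF v_Theta_additive to_additive] sm, of j n])
   show "to j (v (Theta f)) = \<zero>\<^bsub>Sk j\<^esub>" if "f <: OH" "f j n = \<zero>\<^bsub>Ak j n\<^esub>" for f
    by (rule v_Theta_zero[OF that le])
  qed blast+
  then show ?thesis by blast
 qed
 from someI_ex[OF this] show "tanv j n <: Dk j n" "\<And>f. f <: OH ==> tanv j n (f j n) = to j (v (Theta f))"
  unfolding tanv_def by blast+
qed

text \<open>The Leibniz rule for \<open>\<theta>\<close> holds with coefficients \<open>\<epsilon> b\<close> and \<open>\<epsilon> c\<close> in \<open>R/p\<^sup>j\<close>, which are lifted to \<open>R\<close> in order to apply \<open>v\<close>.\<close>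

lemma tan_tangent: assumes le: "j \<le> n" shows "A.tangent j n (tanv j n)"
 unfolding A.tangent_def
proof (intro conjI ballI)
 show "linear_map (Sk j) (Ak j n) (ring_module (Sk j)) (tanv j n)"
  using A.D_linear[of "tanv j n" j n] tan_closed[OF le] by (simp add: Dk_eq)
 fix b c assume bc: "b <: Ak j n" "c <: Ak j n"
 obtain f where f: "f <: OH" "f j n = b" using bc(1) by (rule OH_lift)
 obtain g where g: "g <: OH" "g j n = c" using bc(2) by (rule OH_lift)
 obtain r where r: "r <: R" "A.\<epsilon> j n b = to j r" using A.counit_closed[OF bc(1)] by (rule SkE)
 obtain s where s: "s <: R" "A.\<epsilon> j n c = to j s" using A.counit_closed[OF bc(2)] by (rule SkE)
 have fg: "f \<otimes>\<^bsub>OH\<^esub> g <: OH" using f g by simp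
 let ?w = "r \<odot>\<^bsub>wH\<^esub> Theta g \<oplus>\<^bsub>wH\<^esub> s \<odot>\<^bsub>wH\<^esub> Theta f"
 have "tanv j n (b \<otimes>\<^bsub>Ak j n\<^esub> c) = to j (v (Theta (f \<otimes>\<^bsub>OH\<^esub> g)))"
  unfolding tan_apply[OF le fg, symmetric] OH_apply f(2) g(2) ..
 also have "\<dots> = to j (v ?w)"
 proof (rule v_level[OF Theta_closed[OF fg] _ _ le])
  show "Theta (f \<otimes>\<^bsub>OH\<^esub> g) j n = ?w j n"
   unfolding wH_apply Theta_def OH_apply f(2) g(2) A.\<theta>_mult[OF bc] r(2) s(2) ..
 qed (use f g r s in simp)
 also have "\<dots> = to j r \<otimes>\<^bsub>Sk j\<^esub> to j (v (Theta g)) \<oplus>\<^bsub>Sk j\<^esub> to j s \<otimes>\<^bsub>Sk j\<^esub> to j (v (Theta f))"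
  using f g r s v_closed
  by (simp add: additive_add[OF v_additive] lin_smult[OF v_linear] ring_hom_add[OF to_hom] ring_hom_mult[OF to_hom])
 also have "\<dots> = A.\<epsilon> j n b \<otimes>\<^bsub>Sk j\<^esub> tanv j n c \<oplus>\<^bsub>Sk j\<^esub> A.\<epsilon> j n c \<otimes>\<^bsub>Sk j\<^esub> tanv j n b"
  unfolding r(2) s(2) tan_apply[OF le f(1), symmetric] tan_apply[OF le g(1), symmetric] f(2) g(2) ..
 finally show "tanv j n (b \<otimes>\<^bsub>Ak j n\<^esub> c) = A.\<epsilon> j n b \<otimes>\<^bsub>Sk j\<^esub> tanv j n c \<oplus>\<^bsub>Sk j\<^esub> A.\<epsilon> j n c \<otimes>\<^bsub>Sk j\<^esub> tanv j n b" .
qed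

lemma lin_fun_component: assumes le: "k \<le> n" shows "lin_fun k = cl k (n, tanv k n)"
proof (rule ev_inj[OF T_closed[OF lin_fun_closed] cl_closed[OF tan_closed[OF le]]])
 fix f assume f: "f <: OH"
 show "ev k (lin_fun k) f = ev k (cl k (n, tanv k n)) f"
  unfolding to_pair[OF f lin_fun_closed, symmetric] ev_cl[OF tan_closed[OF le] f] tan_apply[OF le f] pair_lin_fun[OF f] ..
qed

text \<open>
 Differentiation along \<open>v\<close> is defined as the transpose of multiplication by the function attached to \<open>v\<close>.  On
 a finite level multiplication on the dual is convolution, whose transpose is the derivation given by \<open>v\<close>.
\<close>

definition der where
 "der f = fourier_lower R p H (\<lambda>g\<in>carrier T. pair f (lin_fun \<otimes>\<^sub>T g))"

lemma mult_dual: assumes f: "f <: OH" shows "(\<lambda>g\<in>carrier T. pair f (lin_fun \<otimes>\<^sub>T g)) <: Td"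
proof (rule Td_restrict, rule linear_comp[OF _ pair_linear_right[OF f]])
 show "linear_map R T T (\<lambda>g. lin_fun \<otimes>\<^sub>T g)"
  by (rule bilinearD(1)[OF algebra_mult_bilinear[OF T_algebra] lin_fun_closed])
qed

lemma der_closed [simp]: "f <: OH ==> der f <: OH"
 unfolding der_def by (rule fourier_lower_closed[OF mult_dual])

lemma pair_der: "f <: OH ==> g <: T ==> pair (der f) g = pair f (lin_fun \<otimes>\<^sub>T g)"
 unfolding der_def using pair_fourier_lower[OF mult_dual] by simp

lemma der_component:
 assumes f: "f <: OH" and le: "k \<le> n"
 shows "der f k n = A.deriv k n (tanv k n) (f k n)"
proof -
 let ?D = "Dk k n"
 note tD = tan_closed[OF le]
 have lin: "linear_map (Sk k) (Ak k n) (Ak k n) (A.deriv k n (tanv k n))"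
  by (rule A.deriv_linear[OF A.tangentD(1)[OF tan_tangent[OF le]]])
 show ?thesis
 proof (rule A.D_separates[OF OH_closed[OF der_closed[OF f]] lin_closed[OF lin OH_closed[OF f]]], fold Dk_eq)
  fix \<phi> assume \<phi>: "\<phi> <: ?D"
  obtain g where g: "g <: T" "g k = cl k (n, \<phi>)" using T_lift[OF cl_closed[OF \<phi>]] by blast
  interpret D: algebra "Sk k" ?D by (rule Dk_algebra)
  have prod: "(lin_fun \<otimes>\<^sub>T g) k = cl k (n, tanv k n \<otimes>\<^bsub>?D\<^esub> \<phi>)"
   unfolding T_apply lin_fun_component[OF le] g(2) by (rule cl_mult[OF tD \<phi>])
  have "\<phi> (der f k n) = ev k (g k) (der f)" unfolding g(2) ev_cl[OF \<phi> der_closed[OF f]] ..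
  also have "\<dots> = ev k ((lin_fun \<otimes>\<^sub>T g) k) f"
   unfolding to_pair[OF der_closed[OF f] g(1), symmetric] pair_der[OF f g(1)]
   by (rule to_pair[OF f]) (simp add: g)
  also have "\<dots> = (\<phi> \<otimes>\<^bsub>?D\<^esub> tanv k n) (f k n)"
   unfolding prod ev_cl[OF D.m_closed[OF tD \<phi>] f] using D.m_comm[OF tD \<phi>] by simp
  also have "\<dots> = \<phi> (A.deriv k n (tanv k n) (f k n))"
   using A.D_deriv[of \<phi> k n "tanv k n" "f k n"] \<phi> tD OH_closed[OF f] by (simp add: Dk_eq)
  finally show "\<phi> (der f k n) = \<phi> (A.deriv k n (tanv k n) (f k n))" .
 qed
qed

lemma deriv_compat:
 assumes le: "k \<le> n"
 shows deriv_res: "b <: Ak k (Suc n) ==>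
   res k n (A.deriv k (Suc n) (tanv k (Suc n)) b) = A.deriv k n (tanv k n) (res k n b)"
  and deriv_bc: "Suc k \<le> n ==> b <: Ak (Suc k) n ==>
   bch k n (A.deriv (Suc k) n (tanv (Suc k) n) b) = A.deriv k n (tanv k n) (bch k n b)"
proof -
 assume b: "b <: Ak k (Suc n)"
 obtain f where f: "f <: OH" "f k (Suc n) = b" using b by (rule OH_lift)
 show "res k n (A.deriv k (Suc n) (tanv k (Suc n)) b) = A.deriv k n (tanv k n) (res k n b)"
  using OH_res[OF der_closed[OF f(1)], of k n] OH_res[OF f(1), of k n] der_component[OF f(1), of k n]
   der_component[OF f(1), of k "Suc n"] le f(2) by simp
next
 assume le': "Suc k \<le> n" and b: "b <: Ak (Suc k) n"
 obtain f where f: "f <: OH" "f (Suc k) n = b" using b by (rule OH_lift)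
 show "bch k n (A.deriv (Suc k) n (tanv (Suc k) n) b) = A.deriv k n (tanv k n) (bch k n b)"
  using OH_bc[OF der_closed[OF f(1)], of k n] OH_bc[OF f(1), of k n] der_component[OF f(1), of k n]
   der_component[OF f(1), of "Suc k" n] le le' f(2) by simp
qed

lemma vfield_res:
 assumes le: "k \<le> n" and w: "w <: Om k (Suc n)"
 shows "res k n (A.vfield k (Suc n) (tanv k (Suc n)) w) = A.vfield k n (tanv k n) (Res k n w)"
proof (rule A.kahler_map_eqI[OF _ _ A.A_group _ w])
 note t = tan_tangent[OF le] tan_tangent[of k "Suc n"]
 show "additive (Om k (Suc n)) (Ak k n) (\<lambda>w. res k n (A.vfield k (Suc n) (tanv k (Suc n)) w))"
  by (rule additive_comp[OF A.vfield_additive res_additive]) (use t le in simp)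
 show "additive (Om k (Suc n)) (Ak k n) (\<lambda>w. A.vfield k n (tanv k n) (Res k n w))"
  by (rule additive_comp[OF Res_additive A.vfield_additive[OF t(1)]])
 fix a b assume ab: "a <: Ak k (Suc n)" "b <: Ak k (Suc n)"
 have db: "A.deriv k (Suc n) (tanv k (Suc n)) b <: Ak k (Suc n)"
  by (rule lin_closed[OF A.deriv_linear[OF A.tangentD(1)[OF t(2)]] ab(2)]) (use le in simp)
 show "res k n (A.vfield k (Suc n) (tanv k (Suc n)) (A.act k (Suc n) a (A.d k (Suc n) b)))
   = A.vfield k n (tanv k n) (Res k n (A.act k (Suc n) a (A.d k (Suc n) b)))"
  using ab db le t
  by (simp add: A.vfield_gen Res_act Res_d deriv_res[OF le] ring_hom_mult[OF res_ring_hom])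
qed

lemma vfield_bc:
 assumes le: "Suc k \<le> n" and w: "w <: Om (Suc k) n"
 shows "bch k n (A.vfield (Suc k) n (tanv (Suc k) n) w) = A.vfield k n (tanv k n) (Bc k n w)"
proof (rule A.kahler_map_eqI[OF _ _ A.A_group _ w])
 have le': "k \<le> n" using le by simp
 note t = tan_tangent[OF le'] tan_tangent[OF le]
 show "additive (Om (Suc k) n) (Ak k n) (\<lambda>w. bch k n (A.vfield (Suc k) n (tanv (Suc k) n) w))"
  by (rule additive_comp[OF A.vfield_additive[OF t(2)] bc_additive])
 show "additive (Om (Suc k) n) (Ak k n) (\<lambda>w. A.vfield k n (tanv k n) (Bc k n w))"
  by (rule additive_comp[OF Bc_additive A.vfield_additive[OF t(1)]])
 fix a b assume ab: "a <: Ak (Suc k) n" "b <: Ak (Suc k) n"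
 have db: "A.deriv (Suc k) n (tanv (Suc k) n) b <: Ak (Suc k) n"
  by (rule lin_closed[OF A.deriv_linear[OF A.tangentD(1)[OF t(2)]] ab(2)])
 show "bch k n (A.vfield (Suc k) n (tanv (Suc k) n) (A.act (Suc k) n a (A.d (Suc k) n b)))
   = A.vfield k n (tanv k n) (Bc k n (A.act (Suc k) n a (A.d (Suc k) n b)))"
  using ab db t
  by (simp add: A.vfield_gen Bc_act Bc_d deriv_bc[OF le' le] ring_hom_mult[OF bc_ring_hom])
qed

subsection \<open>The invariant field\<close>

definition inv_field where
 "inv_field = (\<lambda>w\<in>carrier WH. SOME f. f <: OH \<and> (\<forall>k n. k \<le> n \<longrightarrow> f k n = A.vfield k n (tanv k n) (w k n)))"

lemma
 assumes w: "w <: WH"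
 shows inv_field_closed: "inv_field w <: OH"
  and inv_field_component: "\<And>k n. k \<le> n ==> inv_field w k n = A.vfield k n (tanv k n) (w k n)"
proof -
 have "\<exists>f\<in>carrier OH. \<forall>k n. k \<le> n \<longrightarrow> f k n = A.vfield k n (tanv k n) (w k n)"
 proof (rule OH_extend)
  show "A.vfield k n (tanv k n) (w k n) <: Ak k n" if "k \<le> n" for k n
   by (rule additive_closed[OF A.vfield_additive[OF tan_tangent[OF that]] WH_Om[OF w]])
  show "res k n (A.vfield k (Suc n) (tanv k (Suc n)) (w k (Suc n))) = A.vfield k n (tanv k n) (w k n)" if "k \<le> n" for k n
   unfolding vfield_res[OF that WH_Om[OF w]] WH_Res[OF w] ..
  show "bch k n (A.vfield (Suc k) n (tanv (Suc k) n) (w (Suc k) n)) = A.vfield k n (tanv k n) (w k n)" if "Suc k \<le> n" for k n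
   unfolding vfield_bc[OF that WH_Om[OF w]] WH_Bc[OF w] ..
 qed
 then have "\<exists>f. f <: OH \<and> (\<forall>k n. k \<le> n \<longrightarrow> f k n = A.vfield k n (tanv k n) (w k n))" by blast
 from someI_ex[OF this]
 show "inv_field w <: OH" "\<And>k n. k \<le> n ==> inv_field w k n = A.vfield k n (tanv k n) (w k n)"
  using w unfolding inv_field_def by auto
qed

lemma inv_field_additive: "additive WH OH inv_field"
proof (rule additive_mapI[OF inv_field_closed])
 fix w w' assume w: "w <: WH" "w' <: WH"
 show "inv_field (w \<oplus>\<^bsub>WH\<^esub> w') = inv_field w \<oplus>\<^bsub>OH\<^esub> inv_field w'"
 proof (rule OH_eqI_large)
  fix k n :: nat assume le: "k \<le> n"
  show "inv_field (w \<oplus>\<^bsub>WH\<^esub> w') k n = (inv_field w \<oplus>\<^bsub>OH\<^esub> inv_field w') k n"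
   unfolding OH_apply inv_field_component[OF WH.M.a_closed[OF w] le] inv_field_component[OF w(1) le] inv_field_component[OF w(2) le] WH_apply
   by (rule additive_add[OF A.vfield_additive[OF tan_tangent[OF le]] WH_Om[OF w(1)] WH_Om[OF w(2)]])
 qed (use w inv_field_closed in auto)
qed

lemma inv_field_act:
 assumes f: "f <: OH" and w: "w <: WH"
 shows "inv_field (\<lambda>k n. A.act k n (f k n) (w k n)) = f \<otimes>\<^bsub>OH\<^esub> inv_field w"
proof (rule OH_eqI_large)
 fix k n :: nat assume le: "k \<le> n"
 show "inv_field (\<lambda>k n. A.act k n (f k n) (w k n)) k n = (f \<otimes>\<^bsub>OH\<^esub> inv_field w) k n"
  unfolding OH_apply inv_field_component[OF WH_act_closed[OF f w] le] inv_field_component[OF w le]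
  by (rule A.vfield_act[OF tan_tangent[OF le] OH_closed[OF f] WH_Om[OF w]])
qed (use f w inv_field_closed WH_act_closed[OF f w] in auto)

lemma inv_field_zero:
 assumes w: "w <: WH" "w k n = \<zero>\<^bsub>Om k n\<^esub>" and le: "k \<le> n"
 shows "inv_field w k n = \<zero>\<^bsub>Ak k n\<^esub>"
 unfolding inv_field_component[OF w(1) le] w(2)
 by (rule additive_zero[OF A.vfield_additive[OF tan_tangent[OF le]] Om_group A.A_group])

lemma inv_field_continuous: "continuous_at_zero (limit_nhds WH) (limit_nhds OH) inv_field"
 unfolding continuous_WH_OH
proof (intro allI)
 fix k n
 have "inv_field w k n = \<zero>\<^bsub>Ak k n\<^esub>" if w: "w <: WH" "w k (max k n) = \<zero>\<^bsub>Om k (max k n)\<^esub>" for w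
  by (rule OH_zero_mono[OF inv_field_closed[OF w(1)] inv_field_zero[OF w]]) auto
 then show "\<exists>K N. \<forall>w\<in>carrier WH. w K N = \<zero>\<^bsub>Om K N\<^esub> \<longrightarrow> inv_field w <: OH \<and> inv_field w k n = \<zero>\<^bsub>Ak k n\<^esub>"
  using inv_field_closed by blast
qed

lemma inv_field_invariant:
 assumes w: "w <: wH" shows "inv_field w = v w \<odot>\<^bsub>OH\<^esub> \<one>\<^bsub>OH\<^esub>"
proof (rule OH_eqI_large)
 fix k n :: nat assume le: "k \<le> n"
 obtain f where f: "f <: OH" "w k n = Theta f k n" using w by (rule wH_component)
 have "inv_field w k n = tanv k n (f k n) \<odot>\<^bsub>Ak k n\<^esub> \<one>\<^bsub>Ak k n\<^esub>"
  unfolding inv_field_component[OF wH_WH[OF w] le] f(2) Theta_def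
  by (rule A.vfield_\<theta>[OF tan_tangent[OF le] OH_closed[OF f(1)]])
 also have "tanv k n (f k n) = to k (v w)"
  unfolding tan_apply[OF le f(1)] by (rule v_level[OF Theta_closed[OF f(1)] w f(2)[symmetric] le])
 finally show "inv_field w k n = (v w \<odot>\<^bsub>OH\<^esub> \<one>\<^bsub>OH\<^esub>) k n" unfolding OH_apply(3,5) .
qed (use w inv_field_closed[OF wH_WH] v_closed in auto)

lemma invariant_field_eq: "invariant_field R p H v = inv_field"
proof (rule invariant_field_eqI)
 have "inv_field \<in> carrier WH \<rightarrow>\<^sub>E carrier OH" using inv_field_closed by (auto simp: PiE_def extensional_def inv_field_def)
 then show "vector_field v inv_field"
  unfolding vector_field_def
  using additive_add[OF inv_field_additive] inv_field_act inv_field_continuous inv_field_invariant by blast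
qed

lemma field_deriv_eq: assumes f: "f <: OH" shows "field_deriv R p H v f = der f"
 unfolding field_deriv_def invariant_field_eq
proof (rule OH_eqI_large[OF inv_field_closed[OF WH_d_closed[OF f]] der_closed[OF f]])
 fix k n :: nat assume le: "k \<le> n"
 note a = OH_closed[OF f, of k n]
 have "A.vfield k n (tanv k n) (A.d k n (f k n)) = A.vfield k n (tanv k n) (A.act k n \<one>\<^bsub>Ak k n\<^esub> (A.d k n (f k n)))"
  using a by (simp add: A.kahler_act_one)
 also have "\<dots> = \<one>\<^bsub>Ak k n\<^esub> \<otimes>\<^bsub>Ak k n\<^esub> A.deriv k n (tanv k n) (f k n)"
  by (rule A.vfield_gen[OF tan_tangent[OF le] _ a]) simp
 also have "\<dots> = A.deriv k n (tanv k n) (f k n)"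
  using lin_closed[OF A.deriv_linear[OF A.tangentD(1)[OF tan_tangent[OF le]]] a] by simp
 finally show "inv_field (\<lambda>k n. A.d k n (f k n)) k n = der f k n"
  unfolding inv_field_component[OF WH_d_closed[OF f] le] der_component[OF f le] .
qed

end

section \<open>The Hodge--Tate map\<close>

context p_div_group
begin

lemma hodge_tate_copair: "hodge_tate R p H k n = cop k n (Om k n) (th k n)"
proof -
 have \<kappa>: "kappa R p H k n = dual_point.\<kappa> (Sk k) (Ak k n) (B k) (\<lambda>\<phi>. cl k (n, \<phi>))"
  unfolding kappa_copair dual_point.\<kappa>_eq[OF P_point] ..
 show ?thesis
  unfolding hodge_tate_def Let_def \<kappa> dual_point.log_derivative_unique[OF P_point] by (rule the_eq_trivial)
qed

lemma hodge_tate_approximation: "\<exists>zs. approximates R p H Om (hodge_tate R p H) wH k n zs"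
proof -
 have "\<exists>f\<in>carrier OH. f k n = a" if "a <: Ak k n" for a using OH_lift[OF that] by blast
 then obtain l where l: "\<And>a. a <: Ak k n ==> l a <: OH \<and> l a k n = a" by metis
 have "\<exists>g\<in>carrier T. g k = u" if "u <: B k" for u using T_lift[OF that] by blast
 then obtain m where m: "\<And>u. u <: B k ==> m u <: T \<and> m u k = u" by metis
 let ?bs = "A.bs k n"
 have bs: "fst z <: Ak k n" "cl k (n, snd z) <: B k" if "z \<in> set ?bs" for z
  using that A.bs_closed[OF that] cl_closed[of "snd z" k n] by (simp_all add: Dk_eq)
 let ?zs = "map (\<lambda>z. (Theta (l (fst z)), m (cl k (n, snd z)))) ?bs"
 have "map (\<lambda>(x, y). (x k n, y k)) ?zs = map (\<lambda>z. (th k n (fst z), cl k (n, snd z))) ?bs"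
  using l m bs by (simp add: Theta_def)
 then have "tclass (Sk k) (Om k n) (B k) (map (\<lambda>(x, y). (x k n, y k)) ?zs)
   = lsum (tensor (Sk k) (Om k n) (B k)) (map (\<lambda>(x, y). pure (Sk k) (Om k n) (B k) x y) (map (\<lambda>z. (th k n (fst z), cl k (n, snd z))) ?bs))"
  using bs by (simp only:) (rule tclass_eq_lsum, auto)
 also have "\<dots> = cop k n (Om k n) (th k n)" by (simp add: dual_point.copair_def[OF P_point] comp_def)
 finally show ?thesis
  using l m bs by (intro exI[of _ ?zs]) (auto simp: approximates_def hodge_tate_copair)
qed

end

context lie_vector
begin

lemma inv_field_smult:
 assumes r: "r <: R" and w: "w <: WH"
 shows "inv_field (r \<odot>\<^bsub>WH\<^esub> w) = r \<odot>\<^bsub>OH\<^esub> inv_field w"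
proof -
 have "r \<odot>\<^bsub>WH\<^esub> w = (\<lambda>k n. A.act k n ((r \<odot>\<^bsub>OH\<^esub> \<one>\<^bsub>OH\<^esub>) k n) (w k n))"
 proof (intro ext)
  fix k n
  show "(r \<odot>\<^bsub>WH\<^esub> w) k n = A.act k n ((r \<odot>\<^bsub>OH\<^esub> \<one>\<^bsub>OH\<^esub>) k n) (w k n)"
   unfolding WH_apply OH_apply using A.act_scalar[OF to_closed[OF r] WH_Om[OF w]] by simp
 qed
 then have "inv_field (r \<odot>\<^bsub>WH\<^esub> w) = (r \<odot>\<^bsub>OH\<^esub> \<one>\<^bsub>OH\<^esub>) \<otimes>\<^bsub>OH\<^esub> inv_field w"
  using inv_field_act[of "r \<odot>\<^bsub>OH\<^esub> \<one>\<^bsub>OH\<^esub>" w] r w by simp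
 then show ?thesis using r inv_field_closed[OF w] by (simp add: OH.smult_assoc2)
qed

text \<open>
 Contracting with the field and evaluating at the origin extends \<open>v\<close> modulo \<open>p\<^sup>j\<close> to all differentials on a level, invariant or
 not, so \<open>v\<close> can be contracted with the tensor \<open>\<Sum> \<theta>(e\<^sub>i) \<otimes> \<phi>\<^sub>i\<close>; the result pairs with \<open>f = \<Sum> \<phi>\<^sub>i(f) e\<^sub>i\<close> to \<open>v (\<theta> f)\<close>.
\<close>

lemma v_extend:
 assumes le: "j \<le> k" "j \<le> n"
 obtains \<psi> where "semilinear (Sk k) (red j) (Om k n) (ring_module (Sk j)) \<psi>"
  "\<And>w. w <: wH ==> \<psi> (w k n) = to j (v w)"
proof -
 define \<mu> where "\<mu> w = A.\<epsilon> j j (inv_field w j j)" for w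
 have e: "additive (Ak j j) (Sk j) (A.\<epsilon> j j)" by (rule ring_hom_additive[OF A.counit_hom])
 have e_smult: "A.\<epsilon> j j (to j r \<odot>\<^bsub>Ak j j\<^esub> a) = to j r \<otimes>\<^bsub>Sk j\<^esub> A.\<epsilon> j j a" if "r <: R" "a <: Ak j j" for r a
  using lin_smult[OF A.counit_linear to_closed[OF that(1)] that(2)] by simp
 have add: "additive WH (Sk j) \<mu>"
  unfolding \<mu>_def by (rule additive_comp[OF additive_comp[OF inv_field_additive OH_proj_additive] e])
 obtain \<psi> where \<psi>: "semilinear (Sk k) (red j) (Om k n) (ring_module (Sk j)) \<psi>"
  "\<And>w. w <: WH ==> \<psi> (w k n) = \<mu> w"
 proof (rule factor_functional[OF le(1) WH_module Om_module WH_proj_additive WH_apply(2) _ add])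
  show "\<exists>w\<in>carrier WH. w k n = a" if "a <: Om k n" for a using comb_surj[OF that] comb_closed by blast
  show "\<mu> (r \<odot>\<^bsub>WH\<^esub> w) = to j r \<otimes>\<^bsub>Sk j\<^esub> \<mu> w" if "r <: R" "w <: WH" for r w
   unfolding \<mu>_def inv_field_smult[OF that] OH_apply(3) by (rule e_smult[OF that(1) OH_closed[OF inv_field_closed[OF that(2)]]])
  show "\<mu> w = \<zero>\<^bsub>Sk j\<^esub>" if w: "w <: WH" "w k n = \<zero>\<^bsub>Om k n\<^esub>" for w
  proof -
   have "inv_field w j j = \<zero>\<^bsub>Ak j j\<^esub>" by (rule inv_field_zero[OF w(1) WH_zero_mono[OF w le]]) simp
   then show ?thesis unfolding \<mu>_def using additive_zero[OF e A.A_group Sk_group] by simp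
  qed
 qed blast+
 have "\<psi> (w k n) = to j (v w)" if w: "w <: wH" for w
 proof -
  have "\<mu> w = to j (v w) \<otimes>\<^bsub>Sk j\<^esub> A.\<epsilon> j j \<one>\<^bsub>Ak j j\<^esub>"
   unfolding \<mu>_def inv_field_invariant[OF w] OH_apply(3,5) by (rule e_smult) (use v_closed[OF w] in auto)
  then show ?thesis using \<psi>(2)[OF wH_WH[OF w]] v_closed[OF w] by (simp add: ring_hom_one[OF A.counit_hom])
 qed
 then show ?thesis using that \<psi>(1) by blast
qed

lemma HT_linear_eq: "HT_linear R p H v = lin_fun"
 unfolding HT_linear_def
proof (rule T_contraction[where Q = Om and L = th and M = wH and t = "hodge_tate R p H" and g = lin_fun])
 fix j
 have "\<exists>\<psi>. semilinear (Sk k) (red j) (Om k n) (ring_module (Sk j)) \<psi>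
    \<and> (\<forall>w\<in>carrier wH. \<psi> (w k n) = to j (v w)) \<and> (\<forall>f\<in>carrier OH. \<psi> (th k n (f k n)) = to j (pair f lin_fun))"
  if k: "j \<le> k" "j \<le> n" for k n
 proof -
  obtain \<psi> where \<psi>: "semilinear (Sk k) (red j) (Om k n) (ring_module (Sk j)) \<psi>"
   "\<And>w. w <: wH ==> \<psi> (w k n) = to j (v w)" using v_extend[OF k] by blast
  have "\<psi> (th k n (f k n)) = to j (pair f lin_fun)" if "f <: OH" for f
   using \<psi>(2)[OF Theta_closed[OF that]] unfolding pair_lin_fun[OF that] by (simp add: Theta_def)
  then show ?thesis using \<psi> by blast
 qed
 then show "\<exists>N. \<forall>k\<ge>N. \<forall>n\<ge>N. j \<le> k \<and> (\<exists>\<psi>. semilinear (Sk k) (red j) (Om k n) (ring_module (Sk j)) \<psi>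
    \<and> (\<forall>w\<in>carrier wH. \<psi> (w k n) = to j (v w)) \<and> (\<forall>f\<in>carrier OH. \<psi> (th k n (f k n)) = to j (pair f lin_fun)))"
  by (intro exI[of _ j]) auto
qed (simp_all add: Om_module A.\<theta>_linear WH_Om wH_WH hodge_tate_copair hodge_tate_approximation v_closed)

end

section \<open>Equivariance\<close>

context p_div_group
begin

abbreviation "Lie \<equiv> Lie_H R p H"
abbreviation "dv \<equiv> field_deriv R p H"
abbreviation "HT \<equiv> HT_linear R p H"

lemma
 assumes "v <: Lie"
 shows HT_closed: "HT v <: T"
  and field_deriv_closed: "\<And>f. f <: OH ==> dv v f <: OH"
  and pair_field_deriv: "\<And>f g. f <: OH ==> g <: T ==> pair (dv v f) g = pair f (HT v \<otimes>\<^sub>T g)"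
proof -
 interpret lie_vector R p H v by unfold_locales (rule assms)
 show "HT v <: T" by (simp add: HT_linear_eq)
 show "\<And>f. f <: OH ==> dv v f <: OH" by (simp add: field_deriv_eq)
 show "\<And>f g. f <: OH ==> g <: T ==> pair (dv v f) g = pair f (HT v \<otimes>\<^sub>T g)"
  by (simp add: field_deriv_eq HT_linear_eq pair_der)
qed

abbreviation "HTs vs \<equiv> foldr (\<lambda>v g. HT v \<otimes>\<^sub>T g) vs \<one>\<^sub>T"

lemma monomial_closed:
 assumes "set vs \<subseteq> carrier Lie"
 shows "f <: OH ==> foldr dv vs f <: OH" and "HTs vs <: T"
 using assms by (induction vs) (auto simp: field_deriv_closed HT_closed)

text \<open>Both sides compose adjoint operators in opposite orders, which does not matter as multiplications commute.\<close>

lemma pair_monomial: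
 assumes "set vs \<subseteq> carrier Lie" "f <: OH" "g <: T"
 shows "pair (foldr dv vs f) g = pair f (HTs vs \<otimes>\<^sub>T g)"
 using assms(1,3)
proof (induction vs arbitrary: g)
 case Nil
 then show ?case by simp
next
 case (Cons v vs)
 then have v: "v <: Lie" and vs: "set vs \<subseteq> carrier Lie" by auto
 note c = HT_closed[OF v] monomial_closed(2)[OF vs] Cons.prems(2)
 have "pair (foldr dv (v # vs) f) g = pair (foldr dv vs f) (HT v \<otimes>\<^sub>T g)"
  using pair_field_deriv[OF v monomial_closed(1)[OF vs assms(2)] Cons.prems(2)] by simp
 also have "\<dots> = pair f (HTs vs \<otimes>\<^sub>T (HT v \<otimes>\<^sub>T g))" by (rule Cons.IH[OF vs]) (simp add: c)
 also have "HTs vs \<otimes>\<^sub>T (HT v \<otimes>\<^sub>T g) = HTs (v # vs) \<otimes>\<^sub>T g" using c by (simp add: T.m_ac)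
 finally show ?case .
qed

lemma Sym_rep:
 assumes "P <: Sym_Lie R p H"
 shows "z \<in> set (rep P) ==> fst z <: R" "z \<in> set (rep P) ==> set (snd z) \<subseteq> carrier Lie"
proof -
 have "P \<in> fsum_class (carrier R \<times> lists (carrier Lie)) (sym_rel R Lie) ` lists (carrier R \<times> lists (carrier Lie))"
  using assms by (simp add: Sym_Lie_def sym_algebra_def symclass_def)
 then have sub: "set (rep P) \<subseteq> carrier R \<times> lists (carrier Lie)" by (rule rep_fsum_class_subset)
 show "z \<in> set (rep P) ==> fst z <: R" "z \<in> set (rep P) ==> set (snd z) \<subseteq> carrier Lie"
  using sub by auto
qed

lemma
 assumes P: "P <: Sym_Lie R p H"
 shows act_O_H_closed: "f <: OH ==> act_O_H R p H P f <: OH"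
  and HT_pullback_closed: "HT_pullback R p H P <: T"
 unfolding act_O_H_def HT_pullback_def fs_lift_def case_prod_unfold
 by (rule lsum_smult_closed[OF OH.module] lsum_smult_closed[OF T.module]; use Sym_rep[OF P] monomial_closed in blast)+

lemma pair_act:
 assumes P: "P <: Sym_Lie R p H" and f: "f <: OH" and g: "g <: T"
 shows "pair (act_O_H R p H P f) g = pair f (act_O_T R p H P g)"
proof -
 note r = Sym_rep[OF P] and m = monomial_closed[OF Sym_rep(2)[OF P]]
 have mult: "additive T T (\<lambda>h. h \<otimes>\<^sub>T g)" using g by (intro additive_mapI) (auto simp: T.l_distr)
 have "pair (act_O_H R p H P f) g = lsum R (map (\<lambda>z. pair (fst z \<odot>\<^bsub>OH\<^esub> foldr dv (snd z) f) g) (rep P))"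
  unfolding act_O_H_def fs_lift_def case_prod_unfold
  by (rule additive_lsum_map[OF pair_additive_left[OF g] OH_group abelian_group_axioms]) (simp add: r m f)
 also have "\<dots> = lsum R (map (\<lambda>z. pair f ((fst z \<odot>\<^sub>T HTs (snd z)) \<otimes>\<^sub>T g)) (rep P))"
 proof (rule lsum_cong)
  fix z assume z: "z \<in> set (rep P)"
  show "pair (fst z \<odot>\<^bsub>OH\<^esub> foldr dv (snd z) f) g = pair f ((fst z \<odot>\<^sub>T HTs (snd z)) \<otimes>\<^sub>T g)"
   using r[OF z] m[OF z] f g by (simp add: pair_smult_left pair_monomial T.smult_assoc2 pair_smult_right)
 qed
 also have "\<dots> = pair f (act_O_T R p H P g)"
  unfolding act_O_T_def HT_pullback_def fs_lift_def case_prod_unfold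
  by (rule additive_lsum_map[OF additive_comp[OF mult pair_additive_right[OF f]] T_group abelian_group_axioms, symmetric])
   (simp add: r m)
 finally show ?thesis .
qed

lemma act_O_T_closed: "P <: Sym_Lie R p H ==> g <: T ==> act_O_T R p H P g <: T"
 unfolding act_O_T_def using HT_pullback_closed by simp

lemma fourier_upper_equivariant:
 assumes P: "P <: Sym_Lie R p H" and \<mu>: "\<mu> <: OHd"
 shows "dual_act OH (act_O_H R p H) P \<mu> <: OHd"
  and "fourier_upper R p H (dual_act OH (act_O_H R p H) P \<mu>) = act_O_T R p H P (fourier_upper R p H \<mu>)"
proof -
 let ?g = "act_O_T R p H P (fourier_upper R p H \<mu>)"
 have g: "?g <: T" by (rule act_O_T_closed[OF P fourier_upper_closed[OF \<mu>]])
 have eq: "pair f ?g = \<mu> (act_O_H R p H P f)" if "f <: OH" for f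
  using pair_act[OF P that fourier_upper_closed[OF \<mu>]] pair_fourier_upper[OF \<mu> act_O_H_closed[OF P that]] by simp
 have "dual_act OH (act_O_H R p H) P \<mu> = (\<lambda>f\<in>carrier OH. pair f ?g)"
  unfolding dual_act_def by (rule restrict_ext) (simp add: eq)
 then show m: "dual_act OH (act_O_H R p H) P \<mu> <: OHd" using pair_in_OHd[OF g] by simp
 show "fourier_upper R p H (dual_act OH (act_O_H R p H) P \<mu>) = ?g"
  by (rule fourier_upper_eqI[OF m g]) (simp add: eq dual_act_def)
qed

lemma fourier_lower_equivariant:
 assumes P: "P <: Sym_Lie R p H" and \<nu>: "\<nu> <: Td"
 shows "dual_act T (act_O_T R p H) P \<nu> <: Td"
  and "fourier_lower R p H (dual_act T (act_O_T R p H) P \<nu>) = act_O_H R p H P (fourier_lower R p H \<nu>)"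
proof -
 let ?f = "act_O_H R p H P (fourier_lower R p H \<nu>)"
 have f: "?f <: OH" by (rule act_O_H_closed[OF P fourier_lower_closed[OF \<nu>]])
 have eq: "pair ?f g = \<nu> (act_O_T R p H P g)" if "g <: T" for g
  using pair_act[OF P fourier_lower_closed[OF \<nu>] that] pair_fourier_lower[OF \<nu> act_O_T_closed[OF P that]] by simp
 have "dual_act T (act_O_T R p H) P \<nu> = (\<lambda>g\<in>carrier T. pair ?f g)"
  unfolding dual_act_def by (rule restrict_ext) (simp add: eq)
 then show m: "dual_act T (act_O_T R p H) P \<nu> <: Td" using pair_in_Td[OF f] by simp
 show "fourier_lower R p H (dual_act T (act_O_T R p H) P \<nu>) = ?f"
  by (rule fourier_lower_eqI[OF m f]) (simp add: eq dual_act_def)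
qed

end

theorem proposition7p0p3:
  fixes R :: "('r, 'm) ring_scheme" and p :: nat and H :: "('r set, 'a) pdiv"
  assumes "cring R" and "prime p" and "p_adically_complete R p" and "p_divisible_group R p H"
  shows "linear_iso R (O_H_dual R p H) (O_T R p H) (fourier_upper R p H)
    \<and> linear_iso R (O_T_dual R p H) (O_H R p H) (fourier_lower R p H)
    \<and> (\<forall>P\<in>carrier (Sym_Lie R p H). \<forall>\<mu>\<in>carrier (O_H_dual R p H).
           dual_act (O_H R p H) (act_O_H R p H) P \<mu> \<in> carrier (O_H_dual R p H) \<and>
           fourier_upper R p H (dual_act (O_H R p H) (act_O_H R p H) P \<mu>)
             = act_O_T R p H P (fourier_upper R p H \<mu>))
    \<and> (\<forall>P\<in>carrier (Sym_Lie R p H). \<forall>\<nu>\<in>carrier (O_T_dual R p H).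
           dual_act (O_T R p H) (act_O_T R p H) P \<nu> \<in> carrier (O_T_dual R p H) \<and>
           fourier_lower R p H (dual_act (O_T R p H) (act_O_T R p H) P \<nu>)
             = act_O_H R p H P (fourier_lower R p H \<nu>))"
proof -
 interpret p_div_group R p H
  by (intro p_div_group.intro p_complete_ring.intro p_div_group_axioms.intro assms)
 show ?thesis
  using fourier_upper_iso fourier_lower_iso fourier_upper_equivariant fourier_lower_equivariant by blast
qed

end
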